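(* Let $\mathcal{M}=(M,\mathbf{u})$, $\mathbf{u}:M\to\mathbb{R}^3$, be a two-dimensional, two-connected minimal tube in $\mathbb{R}^3$ with projection interval $\tau(\mathcal{M})\subset Ox_3$, whose Gauss map is univalent. Let $Q=Q(\mathcal{M})\in\mathbb{R}^3$ be its full flow-vector and let $\alpha=\alpha(\mathcal{M})$ be the angle between $Q(\mathcal{M})$ and the time axis $Ox_3$. If $\alpha(\mathcal{M})\neq 0$, then the life-time $|\tau(\mathcal{M})|$ is finite and $$|\tau(\mathcal{M})|\le \frac{\pi\,\|Q\|\cos\alpha}{\ln\tan\left(\frac{\pi}{4}+\frac{\alpha}{2}\right)}.$$
   Context: Points of $\mathbb{R}^3$ are written $(x_1,x_2,x_3)$; the axis $Ox_3$, directed by $e_3=(0,0,1)$, is called the time axis. Let $M$ be a two-dimensional manifold (without boundary) and $\mathbf{u}=(u_1,u_2,u_3):M\to\mathbb{R}^3$ a $C^2$-immersion; $M$ carries the induced Riemannian metric. For $\tau\in\mathbb{R}$ let $\Pi_\tau=\{x\in\mathbb{R}^3: x_3=\tau\}$. The surface $\mathcal{M}=(M,\mathbf{u})$ is a tube with projection interval $\tau(\mathcal{M})\subset Ox_3$ (the interval which is the projection $u_3(M)$ of the surface to the time axis) if (i) for every $\tau\in\tau(\mathcal{M})$ the section $\Sigma_\tau=\mathbf{u}(M)\cap\Pi_\tau$ is a non-empty compact set; (ii) for any two different $\tau',\tau''\in\tau(\mathcal{M})$ the part of $\mathcal{M}$ situated between $\Pi_{\tau'}$ and $\Pi_{\tau''}$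 (i.e. the set of $m\in M$ with $u_3(m)$ between $\tau'$ and $\tau''$) is compact. The length $|\tau(\mathcal{M})|$ of the projection interval is called the life-time of $\mathcal{M}$. $\mathcal{M}$ is minimal if its mean curvature vanishes everywhere (equivalently, all $u_k$ are harmonic on $M$). "Two-connected" means that $M$ is doubly connected, i.e. homeomorphic to an open annulus. "Univalent Gauss map" means that the Gauss map $M\to S^2$ (given by a choice of unit normal field) is injective. Let $\nu$ be the unit normal to $\Sigma_\tau$ with respect to $\mathcal{M}$ (tangent to the surface, orthogonal to the section) which is co-directed with the time axis, i.e. pointing in the direction of increasing $x_3$. The flow integrals $J_k=\int_{\Sigma_\tau}\langle\nabla u_k,\nu\rangle\,d\Sigma$, $k=1,2,3$ (where $\nabla$ is the gradient on $M$, $d\Sigma$ is one-dimensional Hausdorff measure, and the section is regarded as the curve $\{u_3=\tau\}$ in $M$) do not depend on $\tau\in\tau(\mathcal{M})$, and $J_3>0$. The full flow-vector is $Q(\mathcal{M})=(J_1,J_2,J_3)$, and $\|Q\|$ is its Euclidean norm; since $J_3>0$, the angle $\alpha(\mathcal{M})$ between $Q(\mathcal{M})$ and $e_3$ lies in $[0,\pi/2)$. *)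

theory Defs
  imports "HOL-Analysis.Analysis"
begin

text \<open>
  A surface is a topology \<open>M\<close> together with a C2 atlas \<open>A\<close>. The atlas is given by local
  parametrizations, i.e. inverse charts: a pair \<open>(V, \<psi>)\<close> consists of an open set \<open>V\<close> of the
  parameter plane and a homeomorphism \<open>\<psi>\<close> of \<open>V\<close> onto an open subset of \<open>M\<close>.
\<close>

type_synonym 'a atlas = "((real^2) set \<times> (real^2 \<Rightarrow> 'a)) set"

definition C2_on :: "'a::real_normed_vector set \<Rightarrow> ('a \<Rightarrow> 'b::real_normed_vector) \<Rightarrow> bool" where
  "C2_on S f \<longleftrightarrow> (\<exists>(f' :: 'a \<Rightarrow> 'a \<Rightarrow>\<^sub>L 'b) (f'' :: 'a \<Rightarrow> 'a \<Rightarrow>\<^sub>L ('a \<Rightarrow>\<^sub>L 'b)).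
     (\<forall>x\<in>S. (f has_derivative blinfun_apply (f' x)) (at x)) \<and>
     (\<forall>x\<in>S. (f' has_derivative blinfun_apply (f'' x)) (at x)) \<and>
     continuous_on S f'')"

definition C2_surface :: "'a topology \<Rightarrow> 'a atlas \<Rightarrow> bool" where
  "C2_surface M A \<longleftrightarrow>
     Hausdorff_space M \<and> second_countable M \<and>
     (\<forall>(V, \<psi>)\<in>A. open V \<and> openin M (\<psi> ` V) \<and>
        homeomorphic_map (top_of_set V) (subtopology M (\<psi> ` V)) \<psi>) \<and>
     topspace M = (\<Union>(V, \<psi>)\<in>A. \<psi> ` V) \<and>
     (\<forall>(V, \<psi>)\<in>A. \<forall>(W, \<phi>)\<in>A. C2_on (V \<inter> \<psi> -` (\<phi> ` W)) (inv_into W \<phi> \<circ> \<psi>))"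

definition doubly_connected :: "'a topology \<Rightarrow> bool" where
  "doubly_connected M \<longleftrightarrow> M homeomorphic_space top_of_set {z::complex. 1 < cmod z \<and> cmod z < 2}"

definition C2_immersion :: "'a atlas \<Rightarrow> ('a \<Rightarrow> real^3) \<Rightarrow> bool" where
  "C2_immersion A u \<longleftrightarrow>
     (\<forall>(V, \<psi>)\<in>A. C2_on V (u \<circ> \<psi>) \<and> (\<forall>x\<in>V. inj (frechet_derivative (u \<circ> \<psi>) (at x))))"

definition partial_deriv :: "2 \<Rightarrow> (real^2 \<Rightarrow> 'b::real_normed_vector) \<Rightarrow> real^2 \<Rightarrow> 'b" where
  "partial_deriv i f x = frechet_derivative f (at x) (axis i 1)"

text \<open>
  Mean curvature of a parametrized surface through the coefficients \<open>E, F, G\<close> and \<open>L, K, N\<close> of its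
  first and second fundamental forms. Changing the parametrization affects at most its sign.
\<close>

definition mean_curvature :: "(real^2 \<Rightarrow> real^3) \<Rightarrow> real^2 \<Rightarrow> real" where
  "mean_curvature r x =
    (let r1 = partial_deriv 1 r x;
         r2 = partial_deriv 2 r x;
         n = (1 / norm (cross3 r1 r2)) *\<^sub>R cross3 r1 r2;
         E = r1 \<bullet> r1; F = r1 \<bullet> r2; G = r2 \<bullet> r2;
         L = partial_deriv 1 (partial_deriv 1 r) x \<bullet> n;
         K = partial_deriv 2 (partial_deriv 1 r) x \<bullet> n;
         N = partial_deriv 2 (partial_deriv 2 r) x \<bullet> n
     in (E * N - 2 * F * K + G * L) / (2 * (E * G - F\<^sup>2)))"

definition minimal_surface :: "'a atlas \<Rightarrow> ('a \<Rightarrow> real^3) \<Rightarrow> bool" where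
  "minimal_surface A u \<longleftrightarrow> (\<forall>(V, \<psi>)\<in>A. \<forall>x\<in>V. mean_curvature (u \<circ> \<psi>) x = 0)"

text \<open>
  The tangent plane at \<open>m\<close>, identified by the differential of \<open>u\<close> with a plane in \<open>real^3\<close>; every
  parametrization around \<open>m\<close> contributes the same plane. Under this identification the induced
  Riemannian metric is the inner product of \<open>real^3\<close>.
\<close>

definition tangent_plane :: "'a atlas \<Rightarrow> ('a \<Rightarrow> real^3) \<Rightarrow> 'a \<Rightarrow> (real^3) set" where
  "tangent_plane A u m =
     {frechet_derivative (u \<circ> \<psi>) (at x) v | V \<psi> x v. (V, \<psi>) \<in> A \<and> x \<in> V \<and> \<psi> x = m}"

definition surface_gradient ::
    "'a atlas \<Rightarrow> ('a \<Rightarrow> real^3) \<Rightarrow> ('a \<Rightarrow> real) \<Rightarrow> 'a \<Rightarrow> real^3" where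
  "surface_gradient A u f m = (THE w. w \<in> tangent_plane A u m \<and>
     (\<forall>(V, \<psi>)\<in>A. \<forall>x\<in>V. \<psi> x = m \<longrightarrow>
        (\<forall>v. w \<bullet> frechet_derivative (u \<circ> \<psi>) (at x) v = frechet_derivative (f \<circ> \<psi>) (at x) v)))"

text \<open>
  A Gauss map: a continuous unit normal field, viewed as a map into the unit sphere. On a connected
  surface it is unique up to sign.
\<close>

definition gauss_map ::
    "'a topology \<Rightarrow> 'a atlas \<Rightarrow> ('a \<Rightarrow> real^3) \<Rightarrow> ('a \<Rightarrow> real^3) \<Rightarrow> bool" where
  "gauss_map M A u n \<longleftrightarrow> continuous_map M euclidean n \<and>
     (\<forall>m\<in>topspace M. norm (n m) = 1 \<and> (\<forall>w\<in>tangent_plane A u m. n m \<bullet> w = 0))"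

definition projection_interval :: "'a topology \<Rightarrow> ('a \<Rightarrow> real^3) \<Rightarrow> real set" where
  "projection_interval M u = (\<lambda>m. u m $ 3) ` topspace M"

definition tube :: "'a topology \<Rightarrow> ('a \<Rightarrow> real^3) \<Rightarrow> bool" where
  "tube M u \<longleftrightarrow>
     is_interval (projection_interval M u) \<and>
     (\<forall>\<tau>\<in>projection_interval M u.
        u ` topspace M \<inter> {x. x $ 3 = \<tau>} \<noteq> {} \<and> compact (u ` topspace M \<inter> {x. x $ 3 = \<tau>})) \<and>
     (\<forall>\<tau>'\<in>projection_interval M u. \<forall>\<tau>''\<in>projection_interval M u. \<tau>' < \<tau>'' \<longrightarrow>
        compactin M {m \<in> topspace M. \<tau>' \<le> u m $ 3 \<and> u m $ 3 \<le> \<tau>''})"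

definition life_time :: "'a topology \<Rightarrow> ('a \<Rightarrow> real^3) \<Rightarrow> ennreal" where
  "life_time M u = emeasure lborel (projection_interval M u)"

text \<open>
  Lengths of curves and distances on \<open>M\<close> with respect to the induced metric. Since \<open>u\<close> is an immersion,
  a continuous curve \<open>\<gamma>\<close> in \<open>M\<close> is piecewise C1 iff \<open>u \<circ> \<gamma>\<close> is. The length is a non-negative Lebesgue
  integral, so a curve whose speed is not integrable near a break point has infinite length.
\<close>

definition curve_length :: "('a \<Rightarrow> real^3) \<Rightarrow> (real \<Rightarrow> 'a) \<Rightarrow> ennreal" where
  "curve_length u \<gamma> =
     (\<integral>\<^sup>+ t\<in>{0..1}. ennreal (norm (vector_derivative (u \<circ> \<gamma>) (at t))) \<partial>lborel)"

definition riemannian_dist :: "'a topology \<Rightarrow> ('a \<Rightarrow> real^3) \<Rightarrow> 'a \<Rightarrow> 'a \<Rightarrow> ennreal" where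
  "riemannian_dist M u p q =
     (INF \<gamma> \<in> {\<gamma>. pathin M \<gamma> \<and> (u \<circ> \<gamma>) piecewise_C1_differentiable_on {0..1} \<and> \<gamma> 0 = p \<and> \<gamma> 1 = q}.
        curve_length u \<gamma>)"

text \<open>
  One-dimensional Hausdorff measure of the distance \<open>d\<close> on \<open>X\<close>, restricted to the sets that are
  measurable in the sense of Caratheodory.
\<close>

definition dist_diameter :: "('a \<Rightarrow> 'a \<Rightarrow> ennreal) \<Rightarrow> 'a set \<Rightarrow> ennreal" where
  "dist_diameter d C = (SUP p\<in>C. SUP q\<in>C. d p q)"

definition hausdorff1_outer :: "'a set \<Rightarrow> ('a \<Rightarrow> 'a \<Rightarrow> ennreal) \<Rightarrow> 'a set \<Rightarrow> ennreal" where
  "hausdorff1_outer X d S =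
     (SUP \<delta>\<in>{0<..}. INF C \<in> {C :: nat \<Rightarrow> 'a set. (\<forall>i. C i \<subseteq> X) \<and> S \<subseteq> (\<Union>i. C i) \<and>
          (\<forall>i. dist_diameter d (C i) \<le> ennreal \<delta>)}. \<Sum>i. dist_diameter d (C i))"

definition hausdorff1 :: "'a set \<Rightarrow> ('a \<Rightarrow> 'a \<Rightarrow> ennreal) \<Rightarrow> 'a measure" where
  "hausdorff1 X d =
     measure_of X (lambda_system X (Pow X) (hausdorff1_outer X d)) (hausdorff1_outer X d)"

text \<open>
  The unit normal to a section with respect to the surface, co-directed with the time axis. Where the
  tangent plane is not horizontal, the tangent line of the section consists of the horizontal
  tangent vectors of the surface.
\<close>

definition section_normal :: "'a atlas \<Rightarrow> ('a \<Rightarrow> real^3) \<Rightarrow> 'a \<Rightarrow> real^3" where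
  "section_normal A u m = (THE \<nu>. \<nu> \<in> tangent_plane A u m \<and> norm \<nu> = 1 \<and>
     (\<forall>w\<in>tangent_plane A u m. w $ 3 = 0 \<longrightarrow> \<nu> \<bullet> w = 0) \<and> 0 < \<nu> $ 3)"

text \<open>The vector of flow integrals, evaluated on the section at height \<open>\<tau>\<close>.\<close>

definition flow_vector ::
    "'a topology \<Rightarrow> 'a atlas \<Rightarrow> ('a \<Rightarrow> real^3) \<Rightarrow> real \<Rightarrow> real^3" where
  "flow_vector M A u \<tau> = (\<chi> k.
     LINT m : {m \<in> topspace M. u m $ 3 = \<tau>} | hausdorff1 (topspace M) (riemannian_dist M u).
       surface_gradient A u (\<lambda>p. u p $ k) m \<bullet> section_normal A u m)"

definition vector_angle :: "'a::real_inner \<Rightarrow> 'a \<Rightarrow> real" where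
  "vector_angle v w = arccos ((v \<bullet> w) / (norm v * norm w))"

end

theory Submission
  imports Defs "HOL-Complex_Analysis.Complex_Analysis"
begin

text \<open>
  Let \<open>G\<close> be the stereographic Gauss map in the natural conformal coordinate \<open>z\<close> with \<open>Re z = u\<^sub>3\<close>. The
  maximum principle and the topology of the annulus exclude critical points of \<open>u\<^sub>3\<close>, since at a
  saddle the connected sets above and below the level would have to cross. Hence the tube is
  covered by a vertical strip modulo \<open>\<i>J\<close>, where \<open>J = J\<^sub>3\<close>, and \<open>G = exp H\<close> there, because \<open>G\<close> omits
  \<open>0\<close> and \<open>\<infinity>\<close>. With \<open>\<partial> = \<partial>\<^sub>x - \<i> \<partial>\<^sub>y\<close> and a suitable sign of \<open>G\<close> the Weierstrass data are \<open>\<partial>u\<^sub>1 + \<i> \<partial>u\<^sub>2 = exp H\<close> and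
  \<open>\<partial>u\<^sub>1 - \<i> \<partial>u\<^sub>2 = - exp (- H)\<close>, so the flow integrals prescribe the mean of \<open>exp H\<close> and of
  \<open>exp (- H)\<close> over every section. This forces the image of every section under \<open>H\<close>, a curve on the
  cylinder of circumference \<open>2\<pi>\<close>, to have a definite length inside \<open>{\<bar>Re\<bar> \<le> S}\<close>; as \<open>G\<close> is injective
  modulo the period, the total area is at most \<open>4\<pi>S\<close>, and the length-area inequality bounds the
  width of the strip.
\<close>

section \<open>Curves with prescribed exponential means\<close>

text \<open>The constant is arsinh(tan \<alpha>) in disguise: it equals ln tan(pi/4 + \<alpha>/2),
  and tan \<alpha> = t = |q|/J with q the horizontal flow as a complex number. Since the mean of
  exp(-H) is minus the conjugate of the mean of exp H, on every section cosh(Re H) cis(Im H) has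
  mean 0 and sinh(Re H) cis(Im H) has mean q/J. The second makes a section reach |Re H| = arsinh t,
  the first makes it turn. Length is only counted in a band |Re| \<le> S because the cylinder has
  finite area only there; a section that leaves the band must traverse a part of it twice. A length
  l in the band bounds the width of the strip by 4 pi S J / l^2. Both pairs in use, S = arsinh t, l
  = 2 arsinh t for t \<ge> 1 and S = pi^2 / arsinh t, l = 2 pi for t < 1, turn this into pi J /
  arsinh t. Two gaps separate the hypotheses from complex analysis: only a C2 atlas is given, so the
  conformal coordinate is built as a primitive of a closed form, and the flow integrals are taken
  against Hausdorff measure of the Riemannian distance, which has to be identified with arc length
  on the sections.\<close>

lemma periodic_int_shift:
  fixes f :: "real \<Rightarrow> 'a"
  assumes "\<And>y. f (y + J) = f y"
  shows "f (y + of_int k * J) = f y"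
proof (induction k rule: int_induct[where k = 0])
  case (step1 i)
  then show ?case using assms[of "y + of_int i * J"] by (simp add: algebra_simps)
next
  case (step2 i)
  then show ?case using assms[of "y + of_int (i - 1) * J"] by (simp add: algebra_simps)
qed simp

lemma periodic_representative:
  fixes J y a :: real
  assumes "J > 0"
  obtains k :: int where "a \<le> y + of_int k * J" "y + of_int k * J < a + J"
proof
  let ?k = "- \<lfloor>(y - a) / J\<rfloor>"
  have "of_int \<lfloor>(y - a) / J\<rfloor> \<le> (y - a) / J" "(y - a) / J < of_int \<lfloor>(y - a) / J\<rfloor> + 1"
    by linarith+
  then have "of_int \<lfloor>(y - a) / J\<rfloor> * J \<le> y - a" "y - a < (of_int \<lfloor>(y - a) / J\<rfloor> + 1) * J"
    using assms by (simp_all only: pos_le_divide_eq pos_divide_less_eq)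
  then show "a \<le> y + of_int ?k * J" "y + of_int ?k * J < a + J"
    by (simp_all add: algebra_simps)
qed

lemma integral_periodic_shift:
  fixes f :: "real \<Rightarrow> real"
  assumes J: "J > 0" and per: "\<And>y. f (y + J) = f y" and int: "\<And>a b. f integrable_on {a..b}"
  shows "integral {a..a+J} f = integral {0..J} f"
proof -
  have shift: "integral {a..b} f = integral {a + of_int k * J..b + of_int k * J} f" for a b k
    using integrable_integral[OF int[of "a + of_int k * J" "b + of_int k * J"],
        THEN has_integral_shift_real_ivl[where c = "of_int k * J"]]
    by (simp add: periodic_int_shift[of f, OF per] integral_unique)
  have *: "integral {a..a+J} f = integral {0..J} f" if a: "0 \<le> a" "a < J" for a
  proof -
    have "integral {J..a+J} f = integral {0..a} f"
      using shift[of 0 a 1] by simp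
    moreover have "integral {a..J} f + integral {J..a+J} f = integral {a..a+J} f"
      using a J int by (intro Henstock_Kurzweil_Integration.integral_combine) auto
    moreover have "integral {0..a} f + integral {a..J} f = integral {0..J} f"
      using a J int by (intro Henstock_Kurzweil_Integration.integral_combine) auto
    ultimately show ?thesis by simp
  qed
  obtain k where k: "0 \<le> a + of_int k * J" "a + of_int k * J < 0 + J"
    using periodic_representative[OF J] by blast
  have "integral {a..a+J} f = integral {a + of_int k * J..a + of_int k * J + J} f"
    using shift[of a "a + J" k] by (simp add: algebra_simps)
  then show ?thesis using *[OF k(1)] k by simp
qed

section \<open>Closed curves on the cylinder and their length inside a band\<close>

text \<open>\<open>h\<close> is the logarithm of the stereographic Gauss map along one section, in
  the parameter with period \<open>J\<close>, and \<open>q\<close> is the horizontal flow J1 + i J2.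
  Periodicity is asked of \<open>exp h\<close> alone because \<open>h\<close> may gain a multiple of
  2 pi i per turn: the curve closes up only on the cylinder.\<close>

locale log_curve =
  fixes h h' :: "real \<Rightarrow> complex" and J :: real and q :: complex
  assumes deriv: "\<And>y. (h has_vector_derivative h' y) (at y)"
    and cont': "continuous_on UNIV h'"
    and J: "J > 0"
    and per: "\<And>y. exp (h (y + J)) = exp (h y)"
    and int1: "((\<lambda>y. exp (h y)) has_integral q) {0..J}"
    and int2: "((\<lambda>y. exp (- h y)) has_integral - cnj q) {0..J}"
begin

text \<open>The cut-off makes the integral the length of the part inside the band, the only part
  whose area is controlled later.\<close>

definition speed :: "real \<Rightarrow> real \<Rightarrow> real" where
  "speed S y = (if \<bar>Re (h y)\<bar> \<le> S then norm (h' y) else 0)"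

lemma cont: "continuous_on A h"
  by (metis deriv continuous_at_imp_continuous_on has_vector_derivative_continuous)

lemma speed_nonneg: "speed S y \<ge> 0"
  by (simp add: speed_def)

lemma per_re: "Re (h (y + J)) = Re (h y)"
  using per[of y] by (metis exp_le_cancel_iff norm_exp_eq_Re order_antisym_conv order_refl)

text \<open>\<open>h\<close> itself need not be periodic, so the derivatives of
  \<open>exp (h y)\<close> are compared and the nonzero factor is cancelled.\<close>

lemma per_deriv: "h' (y + J) = h' y"
proof -
  have "((\<lambda>y. exp (h (y + J))) has_vector_derivative h' (y + J) * exp (h (y + J))) (at y)"
  proof -
    have "((\<lambda>y. y + J) has_vector_derivative 1) (at y)" by (auto intro!: derivative_eq_intros)
    then have "(h \<circ> (\<lambda>y. y + J) has_vector_derivative 1 *\<^sub>R h' (y + J)) (at y)"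
      by (rule vector_diff_chain_at) (rule deriv)
    from field_vector_diff_chain_at[OF this DERIV_exp] show ?thesis by (simp add: o_def)
  qed
  moreover have "((\<lambda>y. exp (h y)) has_vector_derivative h' y * exp (h y)) (at y)"
    using field_vector_diff_chain_at[OF deriv DERIV_exp] by (simp add: o_def)
  ultimately show ?thesis
    using vector_derivative_unique_at[of "\<lambda>y. exp (h y)" "h' (y + J) * exp (h y)" y "h' y * exp (h y)"]
    by (simp add: per)
qed

lemma speed_per: "speed S (y + J) = speed S y"
  by (simp add: speed_def per_re per_deriv)

text \<open>The cut-off destroys continuity, but on a compact interval \<open>speed\<close> is a
  continuous function times the indicator of a compact set.\<close>

lemma speed_integrable: "speed S integrable_on {a..b}"
proof -
  let ?K = "{a..b} \<inter> (\<lambda>y. \<bar>Re (h y)\<bar>) -` {..S}"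
  have "compact ?K"
    by (rule compact_Int_closed, simp, intro closed_vimage continuous_intros cont closed_atMost)
  then have "integrable lborel (\<lambda>x. indicat_real ?K x *\<^sub>R norm (h' x))"
    by (rule borel_integrable_compact) (use cont' continuous_on_subset in \<open>blast intro: continuous_on_norm\<close>)
  then have "(\<lambda>x. indicat_real ?K x *\<^sub>R norm (h' x)) integrable_on UNIV"
    by (rule integrable_on_lborel)
  moreover have "(\<lambda>x. indicat_real ?K x *\<^sub>R norm (h' x)) = (\<lambda>x. if x \<in> {a..b} then speed S x else 0)"
    by (auto simp: speed_def indicator_def)
  ultimately show ?thesis
    using integrable_restrict_UNIV by metis
qed

lemma piece:
  assumes "s \<le> t" "\<And>y. y \<in> {s..t} \<Longrightarrow> \<bar>Re (h y)\<bar> \<le> S"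
  shows "norm (h t - h s) \<le> integral {s..t} (speed S)"
proof -
  have "(h' has_integral (h t - h s)) {s..t}"
    using assms(1) deriv by (intro fundamental_theorem_of_calculus) (auto intro: has_vector_derivative_at_within)
  then have "norm (h t - h s) = norm (integral {s..t} h')" "h' integrable_on {s..t}" 
    by (simp_all add: integral_unique has_integral_integrable)
  then show ?thesis
    using integral_norm_bound_integral[of h' "{s..t}" "speed S"] assms(2) speed_integrable[of S s t]
    by (simp add: speed_def)
qed

lemma speed_mono_ivl:
  assumes "c \<le> a" "b \<le> d"
  shows "integral {a..b} (speed S) \<le> integral {c..d} (speed S)"
  by (rule integral_subset_le) (use assms speed_integrable speed_nonneg in auto)

lemma speed_period: "integral {a..a+J} (speed S) = integral {0..J} (speed S)"
  by (rule integral_periodic_shift) (use J speed_per speed_integrable in auto)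

text \<open>A period that starts at the low point \<open>y0\<close> contains a high point. From
  \<open>y0\<close> to the first time at level \<open>S\<close>, and from the last time at level
  \<open>S\<close> to \<open>y0 + J\<close>, the curve stays in the band, and on each of these two
  arcs the real part changes by at least \<open>S - s0\<close>.\<close>

lemma crossing:
  assumes s0: "\<bar>Re (h y0)\<bar> \<le> s0" and S: "\<bar>Re (h y1)\<bar> \<ge> S" "s0 < S"
  shows "2 * (S - s0) \<le> integral {0..J} (speed S)"
proof -
  let ?p = "\<lambda>y. \<bar>Re (h y)\<bar>"
  have cp: "continuous_on A ?p" for A by (intro continuous_intros cont)
  obtain k where k: "y0 \<le> y1 + of_int k * J" "y1 + of_int k * J < y0 + J"
    using periodic_representative[OF J] by blast
  define y2 where "y2 = y1 + of_int k * J"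
  have y2: "y0 \<le> y2" "y2 < y0 + J" "?p y2 \<ge> S"
    using k S periodic_int_shift[of "\<lambda>y. Re (h y)", OF per_re] by (auto simp: y2_def)
  have perp: "?p (y0 + J) \<le> s0" using s0 by (simp add: per_re)
  have A: "compact ({y0..y2} \<inter> ?p -` {S..})" and B: "compact ({y2..y0+J} \<inter> ?p -` {S..})"
    by (intro compact_Int_closed closed_vimage cp closed_atLeast compact_Icc)+
  obtain t1 where t1: "t1 \<in> {y0..y2}" "?p t1 \<ge> S" "\<And>y. y \<in> {y0..y2} \<Longrightarrow> ?p y \<ge> S \<Longrightarrow> t1 \<le> y"
    using compact_attains_inf[OF A] y2 by fastforce
  obtain t2 where t2: "t2 \<in> {y2..y0+J}" "?p t2 \<ge> S" "\<And>y. y \<in> {y2..y0+J} \<Longrightarrow> ?p y \<ge> S \<Longrightarrow> y \<le> t2"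
    using compact_attains_sup[OF B] y2 by fastforce
  have l1: "?p y \<le> S" if "y \<in> {y0..t1}" for y
  proof (cases "y = t1")
    case True
    \<comment> \<open>An overshoot at \<open>t1\<close> is impossible: the level \<open>S\<close>
      would have been taken earlier.\<close>
    have "\<exists>x\<ge>y0. x \<le> t1 \<and> ?p x = S"
      by (rule IVT') (use s0 S t1 cp in auto)
    then obtain x where "y0 \<le> x" "x \<le> t1" "?p x = S" by blast
    moreover from this have "t1 \<le> x" using t1(1) by (intro t1(3)) auto
    ultimately show ?thesis using True by simp
  next
    case False then show ?thesis using t1(3)[of y] that t1(1) by force
  qed
  have l2: "?p y \<le> S" if "y \<in> {t2..y0+J}" for y
  proof (cases "y = t2")
    case True
    have "\<exists>x\<ge>t2. x \<le> y0+J \<and> ?p x = S"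
      by (rule IVT2') (use perp S t2 cp in auto)
    then obtain x where "t2 \<le> x" "x \<le> y0 + J" "?p x = S" by blast
    moreover from this have "x \<le> t2" using t2(1) by (intro t2(3)) auto
    ultimately show ?thesis using True by simp
  next
    case False then show ?thesis using t2(3)[of y] that t2(1) by force
  qed
  have "S - s0 \<le> norm (h t1 - h y0)"
    using abs_Re_le_cmod[of "h t1 - h y0"] t1(2) s0 by auto
  also have "\<dots> \<le> integral {y0..t1} (speed S)"
    by (rule piece) (use t1 l1 in auto)
  finally have 1: "S - s0 \<le> integral {y0..t1} (speed S)" .
  have "S - s0 \<le> norm (h (y0+J) - h t2)"
    using abs_Re_le_cmod[of "h (y0+J) - h t2"] t2(2) perp by auto
  also have "\<dots> \<le> integral {t2..y0+J} (speed S)"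
    by (rule piece) (use t2 l2 in auto)
  also have "\<dots> \<le> integral {t1..y0+J} (speed S)"
    by (rule speed_mono_ivl) (use t1 t2 in auto)
  finally have "2 * (S - s0) \<le> integral {y0..t1} (speed S) + integral {t1..y0+J} (speed S)"
    using 1 by simp
  also have "\<dots> = integral {y0..y0+J} (speed S)"
    using t1(1) y2 speed_integrable by (intro Henstock_Kurzweil_Integration.integral_combine) auto
  finally show ?thesis by (simp add: speed_period)
qed

text \<open>Conjugation turns the second mean into -q, so half the sum and half the difference of
  \<open>exp h\<close> and \<open>cnj (exp (- h))\<close> have integrals 0 and q. In polar form
  these are cosh and sinh of the real part times the direction given by the imaginary part.\<close>

lemma cosh_int: "((\<lambda>y. cosh (Re (h y)) *\<^sub>R cis (Im (h y))) has_integral 0) {0..J}"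
proof -
  have "((\<lambda>y. (exp (h y) + cnj (exp (- h y))) /\<^sub>R 2) has_integral (q + cnj (- cnj q)) /\<^sub>R 2) {0..J}"
    by (intro has_integral_cmul has_integral_add int1 has_integral_cnj[unfolded o_def, THEN iffD2] int2)
  moreover have "(exp z + cnj (exp (- z))) /\<^sub>R 2 = cosh (Re z) *\<^sub>R cis (Im z)" for z
    by (simp add: complex_eq_iff Re_exp Im_exp cosh_def algebra_simps)
  ultimately show ?thesis by simp
qed

lemma sinh_int: "((\<lambda>y. sinh (Re (h y)) *\<^sub>R cis (Im (h y))) has_integral q) {0..J}"
proof -
  have "((\<lambda>y. (exp (h y) - cnj (exp (- h y))) /\<^sub>R 2) has_integral (q - cnj (- cnj q)) /\<^sub>R 2) {0..J}"
    by (intro has_integral_cmul has_integral_diff int1 has_integral_cnj[unfolded o_def, THEN iffD2] int2)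
  moreover have "(exp z - cnj (exp (- z))) /\<^sub>R 2 = sinh (Re z) *\<^sub>R cis (Im z)" for z
    by (simp add: complex_eq_iff Re_exp Im_exp sinh_def algebra_simps)
  moreover have "(q - cnj (- cnj q)) /\<^sub>R 2 = q" by (simp add: scaleR_conv_of_real)
  ultimately show ?thesis by simp
qed

text \<open>A closed curve on the unit circle that is shorter than \<open>2\<pi>\<close> lies in an open half circle, so
  its weighted centre of mass is not 0.\<close>

lemma turning:
  assumes S: "\<And>y. y \<in> {0..J} \<Longrightarrow> \<bar>Re (h y)\<bar> \<le> S"
  shows "2 * pi \<le> integral {0..J} (speed S)"
proof (rule ccontr)
  assume "\<not> ?thesis"
  then have less: "integral {0..J} (speed S) < 2 * pi" by simp
  let ?I = "\<lambda>s t. integral {s..t} (speed S)"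
  have le: "norm (h t - h s) \<le> ?I s t" if "0 \<le> s" "s \<le> t" "t \<le> J" for s t
    by (rule piece) (use that S in auto)
  \<comment> \<open>A loop this short cannot wind around the cylinder, since one turn already has
    length 2 pi; so \<open>h\<close> itself closes up.\<close>
  have hJ: "h J = h 0"
  proof -
    obtain n :: int where "h J = h 0 + of_int (2*n) * of_real pi * \<i>"
      using per[of 0] by (auto simp: exp_eq)
    then have n: "h J - h 0 = of_int (2*n) * of_real pi * \<i>" by simp
    have "norm (h J - h 0) < 2 * pi" using le[of 0 J] J less by simp
    then have "\<bar>real_of_int (2*n)\<bar> * pi < 2 * pi" unfolding n by (simp add: norm_mult)
    then have "n = 0" by simp
    then show ?thesis using n by simp
  qed
  \<comment> \<open>Two points cut the loop into two arcs, and one of them is shorter than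
    pi.\<close>
  have osc: "\<bar>Im (h t) - Im (h s)\<bar> < pi" if "0 \<le> s" "s \<le> t" "t \<le> J" for s t
  proof -
    have "?I 0 s + ?I s t = ?I 0 t" "?I 0 t + ?I t J = ?I 0 J"
      using that speed_integrable by (auto intro!: Henstock_Kurzweil_Integration.integral_combine)
    moreover have "norm (h t - h s) = norm ((h s - h 0) + (h J - h t))"
      by (simp add: hJ norm_minus_commute)
    then have "norm (h t - h s) \<le> ?I 0 s + ?I t J"
      using norm_triangle_ineq[of "h s - h 0" "h J - h t"] le[of 0 s] le[of t J] that by linarith
    moreover have "norm (h t - h s) \<le> ?I s t" by (rule le[OF that])
    ultimately show ?thesis using less abs_Im_le_cmod[of "h t - h s"] by simp
  qed
  have osc: "\<bar>Im (h t) - Im (h s)\<bar> < pi" if "s \<in> {0..J}" "t \<in> {0..J}" for s t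
    using osc[of s t] osc[of t s] that by (cases "s \<le> t") auto
  have ci: "continuous_on {0..J} (\<lambda>y. Im (h y))" by (intro continuous_intros cont)
  obtain a where a: "a \<in> {0..J}" "\<And>y. y \<in> {0..J} \<Longrightarrow> Im (h y) \<le> Im (h a)"
    using continuous_attains_sup[OF _ _ ci] J by auto
  obtain b where b: "b \<in> {0..J}" "\<And>y. y \<in> {0..J} \<Longrightarrow> Im (h b) \<le> Im (h y)"
    using continuous_attains_inf[OF _ _ ci] J by auto
  \<comment> \<open>The midpoint of the range of the angle is the axis of the open half circle that
    contains all directions.\<close>
  define \<mu> where "\<mu> = (Im (h a) + Im (h b)) / 2"
  then have mu2: "2 * \<mu> = Im (h a) + Im (h b)" by simp
  have half: "\<bar>Im (h y) - \<mu>\<bar> < pi / 2" if "y \<in> {0..J}" for y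
    using a(2)[OF that] b(2)[OF that] osc[OF a(1) b(1)] mu2 by linarith
  \<comment> \<open>The component of the cosh-weighted direction along \<open>\<mu>\<close>:
    positive everywhere, yet with integral 0.\<close>
  define F where "F y = cosh (Re (h y)) * cos (Im (h y) - \<mu>)" for y
  have "((\<lambda>y. Re (cnj (cis \<mu>) * (cosh (Re (h y)) *\<^sub>R cis (Im (h y))))) has_integral Re (cnj (cis \<mu>) * 0)) {0..J}"
    by (intro has_integral_Re has_integral_mult_right cosh_int)
  moreover have "Re (cnj (cis \<mu>) * (cosh (Re (h y)) *\<^sub>R cis (Im (h y)))) = F y" for y
    by (simp add: F_def cos_diff algebra_simps)
  ultimately have F0: "(F has_integral 0) {0..J}" by simp
  have Fpos: "F y > 0" if "y \<in> {0..J}" for y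
    using half[OF that] unfolding F_def abs_less_iff
    by (intro mult_pos_pos cosh_real_pos cos_gt_zero_pi) linarith+
  have cF: "continuous_on (cbox 0 J) F" unfolding F_def by (intro continuous_intros cont)
  have "F 0 = 0"
    by (rule has_integral_0_cbox_imp_0[OF cF]) (use F0 Fpos J in \<open>auto simp: less_imp_le\<close>)
  then show False using Fpos[of 0] J by simp
qed

text \<open>Strictness survives integration because the modulus attains its maximum on the compact
  period.\<close>

lemma int_norm_less:
  fixes f :: "real \<Rightarrow> complex"
  assumes f: "(f has_integral I) {0..J}" "continuous_on {0..J} f" and less: "\<And>y. y \<in> {0..J} \<Longrightarrow> norm (f y) < C"
  shows "norm I < C * J"
proof -
  obtain a where a: "a \<in> {0..J}" "\<And>y. y \<in> {0..J} \<Longrightarrow> norm (f y) \<le> norm (f a)"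
    using continuous_attains_sup[of "{0..J}" "\<lambda>y. norm (f y)"] J continuous_on_norm[OF f(2)]
    by auto
  have "norm I \<le> norm (f a) * measure lborel (cbox 0 J)"
    by (rule has_integral_bound[of _ f]) (use f a in auto)
  also have "\<dots> < C * J" using less[OF a(1)] J by simp
  finally show ?thesis .
qed

text \<open>If \<open>\<bar>Re h\<bar>\<close> exceeded \<open>s\<close> throughout,
  \<open>Re h\<close> would have constant sign by the intermediate value theorem. One of
  \<open>exp h\<close> and \<open>exp (- h)\<close> would then have modulus below exp(-s) \<le> t
  everywhere, although both have a mean of modulus \<open>t\<close>.\<close>

lemma small_re:
  assumes q: "norm q = t * J" "t > 0" and s: "exp (- s) \<le> t" "s \<ge> 0"
  shows "\<exists>y. \<bar>Re (h y)\<bar> \<le> s"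
proof (rule ccontr)
  assume "\<not> ?thesis"
  then have gt: "\<bar>Re (h y)\<bar> > s" for y by (meson not_le)
  have cr: "continuous_on UNIV (\<lambda>y. Re (h y))" by (intro continuous_intros cont)
  have "(\<forall>y. Re (h y) > s) \<or> (\<forall>y. Re (h y) < - s)"
  proof (rule ccontr)
    assume "\<not> ?thesis"
    then obtain y z where yz: "Re (h y) \<le> s" "Re (h z) \<ge> - s" by (meson not_le)
    then have "Re (h y) < 0" "Re (h z) > 0" using gt[of y] gt[of z] s by auto
    then have "\<exists>w. Re (h w) = 0"
      using IVT'[of "\<lambda>y. Re (h y)" y 0 z] IVT2'[of "\<lambda>y. Re (h y)" y 0 z] continuous_on_subset[OF cr]
      by (metis less_imp_le linear subset_UNIV)
    then obtain w where "Re (h w) = 0" by blast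
    then show False using gt[of w] s by simp
  qed
  then show False
  proof
    assume "\<forall>y. Re (h y) > s"
    then have "norm (exp (- h y)) < t" for y
      using s by (simp add: norm_exp_eq_Re) (smt (verit) exp_less_cancel_iff)
    then have "norm (- cnj q) < t * J"
      by (intro int_norm_less[OF int2]) (auto intro!: continuous_intros cont)
    then show False using q by simp
  next
    assume "\<forall>y. Re (h y) < - s"
    then have "norm (exp (h y)) < t" for y
      using s by (simp add: norm_exp_eq_Re) (smt (verit) exp_less_cancel_iff)
    then have "norm q < t * J"
      by (intro int_norm_less[OF int1]) (auto intro!: continuous_intros cont)
    then show False using q by simp
  qed
qed

text \<open>The mean of sinh(Re h) cis(Im h) has modulus \<open>t\<close>, so sinh of
  \<open>\<bar>Re h\<bar>\<close> cannot stay below \<open>t\<close>.\<close>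

lemma large_re:
  assumes q: "norm q = t * J" "t > 0"
  shows "\<exists>y. \<bar>Re (h y)\<bar> \<ge> arsinh t"
proof (rule ccontr)
  assume "\<not> ?thesis"
  then have "\<bar>Re (h y)\<bar> < arsinh t" for y by (meson not_le)
  then have "sinh \<bar>Re (h y)\<bar> < t" for y
    using strict_monoD[OF sinh_real_strict_mono] by (metis sinh_arsinh_real)
  then have "norm (sinh (Re (h y)) *\<^sub>R cis (Im (h y))) < t" for y
    by (simp add: norm_mult)
  then have "norm q < t * J"
    by (intro int_norm_less[OF sinh_int]) (auto intro!: continuous_intros cont)
  then show False using q by simp
qed

text \<open>For \<open>t \<ge> 1\<close> the low level can be taken to be 0: the curve meets Re = 0
  and also reaches \<open>arsinh t\<close>, and it has to go there and back.\<close>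

lemma length_large:
  assumes q: "norm q = t * J" "t \<ge> 1"
  shows "2 * arsinh t \<le> integral {0..J} (speed (arsinh t))"
proof -
  have "arsinh t > 0" using q by simp
  moreover obtain y0 where "\<bar>Re (h y0)\<bar> \<le> 0" using small_re[of t 0] q by auto
  moreover obtain y1 where "\<bar>Re (h y1)\<bar> \<ge> arsinh t" using large_re[of t] q by auto
  ultimately show ?thesis using crossing[of y0 0 "arsinh t" y1] by simp
qed

text \<open>Either the curve stays inside the wide band and has to turn around, or it leaves the
  band. In the second case it also visits the level ln(1/t), and \<open>S\<close> is so large that S
  - ln(1/t) \<ge> pi; the double crossing then costs at least 2 pi as well.\<close>

lemma length_small:
  assumes q: "norm q = t * J" "0 < t" "t < 1"
  shows "2 * pi \<le> integral {0..J} (speed (pi\<^sup>2 / arsinh t))"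
proof -
  define S where "S = pi\<^sup>2 / arsinh t"
  have L: "0 < arsinh t" using q by simp
  \<comment> \<open>From x \<le> sinh x for x \<ge> 0. It replaces pi^2 / arsinh t by the smaller
    pi^2 / t.\<close>
  have "arsinh t \<le> t"
  proof -
    define g where "g x = sinh x - x" for x :: real
    have "g 0 \<le> g (arsinh t)"
    proof (rule DERIV_nonneg_imp_nondecreasing[where f = g])
      show "0 \<le> arsinh t" using L by (rule less_imp_le)
      show "\<exists>y. (g has_real_derivative y) (at x) \<and> 0 \<le> y" for x
        unfolding g_def by (rule exI[of _ "cosh x - 1"]) (auto intro!: derivative_eq_intros simp: cosh_real_ge_1)
    qed
    then show ?thesis by (simp add: g_def)
  qed
  \<comment> \<open>With a = 1/t \<ge> 1 the bounds S \<ge> pi^2 a and ln a \<le> a - 1 give S - ln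
    a \<ge> (pi^2 - 1) a + 1 \<ge> pi.\<close>
  have "ln (1 / t) \<le> 1 / t - 1" using q by (intro ln_le_minus_one) auto
  moreover have "pi\<^sup>2 / t \<le> S" unfolding S_def using L \<open>arsinh t \<le> t\<close> by (intro divide_left_mono) auto
  moreover have "pi\<^sup>2 / t - 1 / t + 1 \<ge> pi"
  proof -
    have "pi\<^sup>2 \<ge> 3 * pi" using pi_gt3 by (simp add: power2_eq_square)
    then have "pi\<^sup>2 - 1 \<ge> pi" using pi_gt3 by linarith
    moreover have "(pi\<^sup>2 - 1) * 1 \<le> (pi\<^sup>2 - 1) * (1 / t)"
      using q \<open>pi\<^sup>2 - 1 \<ge> pi\<close> pi_gt3 by (intro mult_left_mono) (auto simp: field_simps)
    ultimately show ?thesis by (simp add: diff_divide_distrib)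
  qed
  ultimately have S: "S - ln (1 / t) \<ge> pi" by linarith
  show ?thesis
  proof (cases "\<exists>y. \<bar>Re (h y)\<bar> \<ge> S")
    case True
    have "exp (- ln (1 / t)) \<le> t" using q by (simp add: ln_div)
    moreover have "ln (1 / t) \<ge> 0" using q by simp
    ultimately obtain y0 where "\<bar>Re (h y0)\<bar> \<le> ln (1 / t)" using small_re q by blast
    moreover obtain y1 where "\<bar>Re (h y1)\<bar> \<ge> S" using True by blast
    ultimately have "2 * (S - ln (1 / t)) \<le> integral {0..J} (speed S)"
      using S pi_gt3 by (intro crossing) auto
    moreover have "2 * pi \<le> 2 * (S - ln (1 / t))" using S by simp
    ultimately show ?thesis unfolding S_def by (rule order_trans[rotated])
  next
    case False
    then have "\<bar>Re (h y)\<bar> \<le> S" for y by (meson less_imp_le not_le)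
    then show ?thesis using turning[of S] by (simp add: S_def)
  qed
qed

end

section \<open>The length-area estimate\<close>

text \<open>Charts and the change of variables live on \<open>real^2\<close>, holomorphic functions
  on \<open>complex\<close>; \<open>vec2\<close> and \<open>cplx\<close> translate between the
  two.\<close>

definition vec2 :: "complex \<Rightarrow> real^2" where "vec2 z = (\<chi> i. if i = 1 then Re z else Im z)"
definition cplx :: "real^2 \<Rightarrow> complex" where "cplx x = Complex (x $ 1) (x $ 2)"

lemma vec2_nth [simp]: "vec2 z $ 1 = Re z" "vec2 z $ 2 = Im z"
  by (simp_all add: vec2_def)

lemma cplx_simps [simp]: "Re (cplx x) = x $ 1" "Im (cplx x) = x $ 2"
  by (simp_all add: cplx_def)

lemma cplx_vec2 [simp]: "cplx (vec2 z) = z" "vec2 (cplx x) = x"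
  by (simp_all add: complex_eq_iff vec_eq_iff forall_2)

lemma bounded_linear_cplx: "bounded_linear cplx"
  by (rule linear_conv_bounded_linear[THEN iffD1], rule linearI) (auto simp: complex_eq_iff)

lemma bounded_linear_vec2: "bounded_linear vec2"
  by (rule linear_conv_bounded_linear[THEN iffD1], rule linearI) (auto simp: vec_eq_iff forall_2)

lemmas continuous_on_cplx [continuous_intros] = bounded_linear.continuous_on[OF bounded_linear_cplx]
lemmas continuous_on_vec2 [continuous_intros] = bounded_linear.continuous_on[OF bounded_linear_vec2]

lemma borel_cplx [measurable]: "cplx \<in> borel_measurable borel" and borel_vec2 [measurable]: "vec2 \<in> borel_measurable borel"
  by (auto intro!: borel_measurable_continuous_onI continuous_intros)

lemma has_derivative_vec2_cplx:
  assumes "(f has_field_derivative f') (at (cplx x))"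
  shows "((\<lambda>x. vec2 (f (cplx x))) has_derivative (\<lambda>v. vec2 (f' * cplx v))) (at x within S)"
proof -
  have "(cplx has_derivative cplx) (at x within S)"
    by (rule bounded_linear_imp_has_derivative[OF bounded_linear_cplx])
  then have "((\<lambda>x. f (cplx x)) has_derivative (\<lambda>v. f' * cplx v)) (at x within S)"
    using assms has_derivative_compose[of cplx cplx x S f "(*) f'"] by (simp add: has_field_derivative_def)
  then show ?thesis
    by (rule bounded_linear.has_derivative[OF bounded_linear_vec2])
qed

lemma det_mult_complex: "\<bar>det (matrix (\<lambda>v. vec2 (w * cplx v)))\<bar> = (cmod w)\<^sup>2"
  by (simp add: det_2 matrix_def axis_def cmod_power2 flip: power2_eq_square)

text \<open>The derivative of a holomorphic map acts as multiplication by f', whose Jacobian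
  determinant is |f'|^2.\<close>

lemma has_absolute_integral_holomorphic_change:
  fixes \<phi> :: "real^2 \<Rightarrow> real"
  assumes S: "S \<in> sets lebesgue" and d: "\<And>x. x \<in> S \<Longrightarrow> (f has_field_derivative f' (cplx x)) (at (cplx x))"
    and inj: "inj_on f (cplx ` S)"
  shows "(\<lambda>x. (cmod (f' (cplx x)))\<^sup>2 * \<phi> (vec2 (f (cplx x)))) absolutely_integrable_on S \<and>
           integral S (\<lambda>x. (cmod (f' (cplx x)))\<^sup>2 * \<phi> (vec2 (f (cplx x)))) = b
     \<longleftrightarrow> \<phi> absolutely_integrable_on ((\<lambda>x. vec2 (f (cplx x))) ` S) \<and> integral ((\<lambda>x. vec2 (f (cplx x))) ` S) \<phi> = b"
proof -
  have "inj_on (\<lambda>x. vec2 (f (cplx x))) S"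
    by (intro inj_onI) (metis cplx_vec2 image_eqI inj inj_on_eq_iff)
  \<comment> \<open>The change of variables speaks of vector-valued integrands, hence the detour
    through \<open>real^1\<close>.\<close>
  from has_absolute_integral_change_of_variables[OF S has_derivative_vec2_cplx[OF d] this, where f = "\<lambda>y. vec (\<phi> y) :: real^1" and b = "vec b"]
  show ?thesis
    unfolding absolutely_integrable_on_1_iff integral_on_1_eq det_mult_complex
    by (simp add: vec_eq_iff cong: conj_cong)
qed

text \<open>Lebesgue measure on \<open>real^2\<close> is the image of the product measure, because
  both give the same value to boxes; Tonelli does the rest.\<close>

lemma nn_integral_vec2:
  fixes f :: "real^2 \<Rightarrow> ennreal"
  assumes [measurable]: "f \<in> borel_measurable borel"
  shows "(\<integral>\<^sup>+x. f x \<partial>lborel) = (\<integral>\<^sup>+a. (\<integral>\<^sup>+b. f (vec2 (Complex a b)) \<partial>lborel) \<partial>lborel)"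
proof -
  define p :: "real \<times> real \<Rightarrow> real^2" where "p = (\<lambda>(a, b). vec2 (Complex a b))"
  have "continuous_on UNIV p" unfolding p_def case_prod_unfold Complex_eq by (intro continuous_intros)
  then have p [measurable]: "p \<in> borel_measurable borel"
    by (rule borel_measurable_continuous_onI)
  have "lborel = distr (lborel :: (real \<times> real) measure) borel p"
  proof (rule lborel_eqI)
    fix l u :: "real^2" assume le: "\<And>b. b \<in> Basis \<Longrightarrow> l \<bullet> b \<le> u \<bullet> b"
    have le': "l $ i \<le> u $ i" for i
      using le[of "axis i 1"] by (simp add: inner_axis)
    have "p -` box l u = box (l $ 1, l $ 2) (u $ 1, u $ 2)"
      by (auto simp: p_def mem_box_cart forall_2 mem_box Basis_prod_def)
    then have "emeasure (distr lborel borel p) (box l u) = emeasure lborel (box (l $ 1, l $ 2) (u $ 1, u $ 2))"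
      by (simp add: emeasure_distr)
    also have "\<dots> = ennreal ((u $ 1 - l $ 1) * (u $ 2 - l $ 2))"
      using le' by (subst emeasure_lborel_box) (auto simp: Basis_prod_def prod.union_disjoint sum_Basis_prod_eq)
    also have "\<dots> = ennreal (\<Prod>b\<in>Basis. (u - l) \<bullet> b)"
      by (simp add: Basis_vec_def UNIV_2 inner_axis axis_eq_axis mult.commute)
    finally show "emeasure (distr lborel borel p) (box l u) = ennreal (\<Prod>b\<in>Basis. (u - l) \<bullet> b)" .
  qed simp
  then have "(\<integral>\<^sup>+x. f x \<partial>lborel) = (\<integral>\<^sup>+x. f x \<partial>distr lborel borel p)" by simp
  also have "\<dots> = (\<integral>\<^sup>+z. f (p z) \<partial>lborel)" by (rule nn_integral_distr) auto
  also have "\<dots> = (\<integral>\<^sup>+z. f (p z) \<partial>(lborel \<Otimes>\<^sub>M lborel))" by (simp add: lborel_prod)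
  also have "\<dots> = (\<integral>\<^sup>+a. (\<integral>\<^sup>+b. f (p (a, b)) \<partial>lborel) \<partial>lborel)"
    by (rule lborel.nn_integral_fst[symmetric]) (simp add: lborel_prod)
  finally show ?thesis by (simp add: p_def)
qed

text \<open>The weight 1/|w|^2 is the area density of the flat cylinder seen through exp, so the
  integral is the area of a rectangle with sides 2S and 2 pi on which exp is injective.\<close>

lemma annulus_integral:
  fixes S :: real
  assumes "S \<ge> 0"
  defines "R \<equiv> {x::real^2. - S \<le> x $ 1 \<and> x $ 1 \<le> S \<and> 0 \<le> x $ 2 \<and> x $ 2 < 2 * pi}"
  shows "(\<lambda>x. 1 / (cmod (cplx x))\<^sup>2) absolutely_integrable_on ((\<lambda>x. vec2 (exp (cplx x))) ` R)"
    and "integral ((\<lambda>x. vec2 (exp (cplx x))) ` R) (\<lambda>x. 1 / (cmod (cplx x))\<^sup>2) = 4 * pi * S"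
proof -
  let ?C = "cbox (vec2 (Complex (- S) 0)) (vec2 (Complex S (2 * pi)))"
  have sub: "R \<subseteq> ?C" by (auto simp: R_def mem_box_cart forall_2)
  have Rb: "R \<in> sets lborel" unfolding R_def by simp
  then have R: "R \<in> sets lebesgue" by simp
  \<comment> \<open>\<open>R\<close> is half-open in the angle for the sake of injectivity; the
    missing edge has measure zero.\<close>
  have diff: "?C - R \<subseteq> {x. x $ 2 = 2 * pi}" by (auto simp: R_def mem_box_cart forall_2)
  have "negligible {x::real^2. x $ 2 = 2 * pi}" 
    using negligible_standard_hyperplane[of "axis 2 1 :: real^2" "2 * pi"] by (simp add: inner_axis' axis_in_Basis_iff inner_axis)
  then have neg: "negligible (?C - R)" using diff negligible_subset by blast
  have "((\<lambda>x. 1::real) has_integral (1 * measure lebesgue ?C)) ?C"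
    using has_integral_const[of "1::real" "vec2 (Complex (- S) 0)" "vec2 (Complex S (2 * pi))"] by simp
  moreover have "measure lebesgue ?C = 4 * pi * S"
  proof -
    have "?C \<noteq> {}" using assms(1) by (auto simp: interval_ne_empty_cart forall_2)
    then show ?thesis by (simp add: content_cbox_cart UNIV_2)
  qed
  ultimately have "((\<lambda>x. 1::real) has_integral (4 * pi * S)) ?C" by simp
  then have 1: "((\<lambda>x. 1::real) has_integral (4 * pi * S)) R"
    using sub by (subst has_integral_spike_set_eq[of R ?C]) (auto intro: negligible_subset[OF neg])
  then have "(\<lambda>x. 1::real) absolutely_integrable_on R"
    by (auto intro!: nonnegative_absolutely_integrable_1)
  moreover have "(\<lambda>x. (cmod (exp (cplx x)))\<^sup>2 * (1 / (cmod (cplx (vec2 (exp (cplx x)))))\<^sup>2)) = (\<lambda>x. 1::real)"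
    by auto
  moreover have "inj_on exp (cplx ` R)"
  proof (intro inj_onI)
    fix z w assume zw: "z \<in> cplx ` R" "w \<in> cplx ` R" "exp z = exp w"
    then obtain n :: int where n: "z = w + of_int (2*n) * of_real pi * \<i>" by (auto simp: exp_eq)
    have "Im z = Im w + 2 * pi * of_int n" "Re z = Re w" by (auto simp: n)
    moreover have "0 \<le> Im z" "Im z < 2*pi" "0 \<le> Im w" "Im w < 2*pi" using zw by (auto simp: R_def)
    ultimately have "\<bar>2 * pi * real_of_int n\<bar> < 2 * pi" by linarith
    then have "\<bar>real_of_int n\<bar> < 1" by (simp add: abs_mult)
    then have "n = 0" by simp
    then show "z = w" using n by simp
  qed
  ultimately show "(\<lambda>x. 1 / (cmod (cplx x))\<^sup>2) absolutely_integrable_on ((\<lambda>x. vec2 (exp (cplx x))) ` R)"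
    and "integral ((\<lambda>x. vec2 (exp (cplx x))) ` R) (\<lambda>x. 1 / (cmod (cplx x))\<^sup>2) = 4 * pi * S"
    using has_absolute_integral_holomorphic_change[OF R DERIV_exp, where \<phi> = "\<lambda>x. 1 / (cmod (cplx x))\<^sup>2" and b = "4 * pi * S"]
      integral_unique[OF 1] by auto
qed

text \<open>The length-area method: \<open>l\<^sup>2/J\<close> bounds the energy of each vertical curve from below, and the total
  energy is the area of a part of the cylinder of height \<open>2S\<close> and circumference \<open>2\<pi>\<close>.\<close>

lemma energy_upper:
  fixes H H' :: "complex \<Rightarrow> complex"
  assumes S: "S \<ge> 0"
    and der: "\<And>z. c < Re z \<Longrightarrow> Re z < d \<Longrightarrow> (H has_field_derivative H' z) (at z)"
    and inj: "\<And>z w. c < Re z \<Longrightarrow> Re z < d \<Longrightarrow> c < Re w \<Longrightarrow> Re w < d \<Longrightarrow>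
        0 \<le> Im z \<Longrightarrow> Im z < J \<Longrightarrow> 0 \<le> Im w \<Longrightarrow> Im w < J \<Longrightarrow> exp (H z) = exp (H w) \<Longrightarrow> z = w"
    and E: "E = {x. c < x $ 1 \<and> x $ 1 < d \<and> 0 \<le> x $ 2 \<and> x $ 2 < J \<and> \<bar>Re (H (cplx x))\<bar> \<le> S}"
    and Eb: "E \<in> sets borel"
  shows "(\<lambda>x. (cmod (H' (cplx x)))\<^sup>2) absolutely_integrable_on E"
    and "integral E (\<lambda>x. (cmod (H' (cplx x)))\<^sup>2) \<le> 4 * pi * S"
proof -
  define R where "R = {x::real^2. - S \<le> x $ 1 \<and> x $ 1 \<le> S \<and> 0 \<le> x $ 2 \<and> x $ 2 < 2 * pi}"
  define A where "A = (\<lambda>x. vec2 (exp (cplx x))) ` R"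
  define \<phi> where "\<phi> = (\<lambda>x. 1 / (cmod (cplx x))\<^sup>2)"
  define G where "G = (\<lambda>x. vec2 (exp (H (cplx x))))"
  have A: "\<phi> absolutely_integrable_on A" "integral A \<phi> = 4 * pi * S"
    using annulus_integral[OF S] by (simp_all add: A_def R_def \<phi>_def)
  have El: "E \<in> sets lebesgue" using Eb by simp
  have d: "((\<lambda>z. exp (H z)) has_field_derivative exp (H z) * H' z) (at z)" if "z \<in> cplx ` E" for z
    using that by (intro DERIV_chain2[OF DERIV_exp] der) (auto simp: E)
  have inj': "inj_on (\<lambda>z. exp (H z)) (cplx ` E)"
    by (rule inj_onI, rule inj) (auto simp: E)
  \<comment> \<open>The imaginary part of \<open>H\<close> is not confined to one period. A shift by
    a multiple of 2 pi is invisible after exp, so the image still lies in the standard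
    annulus.\<close>
  have GA: "G ` E \<subseteq> A"
  proof clarify
    fix x assume x: "x \<in> E"
    let ?w = "H (cplx x)"
    obtain k where k: "0 \<le> Im ?w + of_int k * (2 * pi)" "Im ?w + of_int k * (2 * pi) < 0 + 2 * pi"
      using periodic_representative[of "2 * pi" 0 "Im ?w"] by auto
    let ?y = "vec2 (Complex (Re ?w) (Im ?w + of_int k * (2 * pi)))"
    have "?y \<in> R" using k x by (auto simp: R_def E)
    moreover have "exp (cplx ?y) = exp ?w"
    proof -
      have "cplx ?y = ?w + (of_int k * of_real (2 * pi)) * \<i>" by (simp add: complex_eq_iff)
      then show ?thesis by (simp add: exp_eq)
    qed
    ultimately show "G x \<in> A" unfolding G_def A_def by force
  qed
  have "G differentiable_on E"
    unfolding G_def differentiable_on_def differentiable_def using has_derivative_vec2_cplx[OF d] by blast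
  then have GE: "G ` E \<in> sets lebesgue"
    by (intro differentiable_image_in_sets_lebesgue[OF El]) auto
  have G: "\<phi> absolutely_integrable_on G ` E"
    by (rule set_integrable_subset[OF A(1) GE GA])
  \<comment> \<open>Pulled back through exp H, the weight 1/|w|^2 leaves exactly |H'|^2.\<close>
  have *: "(cmod (exp (H z) * H' z))\<^sup>2 * \<phi> (vec2 (exp (H z))) = (cmod (H' z))\<^sup>2" for z
    by (simp add: \<phi>_def norm_mult power_mult_distrib)
  have "(\<lambda>x. (cmod (H' (cplx x)))\<^sup>2) absolutely_integrable_on E \<and>
     integral E (\<lambda>x. (cmod (H' (cplx x)))\<^sup>2) = integral (G ` E) \<phi>"
    using has_absolute_integral_holomorphic_change[OF El d inj', where \<phi> = \<phi> and b = "integral (G ` E) \<phi>"] G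
    unfolding * G_def by auto
  moreover have "integral (G ` E) \<phi> \<le> integral A \<phi>"
    by (rule integral_subset_le[OF GA])
      (use G A in \<open>auto simp: \<phi>_def dest: set_lebesgue_integral_eq_integral\<close>)
  ultimately show "(\<lambda>x. (cmod (H' (cplx x)))\<^sup>2) absolutely_integrable_on E"
    and "integral E (\<lambda>x. (cmod (H' (cplx x)))\<^sup>2) \<le> 4 * pi * S"
    using A(2) by auto
qed

text \<open>Cauchy-Schwarz between the truncated speed and the constant 1 on a period.\<close>

lemma (in log_curve) energy_lower:
  assumes l: "0 \<le> l" "l \<le> integral {0..J} (speed S)"
  shows "ennreal (l\<^sup>2) \<le> ennreal J * (\<integral>\<^sup>+y. ennreal ((speed S y)\<^sup>2) * indicator {0..<J} y \<partial>lborel)"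
proof -
  let ?i = "indicator {0..J} :: real \<Rightarrow> ennreal"
  have cr: "continuous_on UNIV (\<lambda>y. Re (h y))" "continuous_on UNIV h'" by (intro continuous_intros cont cont')+
  note [measurable] = borel_measurable_continuous_onI[OF cr(1)] borel_measurable_continuous_onI[OF cr(2)]
  have [measurable]: "speed S \<in> borel_measurable borel"
    unfolding speed_def by measurable
  have "(speed S has_integral integral {0..J} (speed S)) {0..J}"
    using speed_integrable by (rule integrable_integral)
  then have "(\<integral>\<^sup>+y. ennreal (speed S y) * ?i y \<partial>lborel) = ennreal (integral {0..J} (speed S))"
    by (subst nn_integral_has_integral_lebesgue[symmetric, of "{0..J}" "speed S"])
      (auto simp: speed_nonneg indicator_def intro!: nn_integral_cong)
  then have "ennreal l \<le> (\<integral>\<^sup>+y. ?i y * (ennreal (speed S y) * ?i y) \<partial>lborel)"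
  proof -
    have "(\<lambda>y. ?i y * (ennreal (speed S y) * ?i y)) = (\<lambda>y. ennreal (speed S y) * ?i y)"
      by (auto simp: indicator_def)
    moreover assume "(\<integral>\<^sup>+y. ennreal (speed S y) * ?i y \<partial>lborel) = ennreal (integral {0..J} (speed S))"
    ultimately show ?thesis using l by (simp add: ennreal_leI)
  qed
  then have "(ennreal l)\<^sup>2 \<le> (\<integral>\<^sup>+y. ?i y * (ennreal (speed S y) * ?i y) \<partial>lborel)\<^sup>2"
    by (rule power_mono) simp
  also have "\<dots> \<le> (\<integral>\<^sup>+y. (?i y)\<^sup>2 \<partial>lborel) * (\<integral>\<^sup>+y. (ennreal (speed S y) * ?i y)\<^sup>2 \<partial>lborel)"
    by (rule Cauchy_Schwarz_nn_integral) auto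
  also have "(\<integral>\<^sup>+y. (?i y)\<^sup>2 \<partial>lborel) = (\<integral>\<^sup>+y. ?i y \<partial>lborel)"
    by (intro nn_integral_cong) (auto simp: indicator_def)
  also have "\<dots> = ennreal J" using J by simp
  \<comment> \<open>The endpoint \<open>J\<close> is dropped, a null set, to match the half-open
    fundamental domain over which the area is taken.\<close>
  also have "(\<integral>\<^sup>+y. (ennreal (speed S y) * ?i y)\<^sup>2 \<partial>lborel) = (\<integral>\<^sup>+y. ennreal ((speed S y)\<^sup>2) * indicator {0..<J} y \<partial>lborel)"
  proof (rule nn_integral_cong_AE)
    show "AE y in lborel. (ennreal (speed S y) * ?i y)\<^sup>2 = ennreal ((speed S y)\<^sup>2) * indicator {0..<J} y"
      using AE_lborel_singleton[of J]
      by eventually_elim (auto simp: indicator_def ennreal_power speed_nonneg)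
  qed
  finally show ?thesis using l by (simp add: ennreal_power)
qed

text \<open>Integrating the bound l^2 \<le> J * energy of single vertical lines over c < x < d gives
  l^2 (d - c) on the left and at most J times the area 4 pi S on the right.\<close>

theorem ring_estimate:
  fixes H H' :: "complex \<Rightarrow> complex"
  assumes cd: "c < d" and J: "J > 0" and t: "t > 0" "cmod q = t * J"
    and der: "\<And>z. c < Re z \<Longrightarrow> Re z < d \<Longrightarrow> (H has_field_derivative H' z) (at z)"
    and per: "\<And>z. c < Re z \<Longrightarrow> Re z < d \<Longrightarrow> exp (H (z + \<i> * of_real J)) = exp (H z)"
    and inj: "\<And>z w. c < Re z \<Longrightarrow> Re z < d \<Longrightarrow> c < Re w \<Longrightarrow> Re w < d \<Longrightarrow>
        0 \<le> Im z \<Longrightarrow> Im z < J \<Longrightarrow> 0 \<le> Im w \<Longrightarrow> Im w < J \<Longrightarrow> exp (H z) = exp (H w) \<Longrightarrow> z = w"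
    and int1: "\<And>x. c < x \<Longrightarrow> x < d \<Longrightarrow> ((\<lambda>y. exp (H (Complex x y))) has_integral q) {0..J}"
    and int2: "\<And>x. c < x \<Longrightarrow> x < d \<Longrightarrow> ((\<lambda>y. exp (- H (Complex x y))) has_integral - cnj q) {0..J}"
  shows "d - c \<le> pi * J / arsinh t"
proof -
  \<comment> \<open>Both choices satisfy 4 pi S / l^2 = pi / arsinh t, which is the final
    constant.\<close>
  define S where "S = (if t \<ge> 1 then arsinh t else pi\<^sup>2 / arsinh t)"
  define l where "l = (if t \<ge> 1 then 2 * arsinh t else 2 * pi)"
  have L: "arsinh t > 0" using t by simp
  have S: "S \<ge> 0" and l: "l > 0" using L by (auto simp: S_def l_def simp del: arsinh_real_pos_iff)
  define D where "D = {x::real^2. c < x $ 1 \<and> x $ 1 < d}"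
  have D_eq: "D = {x. c < x $ 1} \<inter> {x. x $ 1 < d}" by (auto simp: D_def)
  have oD: "open D" unfolding D_eq
    by (intro open_Int open_Collect_less continuous_intros)
  let ?D = "{z. c < Re z} \<inter> {z. Re z < d}"
  have oD': "open ?D" by (intro open_Int open_halfspace_Re_gt open_halfspace_Re_lt)
  have hol: "H holomorphic_on ?D" using der oD' by (auto simp: holomorphic_on_open)
  have "H' z = deriv H z" if "z \<in> ?D" for z using der[of z] that by (auto simp: DERIV_imp_deriv)
  then have hol': "H' holomorphic_on ?D"
    using holomorphic_deriv[OF hol oD'] by (metis holomorphic_transform)
  have cH: "continuous_on D (\<lambda>x. Re (H (cplx x)))" "continuous_on D (\<lambda>x. (cmod (H' (cplx x)))\<^sup>2)"
    by (intro continuous_intros continuous_on_compose2[OF holomorphic_on_imp_continuous_on[OF hol]]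
        continuous_on_compose2[OF holomorphic_on_imp_continuous_on[OF hol']]; auto simp: D_def)+
  have Db: "D \<in> sets borel" using oD by simp
  \<comment> \<open>Nothing is known about \<open>H\<close> outside the strip; extension by 0
    produces Borel functions on the whole plane.\<close>
  define p where "p x = indicator D x *\<^sub>R Re (H (cplx x))" for x
  define k where "k x = indicator D x *\<^sub>R (cmod (H' (cplx x)))\<^sup>2" for x
  have [measurable]: "p \<in> borel_measurable borel" "k \<in> borel_measurable borel"
    unfolding p_def k_def by (rule borel_measurable_continuous_on_indicator[OF Db cH(1)] borel_measurable_continuous_on_indicator[OF Db cH(2)])+
  define E where "E = {x. c < x $ 1 \<and> x $ 1 < d \<and> 0 \<le> x $ 2 \<and> x $ 2 < J \<and> \<bar>Re (H (cplx x))\<bar> \<le> S}"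
  have "E = D \<inter> {x. 0 \<le> x $ 2 \<and> x $ 2 < J \<and> \<bar>p x\<bar> \<le> S}"
    by (auto simp: E_def D_def p_def)
  moreover have "{x::real^2. 0 \<le> x $ 2 \<and> x $ 2 < J \<and> \<bar>p x\<bar> \<le> S} \<in> sets borel" by measurable
  ultimately have Eb [measurable]: "E \<in> sets borel" using Db by auto
  have up: "(\<lambda>x. (cmod (H' (cplx x)))\<^sup>2) absolutely_integrable_on E"
      "integral E (\<lambda>x. (cmod (H' (cplx x)))\<^sup>2) \<le> 4 * pi * S"
    by (rule energy_upper[OF S der inj E_def Eb]; assumption)+
  have "(\<integral>\<^sup>+x. ennreal (k x) * indicator E x \<partial>lborel) = (\<integral>\<^sup>+x. ennreal (k x) * indicator E x \<partial>lebesgue)"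
    by (rule nn_integral_completion[symmetric])
  also have "\<dots> = (\<integral>\<^sup>+x. ennreal (indicator E x *\<^sub>R (cmod (H' (cplx x)))\<^sup>2) \<partial>lebesgue)"
  proof (rule nn_integral_cong)
    fix x show "ennreal (k x) * indicator E x = ennreal (indicator E x *\<^sub>R (cmod (H' (cplx x)))\<^sup>2)"
      by (cases "x \<in> E") (simp_all add: k_def E_def D_def)
  qed
  also have "\<dots> = ennreal (LINT x:E|lebesgue. (cmod (H' (cplx x)))\<^sup>2)"
    unfolding set_lebesgue_integral_def
    using up(1)[unfolded set_integrable_def] by (rule nn_integral_eq_integral) (intro AE_I2 scaleR_nonneg_nonneg indicator_pos_le zero_le_power2)
  also have "\<dots> = ennreal (integral E (\<lambda>x. (cmod (H' (cplx x)))\<^sup>2))"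
    by (rule arg_cong[OF set_lebesgue_integral_eq_integral(2)[OF up(1)]])
  also have "\<dots> \<le> ennreal (4 * pi * S)" using up(2) by (rule ennreal_leI)
  finally have upper: "(\<integral>\<^sup>+x. ennreal (k x) * indicator E x \<partial>lborel) \<le> ennreal (4 * pi * S)" .
  have line: "ennreal (l\<^sup>2) \<le> ennreal J * (\<integral>\<^sup>+y. ennreal (k (vec2 (Complex x y))) * indicator E (vec2 (Complex x y)) \<partial>lborel)"
    if x: "c < x" "x < d" for x
  proof -
    interpret log_curve "\<lambda>y. H (Complex x y)" "\<lambda>y. \<i> * H' (Complex x y)" J q
    proof
      fix y
      have "((\<lambda>y. Complex x y) has_vector_derivative \<i>) (at y)"
        unfolding Complex_eq by (auto intro!: derivative_eq_intros)
      from field_vector_diff_chain_at[OF this der[of "Complex x y"]] x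
      show "((\<lambda>y. H (Complex x y)) has_vector_derivative \<i> * H' (Complex x y)) (at y)"
        by (simp add: o_def)
      show "exp (H (Complex x (y + J))) = exp (H (Complex x y))"
        using per[of "Complex x y"] x by (simp add: Complex_eq algebra_simps)
    next
      show "continuous_on UNIV (\<lambda>y. \<i> * H' (Complex x y))"
        unfolding Complex_eq
        by (intro continuous_intros continuous_on_compose2[OF holomorphic_on_imp_continuous_on[OF hol']]) (use x in auto)
    qed (use J int1 int2 x in auto)
    have "l \<le> integral {0..J} (speed S)"
      using length_large[OF t(2)] length_small[OF t(2,1)] by (auto simp: l_def S_def)
    then have "ennreal (l\<^sup>2) \<le> ennreal J * (\<integral>\<^sup>+y. ennreal ((speed S y)\<^sup>2) * indicator {0..<J} y \<partial>lborel)"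
      using l by (intro energy_lower) auto
    also have "(\<integral>\<^sup>+y. ennreal ((speed S y)\<^sup>2) * indicator {0..<J} y \<partial>lborel) =
        (\<integral>\<^sup>+y. ennreal (k (vec2 (Complex x y))) * indicator E (vec2 (Complex x y)) \<partial>lborel)"
      
    proof (rule nn_integral_cong)
      fix y show "ennreal ((speed S y)\<^sup>2) * indicator {0..<J} y =
          ennreal (k (vec2 (Complex x y))) * indicator E (vec2 (Complex x y))"
        using x by (cases "0 \<le> y \<and> y < J"; cases "\<bar>Re (H (Complex x y))\<bar> \<le> S")
          (simp_all add: speed_def k_def E_def D_def norm_mult)
    qed
    finally show ?thesis .
  qed
  have "(\<integral>\<^sup>+x. ennreal (l\<^sup>2) * indicator {c<..<d} x \<partial>lborel) \<le>
      (\<integral>\<^sup>+x. ennreal J * (\<integral>\<^sup>+y. ennreal (k (vec2 (Complex x y))) * indicator E (vec2 (Complex x y)) \<partial>lborel) \<partial>lborel)"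
    by (intro nn_integral_mono) (use line in \<open>auto simp: indicator_def\<close>)
  also have "\<dots> = ennreal J * (\<integral>\<^sup>+x. (\<integral>\<^sup>+y. ennreal (k (vec2 (Complex x y))) * indicator E (vec2 (Complex x y)) \<partial>lborel) \<partial>lborel)"
    by (rule nn_integral_cmult) (simp add: Complex_eq)
  also have "\<dots> = ennreal J * (\<integral>\<^sup>+x. ennreal (k x) * indicator E x \<partial>lborel)"
    by (subst nn_integral_vec2) auto
  also have "\<dots> \<le> ennreal J * ennreal (4 * pi * S)" using upper by (rule mult_left_mono) simp
  finally have "ennreal (l\<^sup>2 * (d - c)) \<le> ennreal (J * (4 * pi * S))"
    using cd J S by (simp add: nn_integral_cmult ennreal_mult' ennreal_mult'')
  then have *: "l\<^sup>2 * (d - c) \<le> J * (4 * pi * S)"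
    using J S by (subst (asm) ennreal_le_iff) auto
  show ?thesis
  proof (cases "t \<ge> 1")
    case True
    with * have "(4 * arsinh t) * (arsinh t * (d - c)) \<le> (4 * arsinh t) * (pi * J)"
      by (simp add: l_def S_def power2_eq_square algebra_simps)
    then show ?thesis using L by (simp add: pos_le_divide_eq mult.commute)
  next
    case False
    with * have "(4 * pi\<^sup>2) * (d - c) \<le> (4 * pi\<^sup>2) * (pi * J / arsinh t)"
      by (simp add: l_def S_def power2_eq_square algebra_simps)
    then show ?thesis by (subst (asm) mult_le_cancel_left_pos) auto
  qed
qed

section \<open>Conformal coordinates on a minimal surface\<close>

text \<open>The mean value inequality is applied, in direction \<open>b\<close>, to the difference
  of \<open>f\<close> along two parallel segments a step t a apart, minus its expected value. The
  derivative of this difference is o(t^2) because \<open>f'\<close> is differentiable at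
  \<open>x\<close>.\<close>

lemma second_difference:
  fixes f :: "'a::real_normed_vector \<Rightarrow> 'b::real_normed_vector"
  assumes S: "open S" "x \<in> S"
    and f: "\<And>y. y \<in> S \<Longrightarrow> (f has_derivative blinfun_apply (f' y)) (at y)"
    and f': "(f' has_derivative blinfun_apply f'') (at x)"
    and e: "e > 0"
  shows "\<exists>d>0. \<forall>t. 0 < t \<longrightarrow> t < d \<longrightarrow>
    norm (f (x + t *\<^sub>R a + t *\<^sub>R b) - f (x + t *\<^sub>R a) - f (x + t *\<^sub>R b) + f x - t\<^sup>2 *\<^sub>R f'' a b) \<le> e * t\<^sup>2"
proof -
  define M where "M = norm a + norm b + 1"
  have M: "M > 0" "norm a + norm b \<le> M" "norm b \<le> M" by (auto simp: M_def add_nonneg_pos)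
  \<comment> \<open>The error of \<open>f'\<close> enters twice, each time at most e' t M, and acts
    on a vector of length at most t M: in total 2 e' M^2 t^2 = e t^2.\<close>
  define e' where "e' = e / (2 * M * M)"
  have e': "e' > 0" using e M by (simp add: e'_def)
  obtain d1 where d1: "d1 > 0" "\<And>y. norm (y - x) < d1 \<Longrightarrow> norm (f' y - f' x - f'' (y - x)) \<le> e' * norm (y - x)"
    using f' e' unfolding has_derivative_at_alt by blast
  obtain d2 where d2: "d2 > 0" "ball x d2 \<subseteq> S" using S open_contains_ball by blast
  define d where "d = min d1 d2 / M"
  have "d > 0" using d1 d2 M by (simp add: d_def)
  moreover have "norm (f (x + t *\<^sub>R a + t *\<^sub>R b) - f (x + t *\<^sub>R a) - f (x + t *\<^sub>R b) + f x - t\<^sup>2 *\<^sub>R f'' a b) \<le> e * t\<^sup>2"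
    if t: "0 < t" "t < d" for t
  proof -
    have tM: "t * M < d1" "t * M < d2" using t M by (auto simp: d_def pos_less_divide_eq)
    have nrm: "norm (\<sigma> *\<^sub>R t *\<^sub>R a + s *\<^sub>R t *\<^sub>R b) \<le> t * M" if "s \<in> {0..1}" "\<sigma> \<in> {0..1}" for s \<sigma> :: real
    proof -
      have "norm (\<sigma> *\<^sub>R t *\<^sub>R a + s *\<^sub>R t *\<^sub>R b) \<le> \<sigma> * (t * norm a) + s * (t * norm b)"
        using that t norm_triangle_ineq[of "\<sigma> *\<^sub>R t *\<^sub>R a" "s *\<^sub>R t *\<^sub>R b"] by simp
      also have "\<dots> \<le> 1 * (t * norm a) + 1 * (t * norm b)"
        using that t by (intro add_mono mult_right_mono) auto
      also have "\<dots> \<le> t * M" using M t by (simp add: distrib_left[symmetric])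
      finally show ?thesis .
    qed
    define p where "p \<sigma> s = x + (\<sigma> *\<^sub>R t *\<^sub>R a + s *\<^sub>R t *\<^sub>R b)" for \<sigma> s :: real
    have pS: "p \<sigma> s \<in> S" and pf: "norm (f' (p \<sigma> s) - f' x - f'' (p \<sigma> s - x)) \<le> e' * (t * M)"
      if "s \<in> {0..1}" "\<sigma> \<in> {0..1}" for s \<sigma>
    proof -
      have n: "norm (p \<sigma> s - x) \<le> t * M" using nrm[OF that] by (simp add: p_def)
      then show "p \<sigma> s \<in> S" using d2(2) tM by (auto simp: dist_norm norm_minus_commute intro!: subsetD[OF d2(2)])
      have "norm (f' (p \<sigma> s) - f' x - f'' (p \<sigma> s - x)) \<le> e' * norm (p \<sigma> s - x)"
        using n tM by (intro d1(2)) simp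
      also have "\<dots> \<le> e' * (t * M)" using n e' by simp
      finally show "norm (f' (p \<sigma> s) - f' x - f'' (p \<sigma> s - x)) \<le> e' * (t * M)" .
    qed
    define h where "h s = f (p 1 s) - f (p 0 s) - s *\<^sub>R (t\<^sup>2 *\<^sub>R f'' a b)" for s
    define h' where "h' s = f' (p 1 s) (t *\<^sub>R b) - f' (p 0 s) (t *\<^sub>R b) - t\<^sup>2 *\<^sub>R f'' a b" for s
    have hd: "(h has_vector_derivative h' s) (at s within {0..1})" if "s \<in> {0..1}" for s
    proof -
      have pd: "(p \<sigma> has_derivative (\<lambda>u. u *\<^sub>R t *\<^sub>R b)) (at s within {0..1})" for \<sigma>
        unfolding p_def by (auto intro!: derivative_eq_intros)
      have fd: "((\<lambda>s. f (p \<sigma> s)) has_derivative (\<lambda>u. f' (p \<sigma> s) (u *\<^sub>R t *\<^sub>R b))) (at s within {0..1})"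
        if "\<sigma> \<in> {0..1}" for \<sigma>
        by (rule has_derivative_compose[OF pd f[OF pS]]) (use that \<open>s \<in> {0..1}\<close> in auto)
      show ?thesis unfolding h_def h'_def has_vector_derivative_def
        by (rule derivative_eq_intros fd | simp)+ (auto simp: blinfun.scaleR_right scaleR_diff_right)
    qed
    have bd: "norm (h' s) \<le> e * t\<^sup>2" if s: "s \<in> {0..1}" for s
    proof -
      let ?g = "\<lambda>\<sigma>. f' (p \<sigma> s) - f' x - f'' (p \<sigma> s - x)"
      have "h' s = (?g 1 - ?g 0) (t *\<^sub>R b)"
        by (simp add: h'_def p_def blinfun.bilinear_simps power2_eq_square scaleR_diff_right)
      also have "norm \<dots> \<le> norm (?g 1 - ?g 0) * norm (t *\<^sub>R b)" by (rule norm_blinfun)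
      also have "\<dots> \<le> (e' * (t * M) + e' * (t * M)) * (t * M)"
      proof (rule mult_mono)
        show "norm (?g 1 - ?g 0) \<le> e' * (t * M) + e' * (t * M)"
          by (rule order_trans[OF norm_triangle_ineq4 add_mono]) (use pf[OF s] in auto)
        show "norm (t *\<^sub>R b) \<le> t * M" using M t by simp
      qed (use e' t M in auto)
      also have "\<dots> = e * t\<^sup>2" using M by (simp add: e'_def power2_eq_square field_simps)
      finally show ?thesis .
    qed
    have "norm (h 1 - h 0) \<le> e * t\<^sup>2 * norm (1 - 0 :: real)"
    proof (rule differentiable_bound[of "{0..1::real}" h "\<lambda>s u. u *\<^sub>R h' s"])
      show "onorm (\<lambda>u. u *\<^sub>R h' s) \<le> e * t\<^sup>2" if "s \<in> {0..1}" for s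
        using bd[OF that] by (simp add: onorm_scaleR_left_lemma onorm_scaleR_left onorm_id)
    qed (use hd in \<open>auto simp: has_vector_derivative_def\<close>)
    then show ?thesis by (simp add: h_def p_def algebra_simps)
  qed
  ultimately show ?thesis by blast
qed

text \<open>The second difference is symmetric in the two directions, and divided by t^2 it tends to
  \<open>f'' a b\<close> as well as to \<open>f'' b a\<close>.\<close>

lemma second_derivative_symmetric:
  fixes f :: "'a::real_normed_vector \<Rightarrow> 'b::real_normed_vector"
  assumes S: "open S" "x \<in> S"
    and f: "\<And>y. y \<in> S \<Longrightarrow> (f has_derivative blinfun_apply (f' y)) (at y)"
    and f': "(f' has_derivative blinfun_apply f'') (at x)"
  shows "f'' a b = f'' b a"
proof (rule ccontr)
  assume ne: "f'' a b \<noteq> f'' b a"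
  \<comment> \<open>A quarter of the discrepancy: the two errors add up to 2 e t^2, which is less
    than 4 e t^2.\<close>
  define e where "e = norm (f'' a b - f'' b a) / 4"
  have e: "e > 0" using ne by (simp add: e_def)
  let ?D = "\<lambda>t a b. f (x + t *\<^sub>R a + t *\<^sub>R b) - f (x + t *\<^sub>R a) - f (x + t *\<^sub>R b) + f x"
  obtain d1 where d1: "d1 > 0" "\<And>t. 0 < t \<Longrightarrow> t < d1 \<Longrightarrow> norm (?D t a b - t\<^sup>2 *\<^sub>R f'' a b) \<le> e * t\<^sup>2"
    using second_difference[OF S f f' e, of a b] by blast
  obtain d2 where d2: "d2 > 0" "\<And>t. 0 < t \<Longrightarrow> t < d2 \<Longrightarrow> norm (?D t b a - t\<^sup>2 *\<^sub>R f'' b a) \<le> e * t\<^sup>2"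
    using second_difference[OF S f f' e, of b a] by blast
  define t where "t = min d1 d2 / 2"
  have t: "0 < t" "t < d1" "t < d2" using d1(1) d2(1) by (auto simp: t_def)
  have "?D t a b = ?D t b a" by (simp add: algebra_simps)
  then have "t\<^sup>2 *\<^sub>R (f'' a b - f'' b a) = (?D t b a - t\<^sup>2 *\<^sub>R f'' b a) - (?D t a b - t\<^sup>2 *\<^sub>R f'' a b)"
    by (simp add: algebra_simps)
  then have "norm (t\<^sup>2 *\<^sub>R (f'' a b - f'' b a)) \<le> e * t\<^sup>2 + e * t\<^sup>2"
    using order_trans[OF norm_triangle_ineq4 add_mono[OF d2(2)[OF t(1,3)] d1(2)[OF t(1,2)]]] by metis
  moreover have "norm (t\<^sup>2 *\<^sub>R (f'' a b - f'' b a)) = t\<^sup>2 * (4 * e)" by (simp add: e_def)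
  ultimately have "t\<^sup>2 * (4 * e) \<le> e * t\<^sup>2 + e * t\<^sup>2" by (simp only:)
  moreover have "e * t\<^sup>2 > 0" using t e by simp
  ultimately show False by (simp add: mult.commute)
qed

text \<open>\<open>\<omega>\<close> is integrated along segments from \<open>x0\<close>. Symmetry of
  \<open>\<omega>'\<close> makes the derivative of the integrand equal to d/dt of t \<omega>(x0 + t
  (x - x0)), so that the integral over [0, 1] is \<open>\<omega> x\<close>.\<close>

lemma closed_form_primitive:
  fixes \<omega> :: "'a::euclidean_space \<Rightarrow> 'a \<Rightarrow>\<^sub>L 'b::banach"
  assumes S: "open S" "convex S" and x0: "x0 \<in> S"
    and der: "\<And>x. x \<in> S \<Longrightarrow> (\<omega> has_derivative blinfun_apply (\<omega>' x)) (at x)"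
    and cont: "continuous_on S \<omega>'"
    and sym: "\<And>x u v. x \<in> S \<Longrightarrow> \<omega>' x u v = \<omega>' x v u"
  obtains h where "\<And>x. x \<in> S \<Longrightarrow> (h has_derivative blinfun_apply (\<omega> x)) (at x)"
proof
  define p where "p x t = x0 + t *\<^sub>R (x - x0)" for x :: 'a and t :: real
  define h where "h x = integral (cbox 0 1) (\<lambda>t. \<omega> (p x t) (x - x0))" for x
  define D where "D x t = t *\<^sub>R \<omega>' (p x t) (x - x0) + \<omega> (p x t)" for x t
  have pS: "p x t \<in> S" if "x \<in> S" "t \<in> cbox 0 1" for x t
  proof -
    have "p x t = (1 - t) *\<^sub>R x0 + t *\<^sub>R x" by (simp add: p_def algebra_simps)
    then show ?thesis using convexD_alt[OF S(2) x0 that(1)] that(2) by auto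
  qed
  have c\<omega>: "continuous_on S \<omega>"
    using der S(1) by (metis continuous_at_imp_continuous_on has_derivative_continuous)
  have cp: "continuous_on A (\<lambda>z. p (fst z) (snd z))" for A unfolding p_def by (intro continuous_intros)
  fix x assume x: "x \<in> S"
  have "(h has_derivative integral (cbox 0 1) (D x)) (at x within S)"
    unfolding h_def
  proof (rule leibniz_rule[OF _ _ _ x S(2)])
    fix y t assume y: "y \<in> S" and t: "t \<in> cbox 0 (1::real)"
    have pd: "((\<lambda>y. p y t) has_derivative (\<lambda>v. t *\<^sub>R v)) (at y within S)"
      unfolding p_def by (auto intro!: derivative_eq_intros)
    have "((\<lambda>y. \<omega> (p y t)) has_derivative (\<lambda>v. \<omega>' (p y t) (t *\<^sub>R v))) (at y within S)"
      by (rule has_derivative_compose[OF pd der[OF pS[OF y t]]])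
    then have "((\<lambda>y. \<omega> (p y t) (y - x0)) has_derivative
        (\<lambda>v. \<omega> (p y t) v + \<omega>' (p y t) (t *\<^sub>R v) (y - x0))) (at y within S)"
      by (rule has_derivative_eq_rhs[OF blinfun.FDERIV]) (auto intro!: derivative_eq_intros)
    moreover have "\<omega>' (p y t) (t *\<^sub>R v) (y - x0) = t *\<^sub>R \<omega>' (p y t) (y - x0) v" for v
      using sym[OF pS[OF y t], of v "y - x0"] by (simp add: blinfun.scaleR_left blinfun.scaleR_right)
    ultimately show "((\<lambda>y. \<omega> (p y t) (y - x0)) has_derivative blinfun_apply (D y t)) (at y within S)"
      by (simp add: D_def plus_blinfun.rep_eq scaleR_blinfun.rep_eq add.commute)
  next
    fix y assume y: "y \<in> S"
    have "continuous_on (cbox 0 1) (\<lambda>t. \<omega> (p y t))"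
      by (rule continuous_on_compose2[OF c\<omega>]) (use pS[OF y] in \<open>auto simp: p_def intro!: continuous_intros\<close>)
    then show "(\<lambda>t. \<omega> (p y t) (y - x0)) integrable_on cbox 0 1"
      by (intro integrable_continuous blinfun.continuous_on continuous_intros)
  next
    have "continuous_on (S \<times> cbox 0 1) (\<lambda>z. \<omega> (p (fst z) (snd z)))"
      by (rule continuous_on_compose2[OF c\<omega> cp]) (use pS in auto)
    moreover have "continuous_on (S \<times> cbox 0 1) (\<lambda>z. \<omega>' (p (fst z) (snd z)))"
      by (rule continuous_on_compose2[OF cont cp]) (use pS in auto)
    ultimately show "continuous_on (S \<times> cbox 0 1) (\<lambda>(x, t). D x t)"
      unfolding D_def case_prod_unfold by (intro continuous_intros blinfun.continuous_on)
  qed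
  moreover have "integral (cbox 0 1) (D x) = \<omega> x"
  proof -
    have "(D x has_integral (1 *\<^sub>R \<omega> (p x 1) - 0 *\<^sub>R \<omega> (p x 0))) {0..1}"
    proof (rule fundamental_theorem_of_calculus)
      fix t :: real assume t: "t \<in> {0..1}"
      have pd: "((\<lambda>t. p x t) has_derivative (\<lambda>v. v *\<^sub>R (x - x0))) (at t within {0..1})"
        unfolding p_def by (auto intro!: derivative_eq_intros)
      have "((\<lambda>t. \<omega> (p x t)) has_derivative (\<lambda>v. \<omega>' (p x t) (v *\<^sub>R (x - x0)))) (at t within {0..1})"
        by (rule has_derivative_compose[OF pd der[OF pS[OF x]]]) (use t in auto)
      then show "((\<lambda>t. t *\<^sub>R \<omega> (p x t)) has_vector_derivative D x t) (at t within {0..1})"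
        unfolding has_vector_derivative_def D_def
        by (auto intro!: derivative_eq_intros simp: blinfun.bilinear_simps algebra_simps fun_eq_iff)
    qed simp
    then show ?thesis by (simp add: integral_unique p_def)
  qed
  ultimately show "(h has_derivative blinfun_apply (\<omega> x)) (at x)"
    using at_within_open[OF x S(1)] by simp
qed

section \<open>Cross product identities\<close>

text \<open>Both the cross product and the inner product of \<open>X\<close> with the nonzero vector
  \<open>cross3 a b\<close> vanish, so the Lagrange identity leaves only
  \<open>X = 0\<close>.\<close>

lemma zero_of_orthogonal:
  fixes X a b :: "real^3"
  assumes "X \<bullet> a = 0" "X \<bullet> b = 0" "X \<bullet> cross3 a b = 0" "cross3 a b \<noteq> 0"
  shows "X = 0"
proof -
  have "cross3 (cross3 a b) X = (a \<bullet> X) *\<^sub>R b - (b \<bullet> X) *\<^sub>R a"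
    by (simp add: cross3_simps forall_3 vec_eq_iff algebra_simps)
  then have "cross3 (cross3 a b) X = 0" using assms by (simp add: inner_commute)
  then have "(norm (cross3 a b))\<^sup>2 * (norm X)\<^sup>2 = 0"
    using norm_cross_dot[of "cross3 a b" X] assms by (simp add: inner_commute)
  then show ?thesis using assms by simp
qed

lemma cross3_triple:
  fixes a b c :: "real^3"
  shows "cross3 (cross3 a b) c = (a \<bullet> c) *\<^sub>R b - (b \<bullet> c) *\<^sub>R a"
  by (simp add: cross3_simps forall_3 vec_eq_iff algebra_simps)

lemma bounded_bilinear_cross3: "bounded_bilinear cross3"
  using bilinear_cross bilinear_conv_bounded_bilinear by blast

text \<open>Used for dr \<times> dN: a bilinear expression on the plane is symmetric as soon as it
  is symmetric on the pair of basis directions.\<close>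

lemma cross3_swap:
  assumes "cross3 b A = cross3 a B"
  shows "cross3 (v1 *\<^sub>R a + v2 *\<^sub>R b) (u1 *\<^sub>R A + u2 *\<^sub>R B) = cross3 (u1 *\<^sub>R a + u2 *\<^sub>R b) (v1 *\<^sub>R A + v2 *\<^sub>R B)"
  by (simp add: cross_add_left cross_add_right cross_mult_left cross_mult_right assms scaleR_add_right
      mult.commute add.commute add.left_commute)

lemma cross3_nonzero_of_inj:
  fixes L :: "complex \<Rightarrow>\<^sub>L (real^3)"
  assumes inj: "inj (blinfun_apply L)" shows "cross3 (L 1) (L \<i>) \<noteq> 0"
proof
  assume "cross3 (L 1) (L \<i>) = 0"
  then have "collinear {0, L 1, L \<i>}" by (simp add: cross_eq_0)
  then consider "L 1 = 0" | "L \<i> = 0" | c where "L \<i> = c *\<^sub>R L 1"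
    by (auto simp: collinear_lemma)
  then show False
  proof cases
    case 1 then have "L 1 = L 0" by simp
    then show ?thesis using inj by (metis injD zero_neq_one)
  next
    case 2 then have "L \<i> = L 0" by simp
    then show ?thesis using inj by (metis injD complex_i_not_zero)
  next
    case 3 then have "L \<i> = L (c *\<^sub>R 1)" by (simp add: blinfun.scaleR_right)
    then have "\<i> = c *\<^sub>R 1" using inj by (metis injD)
    then show ?thesis by (simp add: complex_eq_iff)
  qed
qed

section \<open>Minimal patches, their conjugate surface and isothermal coordinates\<close>

text \<open>\<open>N\<close> is the globally chosen normal restricted to the patch, assumed only
  continuous, rather than the normalized cross product; in this way all patches share one
  orientation. The last assumption is the numerator of the mean curvature, which is linear in the
  normal.\<close>

locale minimal_patch =
  fixes V :: "complex set" and r :: "complex \<Rightarrow> real^3" and r' :: "complex \<Rightarrow> complex \<Rightarrow>\<^sub>L (real^3)"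
    and r'' :: "complex \<Rightarrow> complex \<Rightarrow>\<^sub>L (complex \<Rightarrow>\<^sub>L (real^3))" and N :: "complex \<Rightarrow> real^3"
  assumes open_V: "open V"
    and der: "\<And>x. x \<in> V \<Longrightarrow> (r has_derivative blinfun_apply (r' x)) (at x)"
    and der2: "\<And>x. x \<in> V \<Longrightarrow> (r' has_derivative blinfun_apply (r'' x)) (at x)"
    and cont2: "continuous_on V r''"
    and inj: "\<And>x. x \<in> V \<Longrightarrow> inj (blinfun_apply (r' x))"
    and contN: "continuous_on V N"
    and normN: "\<And>x. x \<in> V \<Longrightarrow> norm (N x) = 1"
    and orthN: "\<And>x v. x \<in> V \<Longrightarrow> N x \<bullet> r' x v = 0"
    and minimal: "\<And>x. x \<in> V \<Longrightarrow>
      (r' x 1 \<bullet> r' x 1) * (r'' x \<i> \<i> \<bullet> N x) - 2 * (r' x 1 \<bullet> r' x \<i>) * (r'' x \<i> 1 \<bullet> N x)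
        + (r' x \<i> \<bullet> r' x \<i>) * (r'' x 1 1 \<bullet> N x) = 0"
begin

lemma apply_expand: "blinfun_apply (f :: complex \<Rightarrow>\<^sub>L 'b::real_normed_vector) v = Re v *\<^sub>R f 1 + Im v *\<^sub>R f \<i>"
proof -
  have "v = Re v *\<^sub>R 1 + Im v *\<^sub>R \<i>" by (simp add: complex_eq_iff)
  then show ?thesis by (metis blinfun.add_right blinfun.scaleR_right)
qed

lemma sym2: "x \<in> V \<Longrightarrow> r'' x u v = r'' x v u"
  by (rule second_derivative_symmetric[OF open_V]) (use der der2 in auto)

lemma cont1: "continuous_on V r'"
  using der2 by (meson continuous_at_imp_continuous_on has_derivative_continuous)

lemma cont0: "continuous_on V r"
  using der by (meson continuous_at_imp_continuous_on has_derivative_continuous)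

definition C where "C x = cross3 (r' x 1) (r' x \<i>)"

lemma C_nonzero: "x \<in> V \<Longrightarrow> C x \<noteq> 0"
  unfolding C_def by (rule cross3_nonzero_of_inj[OF inj])

text \<open>Dimension count: the injective differential has a two-dimensional range inside the
  two-dimensional complement of \<open>N x\<close>.\<close>

lemma N_perp_range:
  assumes x: "x \<in> V" and Y: "N x \<bullet> Y = 0"
  shows "\<exists>v. r' x v = Y"
proof -
  have lin: "linear (blinfun_apply (r' x))" by (simp add: blinfun.bounded_linear_right bounded_linear.linear)
  have "dim (range (blinfun_apply (r' x))) = dim (UNIV :: complex set)"
    by (rule dim_image_eq[OF lin]) (use inj[OF x] in \<open>auto intro: inj_on_subset\<close>)
  moreover have "dim {Y. N x \<bullet> Y = 0} = DIM(real^3) - 1"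
    using normN[OF x] by (intro dim_hyperplane) auto
  moreover have "subspace (range (blinfun_apply (r' x)))" by (rule linear_subspace_image[OF lin subspace_UNIV])
  moreover have "range (blinfun_apply (r' x)) \<subseteq> {Y. N x \<bullet> Y = 0}" using orthN[OF x] by auto
  ultimately have "range (blinfun_apply (r' x)) = {Y. N x \<bullet> Y = 0}"
    by (intro subspace_dim_equal) (auto simp: subspace_hyperplane)
  then show ?thesis using Y by (metis (mono_tags, lifting) imageE mem_Collect_eq)
qed

text \<open>The factor between \<open>N\<close> and the normalized cross product is continuous with
  values 1 and -1, hence constant on a ball. This is how the merely continuous \<open>N\<close>
  becomes differentiable.\<close>

lemma N_local:
  assumes B: "ball x0 e \<subseteq> V" "e > 0"
  obtains \<sigma> :: real where "\<And>x. x \<in> ball x0 e \<Longrightarrow> N x = (\<sigma> / norm (C x)) *\<^sub>R C x"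
proof -
  define s where "s x = (N x \<bullet> C x) / norm (C x)" for x
  have cC: "continuous_on V C" unfolding C_def
    by (intro bounded_bilinear.continuous_on[OF bounded_bilinear_cross3] blinfun.continuous_on cont1 continuous_intros)
  have eq: "N x = (s x / norm (C x)) *\<^sub>R C x" and s1: "s x \<in> {-1, 1}" if "x \<in> V" for x
  proof -
    let ?X = "N x - (s x / norm (C x)) *\<^sub>R C x"
    have nz: "norm (C x) \<noteq> 0" using C_nonzero[OF that] by simp
    have "?X = 0"
    proof (rule zero_of_orthogonal)
      show "?X \<bullet> r' x 1 = 0" "?X \<bullet> r' x \<i> = 0"
        using orthN[OF that] by (simp_all add: inner_diff_left C_def dot_cross_self)
      show "?X \<bullet> cross3 (r' x 1) (r' x \<i>) = 0"
        using nz by (simp add: inner_diff_left s_def flip: C_def)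
          (simp add: dot_square_norm power2_eq_square)
      show "cross3 (r' x 1) (r' x \<i>) \<noteq> 0" using C_nonzero[OF that] by (simp add: C_def)
    qed
    then show eq: "N x = (s x / norm (C x)) *\<^sub>R C x" by simp
    have "norm ((s x / norm (C x)) *\<^sub>R C x) = 1" using normN[OF that] eq by simp
    then have "\<bar>s x\<bar> = 1" using nz by simp
    then show "s x \<in> {-1, 1}" by auto
  qed
  have "continuous_on (ball x0 e) s"
    unfolding s_def by (intro continuous_intros continuous_on_subset[OF contN B(1)] continuous_on_subset[OF cC B(1)])
      (use C_nonzero B in auto)
  moreover have "finite (s ` ball x0 e)"
    by (rule finite_subset[of _ "{-1, 1}"]) (use s1 B in auto)
  ultimately have "s constant_on ball x0 e"
    by (intro continuous_finite_range_constant) (auto simp: convex_connected)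
  then obtain \<sigma> where "\<And>x. x \<in> ball x0 e \<Longrightarrow> s x = \<sigma>" by (auto simp: constant_on_def)
  then show ?thesis using eq B that[of \<sigma>] by (metis subsetD)
qed

lemma N_derivative:
  assumes B: "ball x0 e \<subseteq> V" "e > 0"
  obtains N' :: "complex \<Rightarrow> complex \<Rightarrow> real^3"
  where "\<And>x. x \<in> ball x0 e \<Longrightarrow> (N has_derivative N' x) (at x)"
    and "\<And>v. continuous_on (ball x0 e) (\<lambda>x. N' x v)"
proof -
  obtain \<sigma> where \<sigma>: "\<And>x. x \<in> ball x0 e \<Longrightarrow> N x = (\<sigma> / norm (C x)) *\<^sub>R C x"
    using N_local[OF B] by blast
  define C' where "C' x v = cross3 (r' x 1) (r'' x v \<i>) + cross3 (r'' x v 1) (r' x \<i>)" for x v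
  define N' where "N' x v = (\<sigma> * inverse (norm (C x))) *\<^sub>R C' x v +
     (\<sigma> * - (inverse (norm (C x)) * (C' x v \<bullet> sgn (C x)) * inverse (norm (C x)))) *\<^sub>R C x" for x v
  have CV: "C x \<noteq> 0" if "x \<in> ball x0 e" for x using C_nonzero B that by auto
  have dC: "(C has_derivative C' x) (at x)" if "x \<in> V" for x
  proof -
    have "((\<lambda>x. r' x u) has_derivative (\<lambda>v. r'' x v u)) (at x)" for u
      using bounded_linear.has_derivative[OF blinfun.bounded_linear_left der2[OF that]] by simp
    then show ?thesis unfolding C_def C'_def
      by (intro bounded_bilinear.FDERIV[OF bounded_bilinear_cross3])
  qed
  have dN: "(N has_derivative N' x) (at x)" if x: "x \<in> ball x0 e" for x
  proof -
    have "((\<lambda>x. (\<sigma> * inverse (norm (C x))) *\<^sub>R C x) has_derivative N' x) (at x)"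
      unfolding N'_def using x B CV[OF x] by (auto intro!: derivative_eq_intros dC has_derivative_norm[THEN has_derivative_compose[rotated]])
    then show ?thesis
      by (rule has_derivative_transform_within_open[OF _ open_ball x]) (simp add: \<sigma> divide_inverse)
  qed
  have cC: "continuous_on (ball x0 e) C" using dC B by (meson continuous_at_imp_continuous_on has_derivative_continuous subsetD)
  note c1 = continuous_on_subset[OF cont1 B(1)] and c2 = continuous_on_subset[OF cont2 B(1)]
  have "continuous_on (ball x0 e) (\<lambda>x. C' x v)" for v
    unfolding C'_def
    by (intro continuous_intros bounded_bilinear.continuous_on[OF bounded_bilinear_cross3] blinfun.continuous_on c1 c2)
  then have "continuous_on (ball x0 e) (\<lambda>x. N' x v)" for v
    unfolding N'_def sgn_div_norm using CV by (intro continuous_intros cC) auto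
  with dN show ?thesis using that by blast
qed

text \<open>The form \<open>dr \<times> N\<close> is closed because the mean curvature vanishes; its primitive is the conjugate
  surface, and coordinate functions paired with their conjugates are conformal.\<close>

lemma conjugate:
  assumes B: "ball x0 e \<subseteq> V" "e > 0"
  obtains s where "\<And>x. x \<in> ball x0 e \<Longrightarrow> (s has_derivative (\<lambda>v. cross3 (r' x v) (N x))) (at x)"
proof -
  obtain N' where dN: "\<And>x. x \<in> ball x0 e \<Longrightarrow> (N has_derivative N' x) (at x)"
    and cN': "\<And>v. continuous_on (ball x0 e) (\<lambda>x. N' x v)"
    using N_derivative[OF B] by blast
  obtain \<sigma> where \<sigma>: "\<And>x. x \<in> ball x0 e \<Longrightarrow> N x = (\<sigma> / norm (C x)) *\<^sub>R C x"
    using N_local[OF B] by blast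
  define \<omega> where "\<omega> x = Blinfun (\<lambda>v. cross3 (r' x v) (N x))" for x
  have bl: "bounded_linear (\<lambda>v. cross3 (r' x v) (N x))" for x
    by (intro bounded_linear_compose[OF bounded_bilinear.bounded_linear_left[OF bounded_bilinear_cross3]] blinfun.bounded_linear_right)
  then have \<omega>: "blinfun_apply (\<omega> x) = (\<lambda>v. cross3 (r' x v) (N x))" for x
    by (simp add: \<omega>_def bounded_linear_Blinfun_apply)
  define W where "W x u v = cross3 (r'' x u v) (N x) + cross3 (r' x v) (N' x u)" for x u v
  have linN': "linear (N' x)" if "x \<in> ball x0 e" for x
    using dN[OF that] has_derivative_linear by blast
  \<comment> \<open>Differentiating the orthogonality of \<open>N\<close> and the tangent vectors
    expresses dN by the second fundamental form.\<close>
  have N'1: "N' x u \<bullet> r' x v = - (N x \<bullet> r'' x u v)" if x: "x \<in> ball x0 e" for x u v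
  proof -
    have "((\<lambda>x. r' x v) has_derivative (\<lambda>u. r'' x u v)) (at x)"
      using bounded_linear.has_derivative[OF blinfun.bounded_linear_left der2] x B by auto
    then have "((\<lambda>x. N x \<bullet> r' x v) has_derivative (\<lambda>u. N x \<bullet> r'' x u v + N' x u \<bullet> r' x v)) (at x)"
      by (intro has_derivative_inner dN x)
    moreover have "((\<lambda>x. N x \<bullet> r' x v) has_derivative (\<lambda>u. 0)) (at x)"
      by (rule has_derivative_transform_within_open[OF _ open_ball x, of "\<lambda>x. 0"]) (use orthN B in auto)
    ultimately have "(\<lambda>u. N x \<bullet> r'' x u v + N' x u \<bullet> r' x v) = (\<lambda>u. 0)"
      by (rule has_derivative_unique)
    then show ?thesis by (metis add.commute eq_neg_iff_add_eq_0)
  qed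
  have N'2: "N' x u \<bullet> N x = 0" if x: "x \<in> ball x0 e" for x u
  proof -
    have "((\<lambda>x. N x \<bullet> N x) has_derivative (\<lambda>u. N x \<bullet> N' x u + N' x u \<bullet> N x)) (at x)"
      by (intro has_derivative_inner dN x)
    moreover have "((\<lambda>x. N x \<bullet> N x) has_derivative (\<lambda>u. 0)) (at x)"
      by (rule has_derivative_transform_within_open[OF _ open_ball x, of "\<lambda>x. 1"]) (use normN B in \<open>auto simp: dot_square_norm\<close>)
    ultimately have "(\<lambda>u. N x \<bullet> N' x u + N' x u \<bullet> N x) = (\<lambda>u. 0)"
      by (rule has_derivative_unique)
    then have "N x \<bullet> N' x u + N' x u \<bullet> N x = 0" by metis
    then show ?thesis by (simp add: inner_commute)
  qed
  \<comment> \<open>The obstruction to closedness. Since dN is tangential, the tangential components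
    of \<open>X\<close> vanish, and its normal component is a multiple of the mean curvature
    numerator.\<close>
  have key: "cross3 (r' x \<i>) (N' x 1) = cross3 (r' x 1) (N' x \<i>)" if x: "x \<in> ball x0 e" for x
  proof -
    have xV: "x \<in> V" using x B by auto
    let ?a = "r' x 1" and ?b = "r' x \<i>" and ?A = "N' x 1" and ?B = "N' x \<i>"
    define X where "X = cross3 ?a ?B - cross3 ?b ?A"
    let ?k = "\<sigma> / norm (C x)"
    have cyc: "cross3 p q \<bullet> s = q \<bullet> cross3 s p" for p q s :: "real^3"
      by (simp add: cross3_simps)
    have C1: "cross3 (C x) ?a = (?a \<bullet> ?a) *\<^sub>R ?b - (?b \<bullet> ?a) *\<^sub>R ?a"
      "cross3 (C x) ?b = (?a \<bullet> ?b) *\<^sub>R ?b - (?b \<bullet> ?b) *\<^sub>R ?a"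
      unfolding C_def by (rule cross3_triple)+
    have NC: "u \<bullet> C x = 0" if "u \<bullet> N x = 0" for u
    proof -
      have "N x \<noteq> 0" using normN[OF xV] by auto
      then have "?k \<noteq> 0" using \<sigma>[OF x] by auto
      then show ?thesis using that unfolding \<sigma>[OF x] by simp
    qed
    have "X = 0"
    proof (rule zero_of_orthogonal)
      have "X \<bullet> ?a = - (?A \<bullet> C x)" "X \<bullet> ?b = - (?B \<bullet> C x)"
        by (simp_all add: X_def C_def cross3_simps)
      then show "X \<bullet> ?a = 0" "X \<bullet> ?b = 0" using N'2[OF x] NC by simp_all
      show "cross3 ?a ?b \<noteq> 0" using C_nonzero[OF xV] by (simp add: C_def)
      have sy: "r'' x 1 \<i> = r'' x \<i> 1" by (rule sym2[OF xV])
      have "X \<bullet> N x = ?B \<bullet> cross3 (N x) ?a - ?A \<bullet> cross3 (N x) ?b"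
        by (simp add: X_def inner_diff_left cyc)
      also have "\<dots> = ?k * (?B \<bullet> cross3 (C x) ?a - ?A \<bullet> cross3 (C x) ?b)"
        by (simp add: \<sigma>[OF x] cross_mult_left right_diff_distrib)
      also have "\<dots> = ?k * - ((?a \<bullet> ?a) * (r'' x \<i> \<i> \<bullet> N x) - 2 * (?a \<bullet> ?b) * (r'' x \<i> 1 \<bullet> N x)
        + (?b \<bullet> ?b) * (r'' x 1 1 \<bullet> N x))"
        unfolding C1 by (simp add: inner_diff_right N'1[OF x] sy inner_commute algebra_simps)
      also have "\<dots> = 0" using minimal[OF xV] by simp
      finally show "X \<bullet> cross3 ?a ?b = 0" using NC[of X] by (simp add: C_def)
    qed
    then show ?thesis by (simp add: X_def)
  qed
  have Wsym: "W x u v = W x v u" if x: "x \<in> ball x0 e" for x u v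
  proof -
    have xV: "x \<in> V" using x B by auto
    have e: "N' x w = Re w *\<^sub>R N' x 1 + Im w *\<^sub>R N' x \<i>" for w
    proof -
      have "N' x (Re w *\<^sub>R 1 + Im w *\<^sub>R \<i>) = Re w *\<^sub>R N' x 1 + Im w *\<^sub>R N' x \<i>"
        by (simp only: linear_add[OF linN'[OF x]] linear_scale[OF linN'[OF x]])
      moreover have "Re w *\<^sub>R 1 + Im w *\<^sub>R \<i> = w" by (simp add: complex_eq_iff)
      ultimately show ?thesis by (simp only:)
    qed
    have "cross3 (r' x v) (N' x u) = cross3 (r' x u) (N' x v)"
      unfolding e[of u] e[of v] apply_expand[of "r' x" u] apply_expand[of "r' x" v]
      by (rule cross3_swap[OF key[OF x]])
    then show ?thesis unfolding W_def sym2[OF xV, of u v] by simp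
  qed
  have blW: "bounded_linear (W x u)" if "x \<in> ball x0 e" for x u
    unfolding W_def
    by (intro bounded_linear_add bounded_linear_compose[OF bounded_bilinear.bounded_linear_left[OF bounded_bilinear_cross3]] blinfun.bounded_linear_right)
  define \<omega>1 where "\<omega>1 x u = Blinfun (W x u)" for x u
  have \<omega>1: "blinfun_apply (\<omega>1 x u) v = W x u v" if "x \<in> ball x0 e" for x u v
    using blW[OF that] by (simp add: \<omega>1_def bounded_linear_Blinfun_apply)
  define \<omega>' where "\<omega>' x = Blinfun (\<omega>1 x)" for x
  have "bounded_linear (\<omega>1 x)" if x: "x \<in> ball x0 e" for x
  proof -
    have "linear (\<omega>1 x)"
    proof (rule linearI)
      have l: "linear (\<lambda>u. W x u v)" for v unfolding Wsym[OF x, of _ v] using blW[OF x] bounded_linear.linear by blast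
      show "\<omega>1 x (a + b) = \<omega>1 x a + \<omega>1 x b" "\<omega>1 x (c *\<^sub>R a) = c *\<^sub>R \<omega>1 x a" for a b c
        using linear_add[OF l] linear_scale[OF l]
        by (auto intro!: blinfun_eqI simp: \<omega>1[OF x] plus_blinfun.rep_eq scaleR_blinfun.rep_eq)
    qed
    then show ?thesis by (simp add: linear_conv_bounded_linear)
  qed
  then have \<omega>': "blinfun_apply (\<omega>' x) u = \<omega>1 x u" if "x \<in> ball x0 e" for x u
    using that by (simp add: \<omega>'_def bounded_linear_Blinfun_apply)
  have d\<omega>: "(\<omega> has_derivative blinfun_apply (\<omega>' x)) (at x)" if x: "x \<in> ball x0 e" for x
  proof -
    have xV: "x \<in> V" using x B by auto
    \<comment> \<open>Cross product with \<open>N\<close> as an operator, so that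
      \<open>\<omega>\<close> becomes a composition to which the product rule applies.\<close>
    let ?K = "bounded_bilinear.prod_left cross3"
    note K = bounded_bilinear.prod_left.rep_eq[OF bounded_bilinear_cross3]
      and blK = bounded_bilinear.bounded_linear_prod_left[OF bounded_bilinear_cross3]
    have "((\<lambda>x. ?K (N x) o\<^sub>L r' x) has_derivative (\<lambda>u. (?K (N x) o\<^sub>L r'' x u) + (?K (N' x u) o\<^sub>L r' x))) (at x)"
      by (intro bounded_bilinear.FDERIV[OF bounded_bilinear_blinfun_compose] der2 xV
          bounded_linear.has_derivative[OF blK] dN x)
    moreover have "(\<lambda>x. ?K (N x) o\<^sub>L r' x) = \<omega>"
      by (auto intro!: blinfun_eqI simp: fun_eq_iff \<omega> K)
    moreover have "(\<lambda>u. (?K (N x) o\<^sub>L r'' x u) + (?K (N' x u) o\<^sub>L r' x)) = blinfun_apply (\<omega>' x)"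
      by (auto intro!: blinfun_eqI simp: fun_eq_iff \<omega>'[OF x] \<omega>1[OF x] K W_def plus_blinfun.rep_eq)
    ultimately show ?thesis by simp
  qed
  have c\<omega>: "continuous_on (ball x0 e) \<omega>'"
  proof (rule continuous_on_blinfun_componentwise, rule continuous_on_blinfun_componentwise)
    fix i j :: complex
    note c1 = continuous_on_subset[OF cont1 B(1)] and c2 = continuous_on_subset[OF cont2 B(1)] and cN = continuous_on_subset[OF contN B(1)]
    have "continuous_on (ball x0 e) (\<lambda>x. W x i j)"
      unfolding W_def
      by (intro continuous_intros bounded_bilinear.continuous_on[OF bounded_bilinear_cross3] blinfun.continuous_on c1 c2 cN cN')
    then show "continuous_on (ball x0 e) (\<lambda>x. blinfun_apply (blinfun_apply (\<omega>' x) i) j)"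
      by (rule continuous_on_eq) (simp add: \<omega>' \<omega>1)
  qed
  have "\<exists>s. \<forall>x\<in>ball x0 e. (s has_derivative blinfun_apply (\<omega> x)) (at x)"
  proof (rule closed_form_primitive[OF open_ball convex_ball _ d\<omega> c\<omega>])
    show "x0 \<in> ball x0 e" using B by simp
    show "\<omega>' x u v = \<omega>' x v u" if "x \<in> ball x0 e" for x u v
      using Wsym[OF that] by (simp add: \<omega>'[OF that] \<omega>1[OF that])
  next
    fix h assume "\<And>x. x \<in> ball x0 e \<Longrightarrow> (h has_derivative blinfun_apply (\<omega> x)) (at x)"
    then show ?thesis by (intro exI[of _ h] ballI)
  qed
  then show ?thesis using that unfolding \<omega> by metis
qed

text \<open>\<open>w j\<close> pairs a coordinate function with its conjugate. A tangent vector T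
  killed by its differential has T_j = 0 and (T \<times> N)_j = 0, hence T = 0 unless
  \<open>N\<close> is parallel to the j-th axis; so the inverse function theorem makes
  \<open>w j\<close> a coordinate. In it the quarter turn taking T to N \<times> T is multiplication
  by i, which makes all \<open>W k\<close> holomorphic. The index is left free because the third
  coordinate might be critical at this stage.\<close>

lemma isothermal:
  assumes x0: "x0 \<in> V" and j: "cross3 (N x0) (axis j 1) \<noteq> 0"
  obtains B \<Omega> F w and W W' :: "3 \<Rightarrow> complex \<Rightarrow> complex" where
    "open B" "x0 \<in> B" "B \<subseteq> V" "open \<Omega>" "homeomorphism B \<Omega> w F"
    "\<And>x. x \<in> B \<Longrightarrow> Re (w x) = r x $ j"
    "\<And>x. x \<in> B \<Longrightarrow> (w has_derivative (\<lambda>v. Complex (r' x v $ j) (cross3 (r' x v) (N x) $ j))) (at x)"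
    "\<And>\<zeta> k. \<zeta> \<in> \<Omega> \<Longrightarrow> (W k has_field_derivative W' k \<zeta>) (at \<zeta>)"
    "\<And>\<zeta> k. \<zeta> \<in> \<Omega> \<Longrightarrow> Re (W k \<zeta>) = r (F \<zeta>) $ k"
    "\<And>\<zeta>. \<zeta> \<in> \<Omega> \<Longrightarrow> W' j \<zeta> = 1"
    "\<And>\<zeta>. \<zeta> \<in> \<Omega> \<Longrightarrow> cross3 (N (F \<zeta>)) (\<chi> k. Re (W' k \<zeta>)) = (\<chi> k. - Im (W' k \<zeta>))"
    "\<And>\<zeta>. \<zeta> \<in> \<Omega> \<Longrightarrow> N (F \<zeta>) \<bullet> (\<chi> k. Re (W' k \<zeta>)) = 0"
proof -
  have "\<forall>\<^sub>F x in at x0. cross3 (N x) (axis j 1) \<noteq> 0"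
  proof -
    have "(N \<longlongrightarrow> N x0) (at x0)" using contN x0 open_V by (metis continuous_on_def at_within_open)
    then have "((\<lambda>x. cross3 (N x) (axis j 1)) \<longlongrightarrow> cross3 (N x0) (axis j 1)) (at x0)"
      by (intro bounded_bilinear.tendsto[OF bounded_bilinear_cross3] tendsto_const)
    then show ?thesis using j by (rule tendsto_imp_eventually_ne)
  qed
  then obtain e1 where e1: "e1 > 0" "\<And>x. x \<in> ball x0 e1 \<Longrightarrow> cross3 (N x) (axis j 1) \<noteq> 0"
    unfolding eventually_at using j by (metis UNIV_I dist_commute mem_ball)
  obtain e2 where e2: "e2 > 0" "ball x0 e2 \<subseteq> V" using open_V x0 open_contains_ball by blast
  define e where "e = min e1 e2"
  have e: "e > 0" "ball x0 e \<subseteq> V" using e1 e2 by (auto simp: e_def)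
  have nz: "cross3 (N x) (axis j 1) \<noteq> 0" if "x \<in> ball x0 e" for x using e1 that by (auto simp: e_def)
  obtain s where s: "\<And>x. x \<in> ball x0 e \<Longrightarrow> (s has_derivative (\<lambda>v. cross3 (r' x v) (N x))) (at x)"
    using conjugate[OF e(2,1)] by blast
  define w where "w k x = Complex (r x $ k) (s x $ k)" for k x
  define dw where "dw k x v = Complex (r' x v $ k) (cross3 (r' x v) (N x) $ k)" for k x v
  have dw: "(w k has_derivative dw k x) (at x)" if x: "x \<in> ball x0 e" for k x
  proof -
    have "((\<lambda>x. r x $ k) has_derivative (\<lambda>v. r' x v $ k)) (at x)"
      by (rule bounded_linear.has_derivative[OF bounded_linear_vec_nth der]) (use x e in auto)
    moreover have "((\<lambda>x. s x $ k) has_derivative (\<lambda>v. cross3 (r' x v) (N x) $ k)) (at x)"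
      by (rule bounded_linear.has_derivative[OF bounded_linear_vec_nth s[OF x]])
    ultimately show ?thesis unfolding w_def dw_def Complex_eq
      by (auto intro!: derivative_eq_intros)
  qed
  have bldw: "bounded_linear (dw k x)" if "x \<in> ball x0 e" for k x
    using dw[OF that] has_derivative_bounded_linear by blast
  define dW where "dW x = Blinfun (dw j x)" for x
  have dW: "blinfun_apply (dW x) = dw j x" if "x \<in> ball x0 e" for x
    using bldw[OF that] by (simp add: dW_def bounded_linear_Blinfun_apply)
  have cdw: "continuous_on (ball x0 e) (\<lambda>x. dw k x v)" for k v
    unfolding dw_def Complex_eq
    by (intro continuous_intros bounded_bilinear.continuous_on[OF bounded_bilinear_cross3] blinfun.continuous_on
      continuous_on_subset[OF cont1 e(2)] continuous_on_subset[OF contN e(2)])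
  have cdW: "continuous_on (ball x0 e) dW"
    by (rule continuous_on_blinfun_componentwise) (rule continuous_on_eq[OF cdw], simp add: dW)
  have injdw: "inj (dw j x)" if x: "x \<in> ball x0 e" for x
  proof -
    have xV: "x \<in> V" using x e by auto
    have lin: "linear (dw j x)" using bldw[OF x] bounded_linear.linear by blast
    have "v = 0" if "dw j x v = 0" for v
    proof -
      let ?T = "r' x v"
      have T: "?T $ j = 0" "cross3 ?T (N x) $ j = 0" using that by (simp_all add: dw_def complex_eq_iff)
      have "?T = 0"
      proof (rule zero_of_orthogonal)
        show "?T \<bullet> N x = 0" using orthN[OF xV] by (simp add: inner_commute)
        show "?T \<bullet> axis j 1 = 0" using T by (simp add: inner_axis)
        have "?T \<bullet> cross3 (N x) (axis j 1) = cross3 ?T (N x) \<bullet> axis j 1" by (simp add: cross3_simps)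
        then show "?T \<bullet> cross3 (N x) (axis j 1) = 0" using T by (simp add: inner_axis)
      qed (rule nz[OF x])
      then have "r' x v = r' x 0" by simp
      then show "v = 0" using inj[OF xV] by (metis injD)
    qed
    then show ?thesis using lin by (metis linear_injective_0)
  qed
  obtain dwi where dwi: "linear dwi" "dwi \<circ> dw j x0 = id"
    using linear_injective_left_inverse[of "dw j x0"] injdw[of x0] bldw[of x0] e bounded_linear.linear by force
  have inv0: "Blinfun dwi o\<^sub>L dW x0 = id_blinfun"
  proof (rule blinfun_eqI)
    fix i
    have "bounded_linear dwi" using dwi(1) by (simp add: linear_conv_bounded_linear)
    then show "blinfun_apply (Blinfun dwi o\<^sub>L dW x0) i = blinfun_apply id_blinfun i"
      using dwi(2) e by (simp add: dW bounded_linear_Blinfun_apply fun_eq_iff)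
  qed
  have x0e: "x0 \<in> ball x0 e" using e by simp
  have dwj: "(w j has_derivative blinfun_apply (dW x)) (at x)" if "x \<in> ball x0 e" for x
    using dw[OF that] by (simp add: dW[OF that])
  obtain B \<Omega> F F' where B: "open B" "B \<subseteq> ball x0 e" "x0 \<in> B" "open \<Omega>" "homeomorphism B \<Omega> (w j) F"
    and F: "\<And>y. y \<in> \<Omega> \<Longrightarrow> (F has_derivative F' y) (at y)"
    by (rule inverse_function_theorem[OF open_ball dwj cdW x0e inv0]) blast+
  define W where "W k \<zeta> = w k (F \<zeta>)" for k \<zeta>
  define W' where "W' k \<zeta> = dw k (F \<zeta>) (F' \<zeta> 1)" for k \<zeta>
  have FB: "F \<zeta> \<in> B" "F \<zeta> \<in> ball x0 e" "F \<zeta> \<in> V" if "\<zeta> \<in> \<Omega>" for \<zeta>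
    using that B e by (auto simp: homeomorphism_def)
  have WF: "(W k has_derivative (\<lambda>v. dw k (F \<zeta>) (F' \<zeta> v))) (at \<zeta>)" if "\<zeta> \<in> \<Omega>" for k \<zeta>
    unfolding W_def by (rule has_derivative_compose[OF F[OF that] dw[OF FB(2)[OF that]]])
  have Wj: "dw j (F \<zeta>) (F' \<zeta> v) = v" if "\<zeta> \<in> \<Omega>" for \<zeta> v
  proof -
    have "(W j has_derivative (\<lambda>v. v)) (at \<zeta>)"
      by (rule has_derivative_transform_within_open[OF has_derivative_ident B(4) that])
        (use B(5) in \<open>auto simp: W_def homeomorphism_def\<close>)
    then show ?thesis using has_derivative_unique[OF WF[OF that, of j]] by metis
  qed
  \<comment> \<open>The rotated vector is tangent, hence of the form dr v. The injective
    differential of \<open>w j\<close> sends both v and F' i to i, so they agree.\<close>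
  have N_A: "cross3 (N (F \<zeta>)) (r' (F \<zeta>) (F' \<zeta> 1)) = r' (F \<zeta>) (F' \<zeta> \<i>)" if z: "\<zeta> \<in> \<Omega>" for \<zeta>
  proof -
    let ?x = "F \<zeta>" and ?A = "r' (F \<zeta>) (F' \<zeta> 1)"
    have xV: "?x \<in> V" using FB[OF z] by simp
    obtain v where v: "r' ?x v = cross3 (N ?x) ?A"
      using N_perp_range[OF xV, of "cross3 (N ?x) ?A"] by (auto simp: dot_cross_self)
    have A0: "?A \<bullet> N ?x = 0" using orthN[OF xV] by (simp add: inner_commute)
    have "cross3 (cross3 (N ?x) ?A) (N ?x) = ?A"
      by (simp add: cross3_triple A0 dot_square_norm normN[OF xV])
    moreover have "dw j ?x (F' \<zeta> 1) = 1" by (rule Wj[OF z])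
    then have "?A $ j = 1" "cross3 ?A (N ?x) $ j = 0" by (simp_all add: dw_def complex_eq_iff)
    moreover have "cross3 (N ?x) ?A = - cross3 ?A (N ?x)" by (rule cross_skew)
    ultimately have "dw j ?x v = \<i>" by (simp add: dw_def v complex_eq_iff)
    then have "v = F' \<zeta> \<i>" using injdw[OF FB(2)[OF z]] Wj[OF z, of \<i>] by (metis injD)
    then show ?thesis using v by simp
  qed
  have A_N: "cross3 (r' (F \<zeta>) (F' \<zeta> \<i>)) (N (F \<zeta>)) = r' (F \<zeta>) (F' \<zeta> 1)" if z: "\<zeta> \<in> \<Omega>" for \<zeta>
  proof -
    let ?x = "F \<zeta>" and ?A = "r' (F \<zeta>) (F' \<zeta> 1)"
    have xV: "?x \<in> V" using FB[OF z] by simp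
    have A0: "?A \<bullet> N ?x = 0" using orthN[OF xV] by (simp add: inner_commute)
    show ?thesis unfolding N_A[OF z, symmetric]
      by (simp add: cross3_triple A0 dot_square_norm normN[OF xV])
  qed
  have W'1: "(\<chi> k. Re (W' k \<zeta>)) = r' (F \<zeta>) (F' \<zeta> 1)" if z: "\<zeta> \<in> \<Omega>" for \<zeta>
    by (simp add: W'_def dw_def vec_eq_iff)
  have W'2: "(\<chi> k. - Im (W' k \<zeta>)) = r' (F \<zeta>) (F' \<zeta> \<i>)" if z: "\<zeta> \<in> \<Omega>" for \<zeta>
    using N_A[OF z] cross_skew[of "N (F \<zeta>)"] by (simp add: W'_def dw_def vec_eq_iff)
  have "(W k has_field_derivative W' k \<zeta>) (at \<zeta>)" if z: "\<zeta> \<in> \<Omega>" for k \<zeta>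
  proof -
    have lin: "linear (\<lambda>v. dw k (F \<zeta>) (F' \<zeta> v))" using WF[OF z] has_derivative_linear by blast
    \<comment> \<open>The Cauchy-Riemann equation: a right-angle rotation in the tangent plane
      multiplies the differential by i.\<close>
    have i: "dw k (F \<zeta>) (F' \<zeta> \<i>) = \<i> * W' k \<zeta>"
      using N_A[OF z] A_N[OF z] cross_skew[of "N (F \<zeta>)"] by (auto simp: W'_def dw_def complex_eq_iff vec_eq_iff)
    have "dw k (F \<zeta>) (F' \<zeta> v) = W' k \<zeta> * v" for v
    proof -
      have "v = Re v *\<^sub>R 1 + Im v *\<^sub>R \<i>" by (simp add: complex_eq_iff)
      then have "dw k (F \<zeta>) (F' \<zeta> v) = Re v *\<^sub>R W' k \<zeta> + Im v *\<^sub>R dw k (F \<zeta>) (F' \<zeta> \<i>)"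
        using linear_add[OF lin] linear_scale[OF lin] unfolding W'_def by metis
      then show ?thesis unfolding i by (simp add: complex_eq_iff algebra_simps)
    qed
    then show ?thesis using WF[OF z, of k] by (simp add: has_field_derivative_def mult_commute_abs)
  qed
  moreover have "N (F \<zeta>) \<bullet> (\<chi> k. Re (W' k \<zeta>)) = 0" if z: "\<zeta> \<in> \<Omega>" for \<zeta>
    using orthN[OF FB(3)[OF z]] by (simp add: W'1[OF z])
  moreover have "cross3 (N (F \<zeta>)) (\<chi> k. Re (W' k \<zeta>)) = (\<chi> k. - Im (W' k \<zeta>))" if z: "\<zeta> \<in> \<Omega>" for \<zeta>
    by (simp only: W'1[OF z] W'2[OF z] N_A[OF z])
  moreover have "(w j has_derivative (\<lambda>v. Complex (r' x v $ j) (cross3 (r' x v) (N x) $ j))) (at x)" if "x \<in> B" for x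
    using dw[of x j] B that by (auto simp: dw_def[abs_def])
  moreover have "B \<subseteq> V" using B(2) e by auto
  ultimately show ?thesis
    using that[OF B(1,3) _ B(4,5), of W W'] by (simp add: w_def W_def W'_def Wj)
qed

end

section \<open>Level sets on an annulus\<close>

text \<open>Otherwise the component has compact closure inside \<open>R\<close>, and
  \<open>f\<close> attains a maximum there. The maximum point lies above \<open>c\<close> and can be
  added to the component without losing connectedness, so it belongs to the open component, against
  \<open>nomax\<close>.\<close>

lemma component_reaches_collar:
  fixes f :: "complex \<Rightarrow> real"
  assumes contf: "continuous_on R f" and R: "open R"
    and nomax: "\<And>m N. m \<in> R \<Longrightarrow> open N \<Longrightarrow> m \<in> N \<Longrightarrow> \<exists>z\<in>N \<inter> R. f z > f m"
    and x: "x \<in> R" "f x > c" and Ucomp: "U = connected_component_set {z \<in> R. f z > c} x"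
    and M: "compact M" "M \<subseteq> R"
  shows "\<exists>z\<in>U. z \<notin> M"
proof (rule ccontr)
  assume "\<not> ?thesis"
  then have UM: "U \<subseteq> M" by blast
  have oUp: "open {z \<in> R. f z > c}"
    using continuous_open_preimage[OF contf R open_greaterThan[of c]] by (simp add: vimage_def Int_def)
  have oU: "open U" unfolding Ucomp by (rule open_connected_component[OF oUp])
  have xU: "x \<in> U" using x by (simp add: Ucomp connected_component_refl)
  have clM: "closure U \<subseteq> M" using UM M(1) by (simp add: closure_minimal compact_imp_closed)
  then have "compact (closure U)" using M(1) compact_Int_closed[OF M(1), of "closure U"] by (simp add: inf.absorb2)
  moreover have "continuous_on (closure U) f" using contf clM M(2) by (meson continuous_on_subset subset_trans)
  moreover have "closure U \<noteq> {}" using xU by auto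
  ultimately obtain z where z: "z \<in> closure U" "\<And>y. y \<in> closure U \<Longrightarrow> f y \<le> f z"
    using continuous_attains_sup[of "closure U" f] by blast
  have zR: "z \<in> R" using z clM M by auto
  have zc: "f z > c" using z(2)[of x] xU x closure_subset by force
  have "connected (insert z U)"
    by (rule connected_intermediate_closure[of U]) (use z closure_subset[of U] in \<open>auto simp: Ucomp connected_connected_component\<close>)
  moreover have "insert z U \<subseteq> {z \<in> R. f z > c}"
    using zR zc connected_component_subset[of "{z \<in> R. f z > c}" x] by (auto simp: Ucomp)
  ultimately have "insert z U \<subseteq> U" using xU unfolding Ucomp by (intro connected_component_maximal) auto
  then have "z \<in> U" by simp
  then obtain y where "y \<in> U \<inter> R" "f y > f z" using nomax[OF zR oU] by blast
  then show False using z(2)[of y] closure_subset by fastforce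
qed

definition annulus :: "complex set" where "annulus = {z. 1 < cmod z \<and> cmod z < 2}"

lemma open_annulus: "open annulus"
proof -
  have "open ({z. 1 < cmod z} \<inter> {z. cmod z < 2})" by (intro open_Int open_Collect_less continuous_intros)
  then show ?thesis by (simp add: annulus_def Collect_conj_eq)
qed

text \<open>A collar is connected and \<open>f\<close> omits [b, d] on it, so it lies wholly above
  or wholly below \<open>c\<close>. The component reaches one of the collars at a point above
  \<open>c\<close> and therefore swallows that collar.\<close>

lemma superlevel_structure:
  fixes f :: "complex \<Rightarrow> real"
  assumes contf: "continuous_on annulus f"
    and nomax: "\<And>m N. m \<in> annulus \<Longrightarrow> open N \<Longrightarrow> m \<in> N \<Longrightarrow> \<exists>z\<in>N \<inter> annulus. f z > f m"
    and e: "e > 0" "e < 1/2"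
    and x: "x \<in> annulus" "f x > c"
    and sep: "\<And>z. z \<in> annulus \<Longrightarrow> cmod z < 1 + e \<or> 2 - e < cmod z \<Longrightarrow> f z > d \<or> f z < b" and bc: "b \<le> c" "c \<le> d"
  shows "\<exists>C. (C = {z. 1 < cmod z \<and> cmod z < 1 + e} \<or> C = {z. 2 - e < cmod z \<and> cmod z < 2}) \<and>
    C \<subseteq> connected_component_set {z \<in> annulus. f z > c} x"
proof -
  define U where "U = connected_component_set {z \<in> annulus. f z > c} x"
  define M where "M = cball (0::complex) (2 - e) - ball 0 (1 + e)"
  have "compact M" unfolding M_def by (intro compact_diff) auto
  moreover have "M \<subseteq> annulus" using e by (auto simp: M_def annulus_def)
  ultimately obtain z where z: "z \<in> U" "z \<notin> M"
    using component_reaches_collar[OF contf open_annulus nomax x U_def] by metis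
  have Usub: "U \<subseteq> {z \<in> annulus. f z > c}" unfolding U_def by (rule connected_component_subset)
  define C where "C = (if cmod z < 1 + e then {z. 1 < cmod z \<and> cmod z < 1 + e} else {z. 2 - e < cmod z \<and> cmod z < 2})"
  have zC: "z \<in> C" using z Usub by (auto simp: C_def M_def annulus_def)
  have CA: "C \<subseteq> annulus" using e by (auto simp: C_def annulus_def)
  have conC: "connected C" 
    unfolding C_def using connected_annulus(1)[of 1 0 "1 + e"] connected_annulus(1)[of "2 - e" "0::complex" 2] connected_annulus(1)[of 1 "0::complex" "1 + e"]
    by (simp add: dist_norm)
  have sepC: "f w > d \<or> f w < b" if "w \<in> C" for w
    using sep[of w] that CA by (auto simp: C_def split: if_splits)
  have "f w > c" if w: "w \<in> C" for w
  proof (rule ccontr)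
    assume "\<not> f w > c"
    then have "f w < b" using sepC[OF w] bc by auto
    have "connected (f ` C)" using conC contf CA by (meson connected_continuous_image continuous_on_subset)
    moreover have "f w \<in> f ` C" "f z \<in> f ` C" using w zC by auto
    moreover have "f w \<le> c" "c \<le> f z" using \<open>\<not> f w > c\<close> z Usub by auto
    ultimately have "c \<in> f ` C" by (meson connectedD_interval)
    then show False using sepC bc by force
  qed
  then have "C \<subseteq> {z \<in> annulus. f z > c}" using CA by auto
  then have "C \<subseteq> connected_component_set {z \<in> annulus. f z > c} z"
    using conC zC by (intro connected_component_maximal)
  also have "\<dots> = U" using z(1) unfolding U_def by (metis connected_component_eq)
  finally have "C \<subseteq> connected_component_set {z \<in> annulus. f z > c} x" by (simp add: U_def)
  then show ?thesis by (intro exI[of _ C]) (simp add: C_def)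
qed

lemma connected_if_common:
  assumes "\<And>x. x \<in> S \<Longrightarrow> connected_component S x u"
  shows "connected S"
  unfolding connected_iff_connected_component
  by (meson assms connected_component_sym connected_component_trans)

text \<open>Meant for a neighbourhood \<open>D\<close> of a point of a Jordan curve: it meets both
  sides, and off the curve it consists of two pieces, which therefore cannot share a side.\<close>

lemma two_sides:
  assumes "D \<subseteq> J \<union> S1 \<union> S2" "S1 \<subseteq> I \<or> S1 \<subseteq> O'" "S2 \<subseteq> I \<or> S2 \<subseteq> O'" "D \<inter> I \<noteq> {}" "D \<inter> O' \<noteq> {}"
    "I \<inter> O' = {}" "I \<union> O' = - J"
  shows "(S1 \<subseteq> I \<and> S2 \<subseteq> O') \<or> (S1 \<subseteq> O' \<and> S2 \<subseteq> I)"
proof -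
  have "\<not> (S1 \<subseteq> I \<and> S2 \<subseteq> I)" "\<not> (S1 \<subseteq> O' \<and> S2 \<subseteq> O')" using assms(1,4-7) by blast+
  then show ?thesis using assms(2,3) by metis
qed

lemma two_choices:
  "\<lbrakk>C = A \<or> C = B; C' = A \<or> C' = B; D = A \<or> D = B; C \<inter> D = {}; C' \<inter> D = {}; D \<noteq> {}\<rbrakk> \<Longrightarrow> C = C'"
  by auto

text \<open>Compactness of slabs keeps \<open>f\<close> out of the range between two chosen levels
  near both ends of the annulus. Every component above the level and every component below it
  contains a collar. There are only two collars and both kinds of component occur, so all components
  above contain the same collar and coincide; likewise below.\<close>

lemma superlevel_connected:
  fixes f :: "complex \<Rightarrow> real"
  assumes contf: "continuous_on annulus f"
    and slab: "\<And>b d. b \<in> f ` annulus \<Longrightarrow> d \<in> f ` annulus \<Longrightarrow> compact {z \<in> annulus. b \<le> f z \<and> f z \<le> d}"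
    and nomax: "\<And>m N. m \<in> annulus \<Longrightarrow> open N \<Longrightarrow> m \<in> N \<Longrightarrow> \<exists>z\<in>N \<inter> annulus. f z > f m"
    and nomin: "\<And>m N. m \<in> annulus \<Longrightarrow> open N \<Longrightarrow> m \<in> N \<Longrightarrow> \<exists>z\<in>N \<inter> annulus. f z < f m"
    and p: "p \<in> annulus"
  shows "connected {z \<in> annulus. f z > f p}" and "connected {z \<in> annulus. f z < f p}"
proof -
  let ?c = "f p"
  obtain y1 where y1: "y1 \<in> annulus" "f y1 > ?c" using nomax[OF p open_UNIV] by auto
  obtain y2 where y2: "y2 \<in> annulus" "f y2 < ?c" using nomin[OF p open_UNIV] by auto
  define K where "K = {z \<in> annulus. f y2 \<le> f z \<and> f z \<le> f y1}"
  have cK: "compact K" unfolding K_def using slab y1 y2 by auto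
  have KA: "K \<subseteq> annulus" by (auto simp: K_def)
  have pK: "p \<in> K" using p y1 y2 by (auto simp: K_def)
  \<comment> \<open>The compact slab \<open>K\<close> keeps a distance \<open>e\<close> from both
    boundary circles.\<close>
  obtain e where e: "e > 0" "e < 1/2" "\<And>z. z \<in> K \<Longrightarrow> 1 + e \<le> cmod z \<and> cmod z \<le> 2 - e"
  proof -
    have cn: "continuous_on K cmod" by (intro continuous_intros)
    obtain a where a: "a \<in> K" "\<And>z. z \<in> K \<Longrightarrow> cmod a \<le> cmod z" using continuous_attains_inf[OF cK _ cn] pK by auto
    obtain b where b: "b \<in> K" "\<And>z. z \<in> K \<Longrightarrow> cmod z \<le> cmod b" using continuous_attains_sup[OF cK _ cn] pK by auto
    let ?e = "min (1/3) (min (cmod a - 1) (2 - cmod b))"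
    have "?e \<le> 1/3" by (rule min.cobounded1)
    then have "?e < 1/2" by linarith
    moreover have "?e > 0" using a b KA by (auto simp: annulus_def)
    moreover have "1 + ?e \<le> cmod z \<and> cmod z \<le> 2 - ?e" if "z \<in> K" for z
      using a(2)[OF that] b(2)[OF that] by auto
    ultimately show ?thesis using that by blast
  qed
  let ?C1 = "{z. 1 < cmod z \<and> cmod z < 1 + e}" and ?C2 = "{z. 2 - e < cmod z \<and> cmod z < 2}"
  have sep: "f z > f y1 \<or> f z < f y2" if "z \<in> annulus" "cmod z < 1 + e \<or> 2 - e < cmod z" for z
    using e(3)[of z] that by (force simp: K_def)
  have ne: "of_real (1 + e / 2) \<in> ?C1" "of_real (2 - e / 2) \<in> ?C2"
    using e(1,2) by (simp_all only: mem_Collect_eq norm_of_real) auto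
  have up: "\<exists>C. (C = ?C1 \<or> C = ?C2) \<and> C \<subseteq> connected_component_set {z \<in> annulus. f z > ?c} x"
    if "x \<in> annulus" "f x > ?c" for x
  proof (rule superlevel_structure[where d = "f y1" and b = "f y2"])
    show "?c \<le> f y1" "f y2 \<le> ?c" using y1 y2 by auto
  qed (fact contf nomax e that sep)+
  have dn: "\<exists>C. (C = ?C1 \<or> C = ?C2) \<and> C \<subseteq> connected_component_set {z \<in> annulus. f z < ?c} x"
    if "x \<in> annulus" "f x < ?c" for x
  proof -
    \<comment> \<open>Sublevel sets are superlevel sets of -f.\<close>
    have 1: "continuous_on annulus (\<lambda>z. - f z)" by (intro continuous_intros contf)
    have 2: "\<exists>z\<in>N \<inter> annulus. - f z > - f m" if "m \<in> annulus" "open N" "m \<in> N" for m N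
      using nomin[OF that] by auto
    have 3: "- f z > - f y2 \<or> - f z < - f y1" if "z \<in> annulus" "cmod z < 1 + e \<or> 2 - e < cmod z" for z
      using sep[OF that] by auto
    have "\<exists>C. (C = ?C1 \<or> C = ?C2) \<and> C \<subseteq> connected_component_set {z \<in> annulus. - f z > - ?c} x"
    proof (rule superlevel_structure[where d = "- f y2" and b = "- f y1"])
      show "- ?c \<le> - f y2" "- f y1 \<le> - ?c" "- ?c < - f x" using y1 y2 that by auto
    qed (fact 1 2 3 e that)+
    then show ?thesis by auto
  qed
  obtain Cu where Cu: "Cu = ?C1 \<or> Cu = ?C2" "Cu \<subseteq> {z \<in> annulus. f z > ?c}"
    using up[OF y1] connected_component_subset by (metis (no_types, lifting) subset_trans)
  obtain Cd where Cd: "Cd = ?C1 \<or> Cd = ?C2" "Cd \<subseteq> {z \<in> annulus. f z < ?c}"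
    using dn[OF y2] connected_component_subset by (metis (no_types, lifting) subset_trans)
  have ne': "Cu \<noteq> {}" "Cd \<noteq> {}" using ne Cu(1) Cd(1) by blast+
  have ne'': "Cu \<inter> Cd = {}" using Cu(2) Cd(2) by force
  have up': "Cu \<subseteq> connected_component_set {z \<in> annulus. f z > ?c} x" if x: "x \<in> annulus" "f x > ?c" for x
  proof -
    obtain C where C: "C = ?C1 \<or> C = ?C2" "C \<subseteq> connected_component_set {z \<in> annulus. f z > ?c} x" using up[OF x] by blast
    then have "C \<subseteq> {z \<in> annulus. f z > ?c}" using connected_component_subset by (metis (no_types, lifting) subset_trans)
    then have "C \<inter> Cd = {}" using Cd(2) by force
    then have "C = Cu" by (rule two_choices[OF C(1) Cu(1) Cd(1) _ ne'' ne'(2)])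
    then show ?thesis using C by simp
  qed
  have dn': "Cd \<subseteq> connected_component_set {z \<in> annulus. f z < ?c} x" if x: "x \<in> annulus" "f x < ?c" for x
  proof -
    obtain C where C: "C = ?C1 \<or> C = ?C2" "C \<subseteq> connected_component_set {z \<in> annulus. f z < ?c} x" using dn[OF x] by blast
    then have "C \<subseteq> {z \<in> annulus. f z < ?c}" using connected_component_subset by (metis (no_types, lifting) subset_trans)
    then have "C \<inter> Cu = {}" using Cu(2) by force
    then have "C = Cd" by (rule two_choices[OF C(1) Cd(1) Cu(1) _ _ ne'(1)]) (use ne'' in blast)
    then show ?thesis using C by simp
  qed
  obtain u where u: "u \<in> Cu" using ne' by blast
  obtain v where v: "v \<in> Cd" using ne' by blast
  show "connected {z \<in> annulus. f z > f p}"
    by (rule connected_if_common[of _ u]) (use up' u in blast)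
  show "connected {z \<in> annulus. f z < f p}"
    by (rule connected_if_common[of _ v]) (use dn' v in blast)
qed

section \<open>Exclusion of saddles by the Jordan curve theorem\<close>

lemma sector_connected:
  "connected {z. \<exists>s \<theta>. z = of_real s * cis \<theta> \<and> 0 < s \<and> s < \<delta> \<and> a < \<theta> \<and> \<theta> < b}"
proof -
  have "connected ((\<lambda>p. of_real (fst p) * cis (snd p)) ` ({0<..<\<delta>} \<times> {a<..<b}))"
    by (intro connected_continuous_image connected_Times) (auto intro!: continuous_intros)
  moreover have "(\<lambda>p. of_real (fst p) * cis (snd p)) ` ({0<..<\<delta>} \<times> {a<..<b}) =
      {z. \<exists>s \<theta>. z = of_real s * cis \<theta> \<and> 0 < s \<and> s < \<delta> \<and> a < \<theta> \<and> \<theta> < b}"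
    by force
  ultimately show ?thesis by simp
qed

text \<open>At a saddle a loop through two upper sectors separates two lower sectors.\<close>

lemma no_saddle:
  fixes P :: "complex \<Rightarrow> complex" and k :: nat
  assumes k: "k \<ge> 2" and \<rho>: "\<rho> > 0"
    and contP: "continuous_on (ball 0 \<rho>) P" and injP: "inj_on P (ball 0 \<rho>)"
    and Up: "open Up" "connected Up" and Dn: "connected Dn" and disj: "Up \<inter> Dn = {}" and p: "P 0 \<notin> Up"
    and up: "\<And>q. q \<in> ball 0 \<rho> \<Longrightarrow> Re (q ^ k) > 0 \<Longrightarrow> P q \<in> Up"
    and dn: "\<And>q. q \<in> ball 0 \<rho> \<Longrightarrow> Re (q ^ k) < 0 \<Longrightarrow> P q \<in> Dn"
    and p': "P 0 \<notin> Dn"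
  shows False
proof -
  \<comment> \<open>The rays at the angles 0 and \<open>\<beta>\<close> are the axes of two
    neighbouring sectors where Re(q^k) is positive.\<close>
  define \<beta> where "\<beta> = 2 * pi / k"
  have \<beta>: "0 < \<beta>" "\<beta> \<le> pi" using k by (auto simp: \<beta>_def field_simps)
  have k\<beta>: "real k * \<beta> = 2 * pi" using k by (simp add: \<beta>_def)
  define \<omega> where "\<omega> = cis \<beta>"
  have \<omega>: "cmod \<omega> = 1" "\<omega> \<noteq> 0" by (auto simp: \<omega>_def)
  have ray_eq: "of_real s = of_real t * \<omega> \<longleftrightarrow> s = 0 \<and> t = 0" if "s \<ge> 0" "t \<ge> 0" for s t :: real
  proof
    assume eq: "of_real s = of_real t * \<omega>"
    then have "cmod (of_real s) = cmod (of_real t * \<omega>)" by simp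
    then have st: "s = t" using that \<omega> by (simp add: norm_mult)
    show "s = 0 \<and> t = 0"
    proof (rule ccontr)
      assume "\<not> ?thesis"
      then have "\<omega> = 1" using eq st by simp
      then have "cos \<beta> = 1" by (simp add: \<omega>_def complex_eq_iff)
      moreover have "cos \<beta> < cos 0" by (rule cos_monotone_0_pi) (use \<beta> in auto)
      ultimately show False by simp
    qed
  qed simp
  have pow: "Re ((of_real s * cis \<theta>) ^ k) = s ^ k * cos (k * \<theta>)" for s \<theta> :: real
    by (simp add: power_mult_distrib Complex.DeMoivre flip: of_real_power)
  have up_real: "P (of_real s) \<in> Up" if "0 < s" "s < \<rho>" for s
    by (rule up) (use that pow[of s 0] in auto)
  have up_\<omega>: "P (of_real s * \<omega>) \<in> Up" if "0 < s" "s < \<rho>" for s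
    by (rule up) (use that pow[of s \<beta>] \<omega> k\<beta> in \<open>auto simp: norm_mult \<omega>_def\<close>)
  define a where "a = \<rho> / 2"
  have a: "0 < a" "a < \<rho>" using \<rho> by (auto simp: a_def)
  define A where "A = P ` complex_of_real ` {0..a}"
  define B where "B = P ` (\<lambda>s. of_real s * \<omega>) ` {0..a}"
  have inb: "complex_of_real s \<in> ball 0 \<rho>" "of_real s * \<omega> \<in> ball 0 \<rho>" if "s \<in> {0..a}" for s
    using that a \<omega> by (auto simp: norm_mult)
  have "compact A" "compact B" unfolding A_def B_def
    using inb by (auto intro!: compact_continuous_image continuous_on_subset[OF contP] continuous_intros)
  then have clAB: "closed A" "closed B" by (simp_all add: compact_imp_closed)
  have injD: "q = q'" if "P q = P q'" "q \<in> ball 0 \<rho>" "q' \<in> ball 0 \<rho>" for q q'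
    using injP that by (meson inj_onD)
  have AB: "A \<inter> B \<subseteq> {P 0}"
  proof clarify
    fix x assume "x \<in> A" "x \<in> B"
    then obtain s t where st: "s \<in> {0..a}" "t \<in> {0..a}" "x = P (of_real s)" "x = P (of_real t * \<omega>)"
      by (auto simp: A_def B_def)
    then have eqP: "P (of_real s) = P (of_real t * \<omega>)" by simp
    have "of_real s = of_real t * \<omega>" by (rule injD[OF eqP]) (use inb st in auto)
    then show "x = P 0" using ray_eq[of s t] st by auto
  qed
  have "P (of_real a) \<noteq> P (of_real a * \<omega>)"
  proof
    assume "P (of_real a) = P (of_real a * \<omega>)"
    then have "of_real a = of_real a * \<omega>" by (rule injD) (use inb[of a] a in auto)
    then show False using ray_eq[of a a] a by auto
  qed
  moreover have "path_connected Up" using Up connected_open_path_connected by blast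
  ultimately obtain g where g: "arc g" "path_image g \<subseteq> Up" "pathstart g = P (of_real a)" "pathfinish g = P (of_real a * \<omega>)"
    using up_real[OF a] up_\<omega>[OF a] unfolding path_connected_arcwise by meson
  have cg: "continuous_on {0..1} g" using g(1) by (simp add: arc_def path_def)
  have gUp: "g t \<in> Up" if "t \<in> {0..1}" for t using g(2) that by (auto simp: path_image_def)
  have gP: "g t \<noteq> P 0" if "t \<in> {0..1}" for t using gUp[OF that] p by auto
  have "compact ({0..1} \<inter> g -` A)"
    using continuous_closed_preimage[OF cg _ clAB(1)] by (simp add: compact_eq_bounded_closed bounded_Int)
  moreover have "0 \<in> {0..1} \<inter> g -` A" using g(3) a by (auto simp: pathstart_def A_def)
  \<comment> \<open>The arc is trimmed to run from its last point on the first ray to the next point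
    on the second ray, so that between its ends it meets neither ray.\<close>
  ultimately obtain t1 where t1: "t1 \<in> {0..1}" "g t1 \<in> A" "\<And>t. t \<in> {0..1} \<Longrightarrow> g t \<in> A \<Longrightarrow> t \<le> t1"
    using compact_attains_sup[of "{0..1} \<inter> g -` A"] by blast
  have cg1: "continuous_on {t1..1} g" by (rule continuous_on_subset[OF cg]) (use t1 in auto)
  have "compact ({t1..1} \<inter> g -` B)"
    using continuous_closed_preimage[OF cg1 _ clAB(2)] by (simp add: compact_eq_bounded_closed bounded_Int)
  moreover have "1 \<in> {t1..1} \<inter> g -` B" 
  proof -
    have "P (of_real a * \<omega>) \<in> B" unfolding B_def image_image using a by (intro image_eqI[of _ _ a]) auto
    then show ?thesis using g(4) t1(1) by (simp add: pathfinish_def)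
  qed
  ultimately obtain t2 where t2: "t2 \<in> {t1..1}" "g t2 \<in> B" "\<And>t. t \<in> {t1..1} \<Longrightarrow> g t \<in> B \<Longrightarrow> t2 \<le> t"
    using compact_attains_inf[of "{t1..1} \<inter> g -` B"] by blast
  have t2': "t2 \<in> {0..1}" using t1(1) t2(1) by auto
  have "t1 \<noteq> t2" using AB t1(2) t2(2) gP[OF t1(1)] by blast
  then have t12: "t1 < t2" using t2(1) by auto
  obtain s1 where s1: "s1 \<in> {0..a}" "g t1 = P (of_real s1)" using t1(2) by (auto simp: A_def)
  obtain s2 where s2: "s2 \<in> {0..a}" "g t2 = P (of_real s2 * \<omega>)" using t2(2) by (auto simp: B_def)
  have "s1 \<noteq> 0" using s1(2) gP[OF t1(1)] by auto
  have "s2 \<noteq> 0" using s2(2) gP[OF t2'] by auto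
  then have s12: "0 < s1" "0 < s2" "s1 \<le> a" "s2 \<le> a" using s1(1) s2(1) \<open>s1 \<noteq> 0\<close> by auto
  define h where "h = subpath t1 t2 g"
  have h: "arc h" "path_image h = g ` {t1..t2}" "pathstart h = P (of_real s1)" "pathfinish h = P (of_real s2 * \<omega>)"
    using t1(1) t2' t12 g(1) s1 s2 by (auto simp: h_def arc_subpath_arc path_image_subpath)
  \<comment> \<open>The two ray segments, joined at the saddle, close the trimmed arc to a Jordan
    curve.\<close>
  define l where "l = linepath (of_real s2 * \<omega>) 0 +++ linepath 0 (of_real s1 :: complex)"
  have seg1: "closed_segment (of_real s2 * \<omega>) 0 = (\<lambda>s. of_real s * \<omega>) ` {0..s2}"
  proof (intro set_eqI iffI)
    fix z assume "z \<in> closed_segment (of_real s2 * \<omega>) 0"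
    then obtain u where u: "0 \<le> u" "u \<le> 1" "z = of_real ((1 - u) * s2) * \<omega>"
      by (auto simp: in_segment scaleR_conv_of_real)
    moreover have "(1 - u) * s2 \<le> 1 * s2" using u s12 by (intro mult_right_mono) auto
    ultimately show "z \<in> (\<lambda>s. of_real s * \<omega>) ` {0..s2}"
      using s12 by (intro image_eqI[of _ _ "(1 - u) * s2"]) auto
  next
    fix z assume "z \<in> (\<lambda>s. of_real s * \<omega>) ` {0..s2}"
    then obtain s where s: "0 \<le> s" "s \<le> s2" "z = of_real s * \<omega>" by auto
    have "z = (1 - (1 - s / s2)) *\<^sub>R (of_real s2 * \<omega>) + (1 - s / s2) *\<^sub>R 0"
      using s12 s by (simp add: scaleR_conv_of_real)
    moreover have "0 \<le> 1 - s / s2" "1 - s / s2 \<le> 1" using s s12 by (simp_all add: field_simps)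
    ultimately show "z \<in> closed_segment (of_real s2 * \<omega>) 0" unfolding in_segment by blast
  qed
  have seg2: "closed_segment 0 (of_real s1 :: complex) = of_real ` {0..s1}"
    using closed_segment_of_real[of 0 s1] s12 by (simp add: closed_segment_eq_real_ivl)
  have pil: "path_image l = (\<lambda>s. of_real s * \<omega>) ` {0..s2} \<union> of_real ` {0..s1}"
    by (simp add: l_def path_image_join seg1 seg2)
  have "arc l" unfolding l_def
  proof (rule arc_join)
    show "path_image (linepath (of_real s2 * \<omega>) 0) \<inter> path_image (linepath 0 (of_real s1)) \<subseteq> {pathstart (linepath 0 (of_real s1))}"
    proof -
      have "z = 0" if z: "z \<in> (\<lambda>s. of_real s * \<omega>) ` {0..s2}" "z \<in> of_real ` {0..s1}" for z
      proof -
        obtain s t where "s \<in> {0..s1}" "t \<in> {0..s2}" "z = of_real s" "z = of_real t * \<omega>" using z by auto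
        then show ?thesis using ray_eq[of s t] by auto
      qed
      then show ?thesis by (auto simp: seg1 seg2)
    qed
  qed (use s12 \<omega> in \<open>auto simp: arc_linepath\<close>)
  have lball: "path_image l \<subseteq> ball 0 \<rho>" unfolding pil using s12 a \<omega> by (auto simp: norm_mult)
  have Pl: "arc (P \<circ> l)"
    using \<open>arc l\<close> contP injP lball unfolding arc_def
    by (auto simp: path_image_def intro!: path_continuous_image comp_inj_on intro: continuous_on_subset inj_on_subset)
  define J where "J = h +++ (P \<circ> l)"
  have piPl: "path_image (P \<circ> l) = P ` path_image l" by (simp add: path_image_def image_comp)
  have ends: "pathstart (P \<circ> l) = P (of_real s2 * \<omega>)" "pathfinish (P \<circ> l) = P (of_real s1)"
    by (simp_all add: l_def pathstart_compose pathfinish_compose)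
  have sJ: "simple_path J" unfolding J_def
  proof (rule simple_path_join_loop[OF h(1) Pl])
    show "pathfinish h = pathstart (P \<circ> l)" "pathfinish (P \<circ> l) = pathstart h"
      by (simp_all add: h l_def pathstart_compose pathfinish_compose)
    have "x \<in> {g t1, g t2}" if x: "x \<in> g ` {t1..t2}" "x \<in> P ` path_image l" for x
    proof -
      obtain t where t: "t \<in> {t1..t2}" "x = g t" using x by auto
      have "x \<in> A \<or> x \<in> B" using x(2) s12 unfolding pil A_def B_def by force
      then show ?thesis
      proof
        assume "x \<in> A"
        then have "t \<le> t1" using t t1 t2' by (intro t1(3)) auto
        then show ?thesis using t by auto
      next
        assume "x \<in> B"
        then have "t2 \<le> t" using t t2 by (intro t2(3)) auto
        then show ?thesis using t by auto
      qed
    qed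
    moreover have "{pathstart h, pathstart (P \<circ> l)} = {g t1, g t2}" by (simp only: h(3) ends s1(2) s2(2))
    ultimately show "path_image h \<inter> path_image (P \<circ> l) \<subseteq> {pathstart h, pathstart (P \<circ> l)}"
      unfolding h(2) piPl by (simp only:) blast
  qed
  have loop: "pathfinish J = pathstart J"
    by (simp add: J_def h l_def pathfinish_compose)
  have piJ: "path_image J = g ` {t1..t2} \<union> P ` path_image l"
    unfolding J_def using ends by (subst path_image_join) (simp_all add: h piPl)
  have JDn: "path_image J \<inter> Dn = {}"
  proof -
    have "g ` {t1..t2} \<subseteq> Up" using gUp t1(1) t2' by auto
    moreover have "P ` path_image l \<subseteq> insert (P 0) Up"
    proof clarify
      fix z assume z: "z \<in> path_image l" "P z \<notin> Up"
      then obtain s where "0 \<le> s" "s \<le> a" "z = of_real s \<or> z = of_real s * \<omega>" using s12 by (force simp: pil)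
      then show "P z = P 0" using up_real[of s] up_\<omega>[of s] a z(2) by (cases "s = 0") auto
    qed
    ultimately have "path_image J \<subseteq> insert (P 0) Up" unfolding piJ by (intro Un_least) auto
    moreover have "insert (P 0) Up \<inter> Dn = {}" using disj p' by simp
    ultimately show ?thesis by (metis disjoint_iff subsetD)
  qed
  \<comment> \<open>Near the saddle the Jordan curve consists of the two ray segments alone.\<close>
  obtain \<delta> where \<delta>: "0 < \<delta>" "\<delta> \<le> s1" "\<delta> \<le> s2" "P ` ball 0 \<delta> \<inter> g ` {t1..t2} = {}"
  proof -
    have "compact (g ` {t1..t2})"
      by (intro compact_continuous_image continuous_on_subset[OF cg]) (use t1(1) t2' in auto)
    then have "open (- g ` {t1..t2})" by (simp add: compact_imp_closed open_Compl)
    then have "open (ball 0 \<rho> \<inter> P -` (- g ` {t1..t2}))" by (rule continuous_open_preimage[OF contP open_ball])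
    moreover have "P 0 \<notin> g ` {t1..t2}" 
  proof
    assume "P 0 \<in> g ` {t1..t2}"
    then obtain t where "t \<in> {t1..t2}" "g t = P 0" by auto
    then show False using gP[of t] t1(1) t2' by auto
  qed
    then have "0 \<in> ball 0 \<rho> \<inter> P -` (- g ` {t1..t2})" using \<rho> by simp
    ultimately obtain d where d: "d > 0" "ball 0 d \<subseteq> ball 0 \<rho> \<inter> P -` (- g ` {t1..t2})"
      unfolding open_contains_ball by blast
    have "ball 0 (min d (min s1 s2)) \<subseteq> ball (0::complex) d" by auto
    then have "P ` ball 0 (min d (min s1 s2)) \<inter> g ` {t1..t2} = {}" using d(2) by blast
    then show ?thesis using s12 d(1) that[of "min d (min s1 s2)"] by simp
  qed
  have \<delta>\<rho>: "\<delta> < \<rho>" using \<delta> s12 a by auto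
  then have bsub: "ball (0::complex) \<delta> \<subseteq> ball 0 \<rho>" by auto
  have oD: "open (P ` ball 0 \<delta>)"
    by (rule invariance_of_domain[OF continuous_on_subset[OF contP bsub] open_ball inj_on_subset[OF injP bsub]])
  define Sec where "Sec b c = {z::complex. \<exists>s \<theta>. z = of_real s * cis \<theta> \<and> 0 < s \<and> s < \<delta> \<and> b < \<theta> \<and> \<theta> < c}" for b c
  have Secb: "Sec b c \<subseteq> ball 0 \<delta>" for b c by (auto simp: Sec_def norm_mult)
  have SecI: "of_real s * cis \<theta> \<in> Sec b c" if "0 < s" "s < \<delta>" "b < \<theta>" "\<theta> < c" for s \<theta> b c
    using that unfolding Sec_def by blast
  have cover: "z \<in> path_image l \<or> z \<in> Sec 0 \<beta> \<or> z \<in> Sec \<beta> (2 * pi)" if z: "z \<in> ball 0 \<delta>" for z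
  proof -
    let ?s = "cmod z" and ?\<theta> = "Arg2pi z"
    have ze: "z = of_real ?s * cis ?\<theta>" using Arg2pi_eq[of z] by (simp add: cis_conv_exp)
    have th: "0 \<le> ?\<theta>" "?\<theta> < 2 * pi" by (simp_all add: Arg2pi_ge_0 Arg2pi_lt_2pi)
    have s: "?s < \<delta>" using z by simp
    consider "?s = 0" | "?s > 0" "?\<theta> = 0" | "?s > 0" "?\<theta> = \<beta>" | "?s > 0" "0 < ?\<theta>" "?\<theta> < \<beta>" | "?s > 0" "\<beta> < ?\<theta>"
      using th by fastforce
    then show ?thesis
    proof cases
      case 1 then show ?thesis using s12 by (auto simp: pil intro!: image_eqI[of _ _ 0])
    next
      case 2
      then have "z = of_real ?s" using ze by simp
      then show ?thesis using s \<delta>(2) unfolding pil by (metis UnCI atLeastAtMost_iff image_eqI less_imp_le norm_ge_zero order_trans)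
    next
      case 3
      then have "z = of_real ?s * \<omega>" using ze by (simp add: \<omega>_def)
      then show ?thesis using s \<delta>(3) unfolding pil by (metis (no_types, lifting) UnCI atLeastAtMost_iff image_eqI less_imp_le norm_ge_zero order_trans)
    next
      case 4 then show ?thesis using ze s unfolding Sec_def by blast
    next
      case 5 then show ?thesis using ze s th unfolding Sec_def by blast
    qed
  qed
  have Sec_l: "Sec b c \<inter> path_image l = {}" if bc: "(b = 0 \<and> c = \<beta>) \<or> (b = \<beta> \<and> c = 2 * pi)" for b c
  proof -
    have False if z: "z \<in> Sec b c" "z \<in> path_image l" for z
    proof -
      obtain s \<theta> where s: "z = of_real s * cis \<theta>" "0 < s" "b < \<theta>" "\<theta> < c" using z by (auto simp: Sec_def)
      obtain t where t: "t \<ge> 0" "z = of_real t * cis 0 \<or> z = of_real t * cis \<beta>" using z by (auto simp: pil \<omega>_def)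
      have A1: "Arg2pi z = \<theta>" by (rule Arg2pi_unique[of s]) (use s bc \<beta> in \<open>auto simp: cis_conv_exp\<close>)
      have "cmod z = t" using t by (auto simp: norm_mult)
      then have "t > 0" using s by (auto simp: norm_mult)
      then have "Arg2pi z = 0 \<or> Arg2pi z = \<beta>"
        using t(2) \<beta> Arg2pi_unique[of t 0 z] Arg2pi_unique[of t \<beta> z] by (auto simp: cis_conv_exp)
      then show False using A1 s bc \<beta> by auto
    qed
    then show ?thesis by blast
  qed
  have PSec: "P ` Sec b c \<inter> path_image J = {}" if bc: "(b = 0 \<and> c = \<beta>) \<or> (b = \<beta> \<and> c = 2 * pi)" for b c
  proof -
    have False if z: "z \<in> Sec b c" and J: "P z \<in> path_image J" for z
    proof -
      have zb: "z \<in> ball 0 \<delta>" using z Secb by (rule subsetD[rotated])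
      then have "P z \<in> P ` ball 0 \<delta>" by (rule imageI)
      then have "P z \<notin> g ` {t1..t2}" using \<delta>(4) by (meson disjoint_iff)
      then obtain w where w: "w \<in> path_image l" "P z = P w" using J unfolding piJ by auto
      have "z = w" by (rule injD[OF w(2)]) (use zb bsub w lball in auto)
      then show False using Sec_l[OF bc] z w(1) by (metis disjoint_iff)
    qed
    then show ?thesis by auto
  qed
  have conSec: "connected (P ` Sec b c)" for b c
    unfolding Sec_def
    by (intro connected_continuous_image sector_connected continuous_on_subset[OF contP])
      (use Secb[of b c] bsub in \<open>auto simp: Sec_def\<close>)
  define JJ where "JJ = path_image J"
  obtain I O' where IO: "open I" "open O'" "I \<inter> O' = {}" "I \<union> O' = - JJ" "frontier I = JJ" "frontier O' = JJ"
    using Jordan_inside_outside[OF sJ loop] that[of "inside JJ" "outside JJ"] unfolding JJ_def by blast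
  have split: "T \<subseteq> I \<or> T \<subseteq> O'" if T: "connected T" "T \<inter> JJ = {}" for T
  proof (rule ccontr)
    assume "\<not> ?thesis"
    then have "I \<inter> T \<noteq> {}" "O' \<inter> T \<noteq> {}" using IO(4) T(2) by blast+
    moreover have "I \<inter> O' \<inter> T = {}" "T \<subseteq> I \<union> O'" using IO T(2) by blast+
    ultimately show False using connectedD[OF T(1) IO(1,2)] by blast
  qed
  have "(0::complex) \<in> path_image l" using s12 unfolding pil by (intro UnI2 image_eqI[of _ _ 0]) auto
  then have PJ: "P 0 \<in> JJ" unfolding JJ_def piJ by blast
  define D where "D = P ` ball 0 \<delta>"
  have PD: "P 0 \<in> D" using \<delta> by (auto simp: D_def)
  have oD: "open D" using oD by (simp add: D_def)
  have meets: "D \<inter> S \<noteq> {}" if "frontier S = JJ" for S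
  proof -
    have "P 0 \<in> closure S" using PJ that unfolding frontier_def by blast
    then show ?thesis using PD open_Int_closure_eq_empty[OF oD, of S] by blast
  qed
  define S1 where "S1 = P ` Sec 0 \<beta>"
  define S2 where "S2 = P ` Sec \<beta> (2 * pi)"
  have "D \<subseteq> JJ \<union> S1 \<union> S2"
  proof
    fix x assume "x \<in> D"
    then obtain z where z: "z \<in> ball 0 \<delta>" "x = P z" by (auto simp: D_def)
    show "x \<in> JJ \<union> S1 \<union> S2" using cover[OF z(1)] unfolding z(2) S1_def S2_def JJ_def piJ by blast
  qed
  moreover have "S1 \<subseteq> I \<or> S1 \<subseteq> O'" "S2 \<subseteq> I \<or> S2 \<subseteq> O'"
    unfolding S1_def S2_def by (rule split; use conSec PSec in \<open>simp add: JJ_def\<close>)+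
  moreover have "D \<inter> I \<noteq> {}" "D \<inter> O' \<noteq> {}" using meets IO by blast+
  \<comment> \<open>The saddle lies on the common boundary of the two sides, so its neighbourhood
    \<open>D\<close> meets both, and the two sectors are on opposite sides.\<close>
  ultimately have "(S1 \<subseteq> I \<and> S2 \<subseteq> O') \<or> (S1 \<subseteq> O' \<and> S2 \<subseteq> I)"
    by (rule two_sides[OF _ _ _ _ _ IO(3,4)])
  \<comment> \<open>At the angles \<beta>/2 and 2 pi - \<beta>/2, multiplication by k yields an odd
    multiple of pi, so Re(q^k) < 0. Thus \<open>Dn\<close> has points in both sectors, although it
    is connected and avoids the curve.\<close>
  moreover have "P (of_real (\<delta> / 2) * cis (\<beta> / 2)) \<in> Dn" "P (of_real (\<delta> / 2) * cis (\<beta> / 2)) \<in> S1"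
  proof -
    have "real k * (\<beta> / 2) = pi" using k\<beta> by simp
    then show "P (of_real (\<delta> / 2) * cis (\<beta> / 2)) \<in> Dn"
      using \<delta> \<delta>\<rho> pow[of "\<delta> / 2" "\<beta> / 2"] by (intro dn) (auto simp: norm_mult)
    show "P (of_real (\<delta> / 2) * cis (\<beta> / 2)) \<in> S1" unfolding S1_def
      by (intro imageI SecI) (use \<delta>(1) \<beta> in auto)
  qed
  moreover have "P (of_real (\<delta> / 2) * cis (2 * pi - \<beta> / 2)) \<in> Dn" "P (of_real (\<delta> / 2) * cis (2 * pi - \<beta> / 2)) \<in> S2"
  proof -
    have "real k * (2 * pi - \<beta> / 2) = - pi + 2 * pi * real k" using k\<beta> by (simp add: algebra_simps)
    then have "cos (real k * (2 * pi - \<beta> / 2)) = cos (- pi + 2 * pi * real_of_int (int k))" by simp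
    also have "\<dots> = -1" using cos_2npi[of k] by (simp add: cos_add mult_ac)
    finally show "P (of_real (\<delta> / 2) * cis (2 * pi - \<beta> / 2)) \<in> Dn"
      using \<delta> \<delta>\<rho> pow[of "\<delta> / 2" "2 * pi - \<beta> / 2"] by (intro dn) (auto simp: norm_mult)
    have "\<beta> < 2 * pi - \<beta> / 2" using \<beta> pi_gt_zero by linarith
    then show "P (of_real (\<delta> / 2) * cis (2 * pi - \<beta> / 2)) \<in> S2" unfolding S2_def
      by (intro imageI SecI) (use \<delta>(1) \<beta> in auto)
  qed
  moreover have "Dn \<subseteq> I \<or> Dn \<subseteq> O'" by (rule split[OF Dn]) (use JDn in \<open>auto simp: JJ_def\<close>)
  ultimately show False using IO(3) by blast
qed

section \<open>Lifting a translation structure to a strip\<close>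

text \<open>The complex coordinates are only determined up to an imaginary translation; a lift is a local inverse
  of them, defined on a region of the plane.\<close>

locale translation_charts =
  fixes R :: "complex set" and f :: "complex \<Rightarrow> real" and chart :: "complex set \<Rightarrow> (complex \<Rightarrow> complex) \<Rightarrow> bool"
  assumes open_R: "open R" and conn_R: "connected R"
    and contf: "continuous_on R f"
    and chart_open: "\<And>U w. chart U w \<Longrightarrow> open U" and chart_sub: "\<And>U w. chart U w \<Longrightarrow> U \<subseteq> R"
    and chart_cont: "\<And>U w. chart U w \<Longrightarrow> continuous_on U w" and chart_inj: "\<And>U w. chart U w \<Longrightarrow> inj_on w U"
    and chart_Re: "\<And>U w m. chart U w \<Longrightarrow> m \<in> U \<Longrightarrow> Re (w m) = f m"
    and chart_trans: "\<And>U w U' w' m. chart U w \<Longrightarrow> chart U' w' \<Longrightarrow> m \<in> U \<Longrightarrow> m \<in> U' \<Longrightarrow>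
        \<forall>\<^sub>F m' in nhds m. w m' - w' m' = w m - w' m"
    and chart_add: "\<And>U w a. chart U w \<Longrightarrow> chart U (\<lambda>m. w m + \<i> * of_real a)"
    and chart_ex: "\<And>m. m \<in> R \<Longrightarrow> \<exists>U w. chart U w \<and> m \<in> U"
    and slab: "\<And>b d. b \<in> f ` R \<Longrightarrow> d \<in> f ` R \<Longrightarrow> compact {z \<in> R. b \<le> f z \<and> f z \<le> d}"
begin

section \<open>Local lifts and their uniqueness\<close>

definition lift :: "complex set \<Rightarrow> (complex \<Rightarrow> complex) \<Rightarrow> bool" where
  "lift D \<Phi> \<longleftrightarrow> open D \<and> continuous_on D \<Phi> \<and> \<Phi> ` D \<subseteq> R \<and>
     (\<forall>z\<in>D. \<exists>U w. chart U w \<and> \<Phi> z \<in> U \<and> (\<forall>\<^sub>F z' in nhds z. w (\<Phi> z') = z'))"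

lemma liftD:
  assumes "lift D \<Phi>"
  shows "open D" "continuous_on D \<Phi>" "z \<in> D \<Longrightarrow> \<Phi> z \<in> R"
  using assms by (auto simp: lift_def)

lemma lift_tendsto: "lift D \<Phi> \<Longrightarrow> z \<in> D \<Longrightarrow> (\<Phi> \<longlongrightarrow> \<Phi> z) (nhds z)"
  using liftD(1,2) by (metis continuous_on_eq_continuous_at continuous_at tendsto_at_iff_tendsto_nhds isCont_def)

text \<open>Two charts differ by a locally constant function, so a chart that is correct at one
  point of the lift is correct nearby.\<close>

lemma lift_chart:
  assumes "lift D \<Phi>" "z \<in> D" "chart U w" "\<Phi> z \<in> U" "w (\<Phi> z) = z"
  shows "\<forall>\<^sub>F z' in nhds z. \<Phi> z' \<in> U \<and> w (\<Phi> z') = z'"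
proof -
  obtain U1 w1 where 1: "chart U1 w1" "\<Phi> z \<in> U1" and ev1: "\<forall>\<^sub>F z' in nhds z. w1 (\<Phi> z') = z'"
    using assms unfolding lift_def by blast
  have z: "w1 (\<Phi> z) = z" using eventually_nhds_x_imp_x[OF ev1] by simp
  have "\<forall>\<^sub>F z' in nhds z. w (\<Phi> z') - w1 (\<Phi> z') = w (\<Phi> z) - w1 (\<Phi> z)"
    by (rule eventually_compose_filterlim[OF chart_trans[OF assms(3) 1(1) assms(4) 1(2)] lift_tendsto[OF assms(1,2)]])
  moreover have "\<forall>\<^sub>F z' in nhds z. \<Phi> z' \<in> U"
    by (rule eventually_compose_filterlim[OF _ lift_tendsto[OF assms(1,2)]])
      (use assms chart_open eventually_nhds_in_open in blast)
  ultimately show ?thesis using ev1 by eventually_elim (use assms(5) z in simp)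
qed

lemma lift_get_chart:
  assumes "lift D \<Phi>" "z \<in> D"
  obtains U w where "chart U w" "\<Phi> z \<in> U" "w (\<Phi> z) = z" "\<forall>\<^sub>F z' in nhds z. \<Phi> z' \<in> U \<and> w (\<Phi> z') = z'"
proof -
  obtain U w where 1: "chart U w" "\<Phi> z \<in> U" and ev: "\<forall>\<^sub>F z' in nhds z. w (\<Phi> z') = z'"
    using assms unfolding lift_def by blast
  have "w (\<Phi> z) = z" using eventually_nhds_x_imp_x[OF ev] by simp
  then show ?thesis using that[OF 1] lift_chart[OF assms 1] by blast
qed

lemma lift_Re: "lift D \<Phi> \<Longrightarrow> z \<in> D \<Longrightarrow> f (\<Phi> z) = Re z"
  by (metis chart_Re lift_get_chart)

lemma lift_subset: "lift D \<Phi> \<Longrightarrow> open E \<Longrightarrow> E \<subseteq> D \<Longrightarrow> lift E \<Phi>"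
  unfolding lift_def by (meson continuous_on_subset image_mono subsetD subset_trans)

text \<open>Being a lift is a local property; all glueing below rests on this.\<close>

lemma lift_cong_local:
  assumes "open D" and "\<And>z. z \<in> D \<Longrightarrow> \<exists>E \<Psi>. lift E \<Psi> \<and> z \<in> E \<and> (\<forall>z'\<in>E. \<Phi> z' = \<Psi> z')"
  shows "lift D \<Phi>"
  unfolding lift_def
proof (intro conjI ballI)
  have *: "isCont \<Phi> z \<and> \<Phi> z \<in> R \<and> (\<exists>U w. chart U w \<and> \<Phi> z \<in> U \<and> (\<forall>\<^sub>F z' in nhds z. w (\<Phi> z') = z'))" if zD: "z \<in> D" for z
  proof -
    obtain E \<Psi> where E: "lift E \<Psi>" "z \<in> E" "\<And>z'. z' \<in> E \<Longrightarrow> \<Phi> z' = \<Psi> z'" using assms(2)[OF zD] by blast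
    have ev: "\<forall>\<^sub>F z' in nhds z. z' \<in> E" using E liftD(1) eventually_nhds_in_open by blast
    have "isCont \<Psi> z" using liftD(1,2)[OF E(1)] E(2) continuous_on_eq_continuous_at by blast
    moreover have "\<forall>\<^sub>F x in nhds z. \<Phi> x = \<Psi> x" using ev by (rule eventually_mono) (rule E(3))
    ultimately have c: "isCont \<Phi> z" by (simp only: isCont_cong)
    obtain U w where U: "chart U w" "\<Psi> z \<in> U" "\<forall>\<^sub>F z' in nhds z. \<Psi> z' \<in> U \<and> w (\<Psi> z') = z'"
      by (rule lift_get_chart[OF E(1,2)])
    have "\<forall>\<^sub>F z' in nhds z. w (\<Phi> z') = z'" using ev U(3) by eventually_elim (simp add: E(3))
    then show ?thesis using c U E(2) E(3)[OF E(2)] liftD(3)[OF E(1,2)] by auto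
  qed
  show "open D" by fact
  show "continuous_on D \<Phi>" using * by (simp add: continuous_at_imp_continuous_on)
  show "\<Phi> ` D \<subseteq> R" using * by blast
  show "\<exists>U w. chart U w \<and> \<Phi> z \<in> U \<and> (\<forall>\<^sub>F z' in nhds z. w (\<Phi> z') = z')" if "z \<in> D" for z using *[OF that] by blast
qed

lemma lift_translate:
  assumes "lift D \<Phi>"
  shows "lift ((\<lambda>z. z + \<i> * of_real a) ` D) (\<lambda>z. \<Phi> (z - \<i> * of_real a))"
proof -
  let ?t = "\<lambda>z. z + \<i> * complex_of_real a" and ?D = "(\<lambda>z. z + \<i> * complex_of_real a) ` D"
  have D: "z \<in> ?D \<longleftrightarrow> z - \<i> * of_real a \<in> D" for z 
    by (auto simp: image_iff intro!: bexI[of _ "z - \<i> * of_real a"])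
  have "open ?D" using open_translation[OF liftD(1)[OF assms], of "\<i> * of_real a"] by (simp add: add.commute)
  moreover have "continuous_on ?D (\<lambda>z. \<Phi> (z - \<i> * of_real a))"
    by (rule continuous_on_compose2[OF liftD(2)[OF assms]]) (auto simp: D intro!: continuous_intros)
  moreover have "\<exists>U w. chart U w \<and> \<Phi> (z - \<i> * of_real a) \<in> U \<and> (\<forall>\<^sub>F z' in nhds z. w (\<Phi> (z' - \<i> * of_real a)) = z')"
    if z: "z \<in> ?D" for z
  proof -
    obtain U w where U: "chart U w" "\<Phi> (z - \<i> * of_real a) \<in> U"
      "\<forall>\<^sub>F z' in nhds (z - \<i> * of_real a). \<Phi> z' \<in> U \<and> w (\<Phi> z') = z'"
      by (rule lift_get_chart[OF assms z[unfolded D]])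
    have "((\<lambda>z'. z' - \<i> * of_real a) \<longlongrightarrow> z - \<i> * of_real a) (nhds z)"
      by (intro tendsto_intros filterlim_ident)
    from eventually_compose_filterlim[OF U(3) this]
    have "\<forall>\<^sub>F z' in nhds z. w (\<Phi> (z' - \<i> * of_real a)) + \<i> * of_real a = z'"
      by eventually_elim simp
    then show ?thesis using chart_add[OF U(1)] U(2) by blast
  qed
  ultimately show ?thesis unfolding lift_def using liftD(3)[OF assms] D by auto
qed

text \<open>The set of agreement is closed by continuity. It is open because near a common value
  both lifts invert the same injective chart.\<close>

lemma lift_unique:
  assumes 1: "lift D1 \<Phi>1" and 2: "lift D2 \<Phi>2" and D: "connected D" "open D" "D \<subseteq> D1" "D \<subseteq> D2"
    and z0: "z0 \<in> D" "\<Phi>1 z0 = \<Phi>2 z0" and z: "z \<in> D"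
  shows "\<Phi>1 z = \<Phi>2 z"
proof -
  let ?S = "{z \<in> D. \<Phi>1 z = \<Phi>2 z}"
  note c1 = continuous_on_subset[OF liftD(2)[OF 1] D(3)] and c2 = continuous_on_subset[OF liftD(2)[OF 2] D(4)]
  have "closedin (top_of_set D) ?S"
    using continuous_closedin_preimage[OF continuous_on_diff[OF c1 c2] closed_singleton[of 0]]
    by (simp add: vimage_def Int_def)
  moreover have "openin (top_of_set D) ?S"
  proof -
    have "\<exists>T. open T \<and> x \<in> T \<and> T \<subseteq> ?S" if x: "x \<in> ?S" for x
    proof -
      have xD: "x \<in> D1" "x \<in> D2" "x \<in> D" "\<Phi>2 x = \<Phi>1 x" using x D by auto
      obtain U w where U: "chart U w" "\<Phi>1 x \<in> U" "w (\<Phi>1 x) = x" "\<forall>\<^sub>F z' in nhds x. \<Phi>1 z' \<in> U \<and> w (\<Phi>1 z') = z'"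
        by (rule lift_get_chart[OF 1 xD(1)])
      have "\<forall>\<^sub>F z' in nhds x. \<Phi>2 z' \<in> U \<and> w (\<Phi>2 z') = z'"
        by (rule lift_chart[OF 2 xD(2) U(1)]) (use U xD in auto)
      moreover have "\<forall>\<^sub>F z' in nhds x. z' \<in> D" using D(2) xD(3) eventually_nhds_in_open by blast
      ultimately have "\<forall>\<^sub>F z' in nhds x. z' \<in> ?S"
        using U(4) by eventually_elim (use chart_inj[OF U(1)] in \<open>auto simp: inj_on_def\<close>)
      then show ?thesis unfolding eventually_nhds by blast
    qed
    then have "open ?S" by (subst open_subopen) blast
    then show ?thesis using D(2) by (simp add: openin_open_eq)
  qed
  moreover have "?S \<noteq> {}" using z0 by blast
  ultimately have "?S = D" using D(1) unfolding connected_clopen by blast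
  then show ?thesis using z by blast
qed

text \<open>A lift has local left inverses, so it is locally injective and invariance of domain
  applies.\<close>

lemma lift_open_image:
  assumes "lift D \<Phi>" "open E" "E \<subseteq> D"
  shows "open (\<Phi> ` E)"
proof -
  have "\<exists>T. open T \<and> y \<in> T \<and> T \<subseteq> \<Phi> ` E" if y: "y \<in> \<Phi> ` E" for y
  proof -
    obtain z where z: "z \<in> E" "y = \<Phi> z" using y by blast
    obtain U w where U: "\<forall>\<^sub>F z' in nhds z. \<Phi> z' \<in> U \<and> w (\<Phi> z') = z'"
      using lift_get_chart[OF assms(1), of z] z assms(3) by blast
    moreover have "\<forall>\<^sub>F z' in nhds z. z' \<in> E" using z assms(2) eventually_nhds_in_open by blast
    ultimately have "\<forall>\<^sub>F z' in nhds z. z' \<in> E \<and> w (\<Phi> z') = z'" by eventually_elim simp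
    then obtain T where T: "open T" "z \<in> T" "\<And>z'. z' \<in> T \<Longrightarrow> z' \<in> E \<and> w (\<Phi> z') = z'"
      unfolding eventually_nhds by blast
    have TE: "T \<subseteq> E" "T \<subseteq> D" using T assms(3) by auto
    have "open (\<Phi> ` T)"
      by (rule invariance_of_domain[OF continuous_on_subset[OF liftD(2)[OF assms(1)] TE(2)] T(1)]) (use T(3) in \<open>auto intro: inj_on_inverseI\<close>)
    then show ?thesis using T TE z by blast
  qed
  then show ?thesis by (subst open_subopen) blast
qed

text \<open>An imaginary translation moves the chart value of \<open>m\<close> to \<open>z0\<close>;
  the lift is the inverse of the shifted chart.\<close>

lemma lift_local:
  assumes m: "m \<in> R" and z0: "Re z0 = f m"
  obtains e \<Phi> where "e > 0" "lift (ball z0 e) \<Phi>" "\<Phi> z0 = m"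
proof -
  obtain U w0 where U0: "chart U w0" "m \<in> U" using chart_ex[OF m] by blast
  define w where "w = (\<lambda>m'. w0 m' + \<i> * of_real (Im z0 - Im (w0 m)))"
  have U: "chart U w" unfolding w_def by (rule chart_add[OF U0(1)])
  have wm: "w m = z0" using chart_Re[OF U0] z0 by (simp add: w_def complex_eq_iff)
  have "open (w ` U)" by (rule invariance_of_domain[OF chart_cont[OF U] chart_open[OF U] chart_inj[OF U]])
  moreover have "z0 \<in> w ` U" using wm U0(2) by blast
  ultimately obtain e where e: "e > 0" "ball z0 e \<subseteq> w ` U" using open_contains_ball by blast
  obtain \<Phi> where hom: "homeomorphism U (w ` U) w \<Phi>"
    using invariance_of_domain_homeomorphism[OF chart_open[OF U] chart_cont[OF U] _ chart_inj[OF U]] by auto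
  have \<Phi>: "\<Phi> z \<in> U" "w (\<Phi> z) = z" if "z \<in> ball z0 e" for z
    using homeomorphism_image2[OF hom] homeomorphism_apply2[OF hom] subsetD[OF e(2) that] by auto
  have "lift (ball z0 e) \<Phi>"
    unfolding lift_def
  proof (intro conjI ballI)
    show "continuous_on (ball z0 e) \<Phi>" using homeomorphism_cont2[OF hom] e(2) by (rule continuous_on_subset)
    show "\<Phi> ` ball z0 e \<subseteq> R" using \<Phi>(1) chart_sub[OF U] by blast
    show "\<exists>U w. chart U w \<and> \<Phi> z \<in> U \<and> (\<forall>\<^sub>F z' in nhds z. w (\<Phi> z') = z')" if "z \<in> ball z0 e" for z
    proof -
      have "\<forall>\<^sub>F z' in nhds z. w (\<Phi> z') = z'"
        using eventually_nhds_in_open[OF open_ball that] by (rule eventually_mono) (rule \<Phi>(2))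
      then show ?thesis using U \<Phi>(1)[OF that] by blast
    qed
  qed simp
  moreover have "\<Phi> z0 = m" using \<Phi>[of z0] e wm chart_inj[OF U] U0(2) by (auto simp: inj_on_def)
  ultimately show ?thesis using that e by blast
qed

lemma translate_ball: "(\<lambda>z. z + \<i> * complex_of_real a) ` ball z e = ball (z + \<i> * of_real a) e"
  using ball_translation[of "\<i> * of_real a" z e] by (simp add: add.commute)

text \<open>A Lebesgue number argument: finitely many local lifts cover \<open>K\<close> already
  with half of their radii, which leaves room for a common radius at every point. Only the real part
  of the centre is prescribed, since imaginary translations preserve lifts.\<close>

lemma lift_uniform:
  assumes K: "compact K" "K \<subseteq> R"
  obtains e where "e > 0" "\<And>m z0. m \<in> K \<Longrightarrow> Re z0 = f m \<Longrightarrow> \<exists>\<Phi>. lift (ball z0 e) \<Phi> \<and> \<Phi> z0 = m"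
proof -
  have "\<exists>e \<Phi>. e > 0 \<and> lift (ball (of_real (f m)) e) \<Phi> \<and> \<Phi> (of_real (f m)) = m" if "m \<in> K" for m
  proof -
    have mR: "m \<in> R" using K that by blast
    obtain e \<Phi> where "e > 0" "lift (ball (of_real (f m)) e) \<Phi>" "\<Phi> (of_real (f m)) = m"
      by (rule lift_local[OF mR Re_complex_of_real])
    then show ?thesis by blast
  qed
  then obtain E F where E: "\<And>m. m \<in> K \<Longrightarrow> E m > 0" and F: "\<And>m. m \<in> K \<Longrightarrow> lift (ball (of_real (f m)) (E m)) (F m)"
    and Fm: "\<And>m. m \<in> K \<Longrightarrow> F m (of_real (f m)) = m" by metis
  define O' where "O' m = F m ` ball (of_real (f m)) (E m / 2)" for m
  have oO: "open (O' m)" if "m \<in> K" for m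
    unfolding O'_def by (rule lift_open_image[OF F[OF that]]) (use E[OF that] in auto)
  have "K \<subseteq> (\<Union>m\<in>K. O' m)"
  proof
    fix m assume m: "m \<in> K"
    then have "m \<in> O' m" unfolding O'_def using Fm[OF m] E[OF m] by (intro image_eqI[of _ _ "of_real (f m)"]) auto
    then show "m \<in> (\<Union>m\<in>K. O' m)" using m by blast
  qed
  then obtain K' where K': "K' \<subseteq> K" "finite K'" "K \<subseteq> (\<Union>m\<in>K'. O' m)"
    using compactE_image[OF K(1), of K O'] oO by metis
  \<comment> \<open>Inserting 1 keeps the minimum defined when \<open>K\<close> is empty.\<close>
  define e where "e = Min (insert 1 ((\<lambda>m. E m / 2) ` K'))"
  have e: "e > 0" using K' E by (auto simp: e_def)
  have le: "e \<le> E m / 2" if "m \<in> K'" for m 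
    unfolding e_def by (rule Min_le) (use K' that in auto)
  have "\<exists>\<Phi>. lift (ball z0 e) \<Phi> \<and> \<Phi> z0 = m" if m: "m \<in> K" and z0: "Re z0 = f m" for m z0
  proof -
    obtain k where k: "k \<in> K'" "m \<in> O' k" using K' m by blast
    then have kK: "k \<in> K" using K' by auto
    obtain a where a: "a \<in> ball (of_real (f k)) (E k / 2)" "m = F k a" using k by (auto simp: O'_def)
    have "ball a e \<subseteq> ball (of_real (f k)) (E k)"
    proof
      fix z assume z: "z \<in> ball a e"
      have "dist (of_real (f k)) z \<le> dist (of_real (f k)) a + dist a z" by (rule dist_triangle)
      then show "z \<in> ball (of_real (f k)) (E k)" using z a(1) le[OF k(1)] by simp
    qed
    then have l: "lift (ball a e) (F k)" using F[OF kK] lift_subset by blast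
    have "Re a = f m" using lift_Re[OF l, of a] e a by simp
    then have "z0 = a + \<i> * of_real (Im z0 - Im a)" using z0 by (simp add: complex_eq_iff)
    then have "lift (ball z0 e) (\<lambda>z. F k (z - \<i> * of_real (Im z0 - Im a)))"
      using lift_translate[OF l, of "Im z0 - Im a"] unfolding translate_ball by simp
    moreover have "z0 - \<i> * of_real (Im z0 - Im a) = a" using z0 \<open>Re a = f m\<close> by (simp add: complex_eq_iff)
    ultimately show ?thesis using a(2) by auto
  qed
  then show ?thesis using that e by blast
qed

section \<open>Continuation of lifts to convex regions\<close>

text \<open>All local lifts have the same radius \<open>e\<close>. Two of them with centres less
  than \<open>e\<close> apart agree on the intersection of their balls, which is convex and contains
  a point where both equal \<open>\<Phi>\<close>; so they glue to a lift on a ball larger by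
  e/2.\<close>

lemma lift_extend_step:
  assumes D: "convex D" "open D" and z0: "z0 \<in> D" and r: "r > 0" and e: "e > 0"
    and L: "lift (ball z0 r \<inter> D) \<Phi>"
    and unif: "\<And>m z. m \<in> R \<Longrightarrow> z \<in> D \<Longrightarrow> Re z = f m \<Longrightarrow> \<exists>\<Psi>. lift (ball z e) \<Psi> \<and> \<Psi> z = m"
  shows "\<exists>\<Phi>'. lift (ball z0 (r + e / 2) \<inter> D) \<Phi>' \<and> \<Phi>' z0 = \<Phi> z0"
proof -
  define E where "E = ball z0 r \<inter> D"
  have E: "convex E" "open E" "z0 \<in> E" using D z0 r by (auto simp: E_def convex_Int)
  have "\<exists>\<Psi>. lift (ball z e) \<Psi> \<and> \<Psi> z = \<Phi> z" if "z \<in> E" for z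
    using unif[of "\<Phi> z" z] liftD(3)[OF L] lift_Re[OF L] that by (auto simp: E_def)
  then obtain \<Psi> where \<Psi>: "\<And>z. z \<in> E \<Longrightarrow> lift (ball z e) (\<Psi> z)" "\<And>z. z \<in> E \<Longrightarrow> \<Psi> z z = \<Phi> z" by metis
  have LE: "lift E \<Phi>" using L by (simp add: E_def)
  have A: "\<Psi> z z' = \<Phi> z'" if "z \<in> E" "z' \<in> E" "dist z z' < e" for z z'
    by (rule lift_unique[OF \<Psi>(1)[OF that(1)] LE, of "ball z e \<inter> E" z])
      (use that E e \<Psi>(2) in \<open>auto intro!: convex_connected convex_Int\<close>)
  have B: "\<Psi> z \<zeta> = \<Psi> z' \<zeta>" if "z \<in> E" "z' \<in> E" "dist z \<zeta> < e / 2" "dist z' \<zeta> < e / 2" for z z' \<zeta>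
  proof -
    have "dist z z' < e" using that dist_triangle_half_r[of \<zeta> z e z'] by (simp add: dist_commute)
    then have z': "\<Psi> z z' = \<Psi> z' z'" using A[OF that(1,2)] \<Psi>(2)[OF that(2)] by simp
    show ?thesis
      by (rule lift_unique[OF \<Psi>(1)[OF that(1)] \<Psi>(1)[OF that(2)] _ _ _ _ _ z', of "ball z e \<inter> ball z' e"])
        (use that e \<open>dist z z' < e\<close> in \<open>auto intro!: convex_connected convex_Int\<close>)
  qed
  \<comment> \<open>Walking back from the new point towards \<open>z0\<close> along a segment, one
    enters the old ball within e/2 and never leaves the convex \<open>D\<close>.\<close>
  have C: "\<exists>z\<in>E. dist z \<zeta> < e / 2" if \<zeta>: "\<zeta> \<in> ball z0 (r + e / 2) \<inter> D" for \<zeta>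
  proof (cases "\<zeta> \<in> E")
    case True then show ?thesis using e by (intro bexI[of _ \<zeta>]) auto
  next
    case False
    let ?n = "dist z0 \<zeta>"
    have n: "r \<le> ?n" "?n < r + e / 2" using False \<zeta> by (auto simp: E_def)
    define \<eta> where "\<eta> = min (r / 2) ((r + e / 2 - ?n) / 2)"
    have \<eta>: "0 < \<eta>" "\<eta> < r" "\<eta> < r + e / 2 - ?n" using n r by (auto simp: \<eta>_def min_def)
    define t where "t = (r - \<eta>) / ?n"
    have n0: "?n > 0" using n r by linarith
    have t: "0 \<le> t" "t \<le> 1" "t * ?n = r - \<eta>" using n0 \<eta> n by (auto simp: t_def field_simps)
    define z where "z = (1 - t) *\<^sub>R z0 + t *\<^sub>R \<zeta>"
    have "z \<in> D" unfolding z_def using convexD_alt[OF D(1) z0, of \<zeta> t] \<zeta> t by auto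
    moreover have "z - z0 = t *\<^sub>R (\<zeta> - z0)" by (simp add: z_def algebra_simps)
    then have "dist z z0 = t * dist \<zeta> z0" using t by (simp add: dist_norm)
    then have "dist z0 z = t * ?n" by (simp only: dist_commute)
    moreover have "\<zeta> - z = (1 - t) *\<^sub>R (\<zeta> - z0)" by (simp add: z_def algebra_simps)
    then have "dist \<zeta> z = (1 - t) * dist \<zeta> z0" using t by (simp add: dist_norm)
    then have "dist z \<zeta> = (1 - t) * ?n" by (simp only: dist_commute)
    ultimately show ?thesis using t \<eta> by (intro bexI[of _ z]) (auto simp: E_def algebra_simps)
  qed
  define c where "c \<zeta> = (SOME z. z \<in> E \<and> dist z \<zeta> < e / 2)" for \<zeta>
  have c: "c \<zeta> \<in> E" "dist (c \<zeta>) \<zeta> < e / 2" if "\<zeta> \<in> ball z0 (r + e / 2) \<inter> D" for \<zeta>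
    using someI_ex[of "\<lambda>z. z \<in> E \<and> dist z \<zeta> < e / 2"] C[OF that] unfolding c_def by blast+
  define \<Phi>' where "\<Phi>' \<zeta> = \<Psi> (c \<zeta>) \<zeta>" for \<zeta>
  let ?B = "ball z0 (r + e / 2) \<inter> D"
  have "lift ?B \<Phi>'"
  proof (rule lift_cong_local)
    show "open ?B" using D by auto
    fix \<zeta> assume \<zeta>: "\<zeta> \<in> ?B"
    let ?E = "ball (c \<zeta>) (e / 2) \<inter> ?B"
    have "lift ?E (\<Psi> (c \<zeta>))"
      by (rule lift_subset[OF \<Psi>(1)[OF c(1)[OF \<zeta>]]]) (use D e in auto)
    moreover have "\<Phi>' z' = \<Psi> (c \<zeta>) z'" if "z' \<in> ?E" for z'
      unfolding \<Phi>'_def by (rule B) (use that c \<zeta> in auto)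
    ultimately show "\<exists>E \<Psi>. lift E \<Psi> \<and> \<zeta> \<in> E \<and> (\<forall>z'\<in>E. \<Phi>' z' = \<Psi> z')"
      using c(2)[OF \<zeta>] \<zeta> by (intro exI[of _ ?E] exI[of _ "\<Psi> (c \<zeta>)"]) auto
  qed
  moreover have "z0 \<in> ?B" using z0 r e by auto
  then have "\<Phi>' z0 = \<Phi> z0" unfolding \<Phi>'_def using c[of z0] e E(3) by (simp add: A)
  ultimately show ?thesis by blast
qed

text \<open>Each extension enlarges the radius by the same amount, so finitely many reach any given
  point, and uniqueness makes the lifts on nested balls compatible.\<close>

lemma lift_convex:
  assumes D: "convex D" "open D" and z0: "z0 \<in> D" and m: "m \<in> R" "f m = Re z0" and e: "e > 0"
    and unif: "\<And>m z. m \<in> R \<Longrightarrow> z \<in> D \<Longrightarrow> Re z = f m \<Longrightarrow> \<exists>\<Psi>. lift (ball z e) \<Psi> \<and> \<Psi> z = m"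
  obtains \<Phi> where "lift D \<Phi>" "\<Phi> z0 = m"
proof -
  let ?r = "\<lambda>n::nat. e + real n * (e / 2)"
  have r: "?r n > 0" for n using e by (simp add: add_pos_nonneg)
  have "\<exists>\<Phi>. lift (ball z0 (?r n) \<inter> D) \<Phi> \<and> \<Phi> z0 = m" for n
  proof (induction n)
    case 0
    obtain \<Psi> where "lift (ball z0 e) \<Psi>" "\<Psi> z0 = m" using unif[OF m(1) z0] m by auto
    then show ?case using lift_subset[of "ball z0 e" \<Psi> "ball z0 e \<inter> D"] D by auto
  next
    case (Suc n)
    then obtain \<Phi> where "lift (ball z0 (?r n) \<inter> D) \<Phi>" "\<Phi> z0 = m" by blast
    then obtain \<Phi>' where "lift (ball z0 (?r n + e / 2) \<inter> D) \<Phi>'" "\<Phi>' z0 = m"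
      using lift_extend_step[OF D z0 r e, of n \<Phi>] unif by metis
    moreover have "?r n + e / 2 = ?r (Suc n)" by (simp add: field_simps)
    ultimately show ?case by metis
  qed
  then obtain \<Phi> where \<Phi>: "\<And>n. lift (ball z0 (?r n) \<inter> D) (\<Phi> n)" "\<And>n. \<Phi> n z0 = m" by metis
  have mono: "\<Phi> n z = \<Phi> k z" if "z \<in> ball z0 (?r n) \<inter> D" "n \<le> k" for n k z
  proof (rule lift_unique[OF \<Phi>(1)[of n] \<Phi>(1)[of k], of "ball z0 (?r n) \<inter> D" z0])
    have "?r n \<le> ?r k" using that e by (intro add_left_mono mult_right_mono) auto
    then show "ball z0 (?r n) \<inter> D \<subseteq> ball z0 (?r k) \<inter> D" by auto
    show "connected (ball z0 (?r n) \<inter> D)" by (intro convex_connected convex_Int convex_ball D)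
  qed (use that D z0 r \<Phi>(2) in auto)
  define N where "N z = nat \<lceil>dist z0 z / (e / 2)\<rceil>" for z
  have N: "dist z0 z < ?r (N z)" for z
  proof -
    have "dist z0 z / (e / 2) \<le> real (N z)" unfolding N_def by (rule real_nat_ceiling_ge)
    then have "dist z0 z \<le> real (N z) * (e / 2)" using e by (simp add: pos_divide_le_eq)
    then show ?thesis using e by linarith
  qed
  define \<Phi>' where "\<Phi>' z = \<Phi> (N z) z" for z
  have "lift D \<Phi>'"
  proof (rule lift_cong_local[OF D(2)])
    fix z assume z: "z \<in> D"
    have "\<Phi>' z' = \<Phi> (N z) z'" if "z' \<in> ball z0 (?r (N z)) \<inter> D" for z'
    proof -
      have "z' \<in> ball z0 (?r (N z')) \<inter> D" using N[of z'] that by auto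
      then show ?thesis unfolding \<Phi>'_def using mono[of z' "N z" "N z'"] mono[of z' "N z'" "N z"] that by (metis linear)
    qed
    then show "\<exists>E \<Psi>. lift E \<Psi> \<and> z \<in> E \<and> (\<forall>z'\<in>E. \<Phi>' z' = \<Psi> z')"
      using \<Phi>(1)[of "N z"] N[of z] z by (intro exI[of _ "ball z0 (?r (N z)) \<inter> D"] exI[of _ "\<Phi> (N z)"]) auto
  qed
  then show ?thesis using that \<Phi>(2) by (simp add: \<Phi>'_def)
qed

section \<open>Lifts of strips: period and surjectivity\<close>

definition strip :: "real \<Rightarrow> real \<Rightarrow> complex set" where "strip c d = {z. c < Re z \<and> Re z < d}"

lemma strip: "open (strip c d)" "convex (strip c d)" "connected (strip c d)"
proof -
  have eq: "strip c d = {z. c < Re z} \<inter> {z. Re z < d}" by (auto simp: strip_def)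
  show "open (strip c d)" unfolding eq by (intro open_Int open_halfspace_Re_gt open_halfspace_Re_lt)
  show cv: "convex (strip c d)" unfolding eq by (intro convex_Int convex_halfspace_Re_gt convex_halfspace_Re_lt)
  then show "connected (strip c d)" by (rule convex_connected)
qed

lemma strip_shift [simp]: "z + \<i> * of_real a \<in> strip c d \<longleftrightarrow> z \<in> strip c d"
  by (simp add: strip_def)

lemma lift_shift:
  assumes "lift (strip c d) \<Phi>"
  shows "lift (strip c d) (\<lambda>z. \<Phi> (z + \<i> * of_real a))"
proof -
  have "(\<lambda>z. z + \<i> * of_real (- a)) ` strip c d = strip c d"
  proof (intro equalityI subsetI)
    fix z assume "z \<in> strip c d"
    then show "z \<in> (\<lambda>z. z + \<i> * of_real (- a)) ` strip c d"
      by (intro image_eqI[of _ _ "z + \<i> * of_real a"]) auto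
  qed (auto simp: strip_def)
  then show ?thesis using lift_translate[OF assms, of "- a"] by simp
qed

text \<open>Vertical shifts of a lift are lifts of the same strip, so coincidence at one point is
  coincidence everywhere.\<close>

lemma lift_cong_strip:
  assumes L: "lift (strip c d) \<Phi>" and w: "w \<in> strip c d" "\<Phi> (w + \<i> * of_real a) = \<Phi> (w + \<i> * of_real b)"
    and z: "z \<in> strip c d"
  shows "\<Phi> (z + \<i> * of_real a) = \<Phi> (z + \<i> * of_real b)"
  using lift_unique[OF lift_shift[OF L, of a] lift_shift[OF L, of b] strip(3,1) order_refl order_refl w z] .

text \<open>Real parts in the strip are heights in a compact slab, over which local lifts have a
  common radius.\<close>

lemma strip_lift:
  assumes c: "c \<in> f ` R" and d: "d \<in> f ` R" and m: "m \<in> R" "c < f m" "f m < d"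
  obtains \<Phi> where "lift (strip c d) \<Phi>" "\<Phi> (of_real (f m)) = m"
proof -
  have "{z \<in> R. c \<le> f z \<and> f z \<le> d} \<subseteq> R" by blast
  then obtain e where e: "e > 0" "\<And>m z0. m \<in> {z \<in> R. c \<le> f z \<and> f z \<le> d} \<Longrightarrow> Re z0 = f m \<Longrightarrow> \<exists>\<Phi>. lift (ball z0 e) \<Phi> \<and> \<Phi> z0 = m"
    using lift_uniform[OF slab[OF c d]] by metis
  show ?thesis
  proof (rule lift_convex[OF strip(2,1) _ m(1) _ e(1)])
    show "complex_of_real (f m) \<in> strip c d" using m by (simp add: strip_def)
    show "\<exists>\<Psi>. lift (ball z e) \<Psi> \<and> \<Psi> z = m'" if "m' \<in> R" "z \<in> strip c d" "Re z = f m'" for m' z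
      using that by (intro e(2)) (auto simp: strip_def)
  qed (use that in auto)
qed

text \<open>Pigeonhole on a compact level set: infinitely many points of one vertical line go into
  finitely many small sets, so two of them land in the same one, and the lift repeats itself up to a
  small offset.\<close>

lemma strip_period:
  assumes c: "c \<in> f ` R" and d: "d \<in> f ` R" and \<tau>: "c < \<tau>" "\<tau> < d" and L: "lift (strip c d) \<Phi>"
  shows "\<exists>p>0. \<forall>z\<in>strip c d. \<Phi> (z + \<i> * of_real p) = \<Phi> z"
proof -
  define L where "L = {z \<in> R. \<tau> \<le> f z \<and> f z \<le> \<tau>}"
  have \<tau>s: "of_real \<tau> \<in> strip c d" using \<tau> by (simp add: strip_def)
  have "f (\<Phi> (of_real \<tau>)) = \<tau>" using lift_Re[OF L \<tau>s] by simp
  then have "\<tau> \<in> f ` R" using liftD(3)[OF L \<tau>s] by force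
  then have cL: "compact L" unfolding L_def by (intro slab)
  have "L \<subseteq> R" by (auto simp: L_def)
  then obtain e where e: "e > 0" "\<And>m z0. m \<in> L \<Longrightarrow> Re z0 = f m \<Longrightarrow> \<exists>\<Phi>. lift (ball z0 e) \<Phi> \<and> \<Phi> z0 = m"
    using lift_uniform[OF cL] by metis
  have "\<exists>F. lift (ball (of_real \<tau>) e) F \<and> F (of_real \<tau>) = m" if "m \<in> L" for m
    using e(2)[of m "of_real \<tau>"] that by (auto simp: L_def)
  then obtain F where F: "\<And>m. m \<in> L \<Longrightarrow> lift (ball (of_real \<tau>) e) (F m)" "\<And>m. m \<in> L \<Longrightarrow> F m (of_real \<tau>) = m"
    by metis
  define O' where "O' m = F m ` ball (of_real \<tau>) (e / 2)" for m
  have oO: "open (O' m)" if "m \<in> L" for m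
    unfolding O'_def by (rule lift_open_image[OF F(1)[OF that]]) (use e(1) in auto)
  have "L \<subseteq> (\<Union>m\<in>L. O' m)"
  proof
    fix m assume m: "m \<in> L"
    then have "m \<in> O' m" unfolding O'_def using F(2)[OF m] e(1) by (intro image_eqI[of _ _ "of_real \<tau>"]) auto
    then show "m \<in> (\<Union>m\<in>L. O' m)" using m by blast
  qed
  then obtain L' where L': "L' \<subseteq> L" "finite L'" "L \<subseteq> (\<Union>m\<in>L'. O' m)"
    using compactE_image[OF cL, of L O'] oO by metis
  \<comment> \<open>The spacing \<open>e + 1\<close> exceeds the total offset, which stays below
    \<open>e\<close>; so the period found is positive.\<close>
  define y where "y n = real n * (e + 1)" for n
  have ys: "of_real \<tau> + \<i> * of_real (y n) \<in> strip c d" for n using \<tau>s by simp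
  have "\<Phi> (of_real \<tau> + \<i> * of_real (y n)) \<in> L" for n
    using lift_Re[OF L ys] liftD(3)[OF L ys] by (simp add: L_def)
  then have "\<exists>m\<in>L'. \<Phi> (of_real \<tau> + \<i> * of_real (y n)) \<in> O' m" for n using L'(3) by blast
  then obtain k where k: "\<And>n. k n \<in> L'" "\<And>n. \<Phi> (of_real \<tau> + \<i> * of_real (y n)) \<in> O' (k n)" by metis
  have "\<not> inj k" using finite_subset[OF _ L'(2), of "range k"] k(1) range_inj_infinite[of k] by blast
  then obtain n1 n2 where n12: "k n1 = k n2" "n1 < n2" by (metis injI linorder_neqE_nat)
  define m where "m = k n1"
  have mL: "m \<in> L" using k(1) L'(1) by (auto simp: m_def)
  have get: "\<exists>s. \<bar>s\<bar> < e / 2 \<and> (\<forall>z\<in>ball (of_real \<tau>) e \<inter> strip c d. \<Phi> (z + \<i> * of_real (y n - s)) = F m z)" if kn: "k n = m" for n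
  proof -
    obtain a where a: "a \<in> ball (of_real \<tau>) (e / 2)" "\<Phi> (of_real \<tau> + \<i> * of_real (y n)) = F m a"
      using k(2)[of n] unfolding O'_def kn by blast
    have ae: "a \<in> ball (of_real \<tau>) e" using a(1) e(1) by simp
    have "Re a = f (F m a)" using lift_Re[OF F(1)[OF mL] ae] by simp
    also have "\<dots> = \<tau>" using lift_Re[OF L ys, of n] a(2) by simp
    finally have Ra: "Re a = \<tau>" .
    define s where "s = Im a"
    have as: "a = of_real \<tau> + \<i> * of_real s" using Ra by (simp add: s_def complex_eq_iff)
    have "\<bar>s\<bar> \<le> cmod (a - of_real \<tau>)" using abs_Im_le_cmod[of "a - of_real \<tau>"] by (simp add: s_def)
    then have "\<bar>s\<bar> < e / 2" using a(1) by (simp add: dist_norm norm_minus_commute)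
    moreover have "\<Phi> (z + \<i> * of_real (y n - s)) = F m z" if z: "z \<in> ball (of_real \<tau>) e \<inter> strip c d" for z
    proof (rule lift_unique[OF lift_shift[OF L] F(1)[OF mL]])
      show "connected (ball (of_real \<tau>) e \<inter> strip c d)" by (intro convex_connected convex_Int convex_ball strip)
      show "a \<in> ball (of_real \<tau>) e \<inter> strip c d" using ae \<tau>s by (simp add: as)
      have "a + \<i> * of_real (y n - s) = of_real \<tau> + \<i> * of_real (y n)" by (simp add: as algebra_simps)
      then show "\<Phi> (a + \<i> * of_real (y n - s)) = F m a" using a(2) by simp
    qed (use z strip in auto)
    ultimately show ?thesis by blast
  qed
  obtain s1 where s1: "\<bar>s1\<bar> < e / 2" "\<And>z. z \<in> ball (of_real \<tau>) e \<inter> strip c d \<Longrightarrow> \<Phi> (z + \<i> * of_real (y n1 - s1)) = F m z"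
    using get[of n1] m_def by blast
  obtain s2 where s2: "\<bar>s2\<bar> < e / 2" "\<And>z. z \<in> ball (of_real \<tau>) e \<inter> strip c d \<Longrightarrow> \<Phi> (z + \<i> * of_real (y n2 - s2)) = F m z"
    using get[of n2] m_def n12 by auto
  have "of_real \<tau> \<in> ball (of_real \<tau>) e \<inter> strip c d" using e(1) \<tau>s by simp
  then have eq: "\<Phi> (of_real \<tau> + \<i> * of_real (y n2 - s2)) = \<Phi> (of_real \<tau> + \<i> * of_real (y n1 - s1))"
    using s1(2) s2(2) by metis
  define p where "p = (y n2 - s2) - (y n1 - s1)"
  have "real n1 + 1 \<le> real n2" using n12 by simp
  then have "(real n1 + 1) * (e + 1) \<le> y n2" unfolding y_def by (rule mult_right_mono) (use e in simp)
  then have "y n2 - y n1 \<ge> e + 1" unfolding y_def by (simp add: algebra_simps)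
  then have "p > 0" using s1(1) s2(1) unfolding p_def by linarith
  moreover have "\<Phi> (z + \<i> * of_real p) = \<Phi> z" if z: "z \<in> strip c d" for z
  proof -
    let ?z = "z + \<i> * of_real (- (y n1 - s1))"
    have "\<Phi> (?z + \<i> * of_real (y n2 - s2)) = \<Phi> (?z + \<i> * of_real (y n1 - s1))"
      by (rule lift_cong_strip[OF L \<tau>s eq]) (use z in \<open>simp only: strip_shift\<close>)
    then show ?thesis by (simp add: p_def algebra_simps)
  qed
  ultimately show ?thesis by blast
qed

text \<open>Some chart inverts the lift near one point, so periods are bounded below by a
  \<open>\<delta>\<close>. A period less than \<open>\<delta>\<close> above the infimum is minimal,
  for otherwise a difference of periods would be too small. Points with the same image have the same
  real part, and by uniqueness their difference is a period.\<close>

lemma minimal_period: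
  assumes c: "c \<in> f ` R" and d: "d \<in> f ` R" and \<tau>: "c < \<tau>" "\<tau> < d" and L: "lift (strip c d) \<Phi>"
  obtains J where "J > 0" "\<And>z. z \<in> strip c d \<Longrightarrow> \<Phi> (z + \<i> * of_real J) = \<Phi> z"
    "\<And>z w. z \<in> strip c d \<Longrightarrow> w \<in> strip c d \<Longrightarrow> 0 \<le> Im z \<Longrightarrow> Im z < J \<Longrightarrow> 0 \<le> Im w \<Longrightarrow> Im w < J \<Longrightarrow> \<Phi> z = \<Phi> w \<Longrightarrow> z = w"
proof -
  define Per where "Per = {p. p > 0 \<and> (\<forall>z\<in>strip c d. \<Phi> (z + \<i> * of_real p) = \<Phi> z)}"
  have ne: "Per \<noteq> {}" using strip_period[OF assms] by (auto simp: Per_def)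
  have bdd: "bdd_below Per" by (rule bdd_belowI[of _ 0]) (auto simp: Per_def)
  have \<tau>s: "of_real \<tau> \<in> strip c d" using \<tau> by (simp add: strip_def)
  obtain U w where "\<forall>\<^sub>F z' in nhds (of_real \<tau>). \<Phi> z' \<in> U \<and> w (\<Phi> z') = z'"
    by (rule lift_get_chart[OF L \<tau>s])
  then obtain \<delta> where \<delta>: "\<delta> > 0" "\<And>z'. dist z' (of_real \<tau>) < \<delta> \<Longrightarrow> w (\<Phi> z') = z'"
    unfolding eventually_nhds_metric by blast
  have ge: "p \<ge> \<delta>" if "p \<in> Per" for p
  proof (rule ccontr)
    assume "\<not> p \<ge> \<delta>"
    then have "w (\<Phi> (of_real \<tau> + \<i> * of_real p)) = of_real \<tau> + \<i> * of_real p"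
      using that by (intro \<delta>(2)) (simp add: dist_norm norm_mult Per_def)
    moreover have "w (\<Phi> (of_real \<tau>)) = of_real \<tau>" using \<delta> by simp
    moreover have "\<Phi> (of_real \<tau> + \<i> * of_real p) = \<Phi> (of_real \<tau>)" "p > 0" using that \<tau>s by (auto simp: Per_def)
    ultimately show False by (simp add: complex_eq_iff)
  qed
  obtain J where J: "J \<in> Per" "J < Inf Per + \<delta>"
    using cInf_lessD[OF ne, of "Inf Per + \<delta>"] \<delta>(1) by auto
  have min: "\<not> p < J" if p: "p \<in> Per" for p
  proof
    assume "p < J"
    have "Inf Per \<le> p" by (rule cInf_lower[OF p bdd])
    moreover have "J - p \<in> Per"
    proof -
      have "\<Phi> (z + \<i> * of_real (J - p)) = \<Phi> z" if z: "z \<in> strip c d" for z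
      proof -
        have "\<Phi> (z + \<i> * of_real (J - p)) = \<Phi> (z + \<i> * of_real (J - p) + \<i> * of_real p)"
        proof -
          have zs: "z + \<i> * of_real (J - p) \<in> strip c d" by (simp only: strip_shift z)
          have "\<forall>z\<in>strip c d. \<Phi> (z + \<i> * of_real p) = \<Phi> z" using p by (simp add: Per_def)
          from bspec[OF this zs] show ?thesis by (rule sym)
        qed
        also have "z + \<i> * of_real (J - p) + \<i> * of_real p = z + \<i> * of_real J" by (simp add: algebra_simps)
        also have "\<Phi> \<dots> = \<Phi> z" using J(1) z by (auto simp: Per_def)
        finally show ?thesis .
      qed
      then show ?thesis using \<open>p < J\<close> by (auto simp: Per_def)
    qed
    ultimately show False using ge[of "J - p"] J(2) by simp
  qed
  have noper: False if z: "z \<in> strip c d" and y: "0 < y" "y < J" "\<Phi> (z + \<i> * of_real y) = \<Phi> z" for z y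
  proof -
    have "\<Phi> (w + \<i> * of_real y) = \<Phi> w" if "w \<in> strip c d" for w
      using lift_cong_strip[OF L z, of y 0 w] y that by simp
    then have "y \<in> Per" using y by (auto simp: Per_def)
    then show False using min y by blast
  qed
  show ?thesis
  proof
    show "J > 0" "\<And>z. z \<in> strip c d \<Longrightarrow> \<Phi> (z + \<i> * of_real J) = \<Phi> z" using J(1) by (auto simp: Per_def)
    fix z w assume zw: "z \<in> strip c d" "w \<in> strip c d" "0 \<le> Im z" "Im z < J" "0 \<le> Im w" "Im w < J" "\<Phi> z = \<Phi> w"
    have Re: "Re z = Re w" using lift_Re[OF L] zw by metis
    show "z = w"
    proof (cases "Im z" "Im w" rule: linorder_cases)
      case less
      have "w = z + \<i> * of_real (Im w - Im z)" using Re by (simp add: complex_eq_iff)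
      then show ?thesis using noper[OF zw(1), of "Im w - Im z"] less zw by simp
    next
      case equal then show ?thesis using Re by (simp add: complex_eq_iff)
    next
      case greater
      have "z = w + \<i> * of_real (Im z - Im w)" using Re by (simp add: complex_eq_iff)
      then show ?thesis using noper[OF zw(2), of "Im z - Im w"] greater zw by simp
    qed
  qed
qed

text \<open>A local lift is defined on a whole ball, and its real part is the height.\<close>

lemma range_open:
  assumes "m \<in> R"
  shows "\<exists>x\<in>R. f x < f m" and "\<exists>x\<in>R. f x > f m"
proof -
  obtain e \<Phi> where e: "e > 0" "lift (ball (of_real (f m)) e) \<Phi>"
    by (rule lift_local[OF assms Re_complex_of_real])
  have 1: "of_real (f m) - of_real (e / 2) \<in> ball (complex_of_real (f m)) e" "of_real (f m) + of_real (e / 2) \<in> ball (complex_of_real (f m)) e"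
    using e(1) by (simp_all only: mem_ball dist_norm) (simp_all add: norm_divide)
  show "\<exists>x\<in>R. f x < f m" using lift_Re[OF e(2) 1(1)] liftD(3)[OF e(2) 1(1)] e(1) by (intro bexI) auto
  show "\<exists>x\<in>R. f x > f m" using lift_Re[OF e(2) 1(2)] liftD(3)[OF e(2) 1(2)] e(1) by (intro bexI) auto
qed

text \<open>A path from a lifted point to \<open>q\<close> may leave the slab, so a larger strip
  over all its heights is lifted, and the points of the path in the image form an open and closed
  subset. As \<open>q\<close> has height between \<open>c\<close> and \<open>d\<close>, it already
  comes from the smaller strip, where both lifts agree.\<close>

lemma lift_surj:
  assumes c: "c \<in> f ` R" and d: "d \<in> f ` R" and L: "lift (strip c d) \<Phi>" and \<tau>: "c < \<tau>" "\<tau> < d"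
    and q: "q \<in> R" "c < f q" "f q < d"
  shows "q \<in> \<Phi> ` strip c d"
proof -
  have \<tau>s: "of_real \<tau> \<in> strip c d" using \<tau> by (simp add: strip_def)
  define m where "m = \<Phi> (of_real \<tau>)"
  have m: "m \<in> R" "f m = \<tau>" using liftD(3)[OF L \<tau>s] lift_Re[OF L \<tau>s] by (auto simp: m_def)
  have "path_connected R" using connected_open_path_connected[OF open_R conn_R] .
  then obtain \<gamma> where \<gamma>: "path \<gamma>" "path_image \<gamma> \<subseteq> R" "pathstart \<gamma> = m" "pathfinish \<gamma> = q"
    using m(1) q(1) unfolding path_connected_def by metis
  define P where "P = path_image \<gamma>"
  have P: "connected P" "compact P" "m \<in> P" "q \<in> P" "P \<subseteq> R"
    using \<gamma> connected_path_image compact_path_image pathstart_in_path_image pathfinish_in_path_image by (auto simp: P_def)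
  have cf: "continuous_on P f" using contf P(5) continuous_on_subset by blast
  obtain a where a: "a \<in> P" "\<And>x. x \<in> P \<Longrightarrow> f a \<le> f x" using continuous_attains_inf[OF P(2) _ cf] P(3) by blast
  obtain b where b: "b \<in> P" "\<And>x. x \<in> P \<Longrightarrow> f x \<le> f b" using continuous_attains_sup[OF P(2) _ cf] P(3) by blast
  obtain a' where a': "a' \<in> R" "f a' < f a" using range_open(1) a(1) P(5) by blast
  obtain b' where b': "b' \<in> R" "f b' > f b" using range_open(2) b(1) P(5) by blast
  define c' where "c' = min c (f a')"
  define d' where "d' = max d (f b')"
  have cd': "c' \<in> f ` R" "d' \<in> f ` R" "c' \<le> c" "d \<le> d'" using c d a' b' by (auto simp: c'_def d'_def min_def max_def)
  have PS: "c' < f x" "f x < d'" if "x \<in> P" for x using a(2)[OF that] b(2)[OF that] a' b' by (auto simp: c'_def d'_def)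
  obtain \<Phi>' where L': "lift (strip c' d') \<Phi>'" "\<Phi>' (of_real (f m)) = m"
    by (rule strip_lift[OF cd'(1,2) m(1) PS(1)[OF P(3)] PS(2)[OF P(3)]])
  have sub: "strip c d \<subseteq> strip c' d'" using cd' by (auto simp: strip_def)
  have eq: "\<Phi>' z = \<Phi> z" if "z \<in> strip c d" for z
    by (rule lift_unique[OF L'(1) L strip(3,1) sub order_refl \<tau>s _ that]) (use L'(2) m m_def in simp)
  let ?T = "P \<inter> \<Phi>' ` strip c' d'"
  have "open (\<Phi>' ` strip c' d')" by (rule lift_open_image[OF L'(1) strip(1)]) simp
  then have "openin (top_of_set P) ?T" by (rule openin_open_Int)
  moreover have "closedin (top_of_set P) ?T"
  proof -
    have "x \<in> \<Phi>' ` strip c' d'" if x: "x \<in> P" "x \<in> closure ?T" for x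
    proof -
      have xR: "x \<in> R" using x P by auto
      obtain e F where e: "e > 0" "lift (ball (of_real (f x)) e) F" "F (of_real (f x)) = x"
        by (rule lift_local[OF xR Re_complex_of_real])
      let ?B = "ball (complex_of_real (f x)) e \<inter> strip c' d'"
      have xs: "of_real (f x) \<in> strip c' d'" using PS[OF x(1)] by (simp add: strip_def)
      have xB: "of_real (f x) \<in> ?B" using e(1) xs by simp
      have oB: "open ?B" using strip(1) by auto
      have "open (F ` ?B)" by (rule lift_open_image[OF e(2) oB]) simp
      moreover have "x \<in> F ` ?B" using e(3) xB by force
      ultimately obtain t where "t \<in> ?T" "t \<in> F ` ?B"
        using x(2) by (meson closure_iff_nhds_not_empty disjoint_iff order_refl)
      then obtain z w where zw: "z \<in> strip c' d'" "w \<in> ?B" "\<Phi>' z = F w" by auto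
      have "Re z = Re w" using lift_Re[OF L'(1) zw(1)] lift_Re[OF e(2), of w] zw by auto
      then have z: "z = w + \<i> * of_real (Im z - Im w)" by (simp add: complex_eq_iff)
      \<comment> \<open>Near a limit point the lift and a local lift share a value; after a vertical
        shift they agree on the convex intersection, which contains the parameter of the limit
        point.\<close>
      have "\<Phi>' (of_real (f x) + \<i> * of_real (Im z - Im w)) = F (of_real (f x))"
        by (rule lift_unique[OF lift_shift[OF L'(1)] e(2), of ?B w])
          (use zw z xB oB in \<open>auto intro!: convex_connected convex_Int strip\<close>)
      then have "x = \<Phi>' (of_real (f x) + \<i> * of_real (Im z - Im w))" using e(3) by simp
      then show ?thesis using xs strip_shift by blast
    qed
    then have "?T = P \<inter> closure ?T" using closure_subset[of ?T] by blast
    then show ?thesis by (metis closed_closure closedin_closed_Int)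
  qed
  moreover have "m \<in> ?T"
  proof -
    have "of_real (f m) \<in> strip c' d'" using PS[OF P(3)] by (simp add: strip_def)
    then show ?thesis using L'(2) P(3) by force
  qed
  ultimately have "?T = P" using P(1) unfolding connected_clopen by blast
  then obtain z where z: "z \<in> strip c' d'" "q = \<Phi>' z" using P(4) by blast
  have "Re z = f q" using lift_Re[OF L'(1) z(1)] z(2) by simp
  then have "z \<in> strip c d" using q by (simp add: strip_def)
  then show ?thesis using eq z(2) by auto
qed

end

section \<open>One-dimensional Hausdorff measure\<close>

text \<open>The content at scale \<open>\<delta>\<close>, separated from the supremum so that covers
  of bounded size can be manipulated.\<close>

definition hausdorff1_pre :: "'a set \<Rightarrow> ('a \<Rightarrow> 'a \<Rightarrow> ennreal) \<Rightarrow> real \<Rightarrow> 'a set \<Rightarrow> ennreal" where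
  "hausdorff1_pre X d \<delta> S = (INF C \<in> {C :: nat \<Rightarrow> 'a set. (\<forall>i. C i \<subseteq> X) \<and> S \<subseteq> (\<Union>i. C i) \<and>
          (\<forall>i. dist_diameter d (C i) \<le> ennreal \<delta>)}. \<Sum>i. dist_diameter d (C i))"

lemma hausdorff1_outer_pre: "hausdorff1_outer X d S = (SUP \<delta>\<in>{0<..}. hausdorff1_pre X d \<delta> S)"
  by (simp add: hausdorff1_outer_def hausdorff1_pre_def)

lemma pre_le_outer: "\<delta> > 0 \<Longrightarrow> hausdorff1_pre X d \<delta> S \<le> hausdorff1_outer X d S"
  unfolding hausdorff1_outer_pre by (rule SUP_upper) simp

lemma dist_diameter_empty [simp]: "dist_diameter d {} = 0"
  by (simp add: dist_diameter_def bot_ennreal)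

lemma dist_diameter_upper: "x \<in> C \<Longrightarrow> y \<in> C \<Longrightarrow> d x y \<le> dist_diameter d C"
  unfolding dist_diameter_def by (meson SUP_upper2 order_refl)

lemma dist_diameter_least: "(\<And>x y. x \<in> C \<Longrightarrow> y \<in> C \<Longrightarrow> d x y \<le> b) \<Longrightarrow> dist_diameter d C \<le> b"
  unfolding dist_diameter_def by (meson SUP_least)

lemma pre_upper:
  assumes "\<And>i. C i \<subseteq> X" "S \<subseteq> (\<Union>i. C i)" "\<And>i. dist_diameter d (C i) \<le> ennreal \<delta>"
  shows "hausdorff1_pre X d \<delta> S \<le> (\<Sum>i. dist_diameter d (C i))"
  unfolding hausdorff1_pre_def by (rule INF_lower) (use assms in auto)

lemma pre_greatest:
  assumes "\<And>C :: nat \<Rightarrow> 'a set. (\<And>i. C i \<subseteq> X) \<Longrightarrow> S \<subseteq> (\<Union>i. C i) \<Longrightarrow> (\<And>i. dist_diameter d (C i) \<le> ennreal \<delta>) \<Longrightarrow>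
    b \<le> (\<Sum>i. dist_diameter d (C i))"
  shows "b \<le> hausdorff1_pre X d \<delta> S"
  unfolding hausdorff1_pre_def by (rule INF_greatest) (use assms in auto)

lemma pre_antimono:
  assumes "\<delta> \<le> \<delta>'" shows "hausdorff1_pre X d \<delta>' S \<le> hausdorff1_pre X d \<delta> S"
  by (rule pre_greatest, rule pre_upper) (auto intro: order_trans[OF _ ennreal_leI[OF assms]])

lemma pre_lessD:
  assumes "hausdorff1_pre X d \<delta> S < b"
  shows "\<exists>C :: nat \<Rightarrow> 'a set. (\<forall>i. C i \<subseteq> X) \<and> S \<subseteq> (\<Union>i. C i) \<and>
    (\<forall>i. dist_diameter d (C i) \<le> ennreal \<delta>) \<and> (\<Sum>i. dist_diameter d (C i)) < b"
  using assms by (auto simp: hausdorff1_pre_def INF_less_iff)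

lemma pre_mono:
  assumes "S \<subseteq> T" shows "hausdorff1_pre X d \<delta> S \<le> hausdorff1_pre X d \<delta> T"
  by (rule pre_greatest, rule pre_upper) (use assms in auto)

lemma outer_mono: "S \<subseteq> T \<Longrightarrow> hausdorff1_outer X d S \<le> hausdorff1_outer X d T"
  unfolding hausdorff1_outer_pre by (intro SUP_mono') (auto intro: pre_mono)

text \<open>A monotone sequence of scales allows suprema to be added.\<close>

lemma outer_eq_SUP_nat: "hausdorff1_outer X d S = (SUP n. hausdorff1_pre X d (1 / real (Suc n)) S)"
proof (rule antisym)
  show "hausdorff1_outer X d S \<le> (SUP n. hausdorff1_pre X d (1 / real (Suc n)) S)"
    unfolding hausdorff1_outer_pre
  proof (rule SUP_least)
    fix \<delta> :: real assume "\<delta> \<in> {0<..}"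
    then obtain n where "1 / real (Suc n) < \<delta>" using nat_approx_posE by auto
    then show "hausdorff1_pre X d \<delta> S \<le> (SUP n. hausdorff1_pre X d (1 / real (Suc n)) S)"
      by (intro SUP_upper2[of n] pre_antimono) auto
  qed
qed (auto intro!: SUP_least pre_le_outer)

lemma incseq_pre: "incseq (\<lambda>n. hausdorff1_pre X d (1 / real (Suc n)) S)"
  by (intro incseq_SucI pre_antimono) (simp add: frac_le)

text \<open>Covers of the \<open>A i\<close> that are optimal up to e/2^(i+1) are merged into one
  sequence by the pairing function.\<close>

lemma pre_countably_subadditive:
  "hausdorff1_pre X d \<delta> (\<Union>i::nat. A i) \<le> (\<Sum>i. hausdorff1_pre X d \<delta> (A i))"
proof (cases "(\<Sum>i. hausdorff1_pre X d \<delta> (A i)) = \<infinity>")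
  case False
  have fin: "hausdorff1_pre X d \<delta> (A i) < \<infinity>" for i
  proof -
    have "hausdorff1_pre X d \<delta> (A i) \<le> (\<Sum>i. hausdorff1_pre X d \<delta> (A i))"
      using sum_le_suminf[of "\<lambda>i. hausdorff1_pre X d \<delta> (A i)" "{i}"] by simp
    then show ?thesis using False by (simp add: less_top order_le_less_trans)
  qed
  show ?thesis
  proof (rule ennreal_le_epsilon)
    fix e :: real assume e: "0 < e"
    have "\<exists>C. (\<forall>j::nat. C j \<subseteq> X) \<and> A i \<subseteq> (\<Union>j. C j) \<and> (\<forall>j. dist_diameter d (C j) \<le> ennreal \<delta>) \<and>
        (\<Sum>j. dist_diameter d (C j)) < hausdorff1_pre X d \<delta> (A i) + ennreal (e * (1/2) ^ Suc i)" for i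
    proof -
      have "hausdorff1_pre X d \<delta> (A i) < hausdorff1_pre X d \<delta> (A i) + ennreal (e * (1/2) ^ Suc i)"
        using fin[of i] e by (simp add: ennreal_add_left_cancel_less[of _ 0, simplified] less_top[symmetric])
      then show ?thesis by (rule pre_lessD)
    qed
    then obtain C where C: "\<And>i j::nat. C i j \<subseteq> X" "\<And>i. A i \<subseteq> (\<Union>j. C i j)" "\<And>i j. dist_diameter d (C i j) \<le> ennreal \<delta>"
        "\<And>i. (\<Sum>j. dist_diameter d (C i j)) < hausdorff1_pre X d \<delta> (A i) + ennreal (e * (1/2) ^ Suc i)"
      by metis
    define D where "D n = (case prod_decode n of (i, j) \<Rightarrow> C i j)" for n
    have "hausdorff1_pre X d \<delta> (\<Union>i. A i) \<le> (\<Sum>n. dist_diameter d (D n))"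
    proof (rule pre_upper)
      show "(\<Union>i. A i) \<subseteq> (\<Union>n. D n)"
      proof
        fix x assume "x \<in> (\<Union>i. A i)"
        then obtain i j where "x \<in> C i j" using C(2) by blast
        then have "x \<in> D (prod_encode (i, j))" by (simp add: D_def)
        then show "x \<in> (\<Union>n. D n)" by blast
      qed
    qed (use C in \<open>auto simp: D_def split: prod.split\<close>)
    also have "\<dots> = (\<Sum>n. (\<lambda>(i, j). dist_diameter d (C i j)) (prod_decode n))"
      unfolding D_def by (intro arg_cong[of _ _ suminf] ext) (simp split: prod.split)
    also have "\<dots> = (\<Sum>i. \<Sum>j. dist_diameter d (C i j))"
      by (rule suminf_ennreal_2dimen) simp
    also have "\<dots> \<le> (\<Sum>i. hausdorff1_pre X d \<delta> (A i) + ennreal (e * (1/2) ^ Suc i))"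
      by (intro suminf_le) (use C(4) in \<open>auto intro: less_imp_le\<close>)
    also have "\<dots> = (\<Sum>i. hausdorff1_pre X d \<delta> (A i)) + (\<Sum>i. ennreal (e * (1/2) ^ Suc i))"
      by (rule suminf_add[symmetric]) auto
    also have "(\<Sum>i. ennreal (e * (1/2) ^ Suc i)) = ennreal e"
      using sums_mult[OF power_half_series, of e] e by (intro suminf_ennreal_eq) auto
    finally show "hausdorff1_pre X d \<delta> (\<Union>i. A i) \<le> (\<Sum>i. hausdorff1_pre X d \<delta> (A i)) + ennreal e" .
  qed
qed simp

lemma outer_countably_subadditive:
  "hausdorff1_outer X d (\<Union>i::nat. A i) \<le> (\<Sum>i. hausdorff1_outer X d (A i))"
  unfolding hausdorff1_outer_pre[of X d "\<Union>i. A i"]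
  by (rule SUP_least, rule order_trans[OF pre_countably_subadditive], intro suminf_le) (auto intro: pre_le_outer)

lemma outer_empty [simp]: "hausdorff1_outer X d {} = 0"
proof -
  have "hausdorff1_pre X d \<delta> {} \<le> (\<Sum>i::nat. dist_diameter d {})" for \<delta>
    by (rule pre_upper) auto
  then show ?thesis unfolding hausdorff1_outer_pre by (auto intro!: antisym SUP_least)
qed

lemma outer_Un: "hausdorff1_outer X d (A \<union> B) \<le> hausdorff1_outer X d A + hausdorff1_outer X d B"
proof -
  have "hausdorff1_outer X d (\<Union>i. binaryset A B i) \<le> (\<Sum>i. hausdorff1_outer X d (binaryset A B i))"
    by (rule outer_countably_subadditive)
  also have "\<dots> = hausdorff1_outer X d A + hausdorff1_outer X d B"
    by (rule suminf_binaryset_eq) simp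
  finally show ?thesis by (simp add: UN_binaryset_eq)
qed

lemma outer_measure_space: "outer_measure_space (Pow X) (hausdorff1_outer X d)"
  unfolding outer_measure_space_def positive_def increasing_def countably_subadditive_def
  by (auto intro: outer_mono outer_countably_subadditive)

section \<open>Additivity on separated sets and measurability\<close>

text \<open>A covering set of diameter below \<open>\<eta>\<close> cannot meet both \<open>A\<close>
  and \<open>B\<close>, so every fine cover splits. Separation is measured by a function that is
  1-Lipschitz for \<open>d\<close>, because \<open>d\<close> is an arbitrary function with values in
  \<open>ennreal\<close>.\<close>

lemma outer_separated:
  fixes p :: "'a \<Rightarrow> real"
  assumes lip: "\<And>x y. x \<in> X \<Longrightarrow> y \<in> X \<Longrightarrow> ennreal \<bar>p x - p y\<bar> \<le> d x y"
    and \<eta>: "\<eta> > 0" "\<And>x y. x \<in> A \<Longrightarrow> y \<in> B \<Longrightarrow> \<bar>p x - p y\<bar> \<ge> \<eta>"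
  shows "hausdorff1_outer X d A + hausdorff1_outer X d B \<le> hausdorff1_outer X d (A \<union> B)"
proof -
  have key: "hausdorff1_pre X d \<delta> A + hausdorff1_pre X d \<delta> B \<le> hausdorff1_outer X d (A \<union> B)" if \<delta>: "0 < \<delta>" "\<delta> < \<eta>" for \<delta>
  proof (rule order_trans[OF pre_greatest pre_le_outer[OF \<delta>(1)]])
    fix C :: "nat \<Rightarrow> 'a set"
    assume C: "\<And>i. C i \<subseteq> X" "A \<union> B \<subseteq> (\<Union>i. C i)" "\<And>i. dist_diameter d (C i) \<le> ennreal \<delta>"
    define CA where "CA i = (if C i \<inter> A \<noteq> {} then C i else {})" for i
    define CB where "CB i = (if C i \<inter> A = {} then C i else {})" for i
    have noAB: "C i \<inter> B = {}" if CA: "C i \<inter> A \<noteq> {}" for i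
    proof (rule ccontr)
      assume "C i \<inter> B \<noteq> {}"
      then obtain x y where xy: "x \<in> C i" "x \<in> A" "y \<in> C i" "y \<in> B" using CA by blast
      have "ennreal \<eta> \<le> ennreal \<bar>p x - p y\<bar>" using \<eta>(2) xy by (intro ennreal_leI) auto
      also have "\<dots> \<le> d x y" using lip C(1) xy by blast
      also have "\<dots> \<le> ennreal \<delta>" using dist_diameter_upper[of x "C i" y d] xy C(3)[of i] by (meson order_trans)
      finally show False using \<delta> \<eta>(1) by simp
    qed
    have "hausdorff1_pre X d \<delta> A \<le> (\<Sum>i. dist_diameter d (CA i))"
    proof (rule pre_upper)
      show "A \<subseteq> (\<Union>i. CA i)"
      proof
        fix x assume x: "x \<in> A"
        then obtain i where "x \<in> C i" using C(2) by blast
        then have "x \<in> CA i" using x by (auto simp: CA_def)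
        then show "x \<in> (\<Union>i. CA i)" by blast
      qed
    qed (use C in \<open>auto simp: CA_def\<close>)
    moreover have "hausdorff1_pre X d \<delta> B \<le> (\<Sum>i. dist_diameter d (CB i))"
    proof (rule pre_upper)
      show "B \<subseteq> (\<Union>i. CB i)"
      proof
        fix x assume x: "x \<in> B"
        then obtain i where i: "x \<in> C i" using C(2) by blast
        then have "C i \<inter> A = {}" using noAB[of i] x by blast
        then have "x \<in> CB i" using i by (simp add: CB_def)
        then show "x \<in> (\<Union>i. CB i)" by blast
      qed
    qed (use C in \<open>auto simp: CB_def\<close>)
    ultimately have "hausdorff1_pre X d \<delta> A + hausdorff1_pre X d \<delta> B \<le> (\<Sum>i. dist_diameter d (CA i)) + (\<Sum>i. dist_diameter d (CB i))"
      by (rule add_mono)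
    also have "\<dots> = (\<Sum>i. dist_diameter d (CA i) + dist_diameter d (CB i))" by (rule suminf_add) auto
    also have "\<dots> = (\<Sum>i. dist_diameter d (C i))" by (rule arg_cong[of _ _ suminf]) (auto simp: CA_def CB_def)
    finally show "hausdorff1_pre X d \<delta> A + hausdorff1_pre X d \<delta> B \<le> (\<Sum>i. dist_diameter d (C i))" .
  qed
  have "hausdorff1_outer X d A + hausdorff1_outer X d B =
      (SUP n. hausdorff1_pre X d (1 / real (Suc n)) A + hausdorff1_pre X d (1 / real (Suc n)) B)"
    unfolding outer_eq_SUP_nat by (rule ennreal_SUP_add[symmetric]) (rule incseq_pre)+
  also have "\<dots> \<le> hausdorff1_outer X d (A \<union> B)"
  proof (rule SUP_least)
    fix n
    obtain k where k: "1 / real (Suc k) < \<eta>" using nat_approx_posE[OF \<eta>(1)] by blast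
    let ?\<delta> = "1 / real (Suc (max n k))"
    have "?\<delta> \<le> 1 / real (Suc k)" by (intro divide_left_mono) auto
    then have "?\<delta> < \<eta>" using k by linarith
    moreover have "?\<delta> \<le> 1 / real (Suc n)" by (intro divide_left_mono) auto
    ultimately show "hausdorff1_pre X d (1 / real (Suc n)) A + hausdorff1_pre X d (1 / real (Suc n)) B \<le> hausdorff1_outer X d (A \<union> B)"
      by (intro order_trans[OF add_mono[OF pre_antimono pre_antimono] key]) auto
  qed
  finally show ?thesis .
qed

text \<open>Adding the first \<open>n\<close> terms to both sides completes the tail to the full
  sum; in the limit this finite sum cancels.\<close>

lemma tail_cancel_ennreal:
  fixes g :: "nat \<Rightarrow> ennreal"
  assumes fin: "(\<Sum>k. g k) < \<infinity>" and le: "\<And>n. a \<le> b + (\<Sum>k. g (k + n))"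
  shows "a \<le> b"
proof -
  have *: "a + sum g {..<n} \<le> b + (\<Sum>k. g k)" for n
  proof -
    have "(\<Sum>k. g k) = (\<Sum>k. g (k + n)) + sum g {..<n}" 
      by (subst suminf_offset[of g n]) (simp_all add: add.commute)
    then show ?thesis using le[of n] by (simp add: add.assoc[symmetric] add_right_mono)
  qed
  have "(\<lambda>n. a + sum g {..<n}) \<longlonglongrightarrow> a + (\<Sum>k. g k)"
    by (intro tendsto_add tendsto_const summable_LIMSEQ) auto
  then have "a + (\<Sum>k. g k) \<le> b + (\<Sum>k. g k)" by (rule LIMSEQ_le_const2) (use * in blast)
  then have "(\<Sum>k. g k) + a \<le> (\<Sum>k. g k) + b" by (simp only: add.commute)
  then show ?thesis using fin by (auto simp: ennreal_add_left_cancel_le)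
qed

lemma outer_separated_sum:
  fixes p :: "'a \<Rightarrow> real" and B :: "nat \<Rightarrow> 'a set"
  assumes lip: "\<And>x y. x \<in> X \<Longrightarrow> y \<in> X \<Longrightarrow> ennreal \<bar>p x - p y\<bar> \<le> d x y"
    and sep: "\<And>n. \<exists>\<eta>>0. \<forall>k<n. \<forall>x\<in>B k. \<forall>y\<in>B n. \<bar>p x - p y\<bar> \<ge> \<eta>"
    and sub: "\<And>n. B n \<subseteq> A"
  shows "(\<Sum>n. hausdorff1_outer X d (B n)) \<le> hausdorff1_outer X d A"
proof -
  have *: "(\<Sum>k<n. hausdorff1_outer X d (B k)) \<le> hausdorff1_outer X d (\<Union>k<n. B k)" for n
  proof (induction n)
    case (Suc n)
    obtain \<eta> where \<eta>: "\<eta> > 0" "\<And>k x y. k < n \<Longrightarrow> x \<in> B k \<Longrightarrow> y \<in> B n \<Longrightarrow> \<bar>p x - p y\<bar> \<ge> \<eta>"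
      using sep[of n] by blast
    have "(\<Sum>k<Suc n. hausdorff1_outer X d (B k)) \<le> hausdorff1_outer X d (\<Union>k<n. B k) + hausdorff1_outer X d (B n)"
      using Suc by (simp add: add_right_mono)
    also have "\<dots> \<le> hausdorff1_outer X d ((\<Union>k<n. B k) \<union> B n)"
      by (rule outer_separated[OF lip \<eta>(1)]) (use \<eta>(2) in auto)
    also have "(\<Union>k<n. B k) \<union> B n = (\<Union>k<Suc n. B k)" by (auto simp: less_Suc_eq)
    finally show ?case .
  qed simp
  show ?thesis
    by (rule suminf_le_const) (use * sub in \<open>auto intro: order_trans[OF _ outer_mono]\<close>)
qed

text \<open>Caratheodory's criterion for metric outer measures.\<close>

lemma lipschitz_sublevel_measurable:
  fixes p :: "'a \<Rightarrow> real"
  assumes lip: "\<And>x y. x \<in> X \<Longrightarrow> y \<in> X \<Longrightarrow> ennreal \<bar>p x - p y\<bar> \<le> d x y"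
  shows "{x \<in> X. p x \<le> c} \<in> lambda_system X (Pow X) (hausdorff1_outer X d)"
proof -
  interpret algebra X "Pow X" by (rule algebra_Pow)
  let ?\<mu> = "hausdorff1_outer X d"
  let ?E = "{x \<in> X. p x \<le> c}"
  have "?\<mu> (A \<inter> ?E) + ?\<mu> (A - ?E) = ?\<mu> A" if A: "A \<subseteq> X" for A
  proof (rule antisym)
    show "?\<mu> A \<le> ?\<mu> (A \<inter> ?E) + ?\<mu> (A - ?E)"
      using outer_Un[of X d "A \<inter> ?E" "A - ?E"] by (simp add: Int_Diff_Un)
    show "?\<mu> (A \<inter> ?E) + ?\<mu> (A - ?E) \<le> ?\<mu> A"
    proof (cases "?\<mu> A = \<infinity>")
      case False
      \<comment> \<open>Shells of the part of \<open>A\<close> above the level \<open>c\<close>,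
        approaching it as \<open>k\<close> grows.\<close>
      define B where "B k = {x \<in> A. c + 1 / real (k + 2) \<le> p x \<and> p x < c + 1 / real (k + 1)}" for k
      define An where "An n = {x \<in> A. c + 1 / real (n + 1) \<le> p x}" for n
      \<comment> \<open>Neighbouring shells may touch, while shells of equal parity have a gap; so
        even and odd indices are summed separately.\<close>
      have sepB: "\<exists>\<eta>>0. \<forall>k<n. \<forall>x\<in>B (2 * k + i). \<forall>y\<in>B (2 * n + i). \<bar>p x - p y\<bar> \<ge> \<eta>" for n i
      proof (cases n)
        case (Suc m)
        let ?j = "2 * n + i"
        show ?thesis
        proof (intro exI conjI allI impI ballI)
          have "1 / real (?j + 1) < 1 / real ?j" by (rule divide_strict_left_mono) (use Suc in auto)
          then show "0 < 1 / real ?j - 1 / real (?j + 1)" by simp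
          fix k x y assume k: "k < n" "x \<in> B (2 * k + i)" "y \<in> B ?j"
          have "1 / real ?j \<le> 1 / real (2 * k + i + 2)" using k(1) by (intro divide_left_mono) auto
          then show "\<bar>p x - p y\<bar> \<ge> 1 / real ?j - 1 / real (?j + 1)"
            using k by (auto simp: B_def)
        qed
      qed (auto intro: exI[of _ 1])
      have BA: "B k \<subseteq> A" for k by (auto simp: B_def)
      have half: "(\<Sum>n. ?\<mu> (B (2 * n + i))) \<le> ?\<mu> A" for i
        by (rule outer_separated_sum[OF lip sepB BA])
      have even: "(\<Sum>n. ?\<mu> (B (2 * n))) \<le> ?\<mu> A" and odd: "(\<Sum>n. ?\<mu> (B (2 * n + 1))) \<le> ?\<mu> A"
        using half[of 0] half[of 1] by simp_all
      have "(\<Sum>k. ?\<mu> (B k)) \<le> (\<Sum>n. ?\<mu> (B (2 * n))) + (\<Sum>n. ?\<mu> (B (2 * n + 1)))"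
      proof (rule suminf_le_const)
        fix N
        have "(\<Sum>k<N. ?\<mu> (B k)) \<le> (\<Sum>k<2*N. ?\<mu> (B k))" by (rule sum_mono2) auto
        also have "\<dots> = (\<Sum>n<N. ?\<mu> (B (2 * n))) + (\<Sum>n<N. ?\<mu> (B (2 * n + 1)))"
          by (induction N) (auto simp: algebra_simps)
        also have "\<dots> \<le> (\<Sum>n. ?\<mu> (B (2 * n))) + (\<Sum>n. ?\<mu> (B (2 * n + 1)))"
          by (intro add_mono sum_le_suminf) auto
        finally show "(\<Sum>k<N. ?\<mu> (B k)) \<le> (\<Sum>n. ?\<mu> (B (2 * n))) + (\<Sum>n. ?\<mu> (B (2 * n + 1)))" .
      qed simp
      also have "\<dots> \<le> ?\<mu> A + ?\<mu> A" by (rule add_mono[OF even odd])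
      also have "\<dots> < \<infinity>" using False by (simp add: less_top)
      finally have fin: "(\<Sum>k. ?\<mu> (B k)) < \<infinity>" .
      show ?thesis
      proof (rule tail_cancel_ennreal[OF fin])
        fix n
        \<comment> \<open>What lies above \<open>c\<close> is a part at least 1/(n+1) above it,
          which is separated from the sublevel set, together with the shells from index
          \<open>n\<close> on, whose measures form the tail of a convergent series.\<close>
        have "A - ?E \<subseteq> An n \<union> (\<Union>k. B (k + n))"
        proof
          fix x assume x: "x \<in> A - ?E"
          show "x \<in> An n \<union> (\<Union>k. B (k + n))"
          proof (cases "c + 1 / real (n + 1) \<le> p x")
            case False
            have pos: "p x - c > 0" using x A by auto
            then obtain j where "1 / real (Suc j) < p x - c" using nat_approx_posE by blast
            then have j: "c + 1 / real (j + 1) \<le> p x" by simp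
            define k where "k = (LEAST j. c + 1 / real (j + 1) \<le> p x)"
            have k: "c + 1 / real (k + 1) \<le> p x" unfolding k_def by (rule LeastI[of _ j]) (rule j)
            have kn: "n < k"
            proof (rule ccontr)
              assume "\<not> n < k"
              then have "1 / real (n + 1) \<le> 1 / real (k + 1)" by (intro divide_left_mono) auto
              then show False using k False by linarith
            qed
            have "\<not> c + 1 / real ((k - 1) + 1) \<le> p x"
              using not_less_Least[of "k - 1" "\<lambda>j. c + 1 / real (j + 1) \<le> p x"] kn by (simp add: k_def)
            then have "x \<in> B ((k - 1 - n) + n)" using k kn x by (auto simp: B_def)
            then show ?thesis by blast
          qed (use x in \<open>auto simp: An_def\<close>)
        qed
        then have "?\<mu> (A - ?E) \<le> ?\<mu> (An n \<union> (\<Union>k. B (k + n)))" by (rule outer_mono)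
        also have "\<dots> \<le> ?\<mu> (An n) + ?\<mu> (\<Union>k. B (k + n))" by (rule outer_Un)
        also have "\<dots> \<le> ?\<mu> (An n) + (\<Sum>k. ?\<mu> (B (k + n)))" by (intro add_left_mono outer_countably_subadditive)
        finally have "?\<mu> (A \<inter> ?E) + ?\<mu> (A - ?E) \<le> (?\<mu> (A \<inter> ?E) + ?\<mu> (An n)) + (\<Sum>k. ?\<mu> (B (k + n)))"
          by (simp add: add.assoc add_left_mono)
        also have "?\<mu> (A \<inter> ?E) + ?\<mu> (An n) \<le> ?\<mu> ((A \<inter> ?E) \<union> An n)"
          by (rule outer_separated[OF lip, where \<eta> = "1 / real (n + 1)"]) (auto simp: An_def)
        also have "\<dots> \<le> ?\<mu> A" by (rule outer_mono) (auto simp: An_def)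
        finally show "?\<mu> (A \<inter> ?E) + ?\<mu> (A - ?E) \<le> ?\<mu> A + (\<Sum>k. ?\<mu> (B (k + n)))" by (simp add: add_right_mono)
      qed
    qed simp
  qed
  then show ?thesis unfolding lambda_system_eq by auto
qed

lemma hausdorff1_measure_space:
  "measure_space X (lambda_system X (Pow X) (hausdorff1_outer X d)) (hausdorff1_outer X d)"
  by (rule sigma_algebra.caratheodory_lemma[OF sigma_algebra_Pow outer_measure_space])

lemma space_hausdorff1 [simp]: "space (hausdorff1 X d) = X"
  by (simp add: hausdorff1_def space_measure_of_conv)

lemma sets_hausdorff1: "sets (hausdorff1 X d) = lambda_system X (Pow X) (hausdorff1_outer X d)"
proof -
  have "sigma_algebra X (lambda_system X (Pow X) (hausdorff1_outer X d))"
    using hausdorff1_measure_space by (auto simp: measure_space_def)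
  then show ?thesis unfolding hausdorff1_def by (rule sigma_algebra.sets_measure_of_eq)
qed

lemma emeasure_hausdorff1: "A \<in> sets (hausdorff1 X d) \<Longrightarrow> emeasure (hausdorff1 X d) A = hausdorff1_outer X d A"
proof -
  assume A: "A \<in> sets (hausdorff1 X d)"
  have m: "positive (lambda_system X (Pow X) (hausdorff1_outer X d)) (hausdorff1_outer X d)"
      "countably_additive (lambda_system X (Pow X) (hausdorff1_outer X d)) (hausdorff1_outer X d)"
    using hausdorff1_measure_space[of X d] by (auto simp: measure_space_def)
  show ?thesis
    by (rule emeasure_measure_of[OF hausdorff1_def[of X d]])
      (use A m in \<open>auto simp: sets_hausdorff1 dest: lambda_system_sets\<close>)
qed

lemma lipschitz_measurable:
  fixes p :: "'a \<Rightarrow> real"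
  assumes "\<And>x y. x \<in> X \<Longrightarrow> y \<in> X \<Longrightarrow> ennreal \<bar>p x - p y\<bar> \<le> d x y"
  shows "p \<in> borel_measurable (hausdorff1 X d)"
proof -
  have "{x \<in> X. p x \<le> c} \<in> sets (hausdorff1 X d)" for c
    unfolding sets_hausdorff1 by (rule lipschitz_sublevel_measurable) (rule assms)
  then show ?thesis unfolding borel_measurable_iff_le by simp
qed

section \<open>Upper and lower length bounds\<close>

text \<open>The parameter interval is cut into equal pieces, so short that by the Lipschitz bound
  \<open>K\<close> each image has diameter at most \<open>\<delta>\<close>; the bounds for the
  diameters telescope.\<close>

lemma outer_curve_upper:
  fixes \<gamma> :: "real \<Rightarrow> 'a"
  assumes ab: "a \<le> b" and X: "\<gamma> ` {a..b} \<subseteq> X" and L: "\<And>s t. a \<le> s \<Longrightarrow> s \<le> t \<Longrightarrow> t \<le> b \<Longrightarrow> L s \<le> L t \<and> L t - L s \<le> K * (t - s)"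
    and d: "\<And>s t. s \<in> {a..b} \<Longrightarrow> t \<in> {a..b} \<Longrightarrow> d (\<gamma> s) (\<gamma> t) \<le> ennreal \<bar>L t - L s\<bar>"
  shows "hausdorff1_outer X d (\<gamma> ` {a..b}) \<le> ennreal (L b - L a)"
  unfolding hausdorff1_outer_pre
proof (rule SUP_least)
  fix \<delta> :: real assume "\<delta> \<in> {0<..}"
  then have \<delta>: "\<delta> > 0" by simp
  obtain n :: nat where n: "n > 0" "K * (b - a) / n \<le> \<delta>"
  proof -
    obtain n :: nat where "K * (b - a) / \<delta> < n" using reals_Archimedean2 by blast
    then have "K * (b - a) / real (Suc n) \<le> \<delta>" using \<delta> by (simp add: field_simps)
    then show ?thesis using that[of "Suc n"] by simp
  qed
  define g where "g i = a + real i * ((b - a) / n)" for i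
  have gm: "g i \<le> g j" if "i \<le> j" for i j
    unfolding g_def using that ab by (intro add_left_mono mult_right_mono) auto
  have g0: "g 0 = a" "g n = b" using n by (simp_all add: g_def)
  define C where "C i = (if i < n then \<gamma> ` {g i..g (Suc i)} else {})" for i
  have gin: "g i \<in> {a..b}" if "i \<le> n" for i using gm[of 0 i] gm[of i n] that g0 by auto
  have diam: "dist_diameter d (C i) \<le> ennreal (L (g (Suc i)) - L (g i))" if i: "i < n" for i
  proof (rule dist_diameter_least)
    fix x y assume "x \<in> C i" "y \<in> C i"
    then obtain s t where st: "s \<in> {g i..g (Suc i)}" "t \<in> {g i..g (Suc i)}" "x = \<gamma> s" "y = \<gamma> t"
      using i by (auto simp: C_def)
    have ab': "a \<le> g i" "g (Suc i) \<le> b" using gin[of i] gin[of "Suc i"] i by auto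
    then have st': "s \<in> {a..b}" "t \<in> {a..b}" using st by auto
    have "L (g i) \<le> L s" "L s \<le> L (g (Suc i))" "L (g i) \<le> L t" "L t \<le> L (g (Suc i))"
      using L[of "g i" s] L[of s "g (Suc i)"] L[of "g i" t] L[of t "g (Suc i)"] st ab' by auto
    then have "\<bar>L t - L s\<bar> \<le> L (g (Suc i)) - L (g i)" by linarith
    then show "d x y \<le> ennreal (L (g (Suc i)) - L (g i))"
      using d[OF st'] st by (auto intro: order_trans[OF _ ennreal_leI])
  qed
  have "hausdorff1_pre X d \<delta> (\<gamma> ` {a..b}) \<le> (\<Sum>i. dist_diameter d (C i))"
  proof (rule pre_upper)
    show "C i \<subseteq> X" for i
      using X gin[of i] gin[of "Suc i"] by (auto simp: C_def)
    show "\<gamma> ` {a..b} \<subseteq> (\<Union>i. C i)"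
    proof clarify
      fix t assume t: "t \<in> {a..b}"
      have "\<exists>i<n. t \<in> {g i..g (Suc i)}"
      proof (cases "t = b")
        case True
        then show ?thesis using n g0 gm[of "n - 1" n] by (intro exI[of _ "n - 1"]) auto
      next
        case False
        define i where "i = (LEAST i. t < g (Suc i))"
        have ex: "t < g (Suc (n - 1))" using False t n g0 by simp
        have i: "t < g (Suc i)" unfolding i_def by (rule LeastI) (rule ex)
        have "i \<le> n - 1" unfolding i_def by (rule Least_le) (rule ex)
        moreover have "g i \<le> t"
        proof (cases i)
          case 0 then show ?thesis using g0 t by simp
        next
          case (Suc k)
          then have "\<not> t < g (Suc k)" using not_less_Least[of k "\<lambda>i. t < g (Suc i)"] by (simp add: i_def)
          then show ?thesis using Suc by simp
        qed
        ultimately show ?thesis using i n by (intro exI[of _ i]) auto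
      qed
      then show "\<gamma> t \<in> (\<Union>i. C i)" by (auto simp: C_def)
    qed
    show "dist_diameter d (C i) \<le> ennreal \<delta>" for i
    proof (cases "i < n")
      case True
      have "L (g (Suc i)) - L (g i) \<le> K * (g (Suc i) - g i)"
        using L[of "g i" "g (Suc i)"] gin[of i] gin[of "Suc i"] gm[of i "Suc i"] True by auto
      also have "g (Suc i) - g i = (b - a) / n" by (simp add: g_def add_divide_distrib diff_divide_distrib distrib_right)
      also have "K * ((b - a) / n) = K * (b - a) / n" by simp
      also have "\<dots> \<le> \<delta>" by (rule n)
      finally show ?thesis using diam[OF True] by (auto intro: order_trans[OF _ ennreal_leI])
    qed (simp add: C_def)
  qed
  also have "\<dots> = (\<Sum>i<n. dist_diameter d (C i))" by (rule suminf_finite) (auto simp: C_def)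
  also have "\<dots> \<le> (\<Sum>i<n. ennreal (L (g (Suc i)) - L (g i)))" by (intro sum_mono diam) simp
  also have "\<dots> = ennreal (\<Sum>i<n. L (g (Suc i)) - L (g i))"
  proof (rule sum_ennreal)
    fix i assume "i \<in> {..<n}"
    then show "0 \<le> L (g (Suc i)) - L (g i)"
      using L[of "g i" "g (Suc i)"] gin[of i] gin[of "Suc i"] gm[of i "Suc i"] by auto
  qed
  also have "(\<Sum>i<n. L (g (Suc i)) - L (g i)) = L b - L a"
    using sum_lessThan_telescope[of "\<lambda>i. L (g i)" n] g0 by simp
  finally show "hausdorff1_pre X d \<delta> (\<gamma> ` {a..b}) \<le> ennreal (L b - L a)" .
qed

text \<open>The 1-Lipschitz \<open>p\<close> maps each covering set into an interval no longer than
  its diameter, and these intervals cover \<open>{\<alpha>..\<beta>}\<close>. The scale 1 makes the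
  diameters finite.\<close>

lemma outer_projection_lower:
  fixes p :: "'a \<Rightarrow> real"
  assumes lip: "\<And>x y. x \<in> X \<Longrightarrow> y \<in> X \<Longrightarrow> ennreal \<bar>p x - p y\<bar> \<le> d x y"
    and cover: "{\<alpha>..\<beta>} \<subseteq> p ` S"
  shows "ennreal (\<beta> - \<alpha>) \<le> hausdorff1_outer X d S"
proof (rule order_trans[OF pre_greatest pre_le_outer[of 1]])
  fix C :: "nat \<Rightarrow> 'a set"
  assume C: "\<And>i. C i \<subseteq> X" "S \<subseteq> (\<Union>i. C i)" "\<And>i. dist_diameter d (C i) \<le> ennreal 1"
  have "\<exists>I. I \<in> sets lborel \<and> p ` C i \<subseteq> I \<and> emeasure lborel I \<le> dist_diameter d (C i)" for i
  proof (cases "C i = {}")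
    case True then show ?thesis by (intro exI[of _ "{}"]) auto
  next
    case False
    have "dist_diameter d (C i) < \<infinity>" using C(3)[of i] by (auto intro: order_le_less_trans)
    then obtain D where D: "D \<ge> 0" "dist_diameter d (C i) = ennreal D" by (cases "dist_diameter d (C i)") auto
    have le: "\<bar>p x - p y\<bar> \<le> D" if "x \<in> C i" "y \<in> C i" for x y
    proof -
      have "ennreal \<bar>p x - p y\<bar> \<le> ennreal D"
        using lip[of x y] dist_diameter_upper[OF that, of d] C(1)[of i] that D(2) by (auto intro: order_trans)
      then show ?thesis using D(1) by (simp add: ennreal_le_iff)
    qed
    obtain x0 where x0: "x0 \<in> C i" using False by blast
    have bdd: "bdd_above (p ` C i)" "bdd_below (p ` C i)"
      using le[OF _ x0] by (auto intro!: bdd_aboveI2[of _ _ "p x0 + D"] bdd_belowI2[of _ "p x0 - D"] simp: abs_le_iff algebra_simps)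
    have "Sup (p ` C i) \<le> Inf (p ` C i) + D"
    proof (rule cSUP_least)
      fix x assume x: "x \<in> C i"
      have "p x - D \<le> Inf (p ` C i)"
        by (rule cINF_greatest) (use False le[OF x] in \<open>auto simp: abs_le_iff algebra_simps\<close>)
      then show "p x \<le> Inf (p ` C i) + D" by simp
    qed (rule False)
    moreover have "Inf (p ` C i) \<le> Sup (p ` C i)" by (rule cInf_le_cSup) (use False bdd in auto)
    ultimately have "emeasure lborel {Inf (p ` C i)..Sup (p ` C i)} \<le> dist_diameter d (C i)"
      by (simp add: D ennreal_leI)
    moreover have "p ` C i \<subseteq> {Inf (p ` C i)..Sup (p ` C i)}"
      using bdd by (auto intro: cINF_lower cSUP_upper)
    ultimately show ?thesis by (intro exI[of _ "{Inf (p ` C i)..Sup (p ` C i)}"]) auto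
  qed
  then obtain I where I: "\<And>i. I i \<in> sets lborel" "\<And>i. p ` C i \<subseteq> I i" "\<And>i. emeasure lborel (I i) \<le> dist_diameter d (C i)"
    by metis
  have "{\<alpha>..\<beta>} \<subseteq> (\<Union>i. I i)" 
  proof
    fix t assume "t \<in> {\<alpha>..\<beta>}"
    then obtain x where x: "x \<in> S" "t = p x" using cover by blast
    then obtain i where "x \<in> C i" using C(2) by blast
    then have "t \<in> I i" using I(2)[of i] x(2) by blast
    then show "t \<in> (\<Union>i. I i)" by blast
  qed
  then have "emeasure lborel {\<alpha>..\<beta>} \<le> emeasure lborel (\<Union>i. I i)" by (rule emeasure_mono) (use I in auto)
  also have "\<dots> \<le> (\<Sum>i. emeasure lborel (I i))" by (rule emeasure_subadditive_countably) (use I in auto)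
  also have "\<dots> \<le> (\<Sum>i. dist_diameter d (C i))" by (intro suminf_le I) auto
  finally show "ennreal (\<beta> - \<alpha>) \<le> (\<Sum>i. dist_diameter d (C i))"
    by (cases "\<alpha> \<le> \<beta>") (auto simp: ennreal_neg)
qed simp

section \<open>Integration over a closed curve\<close>

text \<open>The increments of \<open>\<phi>\<close> lie between the chords of \<open>U\<close> and
  the increments of \<open>\<Lambda>\<close>, and both bounds have the same first order
  term.\<close>

lemma squeeze_derivative:
  fixes \<phi> \<Lambda> :: "real \<Rightarrow> real" and U :: "real \<Rightarrow> 'b::real_normed_vector"
  assumes y: "y \<in> {a..b}" and U: "(U has_vector_derivative U') (at y)"
    and L: "(\<Lambda> has_vector_derivative norm U') (at y within {a..b})"
    and sq: "\<And>s t. a \<le> s \<Longrightarrow> s \<le> t \<Longrightarrow> t \<le> b \<Longrightarrow> norm (U t - U s) \<le> \<phi> t - \<phi> s \<and> \<phi> t - \<phi> s \<le> \<Lambda> t - \<Lambda> s"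
  shows "(\<phi> has_vector_derivative norm U') (at y within {a..b})"
  unfolding has_vector_derivative_def has_derivative_within_alt
proof (intro conjI allI impI)
  show "bounded_linear (\<lambda>x. x *\<^sub>R norm U')" by (rule bounded_linear_scaleR_left)
  fix e :: real assume e: "0 < e"
  have "(U has_derivative (\<lambda>x. x *\<^sub>R U')) (at y within {a..b})"
    using U has_derivative_at_withinI by (auto simp: has_vector_derivative_def)
  then obtain d1 where d1: "d1 > 0" "\<And>z. z \<in> {a..b} \<Longrightarrow> norm (z - y) < d1 \<Longrightarrow> norm (U z - U y - (z - y) *\<^sub>R U') \<le> e * norm (z - y)"
    using e unfolding has_derivative_within_alt by metis
  obtain d2 where d2: "d2 > 0" "\<And>z. z \<in> {a..b} \<Longrightarrow> norm (z - y) < d2 \<Longrightarrow> norm (\<Lambda> z - \<Lambda> y - (z - y) *\<^sub>R norm U') \<le> e * norm (z - y)"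
    using L e unfolding has_vector_derivative_def has_derivative_within_alt by metis
  have "norm (\<phi> z - \<phi> y - (z - y) *\<^sub>R norm U') \<le> e * norm (z - y)"
    if z: "z \<in> {a..b}" "norm (z - y) < min d1 d2" for z
  proof -
    have 1: "norm (U z - U y - (z - y) *\<^sub>R U') \<le> e * \<bar>z - y\<bar>" using d1(2)[OF z(1)] z(2) by simp
    have 2: "\<bar>\<Lambda> z - \<Lambda> y - (z - y) * norm U'\<bar> \<le> e * \<bar>z - y\<bar>" using d2(2)[OF z(1)] z(2) by simp
    have "\<bar>z - y\<bar> * norm U' \<le> norm (U z - U y) + norm (U z - U y - (z - y) *\<^sub>R U')"
      using norm_triangle_ineq4[of "U z - U y" "U z - U y - (z - y) *\<^sub>R U'"] by simp
    then have 3: "\<bar>z - y\<bar> * norm U' - e * \<bar>z - y\<bar> \<le> norm (U z - U y)" using 1 by linarith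
    show ?thesis
    proof (cases "y \<le> z")
      case True
      have "norm (U z - U y) \<le> \<phi> z - \<phi> y \<and> \<phi> z - \<phi> y \<le> \<Lambda> z - \<Lambda> y" using sq[of y z] True y z by auto
      then show ?thesis using 2 3 True by (auto simp: abs_le_iff)
    next
      case False
      have "norm (U y - U z) \<le> \<phi> y - \<phi> z \<and> \<phi> y - \<phi> z \<le> \<Lambda> y - \<Lambda> z" using sq[of z y] False y z by auto
      then show ?thesis using 2 3 False by (auto simp: abs_le_iff norm_minus_commute algebra_simps)
    qed
  qed
  then show "\<exists>d>0. \<forall>z\<in>{a..b}. norm (z - y) < d \<longrightarrow> norm (\<phi> z - \<phi> y - (z - y) *\<^sub>R norm U') \<le> e * norm (z - y)"
    using d1(1) d2(1) by (intro exI[of _ "min d1 d2"]) auto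
qed

text \<open>The measure of an arc lies between its chord and its length, so its derivative is the speed.\<close>

lemma closed_curve_integral:
  fixes N :: "'a measure" and \<gamma> :: "real \<Rightarrow> 'a" and U U' :: "real \<Rightarrow> 'b::real_normed_vector" and g :: "real \<Rightarrow> real"
  assumes J: "J > 0"
    and U: "\<And>y. (U has_vector_derivative U' y) (at y)" and cU': "continuous_on UNIV U'"
    and inj: "inj_on \<gamma> {0..<J}" and closed: "\<gamma> J = \<gamma> 0"
    and arcs: "\<And>a b. 0 \<le> a \<Longrightarrow> a \<le> b \<Longrightarrow> b \<le> J \<Longrightarrow> \<gamma> ` {a..b} \<in> sets N"
    and up: "\<And>a b. 0 \<le> a \<Longrightarrow> a \<le> b \<Longrightarrow> b \<le> J \<Longrightarrow>
        emeasure N (\<gamma> ` {a..b}) \<le> ennreal (integral {a..b} (\<lambda>t. norm (U' t)))"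
    and low: "\<And>a b. 0 \<le> a \<Longrightarrow> a \<le> b \<Longrightarrow> b \<le> J \<Longrightarrow> ennreal (norm (U b - U a)) \<le> emeasure N (\<gamma> ` {a..b})"
    and g: "continuous_on UNIV g" and F: "\<And>y. y \<in> {0..J} \<Longrightarrow> F (\<gamma> y) = g y"
  shows "(LINT m : \<gamma> ` {0..J} | N. F m) = integral {0..J} (\<lambda>y. norm (U' y) * g y)"
proof -
  define s where "s y = norm (U' y)" for y
  have cs: "continuous_on A s" for A unfolding s_def by (intro continuous_on_norm continuous_on_subset[OF cU']) simp
  have s0: "s y \<ge> 0" for y by (simp add: s_def)
  define \<Lambda> where "\<Lambda> y = integral {0..y} s" for y
  have \<Lambda>diff: "integral {a..b} s = \<Lambda> b - \<Lambda> a" if "0 \<le> a" "a \<le> b" for a b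
    using Henstock_Kurzweil_Integration.integral_combine[of 0 a b s] that integrable_continuous_interval[OF cs] by (simp add: \<Lambda>_def)
  have \<Lambda>mono: "\<Lambda> a \<le> \<Lambda> b" if "0 \<le> a" "a \<le> b" for a b
    using \<Lambda>diff[OF that] integral_nonneg[of s "{a..b}"] integrable_continuous_interval[OF cs] s0 by simp
  define \<phi> where "\<phi> y = measure N (\<gamma> ` {0..y})" for y
  have fin: "emeasure N (\<gamma> ` {a..b}) = ennreal (measure N (\<gamma> ` {a..b}))" if "0 \<le> a" "a \<le> b" "b \<le> J" for a b
    using up[OF that] by (intro emeasure_eq_ennreal_measure) (auto simp: top_unique)
  have arc1: "\<gamma> ` {a..a} = {\<gamma> a}" for a by simp
  have null: "{\<gamma> a} \<in> null_sets N" if "0 \<le> a" "a \<le> J" for a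
    using arcs[of a a] up[of a a] that by (auto simp: null_sets_def)
  \<comment> \<open>Consecutive arcs overlap at most in the joint and, if the curve closes up, in
    its starting point. Single points are null sets because degenerate arcs have length 0.\<close>
  have add: "\<phi> t - \<phi> s' = measure N (\<gamma> ` {s'..t})" if st: "0 \<le> s'" "s' \<le> t" "t \<le> J" for s' t
  proof -
    let ?A = "\<gamma> ` {0..s'}" and ?B = "\<gamma> ` {s'..t}" and ?Z = "{\<gamma> s'} \<union> {\<gamma> 0}"
    have AB: "?A \<in> sets N" "?B \<in> sets N" using arcs st by auto
    have Z: "?Z \<in> null_sets N" using null st by (intro null_sets.Un) auto
    have un: "\<gamma> ` {0..t} = ?A \<union> (?B - ?A)" using st by (auto simp: image_iff) (metis atLeastAtMost_iff linear)
    have int: "?B - ?Z \<subseteq> ?B - ?A"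
    proof
      fix m assume m: "m \<in> ?B - ?Z"
      then obtain p where p: "p \<in> {s'..t}" "m = \<gamma> p" by blast
      have "m \<notin> ?A"
      proof
        assume "m \<in> ?A"
        then obtain q where q: "q \<in> {0..s'}" "m = \<gamma> q" by blast
        have "p \<noteq> J" using p(2) m closed by auto
        then have "p \<in> {0..<J}" "q \<in> {0..<J}" using p(1) q(1) st by auto
        then have "p = q" using inj p(2) q(2) by (metis inj_onD)
        then have "p = s'" using p(1) q(1) by auto
        then show False using p(2) m by simp
      qed
      then show "m \<in> ?B - ?A" using m by simp
    qed
    have "emeasure N ?B = emeasure N (?B - ?Z)" using AB Z by (simp add: emeasure_Diff_null_set)
    also have "\<dots> \<le> emeasure N (?B - ?A)" using int AB by (intro emeasure_mono) auto
    finally have "emeasure N (?B - ?A) = emeasure N ?B"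
      by (rule antisym[OF emeasure_mono[OF Diff_subset AB(2)]])
    moreover have "emeasure N (\<gamma> ` {0..t}) = emeasure N ?A + emeasure N (?B - ?A)"
      unfolding un using AB by (intro plus_emeasure[symmetric]) auto
    ultimately have "ennreal (\<phi> t) = ennreal (\<phi> s') + ennreal (measure N ?B)"
      using fin[of 0 t] fin[of 0 s'] fin[of s' t] st by (simp add: \<phi>_def)
    then show ?thesis by (simp add: \<phi>_def flip: ennreal_plus)
  qed
  have sq: "norm (U t - U s') \<le> \<phi> t - \<phi> s' \<and> \<phi> t - \<phi> s' \<le> \<Lambda> t - \<Lambda> s'" if st: "0 \<le> s'" "s' \<le> t" "t \<le> J" for s' t
  proof -
    have "ennreal (norm (U t - U s')) \<le> ennreal (\<phi> t - \<phi> s')" using low[OF st] fin[OF st] add[OF st] by simp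
    moreover have "ennreal (\<phi> t - \<phi> s') \<le> ennreal (\<Lambda> t - \<Lambda> s')"
      using up[OF st] fin[OF st] add[OF st] \<Lambda>diff[OF st(1,2)] by (simp add: s_def[abs_def])
    moreover have "0 \<le> \<phi> t - \<phi> s'" using add[OF st] by simp
    moreover have "0 \<le> \<Lambda> t - \<Lambda> s'" using \<Lambda>mono[OF st(1,2)] by simp
    ultimately show ?thesis by (simp add: ennreal_le_iff)
  qed
  have "\<phi> t = \<Lambda> t" if t: "0 \<le> t" "t \<le> J" for t
  proof -
    have "(s has_integral (\<phi> t - \<phi> 0)) {0..t}"
    proof (rule fundamental_theorem_of_calculus[OF t(1)])
      fix y assume y: "y \<in> {0..t}"
      have "(\<Lambda> has_vector_derivative s y) (at y within {0..t})"
        unfolding \<Lambda>_def by (rule integral_has_vector_derivative[OF cs y])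
      then show "(\<phi> has_vector_derivative s y) (at y within {0..t})"
        unfolding s_def by (rule squeeze_derivative[OF y U]) (use sq t in auto)
    qed
    moreover have "\<phi> 0 = 0" using sq[of 0 0] up[of 0 0] J by (simp add: \<phi>_def measure_def)
    ultimately show ?thesis by (simp add: \<Lambda>_def integral_unique)
  qed note \<phi>\<Lambda> = this
  define \<Sigma> where "\<Sigma> = \<gamma> ` {0..J}"
  have \<Sigma>s: "\<Sigma> \<in> sets N" using arcs[of 0 J] J by (simp add: \<Sigma>_def)
  have \<Sigma>eq: "\<Sigma> = \<gamma> ` {0..<J}"
  proof -
    have "{0..J} = insert J {0..<J}" using J by auto
    then show ?thesis using closed J by (auto simp: \<Sigma>_def)
  qed
  \<comment> \<open>The parameter of a point on the curve. The value -1 marks points off the curve,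
    as parameters are non-negative.\<close>
  define Y where "Y m = (if m \<in> \<Sigma> then the_inv_into {0..<J} \<gamma> m else -1)" for m
  have Y\<gamma>: "Y (\<gamma> y) = y" if "y \<in> {0..<J}" for y
    using that by (simp add: Y_def \<Sigma>eq the_inv_into_f_f[OF inj])
  have Y\<Sigma>: "\<exists>y\<in>{0..<J}. m = \<gamma> y \<and> Y m = y" if "m \<in> \<Sigma>" for m
    using that Y\<gamma> unfolding \<Sigma>eq by blast
  have Yr: "0 \<le> Y m" "Y m < J" if "m \<in> \<Sigma>" for m using Y\<Sigma>[OF that] by auto
  have Ylow: "{m \<in> \<Sigma>. Y m \<le> c} = {}" "{m \<in> \<Sigma>. c < Y m} = \<Sigma>" if "c < 0" for c
  proof -
    have "c < Y m" if "m \<in> \<Sigma>" for m using Yr(1)[OF that] \<open>c < 0\<close> by linarith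
    then show "{m \<in> \<Sigma>. Y m \<le> c} = {}" "{m \<in> \<Sigma>. c < Y m} = \<Sigma>" by (auto simp: not_le[symmetric])
  qed
  have Yhigh: "{m \<in> \<Sigma>. Y m \<le> c} = \<Sigma>" "{m \<in> \<Sigma>. c < Y m} = {}" if "J \<le> c" for c
  proof -
    have "Y m \<le> c" if "m \<in> \<Sigma>" for m using Yr(2)[OF that] \<open>J \<le> c\<close> by linarith
    then show "{m \<in> \<Sigma>. Y m \<le> c} = \<Sigma>" "{m \<in> \<Sigma>. c < Y m} = {}" by (auto simp: not_le[symmetric])
  qed
  have sub: "\<gamma> ` {0..c} \<subseteq> \<Sigma>" if "c \<le> J" for c using that by (auto simp: \<Sigma>_def)
  have Yle: "{m \<in> \<Sigma>. Y m \<le> c} = \<gamma> ` {0..c}" if "0 \<le> c" "c < J" for c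
  proof (intro equalityI subsetI)
    fix m assume "m \<in> {m \<in> \<Sigma>. Y m \<le> c}" then show "m \<in> \<gamma> ` {0..c}" using Y\<Sigma>[of m] by auto
  next
    fix m assume "m \<in> \<gamma> ` {0..c}"
    then obtain y where "y \<in> {0..c}" "m = \<gamma> y" by blast
    then show "m \<in> {m \<in> \<Sigma>. Y m \<le> c}" using that Y\<gamma>[of y] by (auto simp: \<Sigma>_def)
  qed
  have Ym [measurable]: "Y \<in> borel_measurable N"
    unfolding borel_measurable_iff_le
  proof
    fix c
    have "{m \<in> \<Sigma>. Y m \<le> c} \<in> sets N"
    proof -
      consider "c < 0" | "0 \<le> c" "c < J" | "J \<le> c" by linarith
      then show ?thesis
      proof cases
        case 1 then show ?thesis by (simp add: Ylow)
      next
        case 2 then show ?thesis using Yle arcs[of 0 c] by simp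
      next
        case 3 then show ?thesis using \<Sigma>s by (simp add: Yhigh)
      qed
    qed
    moreover have "{m \<in> space N. Y m \<le> c} = {m \<in> \<Sigma>. Y m \<le> c} \<union> (if -1 \<le> c then space N - \<Sigma> else {})"
      using sets.sets_into_space[OF \<Sigma>s] by (auto simp: Y_def)
    ultimately show "{m \<in> space N. Y m \<le> c} \<in> sets N" using \<Sigma>s by auto
  qed
  have [measurable]: "s \<in> borel_measurable borel" "g \<in> borel_measurable borel"
    by (auto intro!: borel_measurable_continuous_onI cs g)
  have [measurable]: "\<Sigma> \<in> sets N" by (rule \<Sigma>s)
  \<comment> \<open>The measure of the curve transported to the parameter line, and the measure with
    the speed as density; agreement on half-lines makes them equal.\<close>
  define \<nu>1 where "\<nu>1 = distr (density N (indicator \<Sigma>)) borel Y"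
  define \<nu>2 where "\<nu>2 = density lborel (\<lambda>y. ennreal (indicator {0..J} y * s y))"
  have Ym': "Y \<in> density N (indicator \<Sigma>) \<rightarrow>\<^sub>M borel" unfolding measurable_density_eq1 by (rule Ym)
  have e1: "emeasure \<nu>1 {x<..} = emeasure N {m \<in> \<Sigma>. x < Y m}" for x
  proof -
    have "emeasure \<nu>1 {x<..} = emeasure (density N (indicator \<Sigma>)) (Y -` {x<..} \<inter> space N)"
      unfolding \<nu>1_def by (subst emeasure_distr[OF Ym']) auto
    also have "\<dots> = (\<integral>\<^sup>+m. indicator \<Sigma> m * indicator (Y -` {x<..} \<inter> space N) m \<partial>N)"
      by (rule emeasure_density) auto
    also have "\<dots> = (\<integral>\<^sup>+m. indicator {m \<in> \<Sigma>. x < Y m} m \<partial>N)"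
      using sets.sets_into_space[OF \<Sigma>s] by (intro nn_integral_cong) (auto simp: indicator_def)
    also have "{m \<in> \<Sigma>. x < Y m} = \<Sigma> \<inter> {m \<in> space N. x < Y m}" using sets.sets_into_space[OF \<Sigma>s] by auto
    also have "(\<integral>\<^sup>+m. indicator (\<Sigma> \<inter> {m \<in> space N. x < Y m}) m \<partial>N) = emeasure N (\<Sigma> \<inter> {m \<in> space N. x < Y m})"
      by (rule nn_integral_indicator) measurable
    finally show ?thesis using \<open>{m \<in> \<Sigma>. x < Y m} = \<Sigma> \<inter> {m \<in> space N. x < Y m}\<close> by simp
  qed
  have e1': "emeasure N {m \<in> \<Sigma>. x < Y m} = ennreal (\<Lambda> J - \<Lambda> (max 0 (min x J)))" for x
  proof -
    have NS: "emeasure N \<Sigma> = ennreal (\<Lambda> J)" using fin[of 0 J] J \<phi>\<Lambda>[of J] by (simp add: \<Sigma>_def \<phi>_def)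
    have \<Lambda>0: "\<Lambda> 0 = 0" by (simp add: \<Lambda>_def)
    consider "x < 0" | "0 \<le> x" "x < J" | "J \<le> x" by linarith
    then show ?thesis
    proof cases
      case 1 then show ?thesis using NS J \<Lambda>0 by (simp add: Ylow)
    next
      case 2
      have "{m \<in> \<Sigma>. x < Y m} = \<Sigma> - \<gamma> ` {0..x}" unfolding Yle[OF 2, symmetric] by auto
      also have "emeasure N \<dots> = emeasure N \<Sigma> - emeasure N (\<gamma> ` {0..x})"
        using arcs[of 0 x] fin[of 0 x] 2 sub[of x] by (intro emeasure_Diff) auto
      also have "\<dots> = ennreal (\<Lambda> J) - ennreal (\<Lambda> x)" using NS fin[of 0 x] \<phi>\<Lambda>[of x] 2 by (simp add: \<phi>_def)
      also have "\<dots> = ennreal (\<Lambda> J - \<Lambda> x)" using \<Lambda>mono[of 0 x] 2 \<Lambda>0 by (intro ennreal_minus) auto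
      finally show ?thesis using 2 by simp
    next
      case 3 then show ?thesis using J by (simp add: Yhigh)
    qed
  qed
  have e2: "emeasure \<nu>2 {x<..} = ennreal (\<Lambda> J - \<Lambda> (max 0 (min x J)))" for x
  proof -
    let ?x = "max 0 (min x J)"
    have "emeasure \<nu>2 {x<..} = (\<integral>\<^sup>+y. ennreal (indicator {0..J} y * s y) * indicator {x<..} y \<partial>lborel)"
      unfolding \<nu>2_def by (rule emeasure_density) auto
    also have "\<dots> = (\<integral>\<^sup>+y. ennreal (indicator {?x..J} y * s y) \<partial>lborel)"
    proof (rule nn_integral_cong_AE)
      show "AE y in lborel. ennreal (indicator {0..J} y * s y) * indicator {x<..} y = ennreal (indicator {?x..J} y * s y)"
        using AE_lborel_singleton[of x] AE_lborel_singleton[of J]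
        by eventually_elim (auto simp: indicator_def max_def min_def)
    qed
    also have "\<dots> = ennreal (integral {?x..J} s)"
      by (rule nn_integral_has_integral_lebesgue)
        (use s0 integrable_continuous_interval[OF cs] in auto)
    also have "integral {?x..J} s = \<Lambda> J - \<Lambda> ?x" using J by (intro \<Lambda>diff) auto
    finally show ?thesis .
  qed
  have "\<nu>1 = \<nu>2"
  proof (rule measure_eqI_lessThan)
    show "sets \<nu>1 = sets borel" "sets \<nu>2 = sets borel" by (simp_all add: \<nu>1_def \<nu>2_def)
    show "emeasure \<nu>1 {x<..} < \<infinity>" for x by (simp add: e1 e1')
    show "emeasure \<nu>1 {x<..} = emeasure \<nu>2 {x<..}" for x by (simp add: e1 e1' e2)
  qed
  have "(LINT m : \<Sigma> | N. F m) = (\<integral>m. indicator \<Sigma> m *\<^sub>R g (Y m) \<partial>N)"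
    unfolding set_lebesgue_integral_def
  proof (rule Bochner_Integration.integral_cong[OF refl])
    fix m show "indicat_real \<Sigma> m *\<^sub>R F m = indicat_real \<Sigma> m *\<^sub>R g (Y m)"
    proof (cases "m \<in> \<Sigma>")
      case True then obtain y where "y \<in> {0..<J}" "m = \<gamma> y" "Y m = y" using Y\<Sigma> by blast
      then show ?thesis using F[of y] by simp
    qed simp
  qed
  also have "\<dots> = (\<integral>m. g (Y m) \<partial>density N (\<lambda>m. ennreal (indicat_real \<Sigma> m)))"
    by (rule integral_density[symmetric]) auto
  also have "\<dots> = (\<integral>m. g (Y m) \<partial>density N (indicator \<Sigma>))" by (simp add: ennreal_indicator)
  also have "\<dots> = (\<integral>y. g y \<partial>\<nu>1)" unfolding \<nu>1_def by (rule integral_distr[symmetric]) auto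
  also have "\<dots> = (\<integral>y. (indicator {0..J} y * s y) *\<^sub>R g y \<partial>lborel)"
    unfolding \<open>\<nu>1 = \<nu>2\<close> \<nu>2_def by (rule integral_density) (auto simp: s0)
  also have "\<dots> = (LBINT y:{0..J}. s y * g y)" by (simp add: set_lebesgue_integral_def mult.assoc)
  also have "\<dots> = integral {0..J} (\<lambda>y. s y * g y)"
    by (intro set_borel_integral_eq_integral borel_integrable_atLeastAtMost' continuous_on_mult cs continuous_on_subset[OF g]) simp
  finally show ?thesis by (simp add: \<Sigma>_def s_def)
qed

section \<open>Riemannian distance, chords and measurable neighbourhoods\<close>

text \<open>Break points form a null set, so the derivative may be replaced by the measurable
  \<open>w\<close>. For infinite length nothing is to be shown; otherwise \<open>w\<close> is
  integrable and the fundamental theorem with finitely many exceptions applies.\<close>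

lemma chord_le_length:
  assumes C1: "(u \<circ> \<gamma>) piecewise_C1_differentiable_on {0..1}" and st: "0 \<le> s" "s \<le> t" "t \<le> 1"
  shows "ennreal (norm (u (\<gamma> t) - u (\<gamma> s))) \<le> curve_length u \<gamma>"
proof -
  let ?f = "u \<circ> \<gamma>"
  obtain S where S: "finite S" and C1': "?f C1_differentiable_on ({0..1} - S)" and cf: "continuous_on {0..1} ?f"
    using C1 unfolding piecewise_C1_differentiable_on_def by blast
  obtain D where D: "\<And>x. x \<in> {0..1} - S \<Longrightarrow> (?f has_vector_derivative D x) (at x)" "continuous_on ({0..1} - S) D"
    using C1' unfolding C1_differentiable_on_def by blast
  define w where "w x = indicat_real ({0..1} - S) x *\<^sub>R D x" for x
  have Sb: "{0..1} - S \<in> sets borel" using S finite_imp_closed[OF S] by (intro sets.Diff borel_closed) auto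
  have [measurable]: "w \<in> borel_measurable borel"
    unfolding w_def by (rule borel_measurable_continuous_on_indicator[OF Sb D(2)])
  have cl: "curve_length u \<gamma> = (\<integral>\<^sup>+x. ennreal (norm (w x)) \<partial>lborel)"
    unfolding curve_length_def
  proof (rule nn_integral_cong_AE)
    have "AE x in lborel. x \<notin> S" using S by (intro AE_not_in) (simp add: finite_imp_null_set_lborel)
    then show "AE x in lborel. ennreal (norm (vector_derivative ?f (at x))) * indicator {0..1} x = ennreal (norm (w x))"
    proof eventually_elim
      case (elim x)
      then show ?case using D(1)[of x] by (cases "x \<in> {0..1}") (auto simp: w_def vector_derivative_at)
    qed
  qed
  show ?thesis
  proof (cases "curve_length u \<gamma> = \<infinity>")
    case False
    then have "(\<integral>\<^sup>+x. ennreal (norm (w x)) \<partial>lborel) < \<infinity>" using cl by (simp add: less_top)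
    then have iw: "integrable lborel w" by (intro integrableI_bounded) auto
    then have inw: "integrable lborel (\<lambda>x. norm (w x))" by (rule integrable_norm)
    have "(w has_integral (?f t - ?f s)) {s..t}"
    proof (rule fundamental_theorem_of_calculus_interior_strong[OF S st(2)])
      show "(?f has_vector_derivative w x) (at x)" if "x \<in> {s<..<t} - S" for x
        using D(1)[of x] that st by (auto simp: w_def)
      show "continuous_on {s..t} ?f" by (rule continuous_on_subset[OF cf]) (use st in auto)
    qed
    then have eq: "integral {s..t} w = ?f t - ?f s" "w integrable_on {s..t}" by (auto simp: integral_unique)
    have nU: "(\<lambda>x. norm (w x)) integrable_on UNIV" using integrable_on_lborel[OF inw] .
    then have nst: "(\<lambda>x. norm (w x)) integrable_on {s..t}" by (rule integrable_on_subinterval) simp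
    have "norm (?f t - ?f s) \<le> integral {s..t} (\<lambda>x. norm (w x))"
      unfolding eq(1)[symmetric] by (rule integral_norm_bound_integral[OF eq(2) nst]) simp
    also have "\<dots> \<le> integral UNIV (\<lambda>x. norm (w x))" by (rule integral_subset_le[OF _ nst nU]) auto
    also have "\<dots> = (\<integral>x. norm (w x) \<partial>lborel)" by (rule integral_lborel[OF inw])
    finally have "ennreal (norm (?f t - ?f s)) \<le> ennreal (\<integral>x. norm (w x) \<partial>lborel)" by (rule ennreal_leI)
    also have "\<dots> = (\<integral>\<^sup>+x. ennreal (norm (w x)) \<partial>lborel)" by (rule nn_integral_eq_integral[symmetric, OF inw]) simp
    finally show ?thesis by (simp add: cl)
  qed simp
qed

lemma riemannian_dist_ge_chord: "ennreal (norm (u p - u q)) \<le> riemannian_dist M u p q"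
  unfolding riemannian_dist_def
proof (rule INF_greatest)
  fix \<gamma> assume "\<gamma> \<in> {\<gamma>. pathin M \<gamma> \<and> (u \<circ> \<gamma>) piecewise_C1_differentiable_on {0..1} \<and> \<gamma> 0 = p \<and> \<gamma> 1 = q}"
  then show "ennreal (norm (u p - u q)) \<le> curve_length u \<gamma>"
    using chord_le_length[of u \<gamma> 0 1] by (auto simp: norm_minus_commute)
qed

text \<open>The arc itself, parametrized affinely over [0, 1], is an admissible curve. The factor
  sgn(t - s) treats both orders of the endpoints at once.\<close>

lemma riemannian_dist_le_arc:
  fixes \<gamma> :: "real \<Rightarrow> 'a"
  assumes \<gamma>: "continuous_map euclideanreal M \<gamma>" and U: "\<And>y. ((u \<circ> \<gamma>) has_vector_derivative U' y) (at y)"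
    and cU': "continuous_on UNIV U'" and L: "\<And>y. y \<in> {p<..<q} \<Longrightarrow> (L has_real_derivative norm (U' y)) (at y)"
    and st: "s \<in> {p<..<q}" "t \<in> {p<..<q}"
  shows "riemannian_dist M u (\<gamma> s) (\<gamma> t) \<le> ennreal \<bar>L t - L s\<bar>"
proof -
  define c where "c x = \<gamma> (s + x * (t - s))" for x
  have c: "pathin M c"
  proof -
    have "continuous_map (top_of_set {0..1}) M (\<gamma> \<circ> (\<lambda>x. s + x * (t - s)))"
      by (rule continuous_map_compose[OF _ \<gamma>]) (auto intro!: continuous_intros)
    then show ?thesis by (simp add: pathin_def c_def[abs_def] o_def)
  qed
  have uc: "u \<circ> c = (u \<circ> \<gamma>) \<circ> (\<lambda>x. s + x * (t - s))" by (auto simp: c_def)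
  have d: "((u \<circ> c) has_vector_derivative (t - s) *\<^sub>R U' (s + x * (t - s))) (at x)" for x
    unfolding uc by (rule vector_diff_chain_at[OF _ U]) (auto intro!: derivative_eq_intros)
  have cont: "continuous_on UNIV (\<lambda>x. U' (s + x * (t - s)))"
    by (rule continuous_on_compose2[OF cU']) (auto intro!: continuous_intros)
  have "(u \<circ> c) C1_differentiable_on {0..1}"
    unfolding C1_differentiable_on_def using d continuous_on_subset[OF cont]
    by (intro exI[of _ "\<lambda>x. (t - s) *\<^sub>R U' (s + x * (t - s))"]) (auto intro!: continuous_intros)
  then have "(u \<circ> c) piecewise_C1_differentiable_on {0..1}"
    by (rule C1_differentiable_imp_piecewise)
  then have "riemannian_dist M u (\<gamma> s) (\<gamma> t) \<le> curve_length u c"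
    unfolding riemannian_dist_def by (intro INF_lower) (use c in \<open>auto simp: c_def\<close>)
  also have "\<dots> = (\<integral>\<^sup>+x. ennreal (\<bar>t - s\<bar> * norm (U' (s + x * (t - s)))) * indicator {0..1} x \<partial>lborel)"
    unfolding curve_length_def vector_derivative_at[OF d] by simp
  also have "\<dots> = ennreal (sgn (t - s) * L (s + 1 * (t - s)) - sgn (t - s) * L (s + 0 * (t - s)))"
  proof (rule nn_integral_FTC_Icc)
    have "continuous_on UNIV (\<lambda>x. \<bar>t - s\<bar> * norm (U' (s + x * (t - s))))"
      by (intro continuous_intros cont)
    then show "(\<lambda>x. \<bar>t - s\<bar> * norm (U' (s + x * (t - s)))) \<in> borel_measurable borel" by (rule borel_measurable_continuous_onI)
    show "((\<lambda>x. sgn (t - s) * L (s + x * (t - s))) has_real_derivative \<bar>t - s\<bar> * norm (U' (s + x * (t - s)))) (at x)"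
      if "x \<in> {0..1}" for x
    proof -
      have "s + x * (t - s) = (1 - x) * s + x * t" by (simp add: algebra_simps)
      then have "s + x * (t - s) \<in> {p<..<q}"
        using convexD_alt[of "{p<..<q}" s t x] st that by simp
      then have "((\<lambda>x. L (s + x * (t - s))) has_real_derivative norm (U' (s + x * (t - s))) * (t - s)) (at x)"
        by (intro DERIV_chain2[OF L]) (auto intro!: derivative_eq_intros)
      from DERIV_cmult[OF this, of "sgn (t - s)"] show ?thesis
        by (simp add: abs_sgn[of "t - s"] mult_ac)
    qed
  qed auto
  also have "sgn (t - s) * L (s + 1 * (t - s)) - sgn (t - s) * L (s + 0 * (t - s)) \<le> \<bar>L t - L s\<bar>"
    by (auto simp: sgn_if)
  finally show ?thesis by (simp add: ennreal_leI)
qed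

text \<open>The Riemannian distance dominates chords, so the coordinates are 1-Lipschitz for
  it.\<close>

lemma u_measurable:
  fixes u :: "'a \<Rightarrow> real^3"
  shows "u \<in> borel_measurable (hausdorff1 X (riemannian_dist M u))"
proof -
  have "(\<lambda>m. u m \<bullet> e) \<in> borel_measurable (hausdorff1 X (riemannian_dist M u))" if "e \<in> Basis" for e
  proof (rule lipschitz_measurable)
    fix x y
    have "\<bar>u x \<bullet> e - u y \<bullet> e\<bar> \<le> norm (u x - u y)"
      using Basis_le_norm[OF that, of "u x - u y"] by (simp add: inner_diff_left)
    then show "ennreal \<bar>u x \<bullet> e - u y \<bullet> e\<bar> \<le> riemannian_dist M u x y"
      using riemannian_dist_ge_chord by (meson ennreal_leI order_trans)
  qed
  then show ?thesis by (subst borel_measurable_euclidean_space) blast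
qed

text \<open>\<open>u\<close> is measurable but may fail to be injective, so preimages under
  \<open>u\<close> cannot isolate a single arc. The cone \<open>q\<close>, extended by 0, is
  1-Lipschitz for the Riemannian distance, because a path that leaves the neighbourhood has to reach
  distance \<open>\<rho>\<close> from the centre in space. Hence its positivity set is
  measurable.\<close>

lemma local_measurable_neighbourhood:
  fixes M :: "'a topology" and u :: "'a \<Rightarrow> real^3" and \<psi> :: "'b::euclidean_space \<Rightarrow> 'a"
  assumes haus: "Hausdorff_space M" and V: "open V" "openin M (\<psi> ` V)"
    and hom: "homeomorphic_map (top_of_set V) (subtopology M (\<psi> ` V)) \<psi>"
    and contr: "continuous_on V (u \<circ> \<psi>)" and e: "e > 0" "cball x0 e \<subseteq> V" and inj: "inj_on (u \<circ> \<psi>) (cball x0 e)"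
  shows "\<exists>O'\<in>sets (hausdorff1 (topspace M) (riemannian_dist M u)). openin M O' \<and> \<psi> x0 \<in> O' \<and> inj_on u O'"
proof -
  let ?d = "riemannian_dist M u"
  have \<psi>c: "continuous_map (top_of_set V) M \<psi>"
    using hom homeomorphic_imp_continuous_map continuous_map_into_fulltopology by blast
  have \<psi>open: "openin M (\<psi> ` T)" if "open T" "T \<subseteq> V" for T
  proof -
    have "openin (top_of_set V) T" using that V by (simp add: openin_open_eq)
    then have "openin (subtopology M (\<psi> ` V)) (\<psi> ` T)"
      using hom homeomorphic_imp_open_map open_map_def by blast
    then show ?thesis using V(2) openin_trans_full by blast
  qed
  have sub: "ball x0 e \<subseteq> V" "sphere x0 e \<subseteq> cball x0 e" "x0 \<in> cball x0 e" using e by auto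
  \<comment> \<open>By injectivity the image of the boundary sphere keeps a positive distance from
    the image of the centre.\<close>
  obtain \<rho> where \<rho>: "\<rho> > 0" "\<And>x. x \<in> sphere x0 e \<Longrightarrow> \<rho> \<le> norm (u (\<psi> x) - u (\<psi> x0))"
  proof (cases "sphere x0 e = {}")
    case False
    have c: "continuous_on (sphere x0 e) (\<lambda>x. norm ((u \<circ> \<psi>) x - (u \<circ> \<psi>) x0))"
      by (intro continuous_intros continuous_on_subset[OF contr]) (use e in auto)
    obtain y where y: "y \<in> sphere x0 e" "\<And>x. x \<in> sphere x0 e \<Longrightarrow> norm ((u \<circ> \<psi>) y - (u \<circ> \<psi>) x0) \<le> norm ((u \<circ> \<psi>) x - (u \<circ> \<psi>) x0)"
      using continuous_attains_inf[OF compact_sphere False c] by blast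
    have "(u \<circ> \<psi>) y \<noteq> (u \<circ> \<psi>) x0" using inj y(1) e sub by (auto simp: inj_on_def)
    then show ?thesis using that[of "norm ((u \<circ> \<psi>) y - (u \<circ> \<psi>) x0)"] y(2) by auto
  qed (use that[of 1] in auto)
  define T where "T = {x \<in> ball x0 e. norm ((u \<circ> \<psi>) x - (u \<circ> \<psi>) x0) < \<rho>}"
  have "open T"
  proof -
    have "continuous_on (ball x0 e) (\<lambda>x. norm ((u \<circ> \<psi>) x - (u \<circ> \<psi>) x0))"
      by (intro continuous_intros continuous_on_subset[OF contr] sub)
    from continuous_open_preimage[OF this open_ball open_lessThan[of \<rho>]]
    show ?thesis by (simp add: T_def vimage_def Int_def)
  qed
  define O' where "O' = \<psi> ` T"
  have Osub: "O' \<subseteq> topspace M" and Oopen: "openin M O'"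
  proof -
    show "openin M O'" unfolding O'_def by (rule \<psi>open[OF \<open>open T\<close>]) (use sub in \<open>auto simp: T_def\<close>)
    then show "O' \<subseteq> topspace M" by (rule openin_subset)
  qed
  have injO: "inj_on u O'"
  proof (rule inj_onI)
    fix a b assume ab: "a \<in> O'" "b \<in> O'" "u a = u b"
    then obtain x y where xy: "x \<in> ball x0 e" "y \<in> ball x0 e" "a = \<psi> x" "b = \<psi> y" by (auto simp: O'_def T_def)
    then have "x = y" using inj ab(3) by (intro inj_onD[OF inj]) auto
    then show "a = b" using xy by simp
  qed
  have xO: "\<psi> x0 \<in> O'" unfolding O'_def T_def using e \<rho> by (intro imageI) auto
  define q where "q m = (if m \<in> O' then \<rho> - norm (u m - u (\<psi> x0)) else 0)" for m
  have q0: "q m \<ge> 0" for m by (auto simp: q_def O'_def T_def)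
  \<comment> \<open>While its image stays closer than \<open>\<rho>\<close>, the path cannot hit the
    sphere, so the open and the closed parameter ball have the same preimage in [0, 1], which is
    then clopen.\<close>
  have cross: "\<exists>t\<in>{0..1}. norm (u (\<gamma> t) - u (\<psi> x0)) \<ge> \<rho>"
    if \<gamma>: "pathin M \<gamma>" and a: "a \<in> {0..1}" "\<gamma> a \<in> O'" and b: "b \<in> {0..1}" "\<gamma> b \<notin> O'" for \<gamma> a b
  proof (rule ccontr)
    assume "\<not> ?thesis"
    then have less: "norm (u (\<gamma> t) - u (\<psi> x0)) < \<rho>" if "t \<in> {0..1}" for t using that by (meson not_le)
    have \<gamma>c: "continuous_map (top_of_set {0..1}) M \<gamma>" using \<gamma> by (simp add: pathin_def)
    let ?S = "{t \<in> {0..1}. \<gamma> t \<in> \<psi> ` ball x0 e}"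
    have eq: "?S = {t \<in> {0..1}. \<gamma> t \<in> \<psi> ` cball x0 e}"
    proof -
      have "\<gamma> t \<in> \<psi> ` ball x0 e" if t: "t \<in> {0..1}" "\<gamma> t \<in> \<psi> ` cball x0 e" for t
      proof -
        obtain x where x: "x \<in> cball x0 e" "\<gamma> t = \<psi> x" using t by blast
        have "x \<notin> sphere x0 e" using \<rho>(2)[of x] less[OF t(1)] x(2) by auto
        then show ?thesis using x by (auto simp: less_le)
      qed
      moreover have "\<psi> ` ball x0 e \<subseteq> \<psi> ` cball x0 e" by (intro image_mono) auto
      ultimately show ?thesis by blast
    qed
    have "openin (top_of_set {0..1}) ?S"
      using openin_continuous_map_preimage[OF \<gamma>c \<psi>open[OF open_ball sub(1)]] by simp
    moreover have "closedin (top_of_set {0..1}) ?S"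
    proof -
      have "compactin (top_of_set V) (cball x0 e)" using e by (simp add: compactin_subtopology)
      then have "compactin M (\<psi> ` cball x0 e)" by (rule image_compactin[OF _ \<psi>c])
      then have "closedin M (\<psi> ` cball x0 e)" by (rule compactin_imp_closedin[OF haus])
      then show ?thesis unfolding eq using closedin_continuous_map_preimage[OF \<gamma>c] by fastforce
    qed
    moreover have "a \<in> ?S" using a by (auto simp: O'_def T_def)
    ultimately have "?S = {0..1}" using connected_Icc[of "0::real" 1] unfolding connected_clopen by blast
    then obtain x where "x \<in> ball x0 e" "\<gamma> b = \<psi> x" using b by blast
    then have "\<gamma> b \<in> O'" using less[OF b(1)] by (auto simp: O'_def T_def)
    then show False using b by simp
  qed
  have half: "ennreal (q x) \<le> curve_length u \<gamma>"
    if \<gamma>: "pathin M \<gamma>" "(u \<circ> \<gamma>) piecewise_C1_differentiable_on {0..1}" and a: "a \<in> {0..1}" "\<gamma> a = x" "x \<in> O'" and b: "b \<in> {0..1}" "\<gamma> b \<notin> O'"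
    for \<gamma> a b x
  proof -
    obtain t where t: "t \<in> {0..1}" "norm (u (\<gamma> t) - u (\<psi> x0)) \<ge> \<rho>" using cross[OF \<gamma>(1) a(1) _ b] a by auto
    have "q x \<le> norm (u (\<gamma> t) - u (\<gamma> a))"
      using a t(2) norm_triangle_ineq[of "u (\<gamma> t) - u (\<gamma> a)" "u (\<gamma> a) - u (\<psi> x0)"] by (simp add: q_def)
    moreover have "ennreal (norm (u (\<gamma> t) - u (\<gamma> a))) \<le> curve_length u \<gamma>"
      using chord_le_length[OF \<gamma>(2), of a t] chord_le_length[OF \<gamma>(2), of t a] a(1) t(1)
      by (cases "a \<le> t") (auto simp: norm_minus_commute)
    ultimately show ?thesis by (meson ennreal_leI order_trans)
  qed
  have lip: "ennreal \<bar>q x - q y\<bar> \<le> ?d x y" for x y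
    unfolding riemannian_dist_def
  proof (rule INF_greatest)
    fix \<gamma> assume "\<gamma> \<in> {\<gamma>. pathin M \<gamma> \<and> (u \<circ> \<gamma>) piecewise_C1_differentiable_on {0..1} \<and> \<gamma> 0 = x \<and> \<gamma> 1 = y}"
    then have \<gamma>: "pathin M \<gamma>" "(u \<circ> \<gamma>) piecewise_C1_differentiable_on {0..1}" "\<gamma> 0 = x" "\<gamma> 1 = y" by auto
    show "ennreal \<bar>q x - q y\<bar> \<le> curve_length u \<gamma>"
    proof (cases "x \<in> O'")
      case True
      show ?thesis
      proof (cases "y \<in> O'")
        case True
        have "\<bar>q x - q y\<bar> \<le> norm (u y - u x)"
          using \<open>x \<in> O'\<close> True norm_triangle_ineq3[of "u y - u (\<psi> x0)" "u x - u (\<psi> x0)"] by (simp add: q_def)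
        then show ?thesis using chord_le_length[OF \<gamma>(2), of 0 1] \<gamma>(3,4) by (auto intro: order_trans[OF ennreal_leI])
      next
        case False
        then show ?thesis using half[OF \<gamma>(1,2), of 0 x 1] \<gamma>(3,4) True q0[of x] by (simp add: q_def[of y])
      qed
    next
      case False
      show ?thesis
      proof (cases "y \<in> O'")
        case True
        then show ?thesis using half[OF \<gamma>(1,2), of 1 y 0] \<gamma>(3,4) False q0[of y] by (simp add: q_def[of x])
      qed (use False in \<open>simp add: q_def\<close>)
    qed
  qed
  have "q \<in> borel_measurable (hausdorff1 (topspace M) ?d)" by (rule lipschitz_measurable) (rule lip)
  then have "{m \<in> space (hausdorff1 (topspace M) ?d). 0 < q m} \<in> sets (hausdorff1 (topspace M) ?d)" by measurable
  moreover have "{m \<in> space (hausdorff1 (topspace M) ?d). 0 < q m} = O'"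
    using Osub by (auto simp: q_def O'_def T_def)
  ultimately show ?thesis using Oopen xO injO by auto
qed

text \<open>Bisection reduces to short arcs. A short arc lies in a measurable set on which
  \<open>u\<close> is injective, and there it is the preimage of a compact set.\<close>

lemma arc_measurable:
  fixes M :: "'a topology" and u :: "'a \<Rightarrow> real^3" and \<gamma> :: "real \<Rightarrow> 'a"
  assumes \<gamma>: "continuous_map euclideanreal M \<gamma>" and cU: "continuous_on UNIV (u \<circ> \<gamma>)"
    and loc: "\<And>m. m \<in> topspace M \<Longrightarrow>
      \<exists>O'\<in>sets (hausdorff1 (topspace M) (riemannian_dist M u)). openin M O' \<and> m \<in> O' \<and> inj_on u O'"
    and ab: "a \<le> b"
  shows "\<gamma> ` {a..b} \<in> sets (hausdorff1 (topspace M) (riemannian_dist M u))" (is "_ \<in> sets ?N")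
  using ab
proof (induction rule: Bolzano)
  case (trans a b c)
  have "\<gamma> ` {a..c} = \<gamma> ` {a..b} \<union> \<gamma> ` {b..c}" using trans ivl_disj_un_two_touch(4)[of a b c] by (metis image_Un)
  then show ?case using trans by auto
next
  case (local x)
  have "\<gamma> x \<in> topspace M" using \<gamma> by (auto simp: continuous_map_def)
  then obtain O' where O': "O' \<in> sets ?N" "openin M O'" "\<gamma> x \<in> O'" "inj_on u O'" using loc by blast
  have "open {y. \<gamma> y \<in> O'}" using openin_continuous_map_preimage[OF \<gamma> O'(2)] by simp
  then obtain d where d: "d > 0" "ball x d \<subseteq> {y. \<gamma> y \<in> O'}" using O'(3) by (auto simp: open_contains_ball)
  have "\<gamma> ` {a..b} \<in> sets ?N" if ab: "a \<le> x" "x \<le> b" "b - a < d" for a b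
  proof -
    have sub: "\<gamma> ` {a..b} \<subseteq> O'"
    proof clarify
      fix t assume "t \<in> {a..b}"
      then have "t \<in> ball x d" using ab by (auto simp: dist_real_def)
      then show "\<gamma> t \<in> O'" using d(2) by blast
    qed
    have "compact ((u \<circ> \<gamma>) ` {a..b})" by (intro compact_continuous_image continuous_on_subset[OF cU]) auto
    then have "(u \<circ> \<gamma>) ` {a..b} \<in> sets borel" by (simp add: compact_imp_closed borel_closed)
    then have "u -` ((u \<circ> \<gamma>) ` {a..b}) \<inter> space ?N \<in> sets ?N" using u_measurable by (rule measurable_sets[rotated])
    then have "O' \<inter> (u -` ((u \<circ> \<gamma>) ` {a..b}) \<inter> space ?N) \<in> sets ?N" using O'(1) by auto
    moreover have "O' \<inter> (u -` ((u \<circ> \<gamma>) ` {a..b}) \<inter> space ?N) = \<gamma> ` {a..b}"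
    proof (intro equalityI subsetI)
      fix m assume m: "m \<in> O' \<inter> (u -` ((u \<circ> \<gamma>) ` {a..b}) \<inter> space ?N)"
      then obtain t where t: "t \<in> {a..b}" "u m = u (\<gamma> t)" by auto
      have "m = \<gamma> t" by (rule inj_onD[OF O'(4) t(2)]) (use m t sub in auto)
      then show "m \<in> \<gamma> ` {a..b}" using t by blast
    next
      fix m assume "m \<in> \<gamma> ` {a..b}"
      then show "m \<in> O' \<inter> (u -` ((u \<circ> \<gamma>) ` {a..b}) \<inter> space ?N)"
        using sub openin_subset[OF O'(2)] by auto
    qed
    ultimately show ?thesis by simp
  qed
  then show ?case using d(1) by blast
qed

section \<open>Minimal tubes\<close>

text \<open>The Gauss map \<open>n\<close> and a homeomorphism to the round annulus are fixed, so
  that plane topology becomes available.\<close>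

locale minimal_tube =
  fixes M :: "'a topology" and A :: "'a atlas" and u n :: "'a \<Rightarrow> real^3"
    and \<xi> :: "'a \<Rightarrow> complex" and \<eta> :: "complex \<Rightarrow> 'a"
  assumes surf: "C2_surface M A" and imm: "C2_immersion A u" and min_surf: "minimal_surface A u"
    and tube: "tube M u" and gauss: "gauss_map M A u n" and n_inj: "inj_on n (topspace M)"
    and homeo: "homeomorphic_maps M (top_of_set annulus) \<xi> \<eta>"
begin

lemma chart_surface:
  assumes "(V, \<psi>) \<in> A"
  shows "open V" "openin M (\<psi> ` V)" "homeomorphic_map (top_of_set V) (subtopology M (\<psi> ` V)) \<psi>"
    "continuous_map (top_of_set V) M \<psi>" "inj_on \<psi> V" "x \<in> V \<Longrightarrow> \<psi> x \<in> topspace M"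
proof -
  show 1: "open V" "openin M (\<psi> ` V)" and 2: "homeomorphic_map (top_of_set V) (subtopology M (\<psi> ` V)) \<psi>"
    using surf assms unfolding C2_surface_def by auto
  show "continuous_map (top_of_set V) M \<psi>"
    using 2 homeomorphic_imp_continuous_map continuous_map_into_fulltopology by blast
  show "inj_on \<psi> V" using homeomorphic_imp_injective_map[OF 2] by simp
  show "x \<in> V \<Longrightarrow> \<psi> x \<in> topspace M" using openin_subset[OF 1(2)] by blast
qed

text \<open>Carries an atlas parametrization over to the complex plane. The mean curvature is
  defined by the normalized cross product; \<open>n\<close> is a multiple of it and the curvature
  numerator is linear in the normal.\<close>

lemma patch:
  assumes VA: "(V, \<psi>) \<in> A"
  obtains r' r'' where "minimal_patch (vec2 -` V) (u \<circ> \<psi> \<circ> vec2) r' r'' (n \<circ> \<psi> \<circ> vec2)"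
    "\<And>x v. x \<in> V \<Longrightarrow> frechet_derivative (u \<circ> \<psi>) (at x) v = r' (cplx x) (cplx v)"
    "\<And>x. x \<in> V \<Longrightarrow> (u \<circ> \<psi>) differentiable (at x)"
proof -
  let ?g = "u \<circ> \<psi>"
  note V = chart_surface[OF VA]
  have C2: "C2_on V ?g" and inj0: "\<And>x. x \<in> V \<Longrightarrow> inj (frechet_derivative ?g (at x))"
    using bspec[OF imm[unfolded C2_immersion_def] VA] by (simp_all add: split_beta)
  obtain f' :: "real^2 \<Rightarrow> (real^2) \<Rightarrow>\<^sub>L (real^3)" and f'' :: "real^2 \<Rightarrow> (real^2) \<Rightarrow>\<^sub>L ((real^2) \<Rightarrow>\<^sub>L (real^3))"
    where f': "\<And>x. x \<in> V \<Longrightarrow> (?g has_derivative blinfun_apply (f' x)) (at x)"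
      and f'': "\<And>x. x \<in> V \<Longrightarrow> (f' has_derivative blinfun_apply (f'' x)) (at x)"
      and cf'': "continuous_on V f''"
    using C2 unfolding C2_on_def by metis
  have fd: "frechet_derivative ?g (at x) = blinfun_apply (f' x)" if "x \<in> V" for x
    using frechet_derivative_at[OF f'[OF that]] by simp
  have injf: "inj (blinfun_apply (f' x))" if "x \<in> V" for x
    using inj0[OF that] fd[OF that] by simp
  have tp: "blinfun_apply (f' x) v \<in> tangent_plane A u (\<psi> x)" if "x \<in> V" for x v
    unfolding fd[OF that, symmetric] tangent_plane_def using VA that by blast
  have unit_normal: "norm (n (\<psi> x)) = 1" "n (\<psi> x) \<bullet> f' x v = 0" if "x \<in> V" for x v
    using gauss V(6)[OF that] tp[OF that] unfolding gauss_map_def by blast+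
  define Vec where "Vec = Blinfun vec2"
  have Vec: "blinfun_apply Vec = vec2" by (simp add: Vec_def bounded_linear_Blinfun_apply[OF bounded_linear_vec2])
  define Comp :: "((real^2) \<Rightarrow>\<^sub>L (real^3)) \<Rightarrow>\<^sub>L (complex \<Rightarrow>\<^sub>L (real^3))" where "Comp = Blinfun (\<lambda>g. g o\<^sub>L Vec)"
  have Comp: "blinfun_apply Comp g = g o\<^sub>L Vec" for g
    by (simp add: Comp_def bounded_linear_Blinfun_apply bounded_bilinear.bounded_linear_left[OF bounded_bilinear_blinfun_compose])
  define r' where "r' x = f' (vec2 x) o\<^sub>L Vec" for x
  define r'' where "r'' x = (Comp o\<^sub>L f'' (vec2 x)) o\<^sub>L Vec" for x
  have r': "r' x v = f' (vec2 x) (vec2 v)" for x v by (simp add: r'_def Vec)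
  have r'': "r'' x v w = f'' (vec2 x) (vec2 v) (vec2 w)" for x v w by (simp add: r''_def Vec Comp)
  have ax: "vec2 1 = axis 1 1" "vec2 \<i> = axis 2 1" by (auto simp: vec_eq_iff forall_2 axis_def)
  have dvec: "(vec2 has_derivative vec2) (at x)" for x by (rule bounded_linear_imp_has_derivative[OF bounded_linear_vec2])
  have cvec: "continuous_on S vec2" for S by (intro continuous_intros)
  have opn: "open (vec2 -` V)" by (rule open_vimage[OF V(1) cvec])
  have pd: "partial_deriv i ?g y = f' y (axis i 1)" if "y \<in> V" for i y using fd[OF that] by (simp add: partial_deriv_def)
  have pd2: "partial_deriv i (partial_deriv j ?g) x = f'' x (axis i 1) (axis j 1)" if "x \<in> V" for i j x
  proof -
    have "((\<lambda>y. f' y (axis j 1)) has_derivative (\<lambda>v. f'' x v (axis j 1))) (at x)"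
      using bounded_linear.has_derivative[OF blinfun.bounded_linear_left f''[OF that]] by simp
    then have "(partial_deriv j ?g has_derivative (\<lambda>v. f'' x v (axis j 1))) (at x)"
      by (rule has_derivative_transform_within_open[OF _ V(1) that]) (simp add: pd)
    from frechet_derivative_at[OF this] show ?thesis by (metis partial_deriv_def)
  qed
  have "minimal_patch (vec2 -` V) (?g \<circ> vec2) r' r'' (n \<circ> \<psi> \<circ> vec2)"
  proof
    fix x assume x: "x \<in> vec2 -` V"
    then have xV: "vec2 x \<in> V" by simp
    have "(?g \<circ> vec2 has_derivative (blinfun_apply (f' (vec2 x)) \<circ> vec2)) (at x)"
      by (rule diff_chain_at[OF dvec f'[OF xV]])
    then show "(?g \<circ> vec2 has_derivative blinfun_apply (r' x)) (at x)" by (simp add: r'[abs_def] o_def r')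
    have "(f' \<circ> vec2 has_derivative (blinfun_apply (f'' (vec2 x)) \<circ> vec2)) (at x)"
      by (rule diff_chain_at[OF dvec f''[OF xV]])
    from bounded_linear.has_derivative[OF blinfun.bounded_linear_right this, of Comp]
    have "((\<lambda>x. Comp ((f' \<circ> vec2) x)) has_derivative (\<lambda>v. Comp ((blinfun_apply (f'' (vec2 x)) \<circ> vec2) v))) (at x)" .
    moreover have "(\<lambda>x. Comp ((f' \<circ> vec2) x)) = r'" by (simp add: fun_eq_iff Comp r'_def)
    moreover have "(\<lambda>v. Comp ((blinfun_apply (f'' (vec2 x)) \<circ> vec2) v)) = blinfun_apply (r'' x)"
      by (simp add: fun_eq_iff r''_def Vec)
    ultimately show "(r' has_derivative blinfun_apply (r'' x)) (at x)" by simp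
    show ir: "inj (blinfun_apply (r' x))"
    proof (rule injI)
      fix v w assume "r' x v = r' x w"
      then have "vec2 v = vec2 w" using injf[OF xV] by (simp add: r' inj_eq)
      then show "v = w" by (metis cplx_vec2(1))
    qed
    show "norm ((n \<circ> \<psi> \<circ> vec2) x) = 1" using unit_normal(1)[OF xV] by simp
    show orth: "(n \<circ> \<psi> \<circ> vec2) x \<bullet> r' x v = 0" for v using unit_normal(2)[OF xV] by (simp add: r')
    let ?a = "r' x 1" and ?b = "r' x \<i>"
    define C where "C = cross3 ?a ?b"
    have C0: "C \<noteq> 0" unfolding C_def by (rule cross3_nonzero_of_inj[OF ir])
    define s where "s = ((n \<circ> \<psi> \<circ> vec2) x \<bullet> C) / (C \<bullet> C)"
    have "(n \<circ> \<psi> \<circ> vec2) x - s *\<^sub>R C = 0"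
    proof (rule zero_of_orthogonal[of _ ?a ?b])
      show "((n \<circ> \<psi> \<circ> vec2) x - s *\<^sub>R C) \<bullet> ?a = 0" "((n \<circ> \<psi> \<circ> vec2) x - s *\<^sub>R C) \<bullet> ?b = 0"
        using orth by (simp_all add: inner_diff_left C_def dot_cross_self)
      show "((n \<circ> \<psi> \<circ> vec2) x - s *\<^sub>R C) \<bullet> cross3 ?a ?b = 0" using C0 by (simp add: inner_diff_left s_def C_def[symmetric])
      show "cross3 ?a ?b \<noteq> 0" using C0 by (simp add: C_def)
    qed
    then have nC: "(n \<circ> \<psi> \<circ> vec2) x = s *\<^sub>R C" by simp
    let ?n = "(1 / norm C) *\<^sub>R C"
    have "mean_curvature ?g (vec2 x) = 0" using min_surf VA xV unfolding minimal_surface_def by auto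
    then have "((?a \<bullet> ?a) * (r'' x \<i> \<i> \<bullet> ?n) - 2 * (?a \<bullet> ?b) * (r'' x \<i> 1 \<bullet> ?n) + (?b \<bullet> ?b) * (r'' x 1 1 \<bullet> ?n)) /
        (2 * ((?a \<bullet> ?a) * (?b \<bullet> ?b) - (?a \<bullet> ?b)\<^sup>2)) = 0"
      unfolding mean_curvature_def Let_def pd[OF xV] pd2[OF xV] C_def r' r'' ax .
    moreover have "(?a \<bullet> ?a) * (?b \<bullet> ?b) - (?a \<bullet> ?b)\<^sup>2 = (norm C)\<^sup>2"
      unfolding C_def norm_cross by (simp add: dot_square_norm)
    ultimately have "(?a \<bullet> ?a) * (r'' x \<i> \<i> \<bullet> ?n) - 2 * (?a \<bullet> ?b) * (r'' x \<i> 1 \<bullet> ?n) + (?b \<bullet> ?b) * (r'' x 1 1 \<bullet> ?n) = 0"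
      using C0 by simp
    note ev = this
    have lin: "a * (k * x) - b * (k * y) + c * (k * z) = k * (a * x - b * y + c * z)" for a b c k x y z :: real
      by (simp add: algebra_simps)
    have nk: "y \<bullet> (n \<circ> \<psi> \<circ> vec2) x = norm C * s * (y \<bullet> ?n)" for y unfolding nC using C0 by simp
    show "(?a \<bullet> ?a) * (r'' x \<i> \<i> \<bullet> (n \<circ> \<psi> \<circ> vec2) x) - 2 * (?a \<bullet> ?b) * (r'' x \<i> 1 \<bullet> (n \<circ> \<psi> \<circ> vec2) x)
        + (?b \<bullet> ?b) * (r'' x 1 1 \<bullet> (n \<circ> \<psi> \<circ> vec2) x) = 0"
      unfolding nk lin ev by simp
  next
    show "open (vec2 -` V)" by (rule opn)
    have "continuous_on (vec2 -` V) (\<lambda>x. f'' (vec2 x))"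
      by (rule continuous_on_compose2[OF cf'' cvec]) auto
    then show "continuous_on (vec2 -` V) r''"
      unfolding r''_def by (intro bounded_bilinear.continuous_on[OF bounded_bilinear_blinfun_compose] continuous_on_const)
    have "continuous_map (top_of_set V) euclidean (n \<circ> \<psi>)"
      using continuous_map_compose[OF V(4)] gauss unfolding gauss_map_def by blast
    then have "continuous_on V (n \<circ> \<psi>)" by simp
    then show "continuous_on (vec2 -` V) (n \<circ> \<psi> \<circ> vec2)"
      by (intro continuous_on_compose[OF cvec]) (auto elim!: continuous_on_subset)
  qed
  then show ?thesis
  proof (rule that)
    show "frechet_derivative ?g (at x) v = r' (cplx x) (cplx v)" if "x \<in> V" for x v using fd[OF that] by (simp add: r')
    show "?g differentiable (at x)" if "x \<in> V" for x using f'[OF that] by (auto simp: differentiable_def)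
  qed
qed

lemma chart_at:
  assumes "m \<in> topspace M"
  obtains V \<psi> x where "(V, \<psi>) \<in> A" "x \<in> V" "\<psi> x = m"
  using assms surf unfolding C2_surface_def by force

lemma n_norm: "m \<in> topspace M \<Longrightarrow> norm (n m) = 1" "m \<in> topspace M \<Longrightarrow> n m \<bullet> n m = 1"
  using gauss by (auto simp: gauss_map_def dot_square_norm)

lemma tangent_plane_eq:
  assumes m: "m \<in> topspace M"
  shows "tangent_plane A u m = {w. n m \<bullet> w = 0}"
proof
  show "tangent_plane A u m \<subseteq> {w. n m \<bullet> w = 0}" using gauss m by (auto simp: gauss_map_def)
  obtain V \<psi> x where VA: "(V, \<psi>) \<in> A" "x \<in> V" "\<psi> x = m" using chart_at[OF m] .
  obtain r' r'' where p: "minimal_patch (vec2 -` V) (u \<circ> \<psi> \<circ> vec2) r' r'' (n \<circ> \<psi> \<circ> vec2)"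
    and fd: "\<And>x v. x \<in> V \<Longrightarrow> frechet_derivative (u \<circ> \<psi>) (at x) v = r' (cplx x) (cplx v)"
    using patch[OF VA(1)] by metis
  show "{w. n m \<bullet> w = 0} \<subseteq> tangent_plane A u m"
  proof clarify
    fix w assume "n m \<bullet> w = 0"
    then have "\<exists>v. r' (cplx x) v = w"
      using VA by (intro minimal_patch.N_perp_range[OF p]) auto
    then obtain v where "r' (cplx x) v = w" by blast
    then have "frechet_derivative (u \<circ> \<psi>) (at x) (vec2 v) = w" using fd[OF VA(2)] by simp
    then show "w \<in> tangent_plane A u m" using VA unfolding tangent_plane_def by blast
  qed
qed

text \<open>The tangential projection of the k-th unit vector. Uniqueness holds because the
  difference of two candidates is tangent and orthogonal to itself.\<close>

lemma surface_gradient_eq: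
  assumes m: "m \<in> topspace M"
  shows "surface_gradient A u (\<lambda>p. u p $ k) m = axis k 1 - (n m $ k) *\<^sub>R n m"
  unfolding surface_gradient_def
proof (rule the_equality)
  have ak: "axis k 1 \<bullet> (y::real^3) = y $ k" for y by (simp add: inner_axis inner_commute)
  have fdk: "frechet_derivative ((\<lambda>p. u p $ k) \<circ> \<psi>) (at x) v = frechet_derivative (u \<circ> \<psi>) (at x) v $ k"
    if "(V, \<psi>) \<in> A" "x \<in> V" for V \<psi> x v
  proof -
    have "((u \<circ> \<psi>) has_derivative frechet_derivative (u \<circ> \<psi>) (at x)) (at x)"
      using patch[OF that(1)] that(2) frechet_derivative_works by metis
    then have "((\<lambda>y. (u \<circ> \<psi>) y $ k) has_derivative (\<lambda>v. frechet_derivative (u \<circ> \<psi>) (at x) v $ k)) (at x)"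
      by (rule bounded_linear.has_derivative[OF bounded_linear_vec_nth])
    from frechet_derivative_at[OF this] show ?thesis by (simp add: o_def fun_eq_iff)
  qed
  have tp: "n m \<bullet> frechet_derivative (u \<circ> \<psi>) (at x) v = 0" if "(V, \<psi>) \<in> A" "x \<in> V" "\<psi> x = m" for V \<psi> x v
    using tangent_plane_eq[OF m] that unfolding tangent_plane_def by blast
  let ?w = "axis k 1 - (n m $ k) *\<^sub>R n m"
  have w: "n m \<bullet> ?w = 0" by (simp add: inner_diff_right n_norm(2)[OF m] inner_axis)
  show "?w \<in> tangent_plane A u m \<and> (\<forall>(V, \<psi>)\<in>A. \<forall>x\<in>V. \<psi> x = m \<longrightarrow>
        (\<forall>v. ?w \<bullet> frechet_derivative (u \<circ> \<psi>) (at x) v = frechet_derivative ((\<lambda>p. u p $ k) \<circ> \<psi>) (at x) v))"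
    using w tp by (auto simp: tangent_plane_eq[OF m] fdk inner_diff_left ak)
  fix w' assume w': "w' \<in> tangent_plane A u m \<and> (\<forall>(V, \<psi>)\<in>A. \<forall>x\<in>V. \<psi> x = m \<longrightarrow>
        (\<forall>v. w' \<bullet> frechet_derivative (u \<circ> \<psi>) (at x) v = frechet_derivative ((\<lambda>p. u p $ k) \<circ> \<psi>) (at x) v))"
  then have "w' - ?w \<in> tangent_plane A u m" using w by (simp add: tangent_plane_eq[OF m] inner_diff_right)
  then obtain V \<psi> x v where VA: "(V, \<psi>) \<in> A" "x \<in> V" "\<psi> x = m" and e: "w' - ?w = frechet_derivative (u \<circ> \<psi>) (at x) v"
    unfolding tangent_plane_def by blast
  have "w' \<bullet> (w' - ?w) = (w' - ?w) $ k" using w' VA fdk[OF VA(1,2)] unfolding e by fastforce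
  moreover have "?w \<bullet> (w' - ?w) = (w' - ?w) $ k"
    using tp[OF VA, of v] unfolding e[symmetric] by (simp only: inner_diff_left ak inner_scaleR_left)
  ultimately have "(w' - ?w) \<bullet> (w' - ?w) = 0" by (simp only: inner_diff_left)
  then show "w' = ?w" by simp
qed

text \<open>This is the gradient of the third coordinate function.\<close>

definition vertical_part :: "'a \<Rightarrow> real^3" where "vertical_part m = axis 3 1 - (n m $ 3) *\<^sub>R n m"

lemma vertical_part:
  assumes m: "m \<in> topspace M"
  shows "n m \<bullet> vertical_part m = 0" "vertical_part m \<bullet> vertical_part m = vertical_part m $ 3" "cross3 (n m) (vertical_part m) = cross3 (n m) (axis 3 1)"
    "w \<bullet> n m = 0 \<Longrightarrow> w \<bullet> vertical_part m = w $ 3" "w \<bullet> n m = 0 \<Longrightarrow> vertical_part m \<bullet> w = w $ 3"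
proof -
  show 1: "n m \<bullet> vertical_part m = 0" by (simp add: vertical_part_def inner_diff_right n_norm(2)[OF m] inner_axis)
  show 2: "w \<bullet> vertical_part m = w $ 3" if "w \<bullet> n m = 0" for w using that by (simp add: vertical_part_def inner_diff_right inner_axis)
  then show "vertical_part m \<bullet> w = w $ 3" if "w \<bullet> n m = 0" using that by (simp add: inner_commute)
  show "vertical_part m \<bullet> vertical_part m = vertical_part m $ 3" using 1 2[of "vertical_part m"] by (simp add: inner_commute)
  show "cross3 (n m) (vertical_part m) = cross3 (n m) (axis 3 1)"
    by (simp add: vertical_part_def Cross3.right_diff_distrib cross_mult_right)
qed

text \<open>A tangent vector orthogonal to the horizontal tangent direction n \<times> e_3 is a
  multiple of the gradient of the height; unit length and upward direction fix the factor.\<close>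

lemma section_normal_eq:
  assumes m: "m \<in> topspace M" and nv: "cross3 (n m) (axis 3 1) \<noteq> 0"
  shows "section_normal A u m = (1 / norm (vertical_part m)) *\<^sub>R vertical_part m"
  unfolding section_normal_def tangent_plane_eq[OF m]
proof (rule the_equality)
  have t0: "vertical_part m \<noteq> 0" using nv vertical_part(3)[OF m] by force
  have t3: "vertical_part m $ 3 > 0" using t0 vertical_part(2)[OF m] by (metis inner_gt_zero_iff)
  show "(1 / norm (vertical_part m)) *\<^sub>R vertical_part m \<in> {w. n m \<bullet> w = 0} \<and> norm ((1 / norm (vertical_part m)) *\<^sub>R vertical_part m) = 1 \<and>
     (\<forall>w\<in>{w. n m \<bullet> w = 0}. w $ 3 = 0 \<longrightarrow> (1 / norm (vertical_part m)) *\<^sub>R vertical_part m \<bullet> w = 0) \<and> 0 < ((1 / norm (vertical_part m)) *\<^sub>R vertical_part m) $ 3"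
    using t0 t3 vertical_part[OF m] by (auto simp: inner_commute)
  fix \<nu> :: "real^3" assume \<nu>: "\<nu> \<in> {w. n m \<bullet> w = 0} \<and> norm \<nu> = 1 \<and> (\<forall>w\<in>{w. n m \<bullet> w = 0}. w $ 3 = 0 \<longrightarrow> \<nu> \<bullet> w = 0) \<and> 0 < \<nu> $ 3"
  define c where "c = (\<nu> \<bullet> vertical_part m) / (vertical_part m \<bullet> vertical_part m)"
  have "\<nu> - c *\<^sub>R vertical_part m = 0"
  proof (rule zero_of_orthogonal[of _ "n m" "vertical_part m"])
    show "(\<nu> - c *\<^sub>R vertical_part m) \<bullet> n m = 0" using \<nu> vertical_part(1)[OF m] by (simp add: inner_diff_right inner_commute)
    show "(\<nu> - c *\<^sub>R vertical_part m) \<bullet> vertical_part m = 0" using t0 by (simp add: inner_diff_left c_def)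
    show "cross3 (n m) (vertical_part m) \<noteq> 0" using nv vertical_part(3)[OF m] by simp
    have "cross3 (n m) (vertical_part m) $ 3 = 0" unfolding vertical_part(3)[OF m] by (simp add: cross3_def axis_def)
    then have "\<nu> \<bullet> cross3 (n m) (vertical_part m) = 0" using \<nu> by (simp add: dot_cross_self)
    then show "(\<nu> - c *\<^sub>R vertical_part m) \<bullet> cross3 (n m) (vertical_part m) = 0" by (simp add: inner_diff_left dot_cross_self)
  qed
  then have e: "\<nu> = c *\<^sub>R vertical_part m" by simp
  then have "\<bar>c\<bar> * norm (vertical_part m) = 1" "c > 0" using \<nu> t3 by (auto simp: zero_less_mult_iff)
  then show "\<nu> = (1 / norm (vertical_part m)) *\<^sub>R vertical_part m" unfolding e using t0 by (simp add: field_simps)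
qed

end

section \<open>Local power form of a holomorphic function\<close>

text \<open>Near a zero of order k, f - f(\<xi>) is the k-th power of a function with a simple zero,
  and this function serves as the local coordinate.\<close>

lemma local_power_form:
  assumes hol: "f holomorphic_on ball \<xi> e" and e: "e > 0" and nc: "w0 \<in> ball \<xi> e" "f w0 \<noteq> f \<xi>"
  obtains k \<rho> h where "k \<ge> 1" "\<rho> > 0" "continuous_on (ball 0 \<rho>) h" "inj_on h (ball 0 \<rho>)" "h ` ball 0 \<rho> \<subseteq> ball \<xi> e"
    "h 0 = \<xi>" "\<And>q. q \<in> ball 0 \<rho> \<Longrightarrow> f (h q) = f \<xi> + q ^ k" "deriv f \<xi> = 0 \<Longrightarrow> k \<ge> 2"
proof -
  have \<xi>e: "\<xi> \<in> ball \<xi> e" using e by simp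
  have "\<exists>k>0. (deriv ^^ k) f \<xi> \<noteq> 0"
    using holomorphic_fun_eq_const_on_connected[OF hol open_ball connected_ball _ \<xi>e nc(1)] nc(2) by blast
  then obtain k where k: "0 < k" "(deriv ^^ k) f \<xi> \<noteq> 0" "\<And>i. 0 < i \<Longrightarrow> i < k \<Longrightarrow> (deriv ^^ i) f \<xi> = 0"
    using exists_least_iff[of "\<lambda>k. 0 < k \<and> (deriv ^^ k) f \<xi> \<noteq> 0"] by blast
  obtain g r where g: "0 < r" "g holomorphic_on ball \<xi> r" "\<And>w. w \<in> ball \<xi> r \<Longrightarrow> f w - f \<xi> = ((w - \<xi>) * g w) ^ k"
      "\<And>w. w \<in> ball \<xi> r \<Longrightarrow> g w \<noteq> 0"
    using holomorphic_factor_order_of_zero_strong[OF hol open_ball \<xi>e k] by metis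
  define p where "p w = (w - \<xi>) * g w" for w
  let ?r = "min r e"
  have hp: "p holomorphic_on ball \<xi> ?r" unfolding p_def
    by (intro holomorphic_intros holomorphic_on_subset[OF g(2)]) auto
  have \<xi>r: "\<xi> \<in> ball \<xi> ?r" using g(1) e by simp
  have "(g has_field_derivative deriv g \<xi>) (at \<xi>)"
    using holomorphic_derivI[OF g(2) open_ball] g(1) by simp
  then have "(p has_field_derivative g \<xi>) (at \<xi>)"
    unfolding p_def by (auto intro!: derivative_eq_intros)
  then have "deriv p \<xi> \<noteq> 0" using g(1,4) by (simp add: DERIV_imp_deriv)
  then obtain s where s: "s > 0" "ball \<xi> s \<subseteq> ball \<xi> ?r" "open (p ` ball \<xi> s)" "inj_on p (ball \<xi> s)"
    using has_complex_derivative_locally_invertible[OF hp \<xi>r open_ball] by metis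
  have cp: "continuous_on (ball \<xi> s) p" using holomorphic_on_imp_continuous_on[OF hp] continuous_on_subset s(2) by blast
  obtain h where h: "homeomorphism (ball \<xi> s) (p ` ball \<xi> s) p h"
    using invariance_of_domain_homeomorphism[OF open_ball cp _ s(4)] by auto
  have p0: "p \<xi> = 0" by (simp add: p_def)
  have "0 \<in> p ` ball \<xi> s" using p0 s(1) by (metis centre_in_ball image_eqI)
  then obtain \<rho> where \<rho>: "\<rho> > 0" "ball 0 \<rho> \<subseteq> p ` ball \<xi> s" using s(3) open_contains_ball by metis
  have hin: "h q \<in> ball \<xi> s" "p (h q) = q" if "q \<in> ball 0 \<rho>" for q
    using homeomorphism_apply2[OF h] homeomorphism_image2[OF h] subsetD[OF \<rho>(2) that] by auto
  show ?thesis
  proof (rule that[of k \<rho> h])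
    show "k \<ge> 1" using k(1) by simp
    show "\<rho> > 0" by (rule \<rho>(1))
    show "continuous_on (ball 0 \<rho>) h" by (rule continuous_on_subset[OF homeomorphism_cont2[OF h] \<rho>(2)])
    show "inj_on h (ball 0 \<rho>)" by (rule inj_onI) (metis hin(2))
    show "h ` ball 0 \<rho> \<subseteq> ball \<xi> e" using subsetD[OF s(2) hin(1)] by auto
    show "h 0 = \<xi>" using homeomorphism_apply1[OF h, of \<xi>] p0 s(1) by simp
    show "f (h q) = f \<xi> + q ^ k" if "q \<in> ball 0 \<rho>" for q
    proof -
      have "h q \<in> ball \<xi> r" using hin(1)[OF that] s(2) by auto
      from g(3)[OF this] show ?thesis using hin(2)[OF that] by (simp add: p_def algebra_simps)
    qed
    show "k \<ge> 2" if "deriv f \<xi> = 0"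
    proof (rule ccontr)
      assume "\<not> k \<ge> 2" then have "k = 1" using k(1) by simp
      then show False using k(2) that by simp
    qed
  qed
qed

lemma minimal_patch_cong:
  assumes "minimal_patch V r r' r'' N" and "\<And>x. x \<in> V \<Longrightarrow> s x = r x" and "\<And>x. x \<in> V \<Longrightarrow> K x = N x"
  shows "minimal_patch V s r' r'' K"
proof -
  interpret minimal_patch V r r' r'' N by fact
  show ?thesis
  proof
    fix x assume x: "x \<in> V"
    show "(s has_derivative blinfun_apply (r' x)) (at x)"
      by (rule has_derivative_transform_within_open[OF der[OF x] open_V x]) (simp add: assms(2))
    show "(r' has_derivative blinfun_apply (r'' x)) (at x)" by (rule der2[OF x])
    show "inj (blinfun_apply (r' x))" by (rule inj[OF x])
    show "norm (K x) = 1" using normN[OF x] assms(3)[OF x] by simp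
    show "K x \<bullet> r' x v = 0" for v using orthN[OF x] assms(3)[OF x] by simp
    show "(r' x 1 \<bullet> r' x 1) * (r'' x \<i> \<i> \<bullet> K x) - 2 * (r' x 1 \<bullet> r' x \<i>) * (r'' x \<i> 1 \<bullet> K x)
        + (r' x \<i> \<bullet> r' x \<i>) * (r'' x 1 1 \<bullet> K x) = 0" using minimal[OF x] assms(3)[OF x] by simp
  next
    show "open V" by (rule open_V)
    show "continuous_on V r''" by (rule cont2)
    show "continuous_on V K" using contN assms(3) by (simp cong: continuous_on_cong)
  qed
qed

lemma vertical_unit:
  fixes x :: "real^3"
  assumes "norm x = 1" "cross3 x (axis 3 1) = 0"
  shows "x \<in> {axis 3 1, - axis 3 1}"
proof -
  have "x $ 1 = 0" "x $ 2 = 0" using assms(2) by (simp_all add: cross3_def axis_def vec_eq_iff forall_3)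
  moreover have "(x $ 1)\<^sup>2 + (x $ 2)\<^sup>2 + (x $ 3)\<^sup>2 = 1"
    using assms(1) by (simp add: norm_eq_1 inner_vec_def sum_3 power2_eq_square)
  ultimately have "x $ 3 = 1 \<or> x $ 3 = -1" by (simp add: power2_eq_1_iff)
  with \<open>x $ 1 = 0\<close> \<open>x $ 2 = 0\<close> show ?thesis by (auto simp: vec_eq_iff forall_3 axis_def)
qed

section \<open>The surface read on the annulus; absence of critical heights\<close>

context minimal_tube
begin

definition position where "position = u \<circ> \<eta>"
definition unit_normal where "unit_normal = n \<circ> \<eta>"
definition height where "height z = position z $ 3"

lemma eta:
  shows "m \<in> topspace M \<Longrightarrow> \<eta> (\<xi> m) = m" "m \<in> topspace M \<Longrightarrow> \<xi> m \<in> annulus"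
    "z \<in> annulus \<Longrightarrow> \<xi> (\<eta> z) = z" "z \<in> annulus \<Longrightarrow> \<eta> z \<in> topspace M"
    "continuous_map M (top_of_set annulus) \<xi>" "continuous_map (top_of_set annulus) M \<eta>"
  using homeo continuous_map_image_subset_topspace[of M "top_of_set annulus" \<xi>]
    continuous_map_image_subset_topspace[of "top_of_set annulus" M \<eta>]
  by (auto simp: homeomorphic_maps_def)

lemma unit_normal_norm: "z \<in> annulus \<Longrightarrow> norm (unit_normal z) = 1"
  using n_norm(1) eta(4) by (simp add: unit_normal_def)

lemma unit_normal_inj: "inj_on unit_normal annulus"
proof (rule inj_onI)
  fix z w assume "z \<in> annulus" "w \<in> annulus" "unit_normal z = unit_normal w"
  then show "z = w" using n_inj eta(3,4) unfolding unit_normal_def inj_on_def by (metis comp_apply)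
qed

lemma surface_point:
  assumes z: "z \<in> annulus"
  obtains V P x0 r' r'' where "x0 \<in> V" "P x0 = z" "continuous_on V P" "inj_on P V" "P ` V \<subseteq> annulus"
    "minimal_patch V (position \<circ> P) r' r'' (unit_normal \<circ> P)"
proof -
  obtain V \<psi> x where VA: "(V, \<psi>) \<in> A" "x \<in> V" "\<psi> x = \<eta> z" using chart_at[OF eta(4)[OF z]] .
  note V = chart_surface[OF VA(1)]
  obtain r' r'' where p: "minimal_patch (vec2 -` V) (u \<circ> \<psi> \<circ> vec2) r' r'' (n \<circ> \<psi> \<circ> vec2)"
    using patch[OF VA(1)] by metis
  define P where "P = \<xi> \<circ> \<psi> \<circ> vec2"
  show ?thesis
  proof (rule that[of "cplx x" "vec2 -` V" P r' r''])
    show "cplx x \<in> vec2 -` V" using VA by simp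
    show "P (cplx x) = z" using VA eta(3)[OF z] by (simp add: P_def)
    have "continuous_map (top_of_set V) (top_of_set annulus) (\<xi> \<circ> \<psi>)"
      by (rule continuous_map_compose[OF V(4) eta(5)])
    then have "continuous_on V (\<xi> \<circ> \<psi>)" by simp
    then show "continuous_on (vec2 -` V) P" unfolding P_def
      by (intro continuous_on_compose continuous_intros) (auto elim!: continuous_on_subset)
    show "inj_on P (vec2 -` V)"
    proof (rule inj_onI)
      fix a b assume ab: "a \<in> vec2 -` V" "b \<in> vec2 -` V" "P a = P b"
      then have "\<psi> (vec2 a) = \<psi> (vec2 b)" using eta(1) V(6) unfolding P_def by (metis comp_apply vimageD)
      then have "vec2 a = vec2 b" using V(5) ab by (meson inj_onD vimageD)
      then show "a = b" by (metis cplx_vec2(1))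
    qed
    show "P ` (vec2 -` V) \<subseteq> annulus" using eta(2) V(6) by (auto simp: P_def)
    show "minimal_patch (vec2 -` V) (position \<circ> P) r' r'' (unit_normal \<circ> P)"
      by (rule minimal_patch_cong[OF p]) (use eta(1) V(6) in \<open>auto simp: position_def unit_normal_def P_def\<close>)
  qed
qed

text \<open>\<open>G\<close> inverts an isothermal coordinate adapted to the j-th component, and
  \<open>W k\<close> is the holomorphic completion of the k-th one. If A and B are the derivatives
  of the position in the real and imaginary direction, then Re W' = A and -Im W' = B, so the last
  conditions say that A is tangent and B = n \<times> A.\<close>

definition coords :: "complex \<Rightarrow> 3 \<Rightarrow> complex set \<Rightarrow> complex set \<Rightarrow> (complex \<Rightarrow> complex) \<Rightarrow> (complex \<Rightarrow> complex)
    \<Rightarrow> (3 \<Rightarrow> complex \<Rightarrow> complex) \<Rightarrow> (3 \<Rightarrow> complex \<Rightarrow> complex) \<Rightarrow> bool" where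
  "coords z j \<Omega> U G w W W' \<longleftrightarrow> open \<Omega> \<and> open U \<and> z \<in> U \<and> U \<subseteq> annulus \<and> homeomorphism \<Omega> U G w \<and>
    (\<forall>\<zeta>\<in>\<Omega>. \<forall>k. (W k has_field_derivative W' k \<zeta>) (at \<zeta>) \<and> Re (W k \<zeta>) = position (G \<zeta>) $ k) \<and>
    (\<forall>\<zeta>\<in>\<Omega>. W' j \<zeta> = 1 \<and> position (G \<zeta>) $ j = Re \<zeta> \<and>
      cross3 (unit_normal (G \<zeta>)) (\<chi> k. Re (W' k \<zeta>)) = (\<chi> k. - Im (W' k \<zeta>)) \<and> unit_normal (G \<zeta>) \<bullet> (\<chi> k. Re (W' k \<zeta>)) = 0)"

lemma coordsD:
  assumes "coords z j \<Omega> U G w W W'"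
  shows "open \<Omega>" "open U" "z \<in> U" "U \<subseteq> annulus" "continuous_on \<Omega> G" "continuous_on U w" "inj_on G \<Omega>"
    "\<zeta> \<in> \<Omega> \<Longrightarrow> G \<zeta> \<in> U" "\<zeta> \<in> \<Omega> \<Longrightarrow> w (G \<zeta>) = \<zeta>" "m \<in> U \<Longrightarrow> w m \<in> \<Omega>" "m \<in> U \<Longrightarrow> G (w m) = m"
    "\<zeta> \<in> \<Omega> \<Longrightarrow> (W k has_field_derivative W' k \<zeta>) (at \<zeta>)" "\<zeta> \<in> \<Omega> \<Longrightarrow> Re (W k \<zeta>) = position (G \<zeta>) $ k"
    "\<zeta> \<in> \<Omega> \<Longrightarrow> W' j \<zeta> = 1" "\<zeta> \<in> \<Omega> \<Longrightarrow> position (G \<zeta>) $ j = Re \<zeta>"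
    "\<zeta> \<in> \<Omega> \<Longrightarrow> cross3 (unit_normal (G \<zeta>)) (\<chi> k. Re (W' k \<zeta>)) = (\<chi> k. - Im (W' k \<zeta>))"
    "\<zeta> \<in> \<Omega> \<Longrightarrow> unit_normal (G \<zeta>) \<bullet> (\<chi> k. Re (W' k \<zeta>)) = 0"
proof -
  have h: "homeomorphism \<Omega> U G w" using assms unfolding coords_def by blast
  show "continuous_on \<Omega> G" "continuous_on U w" "\<zeta> \<in> \<Omega> \<Longrightarrow> G \<zeta> \<in> U" "\<zeta> \<in> \<Omega> \<Longrightarrow> w (G \<zeta>) = \<zeta>"
    "m \<in> U \<Longrightarrow> w m \<in> \<Omega>" "m \<in> U \<Longrightarrow> G (w m) = m"
    using h by (auto simp: homeomorphism_def)
  show "inj_on G \<Omega>" by (rule inj_on_inverseI[of _ w]) (use h in \<open>auto simp: homeomorphism_def\<close>)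
qed (use assms in \<open>simp_all add: coords_def\<close>)

lemma coordinates:
  assumes z: "z \<in> annulus" and j: "cross3 (unit_normal z) (axis j 1) \<noteq> 0"
  shows "\<exists>\<Omega> U G w W W'. coords z j \<Omega> U G w W W'"
proof -
  obtain V P x0 r' r'' where P: "x0 \<in> V" "P x0 = z" "continuous_on V P" "inj_on P V" "P ` V \<subseteq> annulus"
    and p: "minimal_patch V (position \<circ> P) r' r'' (unit_normal \<circ> P)"
    using surface_point[OF z] by metis
  interpret minimal_patch V "position \<circ> P" r' r'' "unit_normal \<circ> P" by (rule p)
  have j': "cross3 ((unit_normal \<circ> P) x0) (axis j 1) \<noteq> 0" using j P(2) by simp
  obtain B \<Omega> F w0 and W W' :: "3 \<Rightarrow> complex \<Rightarrow> complex" where B: "open B" "x0 \<in> B" "B \<subseteq> V" "open \<Omega>" "homeomorphism B \<Omega> w0 F"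
    and Re: "\<And>x. x \<in> B \<Longrightarrow> Re (w0 x) = (position \<circ> P) x $ j"
    and "\<And>x. x \<in> B \<Longrightarrow> (w0 has_derivative (\<lambda>v. Complex (r' x v $ j) (cross3 (r' x v) ((unit_normal \<circ> P) x) $ j))) (at x)"
    and W: "\<And>\<zeta> k. \<zeta> \<in> \<Omega> \<Longrightarrow> (W k has_field_derivative W' k \<zeta>) (at \<zeta>)"
    "\<And>\<zeta> k. \<zeta> \<in> \<Omega> \<Longrightarrow> Re (W k \<zeta>) = (position \<circ> P) (F \<zeta>) $ k" "\<And>\<zeta>. \<zeta> \<in> \<Omega> \<Longrightarrow> W' j \<zeta> = 1"
    "\<And>\<zeta>. \<zeta> \<in> \<Omega> \<Longrightarrow> cross3 ((unit_normal \<circ> P) (F \<zeta>)) (\<chi> k. Re (W' k \<zeta>)) = (\<chi> k. - Im (W' k \<zeta>))"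
    "\<And>\<zeta>. \<zeta> \<in> \<Omega> \<Longrightarrow> (unit_normal \<circ> P) (F \<zeta>) \<bullet> (\<chi> k. Re (W' k \<zeta>)) = 0"
    by (rule isothermal[OF P(1) j'], rule that, assumption+)
  have F: "continuous_on \<Omega> F" "F ` \<Omega> = B" "\<And>\<zeta>. \<zeta> \<in> \<Omega> \<Longrightarrow> w0 (F \<zeta>) = \<zeta>" "\<And>\<zeta>. \<zeta> \<in> \<Omega> \<Longrightarrow> F \<zeta> \<in> B" "w0 x0 \<in> \<Omega>" "F (w0 x0) = x0"
    using B(5) B(2) unfolding homeomorphism_def by auto
  have injF: "inj_on F \<Omega>" by (rule inj_on_inverseI[of _ w0]) (rule F(3))
  have cG: "continuous_on \<Omega> (P \<circ> F)"
    by (intro continuous_on_compose F(1)) (use P(3) F(2) B(3) continuous_on_subset in blast)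
  have iG: "inj_on (P \<circ> F) \<Omega>"
    by (intro comp_inj_on injF) (use P(4) F(2) B(3) inj_on_subset in blast)
  obtain w where w: "homeomorphism \<Omega> ((P \<circ> F) ` \<Omega>) (P \<circ> F) w"
    using invariance_of_domain_homeomorphism[OF B(4) cG _ iG] by auto
  have "open ((P \<circ> F) ` \<Omega>)" by (rule invariance_of_domain[OF cG B(4) iG])
  moreover have "z \<in> (P \<circ> F) ` \<Omega>" using F(5,6) P(2) by (metis comp_apply image_eqI)
  moreover have "(P \<circ> F) ` \<Omega> \<subseteq> annulus" using F(4) B(3) P(5) by auto
  moreover have "position ((P \<circ> F) \<zeta>) $ j = Re \<zeta>" if "\<zeta> \<in> \<Omega>" for \<zeta>
    using Re[OF F(4)[OF that]] F(3)[OF that] by simp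
  ultimately have "coords z j \<Omega> ((P \<circ> F) ` \<Omega>) (P \<circ> F) w W W'"
    unfolding coords_def using B(4) w W by simp
  then show ?thesis by blast
qed

text \<open>A unit vector cannot be parallel to both horizontal axes.\<close>

lemma horizontal_coordinate:
  assumes "z \<in> annulus" obtains j where "cross3 (unit_normal z) (axis j 1) \<noteq> 0" "j \<noteq> 3"
proof -
  have "cross3 (unit_normal z) (axis 1 1) \<noteq> 0 \<or> cross3 (unit_normal z) (axis 2 1) \<noteq> 0"
  proof (rule ccontr)
    assume "\<not> ?thesis"
    then have "unit_normal z = 0" by (simp add: cross3_def axis_def vec_eq_iff forall_3)
    then show False using unit_normal_norm[OF assms] by simp
  qed
  then show ?thesis using that[of 1] that[of 2] by auto
qed

lemma continuous_position: "continuous_on annulus position"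
proof -
  have "\<exists>U. open U \<and> z \<in> U \<and> continuous_on U position" if z: "z \<in> annulus" for z
  proof -
    obtain j where j: "cross3 (unit_normal z) (axis j 1) \<noteq> 0" using horizontal_coordinate[OF z] by metis
    obtain \<Omega> U G w W W' where "coords z j \<Omega> U G w W W'" using coordinates[OF z j] by blast
    note c = coordsD[OF this]
    have cW: "continuous_on \<Omega> (W k)" for k
      using c(12) by (meson DERIV_isCont continuous_at_imp_continuous_on)
    have "continuous_on U (\<lambda>m. \<chi> k. Re (W k (w m)))"
      by (intro continuous_intros continuous_on_vec_lambda continuous_on_compose2[OF cW c(6)]) (use c(10) in auto)
    moreover have "(\<chi> k. Re (W k (w m))) = position m" if "m \<in> U" for m
      using c(13)[OF c(10)[OF that]] c(11)[OF that] by (simp add: vec_eq_iff)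
    ultimately have "continuous_on U position" by (simp cong: continuous_on_cong)
    then show ?thesis using c(2,3) by blast
  qed
  then show ?thesis
    by (metis continuous_on_eq_continuous_at continuous_at_imp_continuous_on)
qed

lemma continuous_height: "continuous_on annulus height"
  unfolding height_def by (intro continuous_intros continuous_position)

text \<open>In an isothermal coordinate of some horizontal component the height is the real part of
  a holomorphic function. If that were locally constant, the normal would be vertical on an open set
  and take at most two values there, against injectivity of the Gauss map. Where the normal is
  vertical the derivative vanishes, so the exponent is at least 2.\<close>

lemma normal_form:
  assumes z: "z \<in> annulus"
  obtains P \<rho> k where "\<rho> > 0" "k \<ge> 1" "continuous_on (ball 0 \<rho>) P" "inj_on P (ball 0 \<rho>)" "P ` ball 0 \<rho> \<subseteq> annulus" "P 0 = z"
    "\<And>q. q \<in> ball 0 \<rho> \<Longrightarrow> height (P q) = height z + Re (q ^ k)" "cross3 (unit_normal z) (axis 3 1) = 0 \<Longrightarrow> k \<ge> 2"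
proof -
  obtain j where j: "cross3 (unit_normal z) (axis j 1) \<noteq> 0" using horizontal_coordinate[OF z] by metis
  obtain \<Omega> U G w W W' where "coords z j \<Omega> U G w W W'" using coordinates[OF z j] by blast
  note c = coordsD[OF this]
  have G: "w z \<in> \<Omega>" "G (w z) = z" using c(3,10,11) by auto
  obtain e where e: "e > 0" "ball (w z) e \<subseteq> \<Omega>" using c(1) G(1) open_contains_ball by metis
  have hol: "W 3 holomorphic_on ball (w z) e"
    using c(12) e(2) by (meson field_differentiable_at_within field_differentiable_def holomorphic_on_def subsetD)
  \<comment> \<open>If A and n \<times> A are both horizontal and A is nonzero, the normal has to be
    vertical.\<close>
  have vert: "cross3 (unit_normal (G \<zeta>)) (axis 3 1) = 0" if \<zeta>: "\<zeta> \<in> \<Omega>" and 0: "W' 3 \<zeta> = 0" for \<zeta>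
  proof -
    let ?N = "unit_normal (G \<zeta>)" and ?A = "\<chi> k. Re (W' k \<zeta>)" and ?B = "\<chi> k. - Im (W' k \<zeta>)"
    have N1: "?N \<bullet> ?N = 1" using unit_normal_norm c(8)[OF \<zeta>] c(4) by (auto simp: norm_eq_1)
    have "?A \<noteq> 0" using c(14)[OF \<zeta>] by (auto simp: vec_eq_iff intro!: exI[of _ j])
    moreover have e1: "cross3 ?N ?A = ?B" "?N \<bullet> ?A = 0" by (rule c(16,17)[OF \<zeta>])+
    moreover have "?A $ 3 = 0" "?B $ 3 = 0" using 0 by auto
    ultimately have "\<exists>A :: real^3. A \<noteq> 0 \<and> ?N \<bullet> A = 0 \<and> A $ 3 = 0 \<and> cross3 ?N A $ 3 = 0" by metis
    then obtain A :: "real^3" where AB: "A \<noteq> 0" "?N \<bullet> A = 0" "A $ 3 = 0" "cross3 ?N A $ 3 = 0" by blast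
    have "A $ 1 * ?N $ 1 + A $ 2 * ?N $ 2 = 0" "A $ 2 * ?N $ 1 = A $ 1 * ?N $ 2"
      using AB by (auto simp: cross3_def inner_vec_def sum_3 algebra_simps)
    then have "(A $ 1 * A $ 1 + A $ 2 * A $ 2) * ?N $ 1 = 0" "(A $ 1 * A $ 1 + A $ 2 * A $ 2) * ?N $ 2 = 0" by algebra+
    moreover have "A $ 1 * A $ 1 + A $ 2 * A $ 2 \<noteq> 0"
      using AB(1,3) by (auto simp: vec_eq_iff forall_3 sum_squares_eq_zero_iff)
    ultimately have "?N $ 1 = 0" "?N $ 2 = 0" using mult_eq_0_iff by blast+
    then show ?thesis by (simp add: cross3_def axis_def vec_eq_iff forall_3)
  qed
  have "\<exists>w0\<in>ball (w z) e. W 3 w0 \<noteq> W 3 (w z)"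
  proof (rule ccontr)
    assume "\<not> ?thesis"
    then have const: "W 3 \<zeta> = W 3 (w z)" if "\<zeta> \<in> ball (w z) e" for \<zeta> using that by blast
    have "W' 3 \<zeta> = 0" if \<zeta>: "\<zeta> \<in> ball (w z) e" for \<zeta>
    proof -
      have "(W 3 has_field_derivative 0) (at \<zeta>)"
        by (rule has_field_derivative_transform_within_open[OF DERIV_const[of "W 3 (w z)"] open_ball \<zeta>]) (simp add: const)
      then show ?thesis using c(12)[of \<zeta> 3] e(2) \<zeta> DERIV_unique by blast
    qed
    note W0 = this
    have "unit_normal (G \<zeta>) \<in> {axis 3 1, - axis 3 1}" if "\<zeta> \<in> ball (w z) e" for \<zeta>
      using vert[OF subsetD[OF e(2) that] W0[OF that]] unit_normal_norm[OF subsetD[OF c(4) c(8)[OF subsetD[OF e(2) that]]]] by (intro vertical_unit)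
    note W1 = this
    have "(unit_normal \<circ> G) ` ball (w z) e \<subseteq> {axis 3 1, - axis 3 1}"
    proof (rule image_subsetI)
      fix \<zeta> assume "\<zeta> \<in> ball (w z) e"
      from W1[OF this] show "(unit_normal \<circ> G) \<zeta> \<in> {axis 3 1, - axis 3 1}" by (simp only: comp_apply)
    qed
    then have "finite ((unit_normal \<circ> G) ` ball (w z) e)" by (rule finite_subset) simp
    moreover have "inj_on (unit_normal \<circ> G) (ball (w z) e)"
      using unit_normal_inj c(7) c(8) c(4) e(2) by (intro comp_inj_on) (auto intro: inj_on_subset)
    ultimately have "finite (ball (w z) e)" using finite_image_iff by blast
    then show False using uncountable_ball[OF e(1), of "w z"] countable_finite[of "ball (w z) e"] by simp
  qed
  then obtain w0 where w0: "w0 \<in> ball (w z) e" "W 3 w0 \<noteq> W 3 (w z)" by blast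
  obtain k \<rho> h where k: "k \<ge> 1" "\<rho> > 0" "continuous_on (ball 0 \<rho>) h" "inj_on h (ball 0 \<rho>)" "h ` ball 0 \<rho> \<subseteq> ball (w z) e"
    "h 0 = w z" "\<And>q. q \<in> ball 0 \<rho> \<Longrightarrow> W 3 (h q) = W 3 (w z) + q ^ k" "deriv (W 3) (w z) = 0 \<Longrightarrow> k \<ge> 2"
    by (rule local_power_form[OF hol e(1) w0], rule that, assumption+)
  have h\<Omega>: "h q \<in> \<Omega>" if "q \<in> ball 0 \<rho>" for q using k(5) e(2) that by blast
  show ?thesis
  proof (rule that[of \<rho> k "G \<circ> h"])
    show "continuous_on (ball 0 \<rho>) (G \<circ> h)"
      by (rule continuous_on_compose[OF k(3) continuous_on_subset[OF c(5)]]) (use h\<Omega> in auto)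
    show "inj_on (G \<circ> h) (ball 0 \<rho>)" by (rule comp_inj_on[OF k(4) inj_on_subset[OF c(7)]]) (use h\<Omega> in auto)
    show "(G \<circ> h) ` ball 0 \<rho> \<subseteq> annulus" using h\<Omega> c(8) c(4) by auto
    show "(G \<circ> h) 0 = z" using k(6) G(2) by simp
    show "height ((G \<circ> h) q) = height z + Re (q ^ k)" if "q \<in> ball 0 \<rho>" for q
      using c(13)[OF h\<Omega>[OF that], of 3] c(13)[OF G(1), of 3] k(7)[OF that] G(2) by (simp add: height_def)
    show "k \<ge> 2" if 0: "cross3 (unit_normal z) (axis 3 1) = 0"
    proof (rule k(8))
      have nz: "unit_normal z $ 1 = 0" "unit_normal z $ 2 = 0" using 0 by (simp_all add: cross3_def axis_def vec_eq_iff forall_3)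
      then have n3: "unit_normal z $ 3 \<noteq> 0" using unit_normal_norm[OF z] by (auto simp: norm_eq_1 inner_vec_def sum_3)
      have "unit_normal z \<bullet> (\<chi> k. Re (W' k (w z))) = 0" using c(17)[OF G(1)] G(2) by simp
      then have "Re (W' 3 (w z)) = 0" using nz n3 by (simp add: inner_vec_def sum_3)
      moreover have "cross3 (unit_normal z) (\<chi> k. Re (W' k (w z))) $ 3 = - Im (W' 3 (w z))" using c(16)[OF G(1)] G(2) by simp
      then have "Im (W' 3 (w z)) = 0" using nz by (simp add: cross3_def)
      ultimately have "W' 3 (w z) = 0" by (simp add: complex_eq_iff)
      then show "deriv (W 3) (w z) = 0" using DERIV_imp_deriv[OF c(12)[OF G(1), of 3]] by simp
    qed
  qed (use k in auto)
qed

text \<open>The real part of q^k takes both signs, at the angles 0 and pi/k.\<close>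

lemma no_extremum:
  assumes m: "m \<in> annulus" and N: "open N" "m \<in> N"
  shows "\<exists>z\<in>N \<inter> annulus. height z > height m" and "\<exists>z\<in>N \<inter> annulus. height z < height m"
proof -
  obtain P \<rho> k where P: "\<rho> > 0" "k \<ge> 1" "continuous_on (ball 0 \<rho>) P" "inj_on P (ball 0 \<rho>)"
    "P ` ball 0 \<rho> \<subseteq> annulus" "P 0 = m" "\<And>q. q \<in> ball 0 \<rho> \<Longrightarrow> height (P q) = height m + Re (q ^ k)"
    "cross3 (unit_normal m) (axis 3 1) = 0 \<Longrightarrow> k \<ge> 2"
    by (rule normal_form[OF m], rule that, assumption+)
  have "open (ball 0 \<rho> \<inter> P -` N)" by (rule continuous_open_preimage[OF P(3) open_ball N(1)])
  moreover have "0 \<in> ball 0 \<rho> \<inter> P -` N" using P N by simp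
  ultimately obtain d where d: "d > 0" "ball 0 d \<subseteq> ball 0 \<rho> \<inter> P -` N" using open_contains_ball by metis
  have pt: "P q \<in> N \<inter> annulus" "height (P q) = height m + Re (q ^ k)" if "cmod q < d" for q
  proof -
    have "q \<in> ball 0 \<rho> \<inter> P -` N" using d(2) that by (simp add: subset_eq)
    then show "P q \<in> N \<inter> annulus" "height (P q) = height m + Re (q ^ k)" using P(5,7) by auto
  qed
  have "cmod (of_real (d / 2)) < d" using d(1) by simp
  note 1 = pt[OF this]
  have "Re (of_real (d / 2) ^ k) > 0" using d(1) by (simp flip: of_real_power)
  then show "\<exists>z\<in>N \<inter> annulus. height z > height m" using 1 by force
  let ?q = "of_real (d / 2) * cis (pi / k)"
  have "cmod ?q < d" using d(1) by (simp add: norm_mult)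
  note 2 = pt[OF this]
  have "cis (pi / k) ^ k = -1" using P(2) by (simp add: Complex.DeMoivre)
  then have "?q ^ k = - of_real ((d / 2) ^ k)" by (simp only: power_mult_distrib of_real_power) simp
  then have "Re (?q ^ k) < 0" using d(1) by simp
  then show "\<exists>z\<in>N \<inter> annulus. height z < height m" using 2 by force
qed

lemma interval_eq: "projection_interval M u = height ` annulus"
  unfolding projection_interval_def height_def position_def
proof (intro equalityI subsetI; clarify)
  fix m assume "m \<in> topspace M"
  then show "u m $ 3 \<in> (\<lambda>z. (u \<circ> \<eta>) z $ 3) ` annulus" using eta(1,2) by (auto intro!: rev_image_eqI[of "\<xi> m"])
next
  fix z assume "z \<in> annulus"
  then show "(u \<circ> \<eta>) z $ 3 \<in> (\<lambda>m. u m $ 3) ` topspace M" using eta(4) by auto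
qed

text \<open>The tube condition concerns two different levels. A single level is a closed subset of a
  slab that ends strictly higher.\<close>

lemma slab_compact:
  assumes b: "b \<in> height ` annulus" and d: "d \<in> height ` annulus"
  shows "compact {z \<in> annulus. b \<le> height z \<and> height z \<le> d}"
proof -
  have lt: "compact {z \<in> annulus. b \<le> height z \<and> height z \<le> d}" if "b < d" "d \<in> height ` annulus" for d
  proof -
    let ?K = "{m \<in> topspace M. b \<le> u m $ 3 \<and> u m $ 3 \<le> d}"
    have "compactin M ?K" using tube that b unfolding tube_def interval_eq by blast
    then have "compactin (top_of_set annulus) (\<xi> ` ?K)" by (rule image_compactin[OF _ eta(5)])
    then have "compact (\<xi> ` ?K)" by (simp add: compactin_subtopology)
    moreover have "\<xi> ` ?K = {z \<in> annulus. b \<le> height z \<and> height z \<le> d}"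
    proof (intro equalityI subsetI)
      fix z assume "z \<in> \<xi> ` ?K" then show "z \<in> {z \<in> annulus. b \<le> height z \<and> height z \<le> d}"
        using eta(1,2) by (auto simp: height_def position_def)
    next
      fix z assume "z \<in> {z \<in> annulus. b \<le> height z \<and> height z \<le> d}" then show "z \<in> \<xi> ` ?K"
        using eta(3,4) by (intro image_eqI[of _ _ "\<eta> z"]) (auto simp: height_def position_def)
    qed
    ultimately show ?thesis by simp
  qed
  consider "b < d" | "b = d" | "d < b" by linarith
  then show ?thesis
  proof cases
    case 2
    obtain m where m: "m \<in> annulus" "d = height m" using d by blast
    obtain z where z: "z \<in> annulus" "height z > d" using no_extremum(1)[OF m(1) open_UNIV] m(2) by auto
    let ?S = "{x \<in> annulus. b \<le> height x \<and> height x \<le> height z}"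
    have S: "compact ?S" using lt[of "height z"] z 2 by auto
    have "continuous_on ?S height" by (rule continuous_on_subset[OF continuous_height]) auto
    then have "closed (?S \<inter> height -` {..d})" using continuous_closed_preimage[OF _ compact_imp_closed[OF S] closed_atMost] by blast
    then have "compact (?S \<inter> (?S \<inter> height -` {..d}))" by (rule compact_Int_closed[OF S])
    moreover have "?S \<inter> (?S \<inter> height -` {..d}) = {z \<in> annulus. b \<le> height z \<and> height z \<le> d}" using z(2) by auto
    ultimately show ?thesis by simp
  next
    case 3 then have "{z \<in> annulus. b \<le> height z \<and> height z \<le> d} = {}" by auto
    then show ?thesis by (simp only: compact_empty)
  qed (use lt d in auto)
qed

text \<open>This makes the third coordinate available as real part of an isothermal coordinate at
  every point.\<close>

lemma not_vertical:
  assumes z: "z \<in> annulus"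
  shows "cross3 (unit_normal z) (axis 3 1) \<noteq> 0"
proof
  assume v: "cross3 (unit_normal z) (axis 3 1) = 0"
  obtain P \<rho> k where P: "\<rho> > 0" "k \<ge> 1" "continuous_on (ball 0 \<rho>) P" "inj_on P (ball 0 \<rho>)"
    "P ` ball 0 \<rho> \<subseteq> annulus" "P 0 = z" "\<And>q. q \<in> ball 0 \<rho> \<Longrightarrow> height (P q) = height z + Re (q ^ k)"
    "cross3 (unit_normal z) (axis 3 1) = 0 \<Longrightarrow> k \<ge> 2"
    by (rule normal_form[OF z], rule that, assumption+)
  have "open (annulus \<inter> height -` {height z<..})" by (rule continuous_open_preimage[OF continuous_height open_annulus open_greaterThan])
  moreover have "annulus \<inter> height -` {height z<..} = {x \<in> annulus. height x > height z}" by auto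
  ultimately have o: "open {x \<in> annulus. height x > height z}" by simp
  have conformal_differential: "connected {x \<in> annulus. height x > height z}" "connected {x \<in> annulus. height x < height z}"
    by (rule superlevel_connected[OF continuous_height slab_compact no_extremum z]; assumption)+
  show False
    by (rule no_saddle[OF P(8)[OF v] P(1,3,4) o conformal_differential]) (use P(5-7) in auto)
qed

end

lemma derivative_zero_if_small:
  fixes H :: "complex \<Rightarrow> complex"
  assumes "\<And>e. e > 0 \<Longrightarrow> \<forall>\<^sub>F y in nhds x. norm (H y - H x) \<le> e * norm (y - x)"
  shows "(H has_derivative (\<lambda>v. 0)) (at x)"
  unfolding has_derivative_at_alt
proof (intro conjI allI impI)
  fix e :: real assume "e > 0"
  from assms[OF this] show "\<exists>d>0. \<forall>y. norm (y - x) < d \<longrightarrow> norm (H y - H x - 0) \<le> e * norm (y - x)"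
    by (simp add: eventually_nhds_metric dist_norm)
qed simp

section \<open>Charts whose real part is the height, and the Weierstrass data of a lift\<close>

context minimal_tube
begin

text \<open>The third component of \<open>du + \<i> (du \<times> n)\<close>, i.e. the differential of \<open>u\<^sub>3\<close> plus \<open>\<i>\<close> times that of its
  harmonic conjugate.\<close>

definition conformal_differential :: "complex \<Rightarrow> real^3 \<Rightarrow> complex" where
  "conformal_differential m v = Complex (v $ 3) (cross3 v (unit_normal m) $ 3)"

text \<open>The differential is prescribed through increments of the position in space, not through
  a parametrization; so the notion depends on no coordinates and is visibly invariant under
  imaginary translations.\<close>

definition chart :: "complex set \<Rightarrow> (complex \<Rightarrow> complex) \<Rightarrow> bool" where
  "chart U w \<longleftrightarrow> open U \<and> U \<subseteq> annulus \<and> continuous_on U w \<and> inj_on w U \<and>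
     (\<forall>m\<in>U. Re (w m) = height m \<and>
       (\<forall>e>0. \<forall>\<^sub>F m' in nhds m. norm (w m' - w m - conformal_differential m (position m' - position m)) \<le> e * norm (position m' - position m)))"

lemma conformal_differential_diff: "conformal_differential m (v - v') = conformal_differential m v - conformal_differential m v'"
  by (simp add: conformal_differential_def complex_eq_iff Cross3.left_diff_distrib)

lemma conformal_differential_bound:
  assumes "m \<in> annulus" shows "cmod (conformal_differential m v) \<le> 2 * norm v"
proof -
  have "norm (cross3 v (unit_normal m)) \<le> norm v * norm (unit_normal m)"
    by (rule power2_le_imp_le) (simp_all add: norm_cross power_mult_distrib)
  then have "norm (cross3 v (unit_normal m)) \<le> norm v" using unit_normal_norm[OF assms] by simp
  then have "\<bar>cross3 v (unit_normal m) $ 3\<bar> \<le> norm v" by (rule order_trans[OF component_le_norm_cart])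
  moreover have "\<bar>v $ 3\<bar> \<le> norm v" by (rule component_le_norm_cart)
  moreover have "cmod (conformal_differential m v) \<le> \<bar>v $ 3\<bar> + \<bar>cross3 v (unit_normal m) $ 3\<bar>"
    using cmod_le[of "conformal_differential m v"] by (simp add: conformal_differential_def)
  ultimately show ?thesis by linarith
qed

lemma coords_derivative:
  assumes c: "coords z j \<Omega> U G w W W'" and \<zeta>: "\<zeta> \<in> \<Omega>"
  shows "((\<lambda>\<zeta>. position (G \<zeta>)) has_derivative (\<lambda>v. \<chi> k. Re (W' k \<zeta> * v))) (at \<zeta>)"
proof -
  note c = coordsD[OF c]
  have "((\<lambda>\<zeta>. position (G \<zeta>) \<bullet> i) has_derivative (\<lambda>v. (\<chi> k. Re (W' k \<zeta> * v)) \<bullet> i)) (at \<zeta>)" if i: "i \<in> Basis" for i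
  proof -
    obtain k where k: "i = axis k 1" using i by (auto simp: Basis_vec_def)
    have "(W k has_derivative (\<lambda>v. W' k \<zeta> * v)) (at \<zeta>)"
      using c(12)[OF \<zeta>, of k] by (simp add: has_field_derivative_def)
    then have "((\<lambda>\<zeta>. Re (W k \<zeta>)) has_derivative (\<lambda>v. Re (W' k \<zeta> * v))) (at \<zeta>)"
      by (rule bounded_linear.has_derivative[OF bounded_linear_Re])
    then have "((\<lambda>\<zeta>. position (G \<zeta>) $ k) has_derivative (\<lambda>v. Re (W' k \<zeta> * v))) (at \<zeta>)"
      by (rule has_derivative_transform_within_open[OF _ c(1) \<zeta>]) (rule c(13))
    then show ?thesis by (simp add: k inner_axis)
  qed
  then show ?thesis using has_derivative_componentwise_within by blast
qed

text \<open>In the coordinate adapted to the height, A has third component 1 and B has third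
  component 0, and the cross product with the normal sends A to -B and B to A.\<close>

lemma coords_conformal_differential:
  assumes c: "coords z 3 \<Omega> U G w W W'" and \<zeta>: "\<zeta> \<in> \<Omega>"
  shows "conformal_differential (G \<zeta>) (\<chi> k. Re (W' k \<zeta> * v)) = v"
proof -
  note c = coordsD[OF c]
  let ?N = "unit_normal (G \<zeta>)" and ?A = "\<chi> k. Re (W' k \<zeta>)" and ?B = "\<chi> k. - Im (W' k \<zeta>)"
  have "norm ?N = 1" using unit_normal_norm c(4,8) \<zeta> by blast
  then have N1: "?N \<bullet> ?N = 1" by (simp add: norm_eq_1)
  have e: "(\<chi> k. Re (W' k \<zeta> * v)) = Re v *\<^sub>R ?A + Im v *\<^sub>R ?B" by (simp add: vec_eq_iff algebra_simps)
  have AN: "cross3 ?A ?N = - ?B" using c(16)[OF \<zeta>] cross_skew[of ?A ?N] by simp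
  have BN: "cross3 ?B ?N = ?A"
    unfolding c(16)[OF \<zeta>, symmetric] cross3_triple using c(17)[OF \<zeta>] N1 by (simp add: inner_commute)
  have "cross3 (Re v *\<^sub>R ?A + Im v *\<^sub>R ?B) ?N = Re v *\<^sub>R (- ?B) + Im v *\<^sub>R ?A"
    by (simp only: cross_add_left cross_mult_left AN BN)
  then show ?thesis unfolding conformal_differential_def e using c(14)[OF \<zeta>] by (simp add: complex_eq_iff)
qed

text \<open>Differentiability controls the position by the coordinate. The converse bound, needed to
  express the error by increments of the position, holds because the conformal differential inverts
  the derivative from the left and has norm at most 2.\<close>

lemma chart_coords:
  assumes c0: "coords z 3 \<Omega> U G w W W'"
  shows "chart U w"
  unfolding chart_def
proof (intro conjI ballI allI impI)
  note c = coordsD[OF c0]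
  show "open U" "U \<subseteq> annulus" "continuous_on U w" by (rule c)+
  show "inj_on w U" by (rule inj_on_inverseI[of _ G]) (rule c(11))
  fix m assume m: "m \<in> U"
  define \<zeta> where "\<zeta> = w m"
  have \<zeta>: "\<zeta> \<in> \<Omega>" "G \<zeta> = m" using c(10,11) m by (auto simp: \<zeta>_def)
  have mR: "m \<in> annulus" using c(4) m by blast
  show "Re (w m) = height m" using c(15)[OF \<zeta>(1)] \<zeta>(2) by (simp add: height_def \<zeta>_def)
  fix e :: real assume e: "e > 0"
  let ?D = "\<lambda>v. \<chi> k. Re (W' k \<zeta> * v)"
  \<comment> \<open>1/4 absorbs the error term in |z| \<le> 2 (|u| + e' |z|), where z and u are the
    increments of coordinate and position; 8 e' is the resulting final factor.\<close>
  define e' where "e' = min (1/4) (e / 8)"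
  have e': "e' > 0" "e' \<le> 1/4" "8 * e' \<le> e" using e by (auto simp: e'_def)
  obtain d where d: "d > 0" "\<And>\<zeta>'. norm (\<zeta>' - \<zeta>) < d \<Longrightarrow> norm (position (G \<zeta>') - position (G \<zeta>) - ?D (\<zeta>' - \<zeta>)) \<le> e' * norm (\<zeta>' - \<zeta>)"
    using coords_derivative[OF c0 \<zeta>(1)] e'(1) unfolding has_derivative_at_alt by blast
  have "(w \<longlongrightarrow> w m) (nhds m)"
    using c(2,6) m by (metis continuous_on_eq_continuous_at isCont_def tendsto_at_iff_tendsto_nhds)
  then have "\<forall>\<^sub>F m' in nhds m. dist (w m') (w m) < d" using d(1) by (rule tendstoD)
  moreover have "\<forall>\<^sub>F m' in nhds m. m' \<in> U" using c(2) m by (rule eventually_nhds_in_open)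
  ultimately show "\<forall>\<^sub>F m' in nhds m. norm (w m' - w m - conformal_differential m (position m' - position m)) \<le> e * norm (position m' - position m)"
  proof eventually_elim
    case (elim m')
    let ?z = "w m' - \<zeta>" and ?u = "position m' - position m"
    have d1: "norm (?u - ?D ?z) \<le> e' * norm ?z"
      using d(2)[of "w m'"] elim c(11)[OF elim(2)] \<zeta>(2) by (simp add: dist_norm \<zeta>_def)
    have cD: "conformal_differential m (?D ?z) = ?z" using coords_conformal_differential[OF c0 \<zeta>(1), of ?z] unfolding \<zeta>(2) .
    have "norm ?z \<le> 2 * norm (?D ?z)" using conformal_differential_bound[OF mR, of "?D ?z"] unfolding cD .
    also have "\<dots> \<le> 2 * (norm ?u + e' * norm ?z)" using d1 norm_triangle_ineq4[of ?u "?u - ?D ?z"] by simp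
    also have "e' * norm ?z \<le> 1/4 * norm ?z" using e'(2) by (intro mult_right_mono) auto
    finally have z4: "norm ?z \<le> 4 * norm ?u" by simp
    have "w m' - w m - conformal_differential m ?u = - conformal_differential m (?u - ?D ?z)" unfolding conformal_differential_diff[of m ?u "?D ?z"] cD by (simp add: \<zeta>_def)
    then have "norm (w m' - w m - conformal_differential m ?u) \<le> 2 * norm (?u - ?D ?z)" using conformal_differential_bound[OF mR] by simp
    also have "\<dots> \<le> 2 * (e' * (4 * norm ?u))" using order_trans[OF d1 mult_left_mono[OF z4]] e'(1) by simp
    also have "\<dots> \<le> e * norm ?u" using mult_right_mono[OF e'(3), of "norm ?u"] by simp
    finally show ?case .
  qed
qed

text \<open>Both charts have the same differential, so in an isothermal coordinate their difference
  has derivative 0 and is constant on a ball.\<close>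

lemma chart_transition:
  assumes ch: "chart U w" "chart U' w'" and m: "m \<in> U" "m \<in> U'"
  shows "\<forall>\<^sub>F m' in nhds m. w m' - w' m' = w m - w' m"
proof -
  have mR: "m \<in> annulus" using ch m by (auto simp: chart_def)
  obtain \<Omega> U0 G w0 W W' where c0: "coords m 3 \<Omega> U0 G w0 W W'" using coordinates[OF mR not_vertical[OF mR]] by blast
  note c = coordsD[OF c0]
  define h where "h m' = w m' - w' m'" for m'
  define \<Omega>' where "\<Omega>' = \<Omega> \<inter> G -` (U \<inter> U')"
  have o: "open \<Omega>'" unfolding \<Omega>'_def
    by (rule continuous_open_preimage[OF c(5,1)]) (use ch in \<open>auto simp: chart_def\<close>)
  have z0: "w0 m \<in> \<Omega>'" using c(3,10,11) m by (auto simp: \<Omega>'_def)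
  have H0: "((h \<circ> G) has_derivative (\<lambda>v. 0)) (at \<zeta>)" if \<zeta>: "\<zeta> \<in> \<Omega>'" for \<zeta>
  proof (rule derivative_zero_if_small)
    fix e :: real assume e: "e > 0"
    have \<zeta>\<Omega>: "\<zeta> \<in> \<Omega>" "G \<zeta> \<in> U" "G \<zeta> \<in> U'" using \<zeta> by (auto simp: \<Omega>'_def)
    let ?D = "\<lambda>v. \<chi> k. Re (W' k \<zeta> * v)"
    note dv = coords_derivative[OF c0 \<zeta>\<Omega>(1)]
    obtain K where K: "\<And>v. norm (?D v) \<le> norm v * K"
      using bounded_linear.bounded[OF has_derivative_bounded_linear[OF dv]] by blast
    define L where "L = \<bar>K\<bar> + 1"
    have L: "L > 0" "norm v * K + norm v \<le> L * norm v" for v :: complex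
    proof -
      show "L > 0" by (simp add: L_def)
      have "norm v * K \<le> norm v * \<bar>K\<bar>" by (intro mult_left_mono) auto
      then show "norm v * K + norm v \<le> L * norm v" by (simp add: L_def algebra_simps)
    qed
    obtain d where d: "d > 0" "\<And>\<zeta>'. norm (\<zeta>' - \<zeta>) < d \<Longrightarrow> norm (position (G \<zeta>') - position (G \<zeta>) - ?D (\<zeta>' - \<zeta>)) \<le> 1 * norm (\<zeta>' - \<zeta>)"
      using dv zero_less_one unfolding has_derivative_at_alt by blast
    have lipG: "\<forall>\<^sub>F \<zeta>' in nhds \<zeta>. norm (position (G \<zeta>') - position (G \<zeta>)) \<le> L * norm (\<zeta>' - \<zeta>)"
      unfolding eventually_nhds_metric
    proof (intro exI[of _ d] conjI allI impI d(1))
      fix \<zeta>' assume "dist \<zeta>' \<zeta> < d"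
      then have "norm (position (G \<zeta>') - position (G \<zeta>) - ?D (\<zeta>' - \<zeta>)) \<le> norm (\<zeta>' - \<zeta>)" using d(2) by (simp add: dist_norm)
      then have "norm (position (G \<zeta>') - position (G \<zeta>)) \<le> norm (\<zeta>' - \<zeta>) * K + norm (\<zeta>' - \<zeta>)"
        using norm_triangle_sub[of "position (G \<zeta>') - position (G \<zeta>)" "?D (\<zeta>' - \<zeta>)"] K[of "\<zeta>' - \<zeta>"] by linarith
      then show "norm (position (G \<zeta>') - position (G \<zeta>)) \<le> L * norm (\<zeta>' - \<zeta>)" using L(2)[of "\<zeta>' - \<zeta>"] by linarith
    qed
    define e1 where "e1 = e / (2 * L)"
    have e1: "e1 > 0" using e L(1) by (simp add: e1_def)
    have G: "(G \<longlongrightarrow> G \<zeta>) (nhds \<zeta>)"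
      using c(1,5) \<zeta>\<Omega>(1) by (metis continuous_on_eq_continuous_at isCont_def tendsto_at_iff_tendsto_nhds)
    have s1: "\<forall>\<^sub>F m' in nhds (G \<zeta>). norm (w m' - w (G \<zeta>) - conformal_differential (G \<zeta>) (position m' - position (G \<zeta>))) \<le> e1 * norm (position m' - position (G \<zeta>))"
      using ch(1) \<zeta>\<Omega>(2) e1 unfolding chart_def by blast
    have s2: "\<forall>\<^sub>F m' in nhds (G \<zeta>). norm (w' m' - w' (G \<zeta>) - conformal_differential (G \<zeta>) (position m' - position (G \<zeta>))) \<le> e1 * norm (position m' - position (G \<zeta>))"
      using ch(2) \<zeta>\<Omega>(3) e1 unfolding chart_def by blast
    show "\<forall>\<^sub>F y in nhds \<zeta>. norm ((h \<circ> G) y - (h \<circ> G) \<zeta>) \<le> e * norm (y - \<zeta>)"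
      using lipG eventually_compose_filterlim[OF s1 G] eventually_compose_filterlim[OF s2 G]
    proof eventually_elim
      case (elim y)
      let ?c = "conformal_differential (G \<zeta>) (position (G y) - position (G \<zeta>))"
      have "(h \<circ> G) y - (h \<circ> G) \<zeta> = (w (G y) - w (G \<zeta>) - ?c) - (w' (G y) - w' (G \<zeta>) - ?c)" by (simp add: h_def)
      then have "norm ((h \<circ> G) y - (h \<circ> G) \<zeta>) \<le> norm (w (G y) - w (G \<zeta>) - ?c) + norm (w' (G y) - w' (G \<zeta>) - ?c)"
        by (metis norm_triangle_ineq4)
      also have "\<dots> \<le> e1 * norm (position (G y) - position (G \<zeta>)) + e1 * norm (position (G y) - position (G \<zeta>))" using elim by (intro add_mono)
      also have "\<dots> = 2 * e1 * norm (position (G y) - position (G \<zeta>))" by simp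
      also have "\<dots> \<le> 2 * e1 * (L * norm (y - \<zeta>))" using elim(1) e1 by (intro mult_left_mono) auto
      also have "\<dots> = e * norm (y - \<zeta>)" using L(1) by (simp add: e1_def)
      finally show ?case .
    qed
  qed
  obtain r where r: "r > 0" "ball (w0 m) r \<subseteq> \<Omega>'" using o z0 open_contains_ball by metis
  have "\<exists>k. \<forall>\<zeta>\<in>ball (w0 m) r. (h \<circ> G) \<zeta> = k"
    by (rule has_derivative_zero_constant[OF convex_ball]) (use H0 r(2) has_derivative_at_withinI in blast)
  then obtain k where k: "\<And>\<zeta>. \<zeta> \<in> ball (w0 m) r \<Longrightarrow> (h \<circ> G) \<zeta> = k" by blast
  have km: "h m = k" using k[of "w0 m"] r(1) c(3,11) by simp
  have "(w0 \<longlongrightarrow> w0 m) (nhds m)"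
    using c(2,6,3) by (metis continuous_on_eq_continuous_at isCont_def tendsto_at_iff_tendsto_nhds)
  then have "\<forall>\<^sub>F m' in nhds m. dist (w0 m') (w0 m) < r" using r(1) by (rule tendstoD)
  moreover have "\<forall>\<^sub>F m' in nhds m. m' \<in> U0" using c(2,3) by (rule eventually_nhds_in_open)
  ultimately show ?thesis
  proof eventually_elim
    case (elim m')
    then show ?case using k[of "w0 m'"] c(11) km by (simp add: h_def dist_commute)
  qed
qed

sublocale tc: translation_charts annulus height chart
proof
  show "connected annulus" using connected_annulus(1)[where a = "0::complex" and ?r1.0 = 1 and ?r2.0 = 2] by (simp add: annulus_def)
  show "\<exists>U w. chart U w \<and> m \<in> U" if m: "m \<in> annulus" for m
    using coordinates[OF m not_vertical[OF m]] chart_coords coordsD(3) by blast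
  show "chart U (\<lambda>m. w m + \<i> * of_real a)" if "chart U w" for U w a
    using that unfolding chart_def by (auto intro!: continuous_intros simp: inj_on_def)
qed (use chart_transition slab_compact open_annulus continuous_height in \<open>auto simp: chart_def\<close>)

text \<open>\<open>\<phi> k\<close> is \<partial>_x - i \<partial>_y of the k-th component of the
  position. Near each point it is the derivative of a holomorphic completion in a translated
  variable. It is defined through the Frechet derivative, so the local pieces match
  automatically.\<close>

lemma lift_structure:
  assumes L: "tc.lift D \<Phi>"
  obtains \<phi> :: "3 \<Rightarrow> complex \<Rightarrow> complex" where
    "\<And>z. z \<in> D \<Longrightarrow> ((position \<circ> \<Phi>) has_derivative (\<lambda>v. \<chi> k. Re (\<phi> k z * v))) (at z)"
    "\<And>k. \<phi> k holomorphic_on D" "\<And>z. z \<in> D \<Longrightarrow> \<phi> 3 z = 1"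
    "\<And>z. z \<in> D \<Longrightarrow> cross3 (unit_normal (\<Phi> z)) (\<chi> k. Re (\<phi> k z)) = (\<chi> k. - Im (\<phi> k z))"
    "\<And>z. z \<in> D \<Longrightarrow> unit_normal (\<Phi> z) \<bullet> (\<chi> k. Re (\<phi> k z)) = 0"
proof -
  have oD: "open D" by (rule tc.liftD(1)[OF L])
  define \<phi> where "\<phi> k z = Complex (frechet_derivative (position \<circ> \<Phi>) (at z) 1 $ k) (- (frechet_derivative (position \<circ> \<Phi>) (at z) \<i> $ k))" for k z
  have local: "\<exists>S \<theta>. open S \<and> z \<in> S \<and> (\<forall>k. \<theta> k holomorphic_on S) \<and> (\<forall>y\<in>S. ((position \<circ> \<Phi>) has_derivative (\<lambda>v. \<chi> k. Re (\<theta> k y * v))) (at y)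
      \<and> \<theta> 3 y = 1 \<and> cross3 (unit_normal (\<Phi> y)) (\<chi> k. Re (\<theta> k y)) = (\<chi> k. - Im (\<theta> k y)) \<and> unit_normal (\<Phi> y) \<bullet> (\<chi> k. Re (\<theta> k y)) = 0)"
    if z: "z \<in> D" for z
  proof -
    have mR: "\<Phi> z \<in> annulus" by (rule tc.liftD(3)[OF L z])
    obtain \<Omega> U G w W W' where c0: "coords (\<Phi> z) 3 \<Omega> U G w W W'" using coordinates[OF mR not_vertical[OF mR]] by blast
    note c = coordsD[OF c0]
    define a where "a = Im z - Im (w (\<Phi> z))"
    let ?w = "\<lambda>m. w m + \<i> * of_real a"
    have ch: "chart U w" by (rule chart_coords[OF c0])
    have "Re (w (\<Phi> z)) = Re z" using tc.chart_Re[OF ch c(3)] tc.lift_Re[OF L z] by simp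
    then have wz: "?w (\<Phi> z) = z" by (simp add: complex_eq_iff a_def)
    have "\<forall>\<^sub>F z' in nhds z. \<Phi> z' \<in> U \<and> ?w (\<Phi> z') = z'"
      by (rule tc.lift_chart[OF L z tc.chart_add[OF ch] c(3) wz])
    then obtain S where S: "open S" "z \<in> S" "\<And>y. y \<in> S \<Longrightarrow> \<Phi> y \<in> U" "\<And>y. y \<in> S \<Longrightarrow> w (\<Phi> y) + \<i> * of_real a = y"
      unfolding eventually_nhds by blast
    define \<sigma> where "\<sigma> y = y - \<i> * of_real a" for y
    have \<sigma>: "\<sigma> y \<in> \<Omega>" "G (\<sigma> y) = \<Phi> y" if "y \<in> S" for y
    proof -
      have "w (\<Phi> y) = \<sigma> y" using S(4)[OF that] by (simp add: \<sigma>_def algebra_simps)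
      then show "\<sigma> y \<in> \<Omega>" "G (\<sigma> y) = \<Phi> y" using c(10,11)[OF S(3)[OF that]] by auto
    qed
    have W'hol: "W' k holomorphic_on \<Omega>" for k
    proof -
      have "W k holomorphic_on \<Omega>" using c(1,12) by (auto simp: holomorphic_on_open)
      then have "deriv (W k) holomorphic_on \<Omega>" by (rule holomorphic_deriv[OF _ c(1)])
      moreover have "deriv (W k) \<zeta> = W' k \<zeta>" if "\<zeta> \<in> \<Omega>" for \<zeta> using DERIV_imp_deriv[OF c(12)[OF that]] .
      ultimately show ?thesis by (rule holomorphic_transform)
    qed
    have "((position \<circ> \<Phi>) has_derivative (\<lambda>v. \<chi> k. Re (W' k (\<sigma> y) * v))) (at y)" if y: "y \<in> S" for y
    proof -
      have "(\<sigma> has_derivative (\<lambda>v. v)) (at y)" unfolding \<sigma>_def by (auto intro!: derivative_eq_intros)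
      from has_derivative_compose[OF this coords_derivative[OF c0 \<sigma>(1)[OF y]]]
      have "((\<lambda>y. position (G (\<sigma> y))) has_derivative (\<lambda>v. \<chi> k. Re (W' k (\<sigma> y) * v))) (at y)" .
      then show ?thesis by (rule has_derivative_transform_within_open[OF _ S(1) y]) (simp add: \<sigma>(2))
    qed
    moreover have "(\<lambda>y. W' k (\<sigma> y)) holomorphic_on S" for k
      by (rule holomorphic_on_compose_gen[OF _ W'hol, unfolded o_def]) (use \<sigma>(1) in \<open>auto simp: \<sigma>_def intro!: holomorphic_intros\<close>)
    ultimately show ?thesis using S(1,2) c(14,16,17)[OF \<sigma>(1)] \<sigma>(2)
      by (intro exI[of _ S] exI[of _ "\<lambda>k y. W' k (\<sigma> y)"]) auto
  qed
  have eq: "\<phi> k y = \<theta> k y" if "((position \<circ> \<Phi>) has_derivative (\<lambda>v. \<chi> k. Re (\<theta> k y * v))) (at y)" for \<theta> :: "3 \<Rightarrow> complex \<Rightarrow> complex" and k y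
    unfolding \<phi>_def frechet_derivative_at[OF that, symmetric] by (simp add: complex_eq_iff)
  have loc2: "\<exists>S. open S \<and> z \<in> S \<and> (\<forall>k. \<phi> k holomorphic_on S)" and
    pt: "((position \<circ> \<Phi>) has_derivative (\<lambda>v. \<chi> k. Re (\<phi> k z * v))) (at z) \<and> \<phi> 3 z = 1 \<and>
      cross3 (unit_normal (\<Phi> z)) (\<chi> k. Re (\<phi> k z)) = (\<chi> k. - Im (\<phi> k z)) \<and> unit_normal (\<Phi> z) \<bullet> (\<chi> k. Re (\<phi> k z)) = 0" if z: "z \<in> D" for z
  proof -
    obtain S \<theta> where S: "open S" "z \<in> S" "\<And>k. \<theta> k holomorphic_on S" "\<And>y. y \<in> S \<Longrightarrow> ((position \<circ> \<Phi>) has_derivative (\<lambda>v. \<chi> k. Re (\<theta> k y * v))) (at y)"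
      and s: "\<And>y. y \<in> S \<Longrightarrow> \<theta> 3 y = 1 \<and> cross3 (unit_normal (\<Phi> y)) (\<chi> k. Re (\<theta> k y)) = (\<chi> k. - Im (\<theta> k y)) \<and> unit_normal (\<Phi> y) \<bullet> (\<chi> k. Re (\<theta> k y)) = 0"
      using local[OF z] by auto
    have e: "\<phi> k y = \<theta> k y" if "y \<in> S" for k y by (rule eq[of \<theta> y k, OF S(4)[OF that]])
    show "\<exists>S. open S \<and> z \<in> S \<and> (\<forall>k. \<phi> k holomorphic_on S)"
      using S(1,2) holomorphic_transform[OF S(3) e[symmetric]] by blast
    show "((position \<circ> \<Phi>) has_derivative (\<lambda>v. \<chi> k. Re (\<phi> k z * v))) (at z) \<and> \<phi> 3 z = 1 \<and>
      cross3 (unit_normal (\<Phi> z)) (\<chi> k. Re (\<phi> k z)) = (\<chi> k. - Im (\<phi> k z)) \<and> unit_normal (\<Phi> z) \<bullet> (\<chi> k. Re (\<phi> k z)) = 0"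
      unfolding e[OF S(2)] using S(4)[OF S(2)] s[OF S(2)] by simp
  qed
  have hol: "\<phi> k holomorphic_on D" for k
    unfolding holomorphic_on_open[OF oD]
  proof
    fix z assume "z \<in> D"
    then obtain S where "open S" "z \<in> S" "\<phi> k holomorphic_on S" using loc2 by blast
    then show "\<exists>f'. (\<phi> k has_field_derivative f') (at z)" using holomorphic_on_open by blast
  qed
  show ?thesis by (rule that[of \<phi>]) (use pt hol in auto)
qed

end

section \<open>The flow vector and the life-time\<close>

lemma arc_measure_upper:
  fixes M :: "'a topology" and u :: "'a \<Rightarrow> real^3" and \<gamma> :: "real \<Rightarrow> 'a"
  assumes \<gamma>: "continuous_map euclideanreal M \<gamma>" and U: "\<And>y. ((u \<circ> \<gamma>) has_vector_derivative U' y) (at y)"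
    and cU': "continuous_on UNIV U'" and ab: "a \<le> b"
    and meas: "\<gamma> ` {a..b} \<in> sets (hausdorff1 (topspace M) (riemannian_dist M u))"
  shows "emeasure (hausdorff1 (topspace M) (riemannian_dist M u)) (\<gamma> ` {a..b}) \<le> ennreal (integral {a..b} (\<lambda>t. norm (U' t)))"
proof -
  define s where "s y = norm (U' y)" for y
  have cs: "continuous_on S s" for S unfolding s_def by (intro continuous_on_norm continuous_on_subset[OF cU']) simp
  have si: "s integrable_on {x..y}" for x y by (rule integrable_continuous_interval[OF cs])
  \<comment> \<open>The primitive starts at \<open>a - 1\<close> so that it is differentiable on an
    open interval around \<open>{a..b}\<close>.\<close>
  define L where "L y = integral {a - 1..y} s" for y
  have Ldiff: "L t - L r = integral {r..t} s" if "a \<le> r" "r \<le> t" for r t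
    using Henstock_Kurzweil_Integration.integral_combine[of "a - 1" r t s] that si by (simp add: L_def)
  have dL: "(L has_real_derivative norm (U' y)) (at y)" if y: "y \<in> {a - 1<..<b + 1}" for y
  proof -
    have "((\<lambda>y. integral {a - 1..y} s) has_real_derivative s y) (at y within {a - 1..b + 1})"
      by (rule integral_has_real_derivative[OF cs]) (use y in auto)
    then have "(L has_real_derivative s y) (at y within {a - 1<..<b + 1})"
      unfolding L_def by (rule DERIV_subset) auto
    then show ?thesis using y by (simp add: at_within_open[of _ "{a - 1<..<b + 1}"] s_def)
  qed
  obtain K where K: "\<And>y. y \<in> {a..b} \<Longrightarrow> s y \<le> K"
    using compact_imp_bounded[OF compact_continuous_image[OF cs compact_Icc], of a b] unfolding bounded_real by (metis abs_le_D1 imageI)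
  have "hausdorff1_outer (topspace M) (riemannian_dist M u) (\<gamma> ` {a..b}) \<le> ennreal (L b - L a)"
  proof (rule outer_curve_upper[OF ab, where K = K])
    show "\<gamma> ` {a..b} \<subseteq> topspace M" using \<gamma> by (auto simp: continuous_map_def)
    show "L r \<le> L t \<and> L t - L r \<le> K * (t - r)" if "a \<le> r" "r \<le> t" "t \<le> b" for r t
    proof
      have "integral {r..t} s \<ge> 0" by (rule integral_nonneg[OF si]) (simp add: s_def)
      then show "L r \<le> L t" using Ldiff[OF that(1,2)] by simp
      have "integral {r..t} s \<le> integral {r..t} (\<lambda>_. K)" by (rule integral_le[OF si]) (use K that in auto)
      then show "L t - L r \<le> K * (t - r)" using Ldiff[OF that(1,2)] that by (simp add: mult.commute)
    qed
    show "riemannian_dist M u (\<gamma> r) (\<gamma> t) \<le> ennreal \<bar>L t - L r\<bar>" if "r \<in> {a..b}" "t \<in> {a..b}" for r t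
      by (rule riemannian_dist_le_arc[OF \<gamma> U cU' dL]) (use that in auto)
  qed
  then show ?thesis using emeasure_hausdorff1[OF meas] Ldiff[OF order_refl ab] by (simp add: s_def[abs_def])
qed

text \<open>Projection to the direction of the chord is 1-Lipschitz and, by the intermediate value
  theorem, covers an interval as long as the chord.\<close>

lemma arc_measure_lower:
  fixes M :: "'a topology" and u :: "'a \<Rightarrow> real^3" and \<gamma> :: "real \<Rightarrow> 'a"
  assumes cU: "continuous_on UNIV (u \<circ> \<gamma>)" and ab: "a \<le> b"
    and meas: "\<gamma> ` {a..b} \<in> sets (hausdorff1 (topspace M) (riemannian_dist M u))"
  shows "ennreal (norm (u (\<gamma> b) - u (\<gamma> a))) \<le> emeasure (hausdorff1 (topspace M) (riemannian_dist M u)) (\<gamma> ` {a..b})"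
proof (cases "u (\<gamma> b) = u (\<gamma> a)")
  case False
  define e where "e = (1 / norm (u (\<gamma> b) - u (\<gamma> a))) *\<^sub>R (u (\<gamma> b) - u (\<gamma> a))"
  define p where "p m = u m \<bullet> e" for m
  have e1: "norm e = 1" using False by (simp add: e_def)
  have pd: "p (\<gamma> b) - p (\<gamma> a) = norm (u (\<gamma> b) - u (\<gamma> a))"
    unfolding p_def inner_diff_left[symmetric] e_def using False by (simp add: dot_square_norm power2_eq_square)
  have "ennreal (p (\<gamma> b) - p (\<gamma> a)) \<le> hausdorff1_outer (topspace M) (riemannian_dist M u) (\<gamma> ` {a..b})"
  proof (rule outer_projection_lower)
    fix x y
    have "\<bar>p x - p y\<bar> \<le> norm (u x - u y) * norm e"
      unfolding p_def inner_diff_left[symmetric] by (rule Cauchy_Schwarz_ineq2)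
    then have "\<bar>p x - p y\<bar> \<le> norm (u x - u y)" using e1 by simp
    from order_trans[OF ennreal_leI[OF this] riemannian_dist_ge_chord[of u x y M]]
    show "ennreal \<bar>p x - p y\<bar> \<le> riemannian_dist M u x y" .
  next
    have cp: "continuous_on {a..b} (\<lambda>y. p (\<gamma> y))"
      using continuous_on_inner[OF continuous_on_subset[OF cU subset_UNIV] continuous_on_const[of _ e]] by (simp add: p_def)
    show "{p (\<gamma> a)..p (\<gamma> b)} \<subseteq> p ` \<gamma> ` {a..b}"
    proof
      fix v assume "v \<in> {p (\<gamma> a)..p (\<gamma> b)}"
      then obtain y where "a \<le> y" "y \<le> b" "p (\<gamma> y) = v" using IVT'[of "\<lambda>y. p (\<gamma> y)" a v b] ab cp by auto
      then show "v \<in> p ` \<gamma> ` {a..b}" by auto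
    qed
  qed
  then show ?thesis using emeasure_hausdorff1[OF meas] pd by simp
qed simp

context minimal_tube
begin

text \<open>An immersion is locally injective, its derivative being continuous and left
  invertible.\<close>

lemma measurable_neighbourhood:
  assumes m: "m \<in> topspace M"
  shows "\<exists>O'\<in>sets (hausdorff1 (topspace M) (riemannian_dist M u)). openin M O' \<and> m \<in> O' \<and> inj_on u O'"
proof -
  obtain V \<psi> x where VA: "(V, \<psi>) \<in> A" "x \<in> V" "\<psi> x = m" using chart_at[OF m] .
  note V = chart_surface[OF VA(1)]
  obtain r' r'' where p: "minimal_patch (vec2 -` V) (u \<circ> \<psi> \<circ> vec2) r' r'' (n \<circ> \<psi> \<circ> vec2)"
    using patch[OF VA(1)] by metis
  interpret minimal_patch "vec2 -` V" "u \<circ> \<psi> \<circ> vec2" r' r'' "n \<circ> \<psi> \<circ> vec2" by (rule p)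
  let ?a = "cplx x"
  have a: "?a \<in> vec2 -` V" using VA by simp
  have lin: "linear (blinfun_apply (r' ?a))" by (simp add: blinfun.bounded_linear_right bounded_linear.linear)
  obtain g' where g': "linear g'" "g' \<circ> blinfun_apply (r' ?a) = id"
    using linear_injective_left_inverse[OF lin inj[OF a]] by blast
  have ex: "\<exists>d>0. \<forall>y. dist ?a y < d \<longrightarrow> onorm (\<lambda>v. r' y v - r' ?a v) < e" if "e > 0" for e
  proof -
    have "isCont r' ?a" using cont1 open_V a by (simp add: continuous_on_eq_continuous_at)
    then obtain d where "d > 0" "\<And>y. dist y ?a < d \<Longrightarrow> dist (r' y) (r' ?a) < e"
      using \<open>e > 0\<close> unfolding continuous_at_eps_delta by blast
    moreover have "onorm (\<lambda>v. r' y v - r' ?a v) = dist (r' y) (r' ?a)" for y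
      by (simp add: dist_norm norm_blinfun.rep_eq minus_blinfun.rep_eq)
    ultimately show ?thesis by (metis dist_commute)
  qed
  have "\<exists>\<rho>>0. ball ?a \<rho> \<subseteq> vec2 -` V \<and> inj_on (u \<circ> \<psi> \<circ> vec2) (ball ?a \<rho>)"
  proof (rule has_derivative_locally_injective[where f' = "\<lambda>x. blinfun_apply (r' x)" and f = "u \<circ> \<psi> \<circ> vec2", OF a open_V _ g'(2)])
    show "bounded_linear g'" using g'(1) by (simp add: linear_conv_bounded_linear)
  qed (use der ex in auto)
  then obtain \<rho> where \<rho>: "\<rho> > 0" "ball ?a \<rho> \<subseteq> vec2 -` V" "inj_on (u \<circ> \<psi> \<circ> vec2) (ball ?a \<rho>)" by blast
  have "open (cplx -` ball ?a \<rho>)" by (rule open_vimage) (auto intro: continuous_intros)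
  moreover have "x \<in> cplx -` ball ?a \<rho>" using \<rho>(1) by simp
  ultimately obtain e where e: "e > 0" "cball x e \<subseteq> cplx -` ball ?a \<rho>" using open_contains_cball by metis
  have cV: "cball x e \<subseteq> V"
  proof
    fix y assume "y \<in> cball x e"
    then have "cplx y \<in> vec2 -` V" using e(2) \<rho>(2) by blast
    then show "y \<in> V" by simp
  qed
  have "continuous_on V (\<lambda>y. (u \<circ> \<psi> \<circ> vec2) (cplx y))"
    by (rule continuous_on_compose2[OF cont0]) (auto intro: continuous_intros)
  then have cu: "continuous_on V (u \<circ> \<psi>)" by (simp add: o_def)
  have "inj_on (u \<circ> \<psi>) (cball x e)"
  proof (rule inj_onI)
    fix y y' assume y: "y \<in> cball x e" "y' \<in> cball x e" "(u \<circ> \<psi>) y = (u \<circ> \<psi>) y'"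
    then have "cplx y = cplx y'" using e(2) by (intro inj_onD[OF \<rho>(3)]) auto
    then show "y = y'" by (metis cplx_vec2(2))
  qed
  from local_measurable_neighbourhood[where u = u, OF _ V(1,2,3) cu e(1) cV this]
  show ?thesis using surf VA(3) by (simp add: C2_surface_def)
qed

text \<open>With A and B the derivatives of the position in the strip coordinate, arc length on the
  section is |B| dy and |B| = |A|, while A is the gradient of the height divided by its squared
  length. So the integrand is A_k / |A| and the length factor cancels.\<close>

lemma flow_vector_lift:
  assumes c: "c \<in> height ` annulus" and d: "d \<in> height ` annulus" and \<tau>: "c < \<tau>" "\<tau> < d"
    and L: "tc.lift (tc.strip c d) \<Phi>"
    and J: "J > 0" "\<And>z. z \<in> tc.strip c d \<Longrightarrow> \<Phi> (z + \<i> * of_real J) = \<Phi> z"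
    and inj: "\<And>z w. z \<in> tc.strip c d \<Longrightarrow> w \<in> tc.strip c d \<Longrightarrow> 0 \<le> Im z \<Longrightarrow> Im z < J \<Longrightarrow> 0 \<le> Im w \<Longrightarrow> Im w < J \<Longrightarrow> \<Phi> z = \<Phi> w \<Longrightarrow> z = w"
    and \<phi>: "\<And>z. z \<in> tc.strip c d \<Longrightarrow> ((position \<circ> \<Phi>) has_derivative (\<lambda>v. \<chi> k. Re (\<phi> k z * v))) (at z)"
      "\<And>k. \<phi> k holomorphic_on tc.strip c d" "\<And>z. z \<in> tc.strip c d \<Longrightarrow> \<phi> 3 z = 1"
      "\<And>z. z \<in> tc.strip c d \<Longrightarrow> cross3 (unit_normal (\<Phi> z)) (\<chi> k. Re (\<phi> k z)) = (\<chi> k. - Im (\<phi> k z))"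
      "\<And>z. z \<in> tc.strip c d \<Longrightarrow> unit_normal (\<Phi> z) \<bullet> (\<chi> k. Re (\<phi> k z)) = 0"
  shows "flow_vector M A u \<tau> $ k = integral {0..J} (\<lambda>y. Re (\<phi> k (Complex \<tau> y)))"
proof -
  let ?S = "tc.strip c d"
  let ?N = "hausdorff1 (topspace M) (riemannian_dist M u)"
  define \<gamma> where "\<gamma> y = \<eta> (\<Phi> (Complex \<tau> y))" for y
  have zS: "Complex \<tau> y \<in> ?S" for y using \<tau> by (simp add: tc.strip_def)
  have zR: "\<Phi> (Complex \<tau> y) \<in> annulus" for y by (rule tc.liftD(3)[OF L zS])
  have cC: "continuous_on T (Complex \<tau>)" for T
    by (intro continuous_on_Complex continuous_intros)
  have c\<Phi>: "continuous_on UNIV (\<lambda>y. \<Phi> (Complex \<tau> y))"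
    by (rule continuous_on_compose2[OF tc.liftD(2)[OF L] cC]) (use zS in auto)
  have c\<gamma>: "continuous_map euclideanreal M \<gamma>"
  proof -
    have "continuous_map euclideanreal (top_of_set annulus) (\<lambda>y. \<Phi> (Complex \<tau> y))"
      using c\<Phi> zR by (auto simp: continuous_map_in_subtopology)
    from continuous_map_compose[OF this eta(6)] show ?thesis by (simp add: \<gamma>_def[abs_def] o_def)
  qed
  define Av where "Av y = (\<chi> k. Re (\<phi> k (Complex \<tau> y)))" for y
  define Bv where "Bv y = (\<chi> k. - Im (\<phi> k (Complex \<tau> y)))" for y
  have U: "((u \<circ> \<gamma>) has_vector_derivative Bv y) (at y)" for y
  proof -
    have "((\<lambda>y. Complex \<tau> y) has_derivative (\<lambda>h. h *\<^sub>R \<i>)) (at y)"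
    proof -
      have "Complex \<tau> y = of_real \<tau> + y *\<^sub>R \<i>" for y by (simp add: Complex_eq scaleR_conv_of_real mult.commute)
      then show ?thesis by (auto intro!: derivative_eq_intros)
    qed
    from has_derivative_compose[OF this \<phi>(1)[OF zS]]
    have "((\<lambda>y. (position \<circ> \<Phi>) (Complex \<tau> y)) has_derivative (\<lambda>h. \<chi> k. Re (\<phi> k (Complex \<tau> y) * (h *\<^sub>R \<i>)))) (at y)" .
    moreover have "(\<lambda>h. \<chi> k. Re (\<phi> k (Complex \<tau> y) * (h *\<^sub>R \<i>))) = (\<lambda>h. h *\<^sub>R Bv y)"
      by (simp add: fun_eq_iff vec_eq_iff Bv_def)
    moreover have "(\<lambda>y. (position \<circ> \<Phi>) (Complex \<tau> y)) = u \<circ> \<gamma>" by (simp add: fun_eq_iff position_def \<gamma>_def)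
    ultimately show ?thesis unfolding has_vector_derivative_def by simp
  qed
  have c\<phi>: "continuous_on UNIV (\<lambda>y. \<phi> k (Complex \<tau> y))" for k
    by (rule continuous_on_compose2[OF holomorphic_on_imp_continuous_on[OF \<phi>(2)] cC]) (use zS in auto)
  have cA: "continuous_on UNIV Av" and cB: "continuous_on UNIV Bv"
    unfolding Av_def Bv_def by (intro continuous_on_vec_lambda continuous_intros c\<phi>)+
  have cU: "continuous_on UNIV (u \<circ> \<gamma>)"
    using U by (meson continuous_at_imp_continuous_on has_vector_derivative_continuous)
  have arcs: "\<gamma> ` {a..b} \<in> sets ?N" if "a \<le> b" for a b
    by (rule arc_measurable[OF c\<gamma> cU _ that]) (rule measurable_neighbourhood)
  have m: "\<gamma> y \<in> topspace M" and nm: "n (\<gamma> y) = unit_normal (\<Phi> (Complex \<tau> y))" for y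
    using eta(4)[OF zR] by (simp_all add: \<gamma>_def unit_normal_def)
  have nv: "cross3 (n (\<gamma> y)) (axis 3 1) \<noteq> 0" for y using not_vertical[OF zR] nm by simp
  have AB: "cross3 (n (\<gamma> y)) (Av y) = Bv y" "n (\<gamma> y) \<bullet> Av y = 0" "Av y $ 3 = 1" "Bv y $ 3 = 0" for y
    using \<phi>(3,4,5)[OF zS] nm by (simp_all add: Av_def Bv_def)
  have A0: "Av y \<noteq> 0" for y using AB(3)[of y] by auto
  have normAB: "norm (Bv y) = norm (Av y)" for y
    using norm_cross_dot[of "n (\<gamma> y)" "Av y"] AB(1,2) n_norm(1)[OF m] by (simp add: power2_eq_iff_nonneg)
  \<comment> \<open>\<open>Av\<close> is tangent, orthogonal to the horizontal tangent direction and
    has third component 1, which determines it.\<close>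
  have tA: "vertical_part (\<gamma> y) \<bullet> vertical_part (\<gamma> y) > 0" "Av y = (1 / (vertical_part (\<gamma> y) \<bullet> vertical_part (\<gamma> y))) *\<^sub>R vertical_part (\<gamma> y)" for y
  proof -
    let ?t = "vertical_part (\<gamma> y)" and ?n = "n (\<gamma> y)"
    have "?t \<noteq> 0" using nv[of y] vertical_part(3)[OF m, of y] by force
    then show p: "?t \<bullet> ?t > 0" by simp
    have "Av y - (1 / (?t \<bullet> ?t)) *\<^sub>R ?t = 0"
    proof (rule zero_of_orthogonal[of _ ?n ?t])
      show "(Av y - (1 / (?t \<bullet> ?t)) *\<^sub>R ?t) \<bullet> ?n = 0" using AB(2)[of y] vertical_part(1)[OF m, of y] by (simp add: inner_diff_right inner_commute)
      show "(Av y - (1 / (?t \<bullet> ?t)) *\<^sub>R ?t) \<bullet> ?t = 0"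
        using vertical_part(4)[OF m, of "Av y" y] AB(2,3)[of y] p by (simp add: inner_diff_left inner_diff_right inner_commute)
      have "Av y \<bullet> cross3 ?n (axis 3 1) = - Bv y $ 3"
        unfolding AB(1)[symmetric] by (simp add: cross3_def axis_def inner_vec_def sum_3)
      then show "(Av y - (1 / (?t \<bullet> ?t)) *\<^sub>R ?t) \<bullet> cross3 ?n ?t = 0"
        using AB(4)[of y] dot_cross_self(2)[of ?t ?n] by (simp add: inner_diff_left vertical_part(3)[OF m] dot_cross_self)
      show "cross3 ?n ?t \<noteq> 0" using nv[of y] vertical_part(3)[OF m, of y] by simp
    qed
    then show "Av y = (1 / (?t \<bullet> ?t)) *\<^sub>R ?t" by simp
  qed
  define F where "F m = surface_gradient A u (\<lambda>p. u p $ k) m \<bullet> section_normal A u m" for m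
  define g where "g y = Av y $ k / norm (Av y)" for y
  have Fg: "F (\<gamma> y) = g y" for y
  proof -
    let ?t = "vertical_part (\<gamma> y)" and ?n = "n (\<gamma> y)"
    have t0: "norm ?t > 0" using tA(1)[of y] by auto
    have "F (\<gamma> y) = (?t $ k - ?n $ k * (?n \<bullet> ?t)) / norm ?t"
      unfolding F_def surface_gradient_eq[OF m] section_normal_eq[OF m nv]
      by (simp add: inner_diff_left inner_axis' diff_divide_distrib)
    also have "\<dots> = ?t $ k / norm ?t" using vertical_part(1)[OF m, of y] by simp
    also have "\<dots> = g y"
    proof -
      have tt2: "?t \<bullet> ?t = norm ?t * norm ?t" by (simp add: dot_square_norm power2_eq_square)
      show ?thesis unfolding g_def tA(2) tt2 using t0 by simp
    qed
    finally show ?thesis .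
  qed
  have cg: "continuous_on UNIV g"
    unfolding g_def by (intro continuous_intros cA) (use A0 in auto)
  have per: "\<Phi> (Complex \<tau> (y + J)) = \<Phi> (Complex \<tau> y)" for y
  proof -
    have "Complex \<tau> (y + J) = Complex \<tau> y + \<i> * of_real J" by (simp add: complex_eq_iff)
    then show ?thesis using J(2)[OF zS] by simp
  qed
  have inj\<gamma>: "inj_on \<gamma> {0..<J}"
  proof (rule inj_onI)
    fix a b assume ab: "a \<in> {0..<J}" "b \<in> {0..<J}" "\<gamma> a = \<gamma> b"
    then have "\<Phi> (Complex \<tau> a) = \<Phi> (Complex \<tau> b)" using eta(3)[OF zR] unfolding \<gamma>_def by metis
    then have "Complex \<tau> a = Complex \<tau> b" by (rule inj[OF zS zS, rotated 4]) (use ab in auto)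
    then show "a = b" by simp
  qed
  \<comment> \<open>By surjectivity of the lift and its period, one period of the vertical line
    covers the whole section.\<close>
  have sec: "{m \<in> topspace M. u m $ 3 = \<tau>} = \<gamma> ` {0..J}"
  proof (intro equalityI subsetI)
    fix q assume "q \<in> \<gamma> ` {0..J}"
    then obtain y where y: "q = \<gamma> y" by blast
    have "height (\<Phi> (Complex \<tau> y)) = \<tau>" using tc.lift_Re[OF L zS] by simp
    then show "q \<in> {m \<in> topspace M. u m $ 3 = \<tau>}" using m[of y] y by (simp add: height_def position_def \<gamma>_def)
  next
    fix q assume q: "q \<in> {m \<in> topspace M. u m $ 3 = \<tau>}"
    then have fq: "\<xi> q \<in> annulus" "height (\<xi> q) = \<tau>" using eta(1,2) by (auto simp: height_def position_def)
    have "\<xi> q \<in> \<Phi> ` ?S" by (rule tc.lift_surj[OF c d L \<tau> fq(1)]) (use fq \<tau> in auto)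
    then obtain w where w: "w \<in> ?S" "\<xi> q = \<Phi> w" by blast
    have "Re w = \<tau>" using tc.lift_Re[OF L w(1)] fq(2) unfolding w(2) by (rule trans[OF sym])
    then have wC: "Complex \<tau> (Im w) = w" using complex_surj[of w] by (simp only:)
    obtain i :: int where i: "0 \<le> Im w + of_int i * J" "Im w + of_int i * J < 0 + J" by (rule periodic_representative[OF J(1)])
    have "\<Phi> (Complex \<tau> (Im w + of_int i * J)) = \<Phi> (Complex \<tau> (Im w))"
      by (rule periodic_int_shift) (rule per)
    then have "\<gamma> (Im w + of_int i * J) = q" using w(2)[symmetric] wC eta(1)[of q] q by (simp add: \<gamma>_def)
    then show "q \<in> \<gamma> ` {0..J}" using i by (auto intro!: rev_image_eqI[of "Im w + of_int i * J"])
  qed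
  have "flow_vector M A u \<tau> $ k = (LINT m : \<gamma> ` {0..J} | ?N. F m)"
    unfolding flow_vector_def sec F_def by simp
  also have "\<dots> = integral {0..J} (\<lambda>y. norm (Bv y) * g y)"
  proof (rule closed_curve_integral[OF J(1) U cB inj\<gamma>])
    show "\<gamma> J = \<gamma> 0" using per[of 0] by (simp add: \<gamma>_def)
    show "\<gamma> ` {a..b} \<in> sets ?N" if "a \<le> b" for a b by (rule arcs[OF that])
    show "emeasure ?N (\<gamma> ` {a..b}) \<le> ennreal (integral {a..b} (\<lambda>t. norm (Bv t)))" if "a \<le> b" for a b
      by (rule arc_measure_upper[OF c\<gamma> U cB that arcs[OF that]])
    show "ennreal (norm ((u \<circ> \<gamma>) b - (u \<circ> \<gamma>) a)) \<le> emeasure ?N (\<gamma> ` {a..b})" if "a \<le> b" for a b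
      using arc_measure_lower[OF cU that arcs[OF that]] by simp
  qed (use cg Fg in auto)
  also have "\<dots> = integral {0..J} (\<lambda>y. Re (\<phi> k (Complex \<tau> y)))"
    using A0 by (intro integral_cong) (simp add: g_def normAB Av_def[symmetric], simp add: Av_def)
  finally show ?thesis .
qed

end

section \<open>From the strip estimate to the life-time\<close>

lemma tan_quarter_plus_half:
  fixes \<alpha> :: real
  assumes "cos \<alpha> > 0"
  shows "tan (pi / 4 + \<alpha> / 2) = (1 + sin \<alpha>) / cos \<alpha>"
proof -
  have "2 * (pi / 4 + \<alpha> / 2) = pi / 2 + \<alpha>" by simp
  then have "tan (pi / 4 + \<alpha> / 2) = cos \<alpha> / (1 - sin \<alpha>)"
    using tan_half[of "pi / 4 + \<alpha> / 2"] by (simp add: sin_add cos_add)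
  moreover have "cos \<alpha> * cos \<alpha> = (1 - sin \<alpha>) * (1 + sin \<alpha>)"
    using sin_cos_squared_add[of \<alpha>] by (simp add: algebra_simps power2_eq_square)
  moreover have "1 - sin \<alpha> \<noteq> 0" using calculation(2) assms by auto
  moreover have "cos \<alpha> / (1 - sin \<alpha>) = (1 + sin \<alpha>) / cos \<alpha>"
    using calculation(2,3) assms by (subst frac_eq_eq) (auto simp: mult.commute)
  ultimately show ?thesis by simp
qed

lemma norm_vec3: "(norm (v :: real^3))\<^sup>2 = (v $ 1)\<^sup>2 + (v $ 2)\<^sup>2 + (v $ 3)\<^sup>2"
  unfolding power2_norm_eq_inner inner_vec_def sum_3 by (simp add: power2_eq_square)

context minimal_tube
begin

text \<open>The period of the strip is the third flow component because \<open>\<phi> 3\<close> is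
  1. The additive periods \<open>\<kappa>\<close> of the holomorphic completions are imaginary, as
  the position is periodic, and their imaginary parts are the flow components; so the means are the
  same on all sections of the strip.\<close>

lemma height_range_estimate:
  fixes Q :: "real^3"
  assumes c: "c \<in> height ` annulus" and d: "d \<in> height ` annulus" and \<tau>: "c < \<tau>" "\<tau> < d"
    and Q: "Q = flow_vector M A u \<tau>"
  shows "Q $ 3 > 0" and "cmod (Complex (Q $ 1) (Q $ 2)) > 0 \<Longrightarrow>
    d - c \<le> pi * Q $ 3 / arsinh (cmod (Complex (Q $ 1) (Q $ 2)) / Q $ 3)"
proof -
  let ?S = "tc.strip c d"
  have "\<tau> \<in> height ` annulus"
    using tube c d \<tau> unfolding tube_def interval_eq is_interval_1 by (meson less_imp_le)
  then obtain m where m: "m \<in> annulus" "height m = \<tau>" by blast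
  obtain \<Phi> where L: "tc.lift ?S \<Phi>" using tc.strip_lift[OF c d m(1)] m(2) \<tau> by metis
  obtain J where J: "J > 0" "\<And>z. z \<in> ?S \<Longrightarrow> \<Phi> (z + \<i> * of_real J) = \<Phi> z"
    and inj: "\<And>z w. z \<in> ?S \<Longrightarrow> w \<in> ?S \<Longrightarrow> 0 \<le> Im z \<Longrightarrow> Im z < J \<Longrightarrow> 0 \<le> Im w \<Longrightarrow> Im w < J \<Longrightarrow> \<Phi> z = \<Phi> w \<Longrightarrow> z = w"
    by (rule tc.minimal_period[OF c d \<tau> L], rule that, assumption+)
  obtain \<phi> :: "3 \<Rightarrow> complex \<Rightarrow> complex" where
    \<phi>: "\<And>z. z \<in> ?S \<Longrightarrow> ((position \<circ> \<Phi>) has_derivative (\<lambda>v. \<chi> k. Re (\<phi> k z * v))) (at z)"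
      "\<And>k. \<phi> k holomorphic_on ?S" "\<And>z. z \<in> ?S \<Longrightarrow> \<phi> 3 z = 1"
      "\<And>z. z \<in> ?S \<Longrightarrow> cross3 (unit_normal (\<Phi> z)) (\<chi> k. Re (\<phi> k z)) = (\<chi> k. - Im (\<phi> k z))"
      "\<And>z. z \<in> ?S \<Longrightarrow> unit_normal (\<Phi> z) \<bullet> (\<chi> k. Re (\<phi> k z)) = 0"
    by (rule lift_structure[OF L], rule that, assumption+)
  have flow: "Q $ k = integral {0..J} (\<lambda>y. Re (\<phi> k (Complex \<tau> y)))" for k
    unfolding Q by (rule flow_vector_lift[where \<phi> = \<phi>, OF c d \<tau> L J(1)]) (fact J(2) inj \<phi>)+
  have S: "open ?S" "convex ?S" by (rule tc.strip)+
  have per: "\<phi> k (z + \<i> * of_real J) = \<phi> k z" if z: "z \<in> ?S" for k z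
  proof -
    have z': "z + \<i> * of_real J \<in> ?S" using z by (simp add: tc.strip_def)
    have "((\<lambda>z. z + \<i> * of_real J) has_derivative (\<lambda>v. v)) (at z)" by (auto intro!: derivative_eq_intros)
    from has_derivative_compose[OF this \<phi>(1)[OF z']]
    have "((\<lambda>z. (position \<circ> \<Phi>) (z + \<i> * of_real J)) has_derivative (\<lambda>v. \<chi> k. Re (\<phi> k (z + \<i> * of_real J) * v))) (at z)" .
    then have "((position \<circ> \<Phi>) has_derivative (\<lambda>v. \<chi> k. Re (\<phi> k (z + \<i> * of_real J) * v))) (at z)"
      by (rule has_derivative_transform_within_open[OF _ S(1) z]) (simp add: J(2))
    note u = has_derivative_unique[OF this \<phi>(1)[OF z]]
    have e: "(\<chi> k. Re (\<phi> k (z + \<i> * of_real J) * v)) = (\<chi> k. Re (\<phi> k z * v))" for v using fun_cong[OF u, of v] .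
    have "Re (\<phi> k (z + \<i> * of_real J) * v) = Re (\<phi> k z * v)" for v using arg_cong[OF e[of v], of "\<lambda>w. w $ k"] by simp
    from this[of 1] this[of \<i>] show ?thesis by (simp add: complex_eq_iff)
  qed
  have "\<exists>\<Psi>. \<forall>z\<in>?S. (\<Psi> has_field_derivative \<phi> k z) (at z)" for k
  proof (rule holomorphic_convex_primitive'[OF S(2,1) \<phi>(2)[of k]])
    fix g assume g: "\<And>x. x \<in> ?S \<Longrightarrow> (g has_field_derivative \<phi> k x) (at x within ?S)"
    have "(g has_field_derivative \<phi> k z) (at z)" if z: "z \<in> ?S" for z
      using g[OF z] unfolding at_within_open[OF z S(1)] .
    then show ?thesis by blast
  qed
  then obtain \<Psi> where \<Psi>: "\<And>k z. z \<in> ?S \<Longrightarrow> (\<Psi> k has_field_derivative \<phi> k z) (at z)" by metis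
  have "\<exists>\<kappa>. (\<forall>z\<in>?S. \<Psi> k (z + \<i> * of_real J) - \<Psi> k z = \<kappa>) \<and> Re \<kappa> = 0" for k
  proof -
    have "((\<lambda>z. \<Psi> k (z + \<i> * of_real J) - \<Psi> k z) has_field_derivative 0) (at z)" if z: "z \<in> ?S" for z
    proof -
      have z': "z + \<i> * of_real J \<in> ?S" using z by (simp add: tc.strip_def)
      have "((\<lambda>z. \<Psi> k (z + \<i> * of_real J)) has_field_derivative \<phi> k (z + \<i> * of_real J) * 1) (at z)"
        by (rule DERIV_chain2[where f = "\<Psi> k" and g = "\<lambda>z. z + \<i> * of_real J", OF \<Psi>[OF z']]) (auto intro!: derivative_eq_intros)
      from DERIV_diff[OF this \<Psi>[OF z, of k]] show ?thesis by (simp add: per[OF z])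
    qed
    then have "\<exists>\<kappa>. \<forall>z\<in>?S. \<Psi> k (z + \<i> * of_real J) - \<Psi> k z = \<kappa>"
      by (intro has_field_derivative_zero_constant[OF S(2)]) (auto intro: has_field_derivative_at_within)
    then obtain \<kappa> where \<kappa>: "\<And>z. z \<in> ?S \<Longrightarrow> \<Psi> k (z + \<i> * of_real J) - \<Psi> k z = \<kappa>" by blast
    have "((\<lambda>z. Re (\<Psi> k z) - (position \<circ> \<Phi>) z $ k) has_derivative (\<lambda>v. 0)) (at z within ?S)" if z: "z \<in> ?S" for z
    proof -
      have "(\<Psi> k has_derivative (\<lambda>v. \<phi> k z * v)) (at z)" using \<Psi>[OF z, of k] unfolding has_field_derivative_def .
      from has_derivative_diff[OF bounded_linear.has_derivative[OF bounded_linear_Re this]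
          bounded_linear.has_derivative[OF bounded_linear_vec_nth \<phi>(1)[OF z], of k]]
      have "((\<lambda>z. Re (\<Psi> k z) - (position \<circ> \<Phi>) z $ k) has_derivative (\<lambda>v. 0)) (at z)" by simp
      then show ?thesis by (rule has_derivative_at_withinI)
    qed
    then have "\<exists>r. \<forall>z\<in>?S. Re (\<Psi> k z) - (position \<circ> \<Phi>) z $ k = r" by (rule has_derivative_zero_constant[OF S(2)])
    then obtain r where r: "\<And>z. z \<in> ?S \<Longrightarrow> Re (\<Psi> k z) - (position \<circ> \<Phi>) z $ k = r" by blast
    have z: "of_real \<tau> \<in> ?S" "of_real \<tau> + \<i> * of_real J \<in> ?S" using \<tau> by (simp_all add: tc.strip_def)
    have "Re \<kappa> = Re (\<Psi> k (of_real \<tau> + \<i> * of_real J)) - Re (\<Psi> k (of_real \<tau>))" using \<kappa>[OF z(1)] by auto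
    also have "\<dots> = 0" using r[OF z(1)] r[OF z(2)] J(2)[OF z(1)] by simp
    finally show ?thesis using \<kappa> by blast
  qed
  then obtain \<kappa> where \<kappa>: "\<And>k z. z \<in> ?S \<Longrightarrow> \<Psi> k (z + \<i> * of_real J) - \<Psi> k z = \<kappa> k" "\<And>k. Re (\<kappa> k) = 0" by metis
  have int: "((\<lambda>y. \<phi> k (Complex x y)) has_integral of_real (Im (\<kappa> k))) {0..J}" if x: "c < x" "x < d" for k x
  proof -
    have zS: "Complex x y \<in> ?S" for y using x by (simp add: tc.strip_def)
    \<comment> \<open>On a vertical line dz = i dy, which accounts for the factor -i.\<close>
    have "((\<lambda>y. \<phi> k (Complex x y)) has_integral (- \<i> * \<Psi> k (Complex x J) - - \<i> * \<Psi> k (Complex x 0))) {0..J}"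
    proof (rule fundamental_theorem_of_calculus)
      fix y assume "y \<in> {0..J}"
      have "((\<lambda>y. of_real x + of_real y * \<i>) has_vector_derivative \<i>) (at y within {0..J})"
        by (auto intro!: derivative_eq_intros)
      moreover have "Complex x = (\<lambda>y. of_real x + of_real y * \<i>)" by (simp add: fun_eq_iff Complex_eq mult.commute)
      ultimately have "(Complex x has_vector_derivative \<i>) (at y within {0..J})" by (simp only:)
      from field_vector_diff_chain_within[OF this has_field_derivative_at_within[OF \<Psi>[OF zS, of k]]]
      have "(\<Psi> k \<circ> Complex x has_vector_derivative \<i> * \<phi> k (Complex x y)) (at y within {0..J})" .
      from has_vector_derivative_mult_right[OF this, of "- \<i>"]
      show "((\<lambda>y. - \<i> * \<Psi> k (Complex x y)) has_vector_derivative \<phi> k (Complex x y)) (at y within {0..J})"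
        by (simp add: o_def mult.assoc[symmetric])
    qed (use J in simp)
    moreover have "Complex x J = Complex x 0 + \<i> * of_real J" by (simp add: complex_eq_iff)
    then have "\<Psi> k (Complex x J) - \<Psi> k (Complex x 0) = \<kappa> k" using \<kappa>(1)[OF zS[of 0], of k] by simp
    then have "- \<i> * \<Psi> k (Complex x J) - - \<i> * \<Psi> k (Complex x 0) = - \<i> * \<kappa> k" by (simp add: algebra_simps)
    moreover have "- \<i> * \<kappa> k = of_real (Im (\<kappa> k))" using \<kappa>(2)[of k] by (simp add: complex_eq_iff)
    ultimately show ?thesis by simp
  qed
  have QI: "Q $ k = Im (\<kappa> k)" for k
    using integral_unique[OF has_integral_Re[OF int[OF \<tau>, of k]]] flow[of k] by simp
  have "((\<lambda>y. \<phi> 3 (Complex \<tau> y)) has_integral of_real J) {0..J}"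
  proof -
    have "((\<lambda>y. 1 :: complex) has_integral of_real J) {0..J}"
      using has_integral_const_real[of "1::complex" 0 J] J(1) by (simp add: scaleR_conv_of_real)
    then show ?thesis by (rule has_integral_eq[rotated]) (use \<phi>(3) \<tau> in \<open>simp add: tc.strip_def\<close>)
  qed
  from has_integral_unique[OF this int[OF \<tau>, of 3]] have QJ: "Q $ 3 = J" using QI[of 3] by simp
  then show Q3: "Q $ 3 > 0" using J(1) by simp
  \<comment> \<open>Conformality says that the squares of the three \<open>\<phi> k\<close> sum to
    0; with \<open>\<phi> 3 = 1\<close> this makes the product of \<open>G\<close> and
    \<open>K\<close> equal to -1.\<close>
  define G where "G z = \<phi> 1 z + \<i> * \<phi> 2 z" for z
  define K where "K z = \<phi> 1 z - \<i> * \<phi> 2 z" for z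
  have frame: "(\<chi> k. Re (\<phi> k z)) \<bullet> (\<chi> k. Re (\<phi> k z)) = (\<chi> k. - Im (\<phi> k z)) \<bullet> (\<chi> k. - Im (\<phi> k z))"
    "(\<chi> k. Re (\<phi> k z)) \<bullet> (\<chi> k. - Im (\<phi> k z)) = 0" if z: "z \<in> ?S" for z
  proof -
    have n1: "norm (unit_normal (\<Phi> z)) = 1" by (rule unit_normal_norm[OF tc.liftD(3)[OF L z]])
    show "(\<chi> k. Re (\<phi> k z)) \<bullet> (\<chi> k. Re (\<phi> k z)) = (\<chi> k. - Im (\<phi> k z)) \<bullet> (\<chi> k. - Im (\<phi> k z))"
      using norm_cross_dot[of "unit_normal (\<Phi> z)" "\<chi> k. Re (\<phi> k z)"] n1 unfolding \<phi>(4,5)[OF z] by (simp add: dot_square_norm)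
    show "(\<chi> k. Re (\<phi> k z)) \<bullet> (\<chi> k. - Im (\<phi> k z)) = 0" unfolding \<phi>(4)[OF z, symmetric] by (simp add: dot_cross_self)
  qed
  have GK: "G z * K z = -1" if z: "z \<in> ?S" for z
  proof -
    have "G z * K z = (\<phi> 1 z)\<^sup>2 + (\<phi> 2 z)\<^sup>2"
      by (simp add: G_def K_def power2_eq_square algebra_simps)
    moreover have "(\<phi> 1 z)\<^sup>2 + (\<phi> 2 z)\<^sup>2 + (\<phi> 3 z)\<^sup>2 = 0"
      using frame[OF z] by (simp add: complex_eq_iff inner_vec_def sum_3 power2_eq_square algebra_simps)
    ultimately show ?thesis using \<phi>(3)[OF z] by (simp add: eq_neg_iff_add_eq_0)
  qed
  have holG: "G holomorphic_on ?S" unfolding G_def by (intro holomorphic_intros \<phi>(2))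
  obtain H where H: "H holomorphic_on ?S" "\<And>z. z \<in> ?S \<Longrightarrow> G z = exp (H z)"
  proof (rule contractible_imp_holomorphic_log[OF holG convex_imp_contractible[OF S(2)]])
    show "G z \<noteq> 0" if "z \<in> ?S" for z using GK[OF that] by auto
  qed (rule that, assumption+)
  have eH: "exp (- H z) = - K z" if z: "z \<in> ?S" for z
    using GK[OF z] H(2)[OF z] by (simp add: exp_minus field_simps eq_neg_iff_add_eq_0)
  \<comment> \<open>The normal is recovered from the \<open>\<phi> k\<close>, so equal values of exp
    H mean equal normals and, by injectivity of the Gauss map, equal points.\<close>
  have N: "unit_normal (\<Phi> z) = (1 / ((\<chi> k. Re (\<phi> k z)) \<bullet> (\<chi> k. Re (\<phi> k z)))) *\<^sub>R
      cross3 (\<chi> k. Re (\<phi> k z)) (\<chi> k. - Im (\<phi> k z))" if z: "z \<in> ?S" for z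
  proof -
    let ?A = "\<chi> k. Re (\<phi> k z)"
    have "?A \<noteq> 0" using \<phi>(3)[OF z] by (auto simp: vec_eq_iff intro!: exI[of _ 3])
    moreover have "cross3 ?A (cross3 (unit_normal (\<Phi> z)) ?A) = (?A \<bullet> ?A) *\<^sub>R unit_normal (\<Phi> z) - (unit_normal (\<Phi> z) \<bullet> ?A) *\<^sub>R ?A"
      using cross3_triple[of "unit_normal (\<Phi> z)" ?A ?A] cross_skew[of ?A "cross3 (unit_normal (\<Phi> z)) ?A"] by simp
    ultimately show ?thesis unfolding \<phi>(4,5)[OF z] by simp
  qed
  assume q: "cmod (Complex (Q $ 1) (Q $ 2)) > 0"
  let ?q = "Complex (Q $ 1) (Q $ 2)"
  have str: "z \<in> ?S \<longleftrightarrow> c < Re z \<and> Re z < d" for z by (simp add: tc.strip_def)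
  have "d - c \<le> pi * J / arsinh (cmod ?q / J)"
  proof (rule ring_estimate[where H = H and H' = "deriv H" and q = ?q])
    show "c < d" using \<tau> by simp
    show "0 < J" by (rule J)
    show "0 < cmod ?q / J" using q J(1) by simp
    show "cmod ?q = cmod ?q / J * J" using J(1) by simp
    show "(H has_field_derivative deriv H z) (at z)" if "c < Re z" "Re z < d" for z
      using holomorphic_derivI[OF H(1) S(1)] that str by blast
    show "exp (H (z + \<i> * of_real J)) = exp (H z)" if "c < Re z" "Re z < d" for z
    proof -
      have z: "z \<in> ?S" "z + \<i> * of_real J \<in> ?S" using that by (simp_all add: tc.strip_def)
      show ?thesis unfolding H(2)[OF z(1), symmetric] H(2)[OF z(2), symmetric] by (simp add: G_def per[OF z(1)])
    qed
    show "z = w" if "c < Re z" "Re z < d" "c < Re w" "Re w < d" "0 \<le> Im z" "Im z < J" "0 \<le> Im w" "Im w < J" "exp (H z) = exp (H w)" for z w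
    proof -
      have zw: "z \<in> ?S" "w \<in> ?S" using that by (simp_all add: tc.strip_def)
      have g: "G z = G w" using that(9) H(2) zw by simp
      have k: "K z = K w" using eH[OF zw(1)] eH[OF zw(2)] that(9) by (simp add: exp_minus)
      have "2 * \<phi> 1 z = G z + K z" "2 * \<phi> 1 w = G w + K w" "2 * \<i> * \<phi> 2 z = G z - K z" "2 * \<i> * \<phi> 2 w = G w - K w"
        by (simp_all add: G_def K_def)
      then have "2 * \<phi> 1 z = 2 * \<phi> 1 w" "2 * \<i> * \<phi> 2 z = 2 * \<i> * \<phi> 2 w" using g k by (simp_all only:)
      then have "\<phi> 1 z = \<phi> 1 w" "\<phi> 2 z = \<phi> 2 w" by simp_all
      moreover have "\<phi> 3 z = \<phi> 3 w" using \<phi>(3) zw by simp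
      ultimately have "\<phi> k z = \<phi> k w" for k using exhaust_3[of k] by auto
      then have "unit_normal (\<Phi> z) = unit_normal (\<Phi> w)" using N[OF zw(1)] N[OF zw(2)] by simp
      then have "\<Phi> z = \<Phi> w" using unit_normal_inj tc.liftD(3)[OF L] zw by (meson inj_onD)
      then show "z = w" using inj zw that by blast
    qed
    fix x assume x: "c < x" "x < d"
    have zS: "Complex x y \<in> ?S" for y using x by (simp add: tc.strip_def)
    have "((\<lambda>y. \<phi> 1 (Complex x y) + \<i> * \<phi> 2 (Complex x y)) has_integral (of_real (Q $ 1) + \<i> * of_real (Q $ 2))) {0..J}"
      unfolding QI by (intro has_integral_add has_integral_mult_right int x)
    then show "((\<lambda>y. exp (H (Complex x y))) has_integral ?q) {0..J}"
      using H(2)[OF zS] by (simp add: G_def Complex_eq)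
    have "((\<lambda>y. - (\<phi> 1 (Complex x y) - \<i> * \<phi> 2 (Complex x y))) has_integral - (of_real (Q $ 1) - \<i> * of_real (Q $ 2))) {0..J}"
      unfolding QI by (intro has_integral_neg has_integral_diff has_integral_mult_right int x)
    moreover have "- (of_real (Q $ 1) - \<i> * of_real (Q $ 2)) = - cnj ?q" by (simp add: complex_eq_iff)
    ultimately show "((\<lambda>y. exp (- H (Complex x y))) has_integral - cnj ?q) {0..J}"
      unfolding eH[OF zS] K_def by simp
  qed
  then show "d - c \<le> pi * Q $ 3 / arsinh (cmod ?q / Q $ 3)" using QJ by simp
qed

end

theorem theorem1:
  fixes M :: "'a topology" and A :: "'a atlas" and u n :: "'a \<Rightarrow> real^3"
    and \<tau> \<alpha> :: real and Q :: "real^3"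
  assumes "C2_surface M A" and "C2_immersion A u"
    and "doubly_connected M"
    and "minimal_surface A u"
    and "tube M u"
    and "gauss_map M A u n" and "inj_on n (topspace M)"
    and "\<tau> \<in> projection_interval M u"
    and "Q = flow_vector M A u \<tau>"
    and "\<alpha> = vector_angle Q (axis 3 1)"
    and "\<alpha> \<noteq> 0"
  shows "life_time M u < \<infinity> \<and>
    enn2real (life_time M u) \<le> pi * norm Q * cos \<alpha> / ln (tan (pi / 4 + \<alpha> / 2))"
proof -
  obtain \<xi> \<eta> where "homeomorphic_maps M (top_of_set annulus) \<xi> \<eta>"
    using \<open>doubly_connected M\<close> unfolding doubly_connected_def annulus_def homeomorphic_space_def by blast
  then interpret minimal_tube M A u n \<xi> \<eta> using assms by unfold_locales
  let ?I = "height ` annulus"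
  have \<tau>I: "\<tau> \<in> ?I" using assms(8) by (simp add: interval_eq)
  then obtain m where m: "m \<in> annulus" "\<tau> = height m" by blast
  \<comment> \<open>The height has no extremum, so \<open>\<tau>\<close> lies inside a strip in
    which the flow can be evaluated.\<close>
  obtain c0 d0 where cd0: "c0 \<in> ?I" "c0 < \<tau>" "d0 \<in> ?I" "\<tau> < d0"
    using tc.range_open[OF m(1)] m(2) by blast
  note Q = assms(9)
  define q where "q = cmod (Complex (Q $ 1) (Q $ 2))"
  have J: "Q $ 3 > 0" by (rule height_range_estimate(1)[OF cd0(1,3,2,4) Q])
  have nQ: "(norm Q)\<^sup>2 = q\<^sup>2 + (Q $ 3)\<^sup>2"
    by (simp add: norm_vec3 q_def cmod_def)
  have nQ0: "norm Q > 0" using J by auto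
  have J1: "\<bar>Q $ 3 / norm Q\<bar> \<le> 1" using component_le_norm_cart[of Q 3] nQ0 by simp
  have \<alpha>: "\<alpha> = arccos (Q $ 3 / norm Q)" using assms(10) by (simp add: vector_angle_def inner_axis)
  have cos: "cos \<alpha> = Q $ 3 / norm Q" unfolding \<alpha> using J1 by (intro cos_arccos_abs)
  have cos0: "cos \<alpha> > 0" using J nQ0 by (simp add: cos)
  have q0: "q \<ge> 0" by (simp add: q_def)
  \<comment> \<open>Without horizontal flow the angle would be 0.\<close>
  have qpos: "q > 0"
  proof (rule ccontr)
    assume "\<not> q > 0"
    then have "(norm Q)\<^sup>2 = (Q $ 3)\<^sup>2" using nQ q0 by simp
    then have "norm Q = Q $ 3" using J nQ0 by (simp add: power2_eq_iff_nonneg)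
    then have "\<alpha> = 0" using \<alpha> nQ0 by simp
    then show False using assms(11) by simp
  qed
  have sin: "sin \<alpha> = q / norm Q"
  proof -
    have "sin \<alpha> \<ge> 0" unfolding \<alpha> using J1 unfolding abs_le_iff
      by (intro sin_ge_zero arccos_lbound arccos_ubound) linarith+
    moreover have "(sin \<alpha>)\<^sup>2 = (q / norm Q)\<^sup>2"
    proof -
      have "(sin \<alpha>)\<^sup>2 = 1 - (Q $ 3 / norm Q)\<^sup>2" using sin_cos_squared_add[of \<alpha>] by (simp add: cos algebra_simps)
      also have "\<dots> = ((norm Q)\<^sup>2 - (Q $ 3)\<^sup>2) / (norm Q)\<^sup>2" using nQ0 by (simp add: power_divide diff_divide_distrib)
      also have "\<dots> = (q / norm Q)\<^sup>2" unfolding nQ by (simp add: power_divide nQ)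
      finally show ?thesis .
    qed
    ultimately show ?thesis using q0 nQ0 by (simp add: power2_eq_iff_nonneg)
  qed
  define t where "t = q / Q $ 3"
  have t: "t > 0" using qpos J by (simp add: t_def)
  \<comment> \<open>Here t = tan \<alpha>, and arsinh t = ln (t + sqrt (t^2 + 1)) is matched with
    the half-angle form of the tangent.\<close>
  have "sqrt (t\<^sup>2 + 1) = norm Q / Q $ 3"
  proof (rule real_sqrt_unique)
    have "t\<^sup>2 + 1 = (q\<^sup>2 + (Q $ 3)\<^sup>2) / (Q $ 3)\<^sup>2" using J by (simp add: t_def power_divide add_divide_distrib)
    then show "(norm Q / Q $ 3)\<^sup>2 = t\<^sup>2 + 1" by (simp add: nQ power_divide)
  qed (use J in simp)
  then have "tan (pi / 4 + \<alpha> / 2) = t + sqrt (t\<^sup>2 + 1)"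
    unfolding tan_quarter_plus_half[OF cos0] sin cos t_def using J nQ0 by (simp add: field_simps)
  then have ln: "ln (tan (pi / 4 + \<alpha> / 2)) = arsinh t" by (simp add: arsinh_real_def)
  define B where "B = pi * Q $ 3 / arsinh t"
  have B: "pi * norm Q * cos \<alpha> / ln (tan (pi / 4 + \<alpha> / 2)) = B"
    unfolding ln B_def cos using nQ0 by simp
  have diam: "y - x \<le> B" if "x \<in> ?I" "y \<in> ?I" for x y
  proof -
    \<comment> \<open>The pair is widened to straddle \<open>\<tau>\<close>, the level at which
      \<open>Q\<close> is taken.\<close>
    have "min x c0 \<in> ?I" "max y d0 \<in> ?I" using that cd0 by (auto simp: min_def max_def)
    from height_range_estimate(2)[OF this _ _ Q] have "max y d0 - min x c0 \<le> B"
      using cd0 qpos by (simp add: q_def t_def B_def)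
    then show ?thesis by linarith
  qed
  have bdd: "bdd_above ?I" "bdd_below ?I"
    using diam[OF \<tau>I] diam[OF _ \<tau>I] by (auto intro!: bdd_aboveI[of _ "\<tau> + B"] bdd_belowI[of _ "\<tau> - B"] simp: algebra_simps) (smt (verit) diam \<tau>I imageI)+
  have "Sup ?I \<le> B + x" if "x \<in> ?I" for x
    using \<tau>I diam[OF that] by (intro cSup_least) (auto simp: algebra_simps)
  then have "Sup ?I - B \<le> Inf ?I" using \<tau>I by (intro cInf_greatest) (auto simp: algebra_simps)
  then have SI: "Sup ?I - Inf ?I \<le> B" by simp
  have le: "Inf ?I \<le> Sup ?I" using cInf_lower[OF \<tau>I bdd(2)] cSup_upper[OF \<tau>I bdd(1)] by linarith
  have "?I \<subseteq> {Inf ?I..Sup ?I}" using cInf_lower[OF _ bdd(2)] cSup_upper[OF _ bdd(1)] by auto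
  then have "emeasure lborel ?I \<le> emeasure lborel {Inf ?I..Sup ?I}" by (rule emeasure_mono) simp
  also have "\<dots> \<le> ennreal B" using le SI by (simp add: ennreal_leI)
  finally have L: "life_time M u \<le> ennreal B" by (simp add: life_time_def interval_eq)
  have "B \<ge> 0" using diam[OF \<tau>I \<tau>I] by simp
  with L have "enn2real (life_time M u) \<le> B" by (rule enn2real_leI[rotated])
  moreover have "life_time M u < \<infinity>" using L ennreal_less_top le_less_trans by (metis infinity_ennreal_def)
  ultimately show ?thesis unfolding B by simp
qed

end
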